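(* Let $\mathbb{D},\mathbb{D}'$ be division rings with $|\mathbb{D}|\geq 4$, and let $m,n,m',n'\geq 2$ be integers. Suppose that $\varphi:\mathbb{D}^{m\times n}\to\mathbb{D}'^{m'\times n'}$ is a non-degenerate graph homomorphism with $\varphi(0)=0$, and assume further that $\dim(\varphi(\mathcal{M}_1))=n$ and $\dim(\varphi(\mathcal{N}_1))=m$. Then one of the following holds. (1) $m'\geq m$, $n'\geq n$, and there exist $P\in GL_{m'}(\mathbb{D}')$, $Q\in GL_{n'}(\mathbb{D}')$, a nonzero ring homomorphism $\tau:\mathbb{D}\to\mathbb{D}'$ and a matrix $L\in\mathbb{D}'^{n\times m}$ such that $I_m+X^\tau L\in GL_m(\mathbb{D}')$ for every $X\in\mathbb{D}^{m\times n}$ and $$\varphi(X)=P\begin{pmatrix}(I_m+X^\tau L)^{-1}X^\tau & 0\\ 0&0\end{pmatrix}Q,\qquad X\in\mathbb{D}^{m\times n};$$ (2) $m'\geq n$, $n'\geq m$, and there exist $P\in GL_{m'}(\mathbb{D}')$, $Q\in GL_{n'}(\mathbb{D}')$, a nonzero ring anti-homomorphism $\sigma:\mathbb{D}\to\mathbb{D}'$ and a matrix $L\in\mathbb{D}'^{m\times n}$ such that $I_m+L\,{}^tX^\sigma\in GL_m(\mathbb{D}')$ for every $X\in\mathbb{D}^{m\times n}$ and $$\varphi(X)=P\begin{pmatrix}{}^tX^\sigma(I_m+L\,{}^tX^\sigma)^{-1} & 0\\ 0&0\end{pmatrix}Q,\qquad X\in\mathbb{D}^{m\times n}.$$ (In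 these block matrices, zero blocks of size $0$ are simply absent.) Moreover, if $\tau$ (respectively $\sigma$) is surjective, then $L=0$ and $\tau$ is a ring isomorphism (respectively $\sigma$ is a ring anti-isomorphism).
   Context: For a division ring $\mathbb{D}$, $\mathbb{D}^{m\times n}$ denotes the set of $m\times n$ matrices over $\mathbb{D}$, $GL_m(\mathbb{D})$ the invertible $m\times m$ matrices, $E_{ij}$ the matrix unit, ${}^tA$ the transpose. For a map $\rho:\mathbb{D}\to\mathbb{D}'$ and $X=(x_{ij})$, $X^\rho=(x_{ij}^\rho)$ and ${}^tX^\rho={}^t(X^\rho)$. Matrices $A,B\in\mathbb{D}^{m\times n}$ are adjacent, $A\sim B$, if $\operatorname{rank}(A-B)=1$. A map $\varphi:\mathbb{D}^{m\times n}\to\mathbb{D}'^{m'\times n'}$ is a graph homomorphism if $A\sim B$ implies $\varphi(A)\sim\varphi(B)$. An adjacent set is a nonempty set of matrices any two distinct of which are adjacent; a maximal set is an adjacent set not properly contained in any adjacent set. Let $\mathcal{M}_1=\{\sum_{j=1}^n x_jE_{1j}:x_j\in\mathbb{D}\}$ and $\mathcal{N}_1=\{\sum_{i=1}^m y_iE_{i1}:y_i\in\mathbb{D}\}$ in $\mathbb{D}^{m\times n}$ (first row matrices, first column matrices); analogously $\mathcal{M}'_1,\mathcal{N}'_1$ in $\mathbb{D}'^{m'\times n'}$. For $m,n\ge 2$, every maximal set in $\mathbb{D}^{m\times n}$ is either of type one, $P\mathcal{M}_1+A$ with $P\in GL_m(\mathbb{D})$, $A\in\mathbb{D}^{m\times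 n}$, or of type two, $\mathcal{N}_1Q+A$ with $Q\in GL_n(\mathbb{D})$, $A\in\mathbb{D}^{m\times n}$, and not both; similarly in $\mathbb{D}'^{m'\times n'}$. Write $\mathbb{D}^{m\times n}_{\le 1}+A=\{X:\operatorname{rank}(X-A)\le1\}$. A graph homomorphism $f:\mathbb{D}^{m\times n}\to\mathbb{D}'^{m'\times n'}$ is degenerate if there exist a matrix $A\in\mathbb{D}^{m\times n}$ with $\operatorname{rank}A\le 1$ and two maximal sets $\mathcal{M},\mathcal{N}$ of different types in $\mathbb{D}'^{m'\times n'}$ such that $f(\mathbb{D}^{m\times n}_{\le1}+A)\subseteq\mathcal{M}\cup\mathcal{N}$ and $f(A)\in\mathcal{M}\cap\mathcal{N}$; it is non-degenerate otherwise. Dimension of an adjacent set: let $\mathcal{S}$ be an adjacent set in $\mathbb{D}^{m\times n}$ with $0\in\mathcal{S}$, $|\mathcal{S}|\ge2$; it lies in a maximal set of the form $P\mathcal{M}_1$ or $\mathcal{N}_1Q$ ($P,Q$ invertible). If $P^{-1}\mathcal{S}\subseteq\mathcal{M}_1$, $\dim(\mathcal{S})$ is the number of matrices in a maximal left linearly independent (over $\mathbb{D}$) subset of $P^{-1}\mathcal{S}$; if $\mathcal{S}Q^{-1}\subseteq\mathcal{N}_1$, it is the number of matrices in a maximal right linearly independent subset of $\mathcal{S}Q^{-1}$. This is well defined. (The same definition applies in $\mathbb{D}'^{m'\times n'}$; for a graph homomorphism $\varphi$ with $\varphi(0)=0$, $\varphi(\mathcal{M}_1)$ and $\varphi(\mathcal{N}_1)$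 are such adjacent sets.) *)

theory Defs
  imports "Jordan_Normal_Form.Matrix" "HOL-Library.FuncSet"
begin

text \<open>
  Matrices over a division ring are elements of \<^term>\<open>carrier_mat m n\<close> over a type of class
  \<^class>\<open>division_ring\<close>; row and column indices start at 0, so the matrix units $E_{1j}$ and
  $E_{i1}$ sit in row 0 and column 0.
\<close>

definition GL :: "nat \<Rightarrow> 'a::division_ring mat set" where
  "GL n = Units (ring_mat TYPE('a) n ())"

definition mat_inv :: "nat \<Rightarrow> 'a::division_ring mat \<Rightarrow> 'a mat" where
  "mat_inv n A = inv\<^bsub>ring_mat TYPE('a) n ()\<^esub> A"

definition left_lin_indep :: "nat \<Rightarrow> nat \<Rightarrow> 'a::division_ring mat set \<Rightarrow> bool" where
  "left_lin_indep m n S \<longleftrightarrow> S \<subseteq> carrier_mat m n \<and>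
     (\<forall>F c. finite F \<and> F \<subseteq> S \<and> (\<forall>i<m. \<forall>j<n. (\<Sum>X\<in>F. c X * X $$ (i,j)) = 0)
        \<longrightarrow> (\<forall>X\<in>F. c X = 0))"

definition right_lin_indep :: "nat \<Rightarrow> nat \<Rightarrow> 'a::division_ring mat set \<Rightarrow> bool" where
  "right_lin_indep m n S \<longleftrightarrow> S \<subseteq> carrier_mat m n \<and>
     (\<forall>F c. finite F \<and> F \<subseteq> S \<and> (\<forall>i<m. \<forall>j<n. (\<Sum>X\<in>F. X $$ (i,j) * c X) = 0)
        \<longrightarrow> (\<forall>X\<in>F. c X = 0))"

text \<open>
  The rank over a division ring is the left row rank: the dimension of the left vector space
  spanned by the rows, i.e. the largest number of left linearly independent rows. (It equals
  the right column rank; the left column rank may differ.)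
\<close>

definition rank :: "'a::division_ring mat \<Rightarrow> nat" where
  "rank A = Max {card S | S. S \<subseteq> mat_of_row ` set (rows A) \<and> left_lin_indep 1 (dim_col A) S}"

definition adjacent :: "'a::division_ring mat \<Rightarrow> 'a mat \<Rightarrow> bool" where
  "adjacent A B \<longleftrightarrow> rank (A - B) = 1"

definition graph_hom ::
    "nat \<Rightarrow> nat \<Rightarrow> nat \<Rightarrow> nat \<Rightarrow> ('a::division_ring mat \<Rightarrow> 'b::division_ring mat) \<Rightarrow> bool" where
  "graph_hom m n m' n' f \<longleftrightarrow> f \<in> carrier_mat m n \<rightarrow> carrier_mat m' n' \<and>
     (\<forall>A\<in>carrier_mat m n. \<forall>B\<in>carrier_mat m n. adjacent A B \<longrightarrow> adjacent (f A) (f B))"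

definition adjacent_set :: "nat \<Rightarrow> nat \<Rightarrow> 'a::division_ring mat set \<Rightarrow> bool" where
  "adjacent_set m n S \<longleftrightarrow> S \<noteq> {} \<and> S \<subseteq> carrier_mat m n \<and>
     (\<forall>A\<in>S. \<forall>B\<in>S. A \<noteq> B \<longrightarrow> adjacent A B)"

definition maximal_set :: "nat \<Rightarrow> nat \<Rightarrow> 'a::division_ring mat set \<Rightarrow> bool" where
  "maximal_set m n S \<longleftrightarrow> adjacent_set m n S \<and> \<not> (\<exists>T. adjacent_set m n T \<and> S \<subset> T)"

definition first_row_mats :: "nat \<Rightarrow> nat \<Rightarrow> 'a::division_ring mat set" where
  "first_row_mats m n = {mat m n (\<lambda>(i,j). if i = 0 then x j else 0) | x. True}"

definition first_col_mats :: "nat \<Rightarrow> nat \<Rightarrow> 'a::division_ring mat set" where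
  "first_col_mats m n = {mat m n (\<lambda>(i,j). if j = 0 then y i else 0) | y. True}"

definition maximal_type_one :: "nat \<Rightarrow> nat \<Rightarrow> 'a::division_ring mat set \<Rightarrow> bool" where
  "maximal_type_one m n S \<longleftrightarrow> maximal_set m n S \<and>
     (\<exists>P\<in>GL m. \<exists>A\<in>carrier_mat m n. S = (\<lambda>X. P * X + A) ` first_row_mats m n)"

definition maximal_type_two :: "nat \<Rightarrow> nat \<Rightarrow> 'a::division_ring mat set \<Rightarrow> bool" where
  "maximal_type_two m n S \<longleftrightarrow> maximal_set m n S \<and>
     (\<exists>Q\<in>GL n. \<exists>A\<in>carrier_mat m n. S = (\<lambda>X. X * Q + A) ` first_col_mats m n)"

definition degenerate ::
    "nat \<Rightarrow> nat \<Rightarrow> nat \<Rightarrow> nat \<Rightarrow> ('a::division_ring mat \<Rightarrow> 'b::division_ring mat) \<Rightarrow> bool" where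
  "degenerate m n m' n' f \<longleftrightarrow>
     (\<exists>A\<in>carrier_mat m n. \<exists>M N. rank A \<le> 1 \<and>
        maximal_type_one m' n' M \<and> maximal_type_two m' n' N \<and>
        f ` {X \<in> carrier_mat m n. rank (X - A) \<le> 1} \<subseteq> M \<union> N \<and> f A \<in> M \<inter> N)"

text \<open>
  Dimension of an adjacent set containing 0 and at least one further matrix, as a relation
  between the set and the number, so that independence of the choice of \<open>P\<close>, \<open>Q\<close>
  and of the basis \<open>B\<close> need not be established beforehand.
\<close>

definition has_adj_dim :: "nat \<Rightarrow> nat \<Rightarrow> 'a::division_ring mat set \<Rightarrow> nat \<Rightarrow> bool" where
  "has_adj_dim m n S d \<longleftrightarrow>
     adjacent_set m n S \<and> 0\<^sub>m m n \<in> S \<and> (\<exists>X\<in>S. X \<noteq> 0\<^sub>m m n) \<and>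
     ((\<exists>P\<in>GL m. \<exists>T B. T = (\<lambda>X. mat_inv m P * X) ` S \<and> T \<subseteq> first_row_mats m n \<and>
         B \<subseteq> T \<and> left_lin_indep m n B \<and>
         \<not> (\<exists>C. C \<subseteq> T \<and> left_lin_indep m n C \<and> B \<subset> C) \<and> finite B \<and> card B = d) \<or>
      (\<exists>Q\<in>GL n. \<exists>T B. T = (\<lambda>X. X * mat_inv n Q) ` S \<and> T \<subseteq> first_col_mats m n \<and>
         B \<subseteq> T \<and> right_lin_indep m n B \<and>
         \<not> (\<exists>C. C \<subseteq> T \<and> right_lin_indep m n C \<and> B \<subset> C) \<and> finite B \<and> card B = d))"

text \<open>Preservation of 1 is not required; for nonzero maps of division rings it is automatic.\<close>

definition nonzero_ring_hom :: "('a::division_ring \<Rightarrow> 'b::division_ring) \<Rightarrow> bool" where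
  "nonzero_ring_hom \<tau> \<longleftrightarrow> (\<forall>x y. \<tau> (x + y) = \<tau> x + \<tau> y) \<and> (\<forall>x y. \<tau> (x * y) = \<tau> x * \<tau> y) \<and>
     (\<exists>x. \<tau> x \<noteq> 0)"

definition nonzero_ring_antihom :: "('a::division_ring \<Rightarrow> 'b::division_ring) \<Rightarrow> bool" where
  "nonzero_ring_antihom \<sigma> \<longleftrightarrow> (\<forall>x y. \<sigma> (x + y) = \<sigma> x + \<sigma> y) \<and> (\<forall>x y. \<sigma> (x * y) = \<sigma> y * \<sigma> x) \<and>
     (\<exists>x. \<sigma> x \<noteq> 0)"

text \<open>\<open>corner p q p' q' Y\<close> is the $p' \times q'$ matrix with the $p \times q$ matrix \<open>Y\<close> as upper
  left block and zeros elsewhere; it is used only for \<open>p \<le> p'\<close> and \<open>q \<le> q'\<close>.\<close>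

definition corner :: "nat \<Rightarrow> nat \<Rightarrow> nat \<Rightarrow> nat \<Rightarrow> 'a::zero mat \<Rightarrow> 'a mat" where
  "corner p q p' q' Y =
     four_block_mat Y (0\<^sub>m p (q' - q)) (0\<^sub>m (p' - p) q) (0\<^sub>m (p' - p) (q' - q))"

definition hom_form ::
    "nat \<Rightarrow> nat \<Rightarrow> nat \<Rightarrow> nat \<Rightarrow> ('a::division_ring mat \<Rightarrow> 'b::division_ring mat) \<Rightarrow>
     'b mat \<Rightarrow> 'b mat \<Rightarrow> ('a \<Rightarrow> 'b) \<Rightarrow> 'b mat \<Rightarrow> bool" where
  "hom_form m n m' n' \<phi> P Q \<tau> L \<longleftrightarrow>
     m \<le> m' \<and> n \<le> n' \<and> P \<in> GL m' \<and> Q \<in> GL n' \<and> nonzero_ring_hom \<tau> \<and> L \<in> carrier_mat n m \<and>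
     (\<forall>X\<in>carrier_mat m n.
        1\<^sub>m m + map_mat \<tau> X * L \<in> GL m \<and>
        \<phi> X = P * corner m n m' n' (mat_inv m (1\<^sub>m m + map_mat \<tau> X * L) * map_mat \<tau> X) * Q)"

definition antihom_form ::
    "nat \<Rightarrow> nat \<Rightarrow> nat \<Rightarrow> nat \<Rightarrow> ('a::division_ring mat \<Rightarrow> 'b::division_ring mat) \<Rightarrow>
     'b mat \<Rightarrow> 'b mat \<Rightarrow> ('a \<Rightarrow> 'b) \<Rightarrow> 'b mat \<Rightarrow> bool" where
  "antihom_form m n m' n' \<phi> P Q \<sigma> L \<longleftrightarrow>
     n \<le> m' \<and> m \<le> n' \<and> P \<in> GL m' \<and> Q \<in> GL n' \<and> nonzero_ring_antihom \<sigma> \<and> L \<in> carrier_mat m n \<and>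
     (\<forall>X\<in>carrier_mat m n.
        1\<^sub>m m + L * transpose_mat (map_mat \<sigma> X) \<in> GL m \<and>
        \<phi> X = P * corner n m m' n'
          (transpose_mat (map_mat \<sigma> X) * mat_inv m (1\<^sub>m m + L * transpose_mat (map_mat \<sigma> X))) * Q)"

end

theory Submission
  imports Defs "HOL-Library.Function_Algebras"
begin

text \<open>
  Let \<open>A\<close> have rank at most one. For fixed \<open>x\<close> the matrices \<open>A + x y\<close> are pairwise adjacent, so \<open>\<phi>\<close> sends
  this row at \<open>A\<close> into a maximal set, and likewise for the column obtained by fixing \<open>y\<close>.
  Non-degeneracy forces one of two alternatives to hold at all \<open>A\<close> simultaneously: rows go into sets
  of type one and columns into sets of type two, or the two types are swapped; transposing into the
  opposite ring reduces the latter to the former. On the row at \<open>0\<close>, \<open>\<phi>\<close> is then a lineation of an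
  affine space with full-dimensional image, so by Desargues' theorem
  (this needs four scalars) it is fractional semilinear. Comparing this description for rows with
  the one for columns gives \<open>\<phi> (x y) = k x (1 + B x y)\<^sup>-\<^sup>1 h y\<close> for all \<open>x\<close> and \<open>y\<close> with a common
  ring homomorphism. After normalization \<open>B\<close> becomes a matrix \<open>L\<close>, and the
  equation \<open>Y + X L Y = X\<close> for \<open>Y = \<phi> X\<close> extends from rank one to all \<open>X\<close> by induction on the number of
  rank one summands. It says that \<open>1 + X L\<close> is invertible and \<open>Y = (1 + X L)\<^sup>-\<^sup>1 X\<close>.
\<close>

subsection \<open>Vectors and matrices over division rings\<close>

text \<open>Degeneracy is tested only at base points of rank at most one, so only there is the type
  of the image of a row or column known. This shapes the final induction: for longer sums of outer
  products mere adjacency remains, and the image of a sum is located by comparing it with images of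
  several shorter sums. The equation \<open>Y + X L Y = X\<close> replaces the closed formula
  because it makes sense before \<open>1 + X L\<close> is known to be invertible;
  \<open>1 - Y L\<close> then turns out to be the inverse. The four scalars are \<open>0\<close>,
  \<open>1\<close>, \<open>c2\<close> and \<open>c3\<close>: Desargues is applied to triangles with
  heights in the ratio \<open>1\<close>, \<open>c2\<close>, \<open>c3\<close>, all different and
  nonzero. The dimension hypotheses enter twice: they decide which alternative in the definition of
  dimension fits the type of the image, and they keep the lineation from flattening planes. Rows and
  columns first yield two ring homomorphisms and two denominators; each denominator is
  \<open>1\<close> plus a term that scales with its argument, so replacing \<open>x\<close> by
  \<open>x a\<close> separates the two terms and shows that one constant conjugates one description
  into the other.\<close>

text \<open>
  Vectors and matrices are functions that vanish outside their index range, so that dimensions can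
  vary within a proof.
\<close>
definition lsc :: "'a::times \<Rightarrow> (nat \<Rightarrow> 'a) \<Rightarrow> nat \<Rightarrow> 'a" (infixr "*\<^sub>l" 75) where
  "a *\<^sub>l v = (\<lambda>i. a * v i)"

definition fvec :: "nat \<Rightarrow> (nat \<Rightarrow> 'a::zero) set" where
  "fvec n = {v. \<forall>i\<ge>n. v i = 0}"

definition ev :: "nat \<Rightarrow> nat \<Rightarrow> 'a::zero_neq_one" where
  "ev k = (\<lambda>i. if i = k then 1 else 0)"

lemma lsc_apply [simp]: "(a *\<^sub>l v) i = a * v i"
  by (simp add: lsc_def)

lemma fun_uminus_apply [simp]: "(- u) i = - u i" for u :: "'a \<Rightarrow> 'b::uminus"
  by (simp add: fun_Compl_def)

lemma fun_plus_apply [simp]: "(u + v) i = u i + v i" for u v :: "'a \<Rightarrow> 'b::plus"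
  by (simp add: plus_fun_def)

lemma fun_zero_apply [simp]: "(0 :: 'a \<Rightarrow> 'b::zero) i = 0"
  by (simp add: zero_fun_def)

lemma fun_sum_apply [simp]: "(\<Sum>i\<in>I. f i) x = (\<Sum>i\<in>I. f i x)" for f :: "'i \<Rightarrow> 'a \<Rightarrow> 'b::comm_monoid_add"
  by (induction I rule: infinite_finite_induct) auto

lemma lsc_add_right [simp]: "a *\<^sub>l (u + v) = a *\<^sub>l u + a *\<^sub>l v" for a :: "'a::ring"
  by (auto simp: fun_eq_iff distrib_left)
lemma lsc_diff_right [simp]: "a *\<^sub>l (u - v) = a *\<^sub>l u - a *\<^sub>l v" for a :: "'a::ring"
  by (auto simp: fun_eq_iff right_diff_distrib)
lemma lsc_add_left: "(a + b) *\<^sub>l u = a *\<^sub>l u + b *\<^sub>l u" for a :: "'a::ring"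
  by (auto simp: fun_eq_iff distrib_right)
lemma lsc_diff_left: "(a - b) *\<^sub>l u = a *\<^sub>l u - b *\<^sub>l u" for a :: "'a::ring"
  by (auto simp: fun_eq_iff left_diff_distrib)
lemma lsc_lsc [simp]: "a *\<^sub>l b *\<^sub>l u = (a * b) *\<^sub>l u" for a :: "'a::ring"
  by (auto simp: fun_eq_iff mult.assoc)
lemma lsc_zero_left [simp]: "0 *\<^sub>l u = 0" for u :: "nat \<Rightarrow> 'a::ring"
  by (auto simp: fun_eq_iff)
lemma lsc_zero_right [simp]: "a *\<^sub>l 0 = 0" for a :: "'a::ring"
  by (auto simp: fun_eq_iff)
lemma lsc_minus_left: "(- a) *\<^sub>l u = - (a *\<^sub>l u)" for a :: "'a::ring"
  by (auto simp: fun_eq_iff)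
lemma lsc_minus_right [simp]: "a *\<^sub>l (- u) = - (a *\<^sub>l u)" for a :: "'a::ring"
  by (auto simp: fun_eq_iff)
lemma lsc_one [simp]: "1 *\<^sub>l u = u" for u :: "nat \<Rightarrow> 'a::ring_1"
  by (auto simp: fun_eq_iff)
lemma lsc_eq_0_iff [simp]: "a *\<^sub>l u = 0 \<longleftrightarrow> a = 0 \<or> u = 0" for u :: "nat \<Rightarrow> 'a::division_ring"
  by (auto simp: fun_eq_iff)
lemma lsc_sum_right: "a *\<^sub>l (\<Sum>i\<in>I. f i) = (\<Sum>i\<in>I. a *\<^sub>l f i)" for a :: "'a::ring"
  by (auto simp: fun_eq_iff sum_distrib_left)
lemma lsc_sum_left: "(\<Sum>i\<in>I. f i) *\<^sub>l u = (\<Sum>i\<in>I. f i *\<^sub>l u)" for u :: "nat \<Rightarrow> 'a::ring"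
  by (auto simp: fun_eq_iff sum_distrib_right)

lemma fun_nonzeroE:
  assumes "u \<noteq> (0 :: nat \<Rightarrow> 'a::zero)"
  obtains i where "u i \<noteq> 0"
  using assms by (auto simp: fun_eq_iff)

lemma fvec_closed [simp]:
  "0 \<in> fvec n"
  "u \<in> fvec n \<Longrightarrow> v \<in> fvec n \<Longrightarrow> u + v \<in> fvec n"
  "u \<in> fvec n \<Longrightarrow> v \<in> fvec n \<Longrightarrow> u - v \<in> fvec n"
  "u \<in> fvec n \<Longrightarrow> - u \<in> fvec n"
  "u \<in> fvec n \<Longrightarrow> a *\<^sub>l u \<in> fvec n"
  for u v :: "nat \<Rightarrow> 'a::division_ring"
  by (auto simp: fvec_def)

lemma fvec_sum [simp]: "(\<And>i. i \<in> I \<Longrightarrow> f i \<in> fvec n) \<Longrightarrow> (\<Sum>i\<in>I. f i) \<in> fvec n"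
  for f :: "'i \<Rightarrow> nat \<Rightarrow> 'a::division_ring"
  by (auto simp: fvec_def)

lemma ev_fvec [simp]: "i < n \<Longrightarrow> ev i \<in> fvec n"
  by (auto simp: fvec_def ev_def)

lemma ev_nonzero [simp]: "ev i \<noteq> (0 :: nat \<Rightarrow> 'a::zero_neq_one)"
  by (auto simp: ev_def fun_eq_iff)

lemma fvec_expand:
  assumes "v \<in> fvec n"
  shows "v = (\<Sum>i<n. v i *\<^sub>l (ev i :: nat \<Rightarrow> 'a::division_ring))"
proof
  fix j
  show "v j = (\<Sum>i<n. v i *\<^sub>l ev i) j"
  proof (cases "j < n")
    case True
    have "(\<Sum>i<n. v i * (ev i j :: 'a)) = (\<Sum>i<n. if i = j then v j else 0)"
      by (rule sum.cong) (auto simp: ev_def)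
    then show ?thesis using True by simp
  next
    case False
    then show ?thesis using assms
      by (auto simp: fvec_def ev_def intro!: sum.neutral[symmetric])
  qed
qed

section \<open>Left linear independence of families\<close>

definition lind :: "'i set \<Rightarrow> ('i \<Rightarrow> nat \<Rightarrow> 'a::division_ring) \<Rightarrow> bool" where
  "lind I w \<longleftrightarrow> (\<forall>c. (\<Sum>i\<in>I. c i *\<^sub>l w i) = 0 \<longrightarrow> (\<forall>i\<in>I. c i = 0))"

lemma lindD: "lind I w \<Longrightarrow> (\<Sum>i\<in>I. c i *\<^sub>l w i) = 0 \<Longrightarrow> i \<in> I \<Longrightarrow> c i = 0"
  by (auto simp: lind_def)

text \<open>Gaussian elimination with the unknowns on the left: a pivot \<open>k\<close> in equation
  \<open>r\<close> removes one equation and one unknown, and the induction hypothesis applies to the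
  reduced coefficients \<open>c'\<close>.\<close>

lemma homogeneous_system:
  fixes c :: "'i \<Rightarrow> 'j \<Rightarrow> 'a::division_ring"
  assumes "finite J" "finite I" "card J < card I"
  shows "\<exists>a. (\<exists>i\<in>I. a i \<noteq> 0) \<and> (\<forall>j\<in>J. (\<Sum>i\<in>I. a i * c i j) = 0)"
  using assms
proof (induction J arbitrary: I c rule: finite_induct)
  case empty
  then have "I \<noteq> {}" by auto
  then show ?case by (intro exI[of _ "\<lambda>_. 1"]) auto
next
  case (insert r J)
  show ?case
  proof (cases "\<forall>i\<in>I. c i r = 0")
    case True
    from insert have "card J < card I" by auto
    from insert.IH[OF insert.prems(1) this, of c] True show ?thesis by auto
  next
    case False
    then obtain k where k: "k \<in> I" "c k r \<noteq> 0" by auto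
    define c' where "c' i j = c i j - c i r * inverse (c k r) * c k j" for i j
    from insert k have "card J < card (I - {k})" by auto
    from insert.IH[OF _ this, of c'] insert.prems(1) obtain a where
      a: "\<exists>i\<in>I - {k}. a i \<noteq> 0" "\<forall>j\<in>J. (\<Sum>i\<in>I - {k}. a i * c' i j) = 0" by auto
    \<comment> \<open>The value at the pivot is the one forced by equation \<open>r\<close>; with it
      every original sum equals the reduced sum.\<close>
    define b where "b i = (if i = k then - (\<Sum>i\<in>I - {k}. a i * c i r) * inverse (c k r) else a i)" for i
    have s: "(\<Sum>i\<in>I. b i * c i j) = (\<Sum>i\<in>I - {k}. a i * c' i j)" for j
    proof -
      have "(\<Sum>i\<in>I. b i * c i j) = b k * c k j + (\<Sum>i\<in>I - {k}. b i * c i j)"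
        using insert.prems(1) k(1) by (rule sum.remove)
      also have "(\<Sum>i\<in>I - {k}. b i * c i j) = (\<Sum>i\<in>I - {k}. a i * c i j)"
        by (rule sum.cong) (auto simp: b_def)
      also have "b k * c k j + \<dots> = (\<Sum>i\<in>I - {k}. a i * c' i j)"
        by (simp add: b_def c'_def right_diff_distrib sum_subtractf sum_distrib_right mult.assoc)
      finally show ?thesis .
    qed
    have r: "(\<Sum>i\<in>I - {k}. a i * c' i r) = 0"
      using k by (simp add: c'_def mult.assoc)
    from a(1) have "\<exists>i\<in>I. b i \<noteq> 0" by (auto simp: b_def)
    moreover have "\<forall>j\<in>insert r J. (\<Sum>i\<in>I. b i * c i j) = 0"
      using a(2) r by (auto simp: s)
    ultimately show ?thesis by blast
  qed
qed

lemma not_lind_in_span: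
  assumes "finite J" "finite I" "card J < card I"
    and "\<And>i. i \<in> I \<Longrightarrow> v i = (\<Sum>j\<in>J. C i j *\<^sub>l w j)"
  shows "\<not> lind I v"
proof -
  obtain a where a: "\<exists>i\<in>I. a i \<noteq> 0" "\<forall>j\<in>J. (\<Sum>i\<in>I. a i * C i j) = 0"
    using homogeneous_system[OF assms(1-3)] by blast
  have "(\<Sum>i\<in>I. a i *\<^sub>l v i) = (\<Sum>i\<in>I. \<Sum>j\<in>J. (a i * C i j) *\<^sub>l w j)"
    by (rule sum.cong) (auto simp: assms(4) lsc_sum_right)
  also have "\<dots> = (\<Sum>j\<in>J. (\<Sum>i\<in>I. a i * C i j) *\<^sub>l w j)"
    by (subst sum.swap) (simp add: lsc_sum_left)
  also have "\<dots> = 0" using a(2) by simp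
  finally show ?thesis using a(1) by (auto simp: lind_def)
qed

text \<open>A relation among the \<open>w j\<close> would express some \<open>w k\<close> by the
  others, so that \<open>card I\<close> independent vectors would lie in the span of one vector
  fewer.\<close>

lemma lind_exchange:
  assumes "finite I" and "lind I v" and v: "\<And>i. i \<in> I \<Longrightarrow> v i = (\<Sum>j\<in>I. C i j *\<^sub>l w j)"
  shows "lind I w"
  unfolding lind_def
proof (intro allI impI ballI, rule ccontr)
  fix d k assume d: "(\<Sum>j\<in>I. d j *\<^sub>l w j) = 0" and k: "k \<in> I" "d k \<noteq> 0"
  let ?J = "I - {k}"
  have "d k *\<^sub>l w k + (\<Sum>j\<in>?J. d j *\<^sub>l w j) = 0"
    using d sum.remove[OF assms(1) k(1), of "\<lambda>j. d j *\<^sub>l w j"] by simp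
  then have "d k *\<^sub>l w k = - (\<Sum>j\<in>?J. d j *\<^sub>l w j)" by (simp add: eq_neg_iff_add_eq_0)
  then have "inverse (d k) *\<^sub>l d k *\<^sub>l w k = inverse (d k) *\<^sub>l - (\<Sum>j\<in>?J. d j *\<^sub>l w j)"
    by (rule arg_cong)
  then have wk: "w k = - (\<Sum>j\<in>?J. (inverse (d k) * d j) *\<^sub>l w j)"
    using k(2) by (simp add: lsc_sum_right)
  have "v i = (\<Sum>j\<in>?J. (C i j - C i k * (inverse (d k) * d j)) *\<^sub>l w j)" if "i \<in> I" for i
  proof -
    have "v i = C i k *\<^sub>l w k + (\<Sum>j\<in>?J. C i j *\<^sub>l w j)"
      using v[OF that] sum.remove[OF assms(1) k(1), of "\<lambda>j. C i j *\<^sub>l w j"] by simp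
    also have "C i k *\<^sub>l w k = - (\<Sum>j\<in>?J. (C i k * (inverse (d k) * d j)) *\<^sub>l w j)"
      by (subst wk) (simp add: lsc_sum_right mult.assoc)
    finally have e: "v i = - (\<Sum>j\<in>?J. (C i k * (inverse (d k) * d j)) *\<^sub>l w j) + (\<Sum>j\<in>?J. C i j *\<^sub>l w j)" .
    show ?thesis
    proof
      fix x
      show "v i x = (\<Sum>j\<in>?J. (C i j - C i k * (inverse (d k) * d j)) *\<^sub>l w j) x"
        unfolding e fun_plus_apply fun_uminus_apply fun_sum_apply lsc_apply left_diff_distrib sum_subtractf
        by (rule uminus_add_conv_diff)
    qed
  qed
  from not_lind_in_span[OF _ assms(1) card_Diff1_less[OF assms(1) k(1)] this] have "\<not> lind I v"
    using assms(1) by simp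
  with assms(2) show False by contradiction
qed

lemma lind_nonzero: "lind I w \<Longrightarrow> finite I \<Longrightarrow> i \<in> I \<Longrightarrow> w i \<noteq> 0"
proof
  assume a: "lind I w" "finite I" "i \<in> I" "w i = 0"
  have "(\<Sum>j\<in>I. (if j = i then 1 else 0) *\<^sub>l w j) = 0"
    using a by (intro sum.neutral) auto
  from lindD[OF a(1) this a(3)] show False by simp
qed

lemma lind_insert:
  assumes I: "finite I" "k \<notin> I" "lind I w"
    and "\<not> (\<exists>c. w k = (\<Sum>i\<in>I. c i *\<^sub>l w i))"
  shows "lind (insert k I) w"
  unfolding lind_def
proof (intro allI impI)
  fix c assume "(\<Sum>i\<in>insert k I. c i *\<^sub>l w i) = 0"
  then have s: "c k *\<^sub>l w k + (\<Sum>i\<in>I. c i *\<^sub>l w i) = 0" using I by simp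
  have "c k = 0"
  proof (rule ccontr)
    assume ck: "c k \<noteq> 0"
    from s have "c k *\<^sub>l w k = - (\<Sum>i\<in>I. c i *\<^sub>l w i)" by (simp add: eq_neg_iff_add_eq_0)
    then have "inverse (c k) *\<^sub>l c k *\<^sub>l w k = inverse (c k) *\<^sub>l - (\<Sum>i\<in>I. c i *\<^sub>l w i)"
      by (rule arg_cong)
    then have "w k = (\<Sum>i\<in>I. (- inverse (c k) * c i) *\<^sub>l w i)"
      using ck by (simp add: lsc_sum_right lsc_minus_left sum_negf)
    with assms(4) show False by (metis (no_types))
  qed
  with s I(3) show "\<forall>i\<in>insert k I. c i = 0" by (auto simp: lind_def)
qed

lemma lind_le_dim:
  assumes "lind I w" "finite I" "\<And>i. i \<in> I \<Longrightarrow> w i \<in> fvec N"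
  shows "card I \<le> N"
proof (rule ccontr)
  assume "\<not> card I \<le> N"
  then have "\<not> lind I w"
    using assms(2,3) by (intro not_lind_in_span[of "{..<N}" I w "\<lambda>i j. w i j" ev]) (auto intro: fvec_expand)
  with assms(1) show False by contradiction
qed

text \<open>As long as \<open>n < N\<close>, some unit vector lies outside the span of the family,
  since otherwise \<open>N\<close> independent unit vectors would lie in the span of
  \<open>n\<close> vectors. It is appended, and the induction runs on \<open>N - n\<close>.\<close>

lemma lind_extend:
  fixes h :: "nat \<Rightarrow> nat \<Rightarrow> 'a::division_ring"
  assumes "lind {..<n} h" "\<And>i. i < n \<Longrightarrow> h i \<in> fvec N"
  shows "\<exists>H. lind {..<N} H \<and> (\<forall>i<N. H i \<in> fvec N) \<and> (\<forall>i<n. H i = h i)"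
  using assms
proof (induction "N - n" arbitrary: n h)
  case 0
  have "n \<le> N" using lind_le_dim[OF 0(2)] 0(3) by auto
  with 0 have "n = N" by auto
  with 0 show ?case by (intro exI[of _ h]) auto
next
  case (Suc d)
  have "\<exists>k<N. \<not> (\<exists>c. (ev k :: nat \<Rightarrow> 'a) = (\<Sum>i<n. c i *\<^sub>l h i))"
  proof (rule ccontr)
    assume "\<not> ?thesis"
    then obtain c where c: "\<And>k. k < N \<Longrightarrow> (ev k :: nat \<Rightarrow> 'a) = (\<Sum>i<n. c k i *\<^sub>l h i)"
      by metis
    have "\<not> lind {..<N} (ev :: nat \<Rightarrow> nat \<Rightarrow> 'a)"
      using Suc(2) by (intro not_lind_in_span[where J = "{..<n}" and C = c and w = h]) (auto simp: c)
    moreover have "lind {..<N} (ev :: nat \<Rightarrow> nat \<Rightarrow> 'a)"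
      unfolding lind_def
    proof (intro allI impI ballI)
      fix c i assume s: "(\<Sum>i<N. c i *\<^sub>l (ev i :: nat \<Rightarrow> 'a)) = 0" and i: "i \<in> {..<N}"
      define v where "v i = (if i < N then c i else 0)" for i
      have "v \<in> fvec N" by (auto simp: fvec_def v_def)
      from fvec_expand[OF this] have "v = (\<Sum>i<N. c i *\<^sub>l (ev i :: nat \<Rightarrow> 'a))"
        by (simp add: v_def)
      with s have "v i = 0" by simp
      with i show "c i = 0" by (simp add: v_def)
    qed
    ultimately show False by contradiction
  qed
  then obtain k where k: "k < N" "\<not> (\<exists>c. (ev k :: nat \<Rightarrow> 'a) = (\<Sum>i<n. c i *\<^sub>l h i))" by auto
  define g where "g = h(n := ev k)"
  have eq: "(\<Sum>i<n. c i *\<^sub>l g i) = (\<Sum>i<n. c i *\<^sub>l h i)" for c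
    by (rule sum.cong) (auto simp: g_def)
  have "lind {..<n} g"
    using Suc(3) by (simp add: lind_def eq)
  then have "lind (insert n {..<n}) g"
    using k by (intro lind_insert) (auto simp only: eq lessThan_iff finite_lessThan, simp_all add: g_def)
  then have "lind {..<Suc n} g" by (simp add: lessThan_Suc)
  moreover have "d = N - Suc n" "\<And>i. i < Suc n \<Longrightarrow> g i \<in> fvec N"
    using Suc(2,4) k(1) by (auto simp: g_def less_Suc_eq)
  ultimately obtain H where
    "lind {..<N} H" "\<forall>i<N. H i \<in> fvec N" "\<forall>i<Suc n. H i = g i"
    using Suc(1) by blast
  then show ?case by (intro exI[of _ H]) (auto simp: g_def)
qed

section \<open>Matrix products and inverses\<close>

definition mm :: "nat \<Rightarrow> (nat \<Rightarrow> nat \<Rightarrow> 'a::semiring_0) \<Rightarrow> (nat \<Rightarrow> nat \<Rightarrow> 'a) \<Rightarrow> nat \<Rightarrow> nat \<Rightarrow> 'a" where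
  "mm N A B = (\<lambda>i j. \<Sum>l<N. A i l * B l j)"

definition idm :: "nat \<Rightarrow> nat \<Rightarrow> nat \<Rightarrow> 'a::zero_neq_one" where
  "idm N = (\<lambda>i j. if i = j \<and> i < N then 1 else 0)"

definition fmat :: "nat \<Rightarrow> nat \<Rightarrow> (nat \<Rightarrow> nat \<Rightarrow> 'a::zero) set" where
  "fmat m n = {A. \<forall>i j. \<not> (i < m \<and> j < n) \<longrightarrow> A i j = 0}"

lemma mm_assoc: "mm N (mm M A B) C = mm M A (mm N B C)"
proof (intro ext)
  fix i j
  have "mm N (mm M A B) C i j = (\<Sum>l<N. \<Sum>k<M. A i k * B k l * C l j)"
    by (simp add: mm_def sum_distrib_right)
  also have "\<dots> = (\<Sum>k<M. \<Sum>l<N. A i k * (B k l * C l j))"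
    by (subst sum.swap) (simp add: mult.assoc)
  finally show "mm N (mm M A B) C i j = mm M A (mm N B C) i j"
    by (simp add: mm_def sum_distrib_left)
qed

lemma mm_add_left: "mm N (A + B) C = mm N A C + mm N B C"
  by (auto simp: mm_def fun_eq_iff distrib_right sum.distrib)
lemma mm_add_right: "mm N A (B + C) = mm N A B + mm N A C"
  by (auto simp: mm_def fun_eq_iff distrib_left sum.distrib)
lemma mm_diff_left: "mm N (A - B) C = mm N A C - mm N B C" for A :: "nat \<Rightarrow> nat \<Rightarrow> 'a::ring"
  by (auto simp: mm_def fun_eq_iff left_diff_distrib sum_subtractf)
lemma mm_diff_right: "mm N A (B - C) = mm N A B - mm N A C" for A :: "nat \<Rightarrow> nat \<Rightarrow> 'a::ring"
  by (auto simp: mm_def fun_eq_iff right_diff_distrib sum_subtractf)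
lemma mm_zero [simp]: "mm N 0 A = 0" "mm N A 0 = 0"
  by (auto simp: mm_def fun_eq_iff)

lemma mm_fmat: "A \<in> fmat m k \<Longrightarrow> B \<in> fmat k' n \<Longrightarrow> mm N A B \<in> fmat m n"
  by (auto simp: fmat_def mm_def)

lemma mm_id_left: "A \<in> fmat m n \<Longrightarrow> m \<le> N \<Longrightarrow> mm N (idm N) A = A"
  for A :: "nat \<Rightarrow> nat \<Rightarrow> 'a::ring_1"
proof (intro ext)
  fix i j assume A: "A \<in> fmat m n" "m \<le> N"
  have "mm N (idm N) A i j = (\<Sum>l<N. if l = i then A i j else 0)"
    unfolding mm_def by (rule sum.cong) (auto simp: idm_def)
  then show "mm N (idm N) A i j = A i j" using A by (auto simp: fmat_def)
qed

lemma mm_id_right: "A \<in> fmat m n \<Longrightarrow> n \<le> N \<Longrightarrow> mm N A (idm N) = A"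
  for A :: "nat \<Rightarrow> nat \<Rightarrow> 'a::ring_1"
proof (intro ext)
  fix i j assume A: "A \<in> fmat m n" "n \<le> N"
  have "mm N A (idm N) i j = (\<Sum>l<N. if l = j then A i j else 0)"
    unfolding mm_def by (rule sum.cong) (auto simp: idm_def)
  then show "mm N A (idm N) i j = A i j" using A by (auto simp: fmat_def)
qed

lemma fmat_closed [simp]:
  "0 \<in> fmat m n" "A \<in> fmat m n \<Longrightarrow> B \<in> fmat m n \<Longrightarrow> A + B \<in> fmat m n"
  "A \<in> fmat m n \<Longrightarrow> B \<in> fmat m n \<Longrightarrow> A - B \<in> fmat m n"
  for A B :: "nat \<Rightarrow> nat \<Rightarrow> 'a::ring"
  by (auto simp: fmat_def)

lemma idm_fmat [simp]: "idm N \<in> fmat N N"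
  by (auto simp: fmat_def idm_def)

text \<open>Independent rows span, so the coordinates of the unit vectors form a left inverse
  \<open>C\<close>. For the other side, \<open>(A C - 1) A = 0\<close> is a family of relations
  among the rows of \<open>A\<close>, hence \<open>A C - 1 = 0\<close>.\<close>

lemma lind_inverse:
  fixes A :: "nat \<Rightarrow> nat \<Rightarrow> 'a::division_ring"
  assumes A: "A \<in> fmat N N" "lind {..<N} A"
  shows "\<exists>C\<in>fmat N N. mm N C A = idm N \<and> mm N A C = idm N"
proof -
  have fv: "A i \<in> fvec N" for i using A(1) by (auto simp: fvec_def fmat_def)
  have "\<exists>c. (ev k :: nat \<Rightarrow> 'a) = (\<Sum>i<N. c i *\<^sub>l A i)" if k: "k < N" for k
  proof (rule ccontr)
    assume n: "\<not> ?thesis"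
    define g where "g = A(N := ev k)"
    have eq: "(\<Sum>i<N. c i *\<^sub>l g i) = (\<Sum>i<N. c i *\<^sub>l A i)" for c
      by (rule sum.cong) (auto simp: g_def)
    have "lind {..<N} g" using A(2) by (simp add: lind_def eq)
    then have "lind (insert N {..<N}) g"
      using n by (intro lind_insert) (auto simp only: eq lessThan_iff finite_lessThan, simp_all add: g_def)
    then have "card (insert N {..<N}) \<le> N"
      by (rule lind_le_dim) (use fv k in \<open>auto simp: g_def\<close>)
    then show False by simp
  qed
  then obtain c where c: "\<And>k. k < N \<Longrightarrow> (ev k :: nat \<Rightarrow> 'a) = (\<Sum>i<N. c k i *\<^sub>l A i)" by metis
  define C where "C i j = (if i < N \<and> j < N then c i j else 0)" for i j
  have C: "C \<in> fmat N N" by (auto simp: fmat_def C_def)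
  have CA: "mm N C A = idm N"
  proof (intro ext)
    fix i j show "mm N C A i j = idm N i j"
    proof (cases "i < N")
      case True
      have "mm N C A i j = (\<Sum>l<N. c i l *\<^sub>l A l) j" using True by (simp add: mm_def C_def)
      also have "\<dots> = ev i j" using c[OF True] by simp
      finally show ?thesis using True by (simp add: ev_def idm_def)
    qed (simp add: mm_def C_def idm_def)
  qed
  define D where "D = mm N A C - idm N"
  have "mm N D A = 0"
    using A(1) by (simp add: D_def mm_diff_left mm_assoc CA mm_id_left mm_id_right)
  then have "(\<Sum>l<N. D i l *\<^sub>l A l) = 0" for i
    by (auto simp: mm_def fun_eq_iff)
  then have "D i l = 0" if "l < N" for i l using lindD[OF A(2)] that by auto
  moreover have "D \<in> fmat N N" unfolding D_def using mm_fmat[OF A(1) C] by simp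
  ultimately have "D i j = 0" for i j
    by (cases "j < N") (simp_all add: fmat_def)
  then have "D = 0" by (intro ext) simp
  then have "mm N A C = idm N" by (simp add: D_def)
  with C CA show ?thesis by blast
qed

text \<open>A row vector \<open>c\<close> with \<open>c A = 0\<close> satisfies
  \<open>c = c A B = 0\<close>. So the rows of \<open>A\<close> are independent, \<open>A\<close>
  has a two-sided inverse, and this must be \<open>B\<close>.\<close>

lemma mm_right_inverse_left:
  fixes A B :: "nat \<Rightarrow> nat \<Rightarrow> 'a::division_ring"
  assumes A: "A \<in> fmat N N" and B: "B \<in> fmat N N" and AB: "mm N A B = idm N"
  shows "mm N B A = idm N"
proof -
  have "lind {..<N} A"
    unfolding lind_def
  proof (intro allI impI ballI)
    fix c i assume s: "(\<Sum>i<N. c i *\<^sub>l A i) = 0" and i: "i \<in> {..<N}"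
    \<comment> \<open>The coefficient vector is stored as a single row, so that the relation becomes
      a matrix equation.\<close>
    define D where "D = (\<lambda>i' j::nat. if i' = i \<and> j < N then c j else 0)"
    have D: "D \<in> fmat N N" using i by (auto simp: D_def fmat_def)
    have "mm N D A = 0"
    proof (intro ext)
      fix x j
      show "mm N D A x j = 0 x j"
        using s by (cases "x = i") (auto simp: mm_def D_def fun_eq_iff)
    qed
    then have "mm N D (mm N A B) = 0" by (simp flip: mm_assoc)
    then have "D = 0" using D by (simp add: AB mm_id_right)
    then show "c i = 0" using i by (metis D_def fun_zero_apply lessThan_iff)
  qed
  from lind_inverse[OF A this] obtain C where C: "C \<in> fmat N N" "mm N C A = idm N" by auto
  have "C = mm N C (mm N A B)" using C by (simp add: AB mm_id_right)
  also have "\<dots> = B" using B by (simp add: C mm_id_left flip: mm_assoc)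
  finally show ?thesis using C by simp
qed

subsection \<open>Spans of two vectors and Desargues' theorem\<close>

definition span2 :: "(nat \<Rightarrow> 'a::division_ring) \<Rightarrow> (nat \<Rightarrow> 'a) \<Rightarrow> (nat \<Rightarrow> 'a) set" where
  "span2 u v = {a *\<^sub>l u + b *\<^sub>l v | a b. True}"

definition ind2 :: "(nat \<Rightarrow> 'a::division_ring) \<Rightarrow> (nat \<Rightarrow> 'a) \<Rightarrow> bool" where
  "ind2 u v \<longleftrightarrow> (\<forall>a b. a *\<^sub>l u + b *\<^sub>l v = 0 \<longrightarrow> a = 0 \<and> b = 0)"

definition ind3 :: "(nat \<Rightarrow> 'a::division_ring) \<Rightarrow> (nat \<Rightarrow> 'a) \<Rightarrow> (nat \<Rightarrow> 'a) \<Rightarrow> bool" where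
  "ind3 u v w \<longleftrightarrow> (\<forall>a b c. a *\<^sub>l u + b *\<^sub>l v + c *\<^sub>l w = 0 \<longrightarrow> a = 0 \<and> b = 0 \<and> c = 0)"

lemma ind2_alt: "ind2 u v \<longleftrightarrow> u \<noteq> 0 \<and> (\<forall>c. v \<noteq> c *\<^sub>l u)"
proof
  assume i: "ind2 u v"
  have "u \<noteq> 0" using i[unfolded ind2_def, rule_format, of 1 0] by auto
  moreover have "v \<noteq> c *\<^sub>l u" for c
    using i[unfolded ind2_def, rule_format, of c "-1"] by (auto simp: lsc_minus_left)
  ultimately show "u \<noteq> 0 \<and> (\<forall>c. v \<noteq> c *\<^sub>l u)" by blast
next
  assume a: "u \<noteq> 0 \<and> (\<forall>c. v \<noteq> c *\<^sub>l u)"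
  show "ind2 u v"
    unfolding ind2_def
  proof (intro allI impI)
    fix x y assume e: "x *\<^sub>l u + y *\<^sub>l v = 0"
    have "y = 0"
    proof (rule ccontr)
      assume y: "y \<noteq> 0"
      have "inverse y *\<^sub>l (x *\<^sub>l u + y *\<^sub>l v) = 0" using e by simp
      then have "(inverse y * x) *\<^sub>l u + v = 0" using y by simp
      then have "v = (- (inverse y * x)) *\<^sub>l u"
        by (simp add: lsc_minus_left eq_neg_iff_add_eq_0 add.commute)
      with a show False by blast
    qed
    with e a show "x = 0 \<and> y = 0" by auto
  qed
qed

lemma ind2_sym: "ind2 u v \<Longrightarrow> ind2 v u"
  unfolding ind2_def by (metis add.commute)

lemma ind2_nonzero: "ind2 u v \<Longrightarrow> u \<noteq> 0" "ind2 u v \<Longrightarrow> v \<noteq> 0"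
  using ind2_sym by (auto simp: ind2_alt)

lemma ind2_eqD:
  assumes "ind2 u v" "a *\<^sub>l u + b *\<^sub>l v = a' *\<^sub>l u + b' *\<^sub>l v"
  shows "a = a'" "b = b'"
proof -
  have "(a - a') *\<^sub>l u + (b - b') *\<^sub>l v = 0"
    using assms(2) by (simp add: lsc_diff_left algebra_simps)
  with assms(1) have "a - a' = 0 \<and> b - b' = 0" unfolding ind2_def by blast
  then show "a = a'" "b = b'" by auto
qed

lemma ind3_eqD:
  assumes "ind3 u v w" "a *\<^sub>l u + b *\<^sub>l v + c *\<^sub>l w = a' *\<^sub>l u + b' *\<^sub>l v + c' *\<^sub>l w"
  shows "a = a'" "b = b'" "c = c'"
proof -
  have "(a - a') *\<^sub>l u + (b - b') *\<^sub>l v + (c - c') *\<^sub>l w = 0"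
    using assms(2) by (simp add: lsc_diff_left algebra_simps)
  with assms(1) have "a - a' = 0 \<and> b - b' = 0 \<and> c - c' = 0" unfolding ind3_def by blast
  then show "a = a'" "b = b'" "c = c'" by auto
qed

lemma ind3_ind2:
  assumes "ind3 u v w"
  shows "ind2 u v" "ind2 u w" "ind2 v w"
proof -
  show "ind2 u v" unfolding ind2_def
    using assms[unfolded ind3_def, rule_format, of _ _ 0] by simp
  show "ind2 u w" unfolding ind2_def
    using assms[unfolded ind3_def, rule_format, of _ 0] by simp
  show "ind2 v w" unfolding ind2_def
    using assms[unfolded ind3_def, rule_format, of 0] by simp
qed

lemma ind3_not_span:
  assumes "ind3 u v w"
  shows "w \<notin> span2 u v" "u \<notin> span2 v w"
proof -
  show "w \<notin> span2 u v"
    using ind3_eqD(3)[OF assms, of 0 0 1 _ _ 0] by (auto simp: span2_def)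
  show "u \<notin> span2 v w"
    using ind3_eqD(1)[OF assms, of 1 0 0 0 _ _] by (auto simp: span2_def)
qed

lemma span2I: "a *\<^sub>l u + b *\<^sub>l v \<in> span2 u v"
  by (auto simp: span2_def)

lemma span2_gen [simp]: "u \<in> span2 u v" "v \<in> span2 u v"
  using span2I[of 1 u 0 v] span2I[of 0 u 1 v] by simp_all

lemma span2_lsc: "x \<in> span2 u v \<Longrightarrow> a *\<^sub>l x \<in> span2 u v"
proof -
  assume "x \<in> span2 u v"
  then obtain b c where "x = b *\<^sub>l u + c *\<^sub>l v" by (auto simp: span2_def)
  then have "a *\<^sub>l x = (a * b) *\<^sub>l u + (a * c) *\<^sub>l v" by simp
  then show ?thesis by (simp add: span2I)
qed

lemma span2E:
  assumes "x \<in> span2 u v"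
  obtains a b where "x = a *\<^sub>l u + b *\<^sub>l v"
  using assms by (auto simp: span2_def)

lemma span2_add:
  assumes "x \<in> span2 u v" "y \<in> span2 u v"
  shows "x + y \<in> span2 u v"
proof -
  from assms obtain a b c d where "x = a *\<^sub>l u + b *\<^sub>l v" "y = c *\<^sub>l u + d *\<^sub>l v"
    by (auto simp: span2_def)
  then have "x + y = (a + c) *\<^sub>l u + (b + d) *\<^sub>l v" by (simp add: lsc_add_left algebra_simps)
  then show ?thesis by (simp add: span2I)
qed

lemma span2_mono: "x \<in> span2 u v \<Longrightarrow> y \<in> span2 u v \<Longrightarrow> span2 x y \<subseteq> span2 u v"
  by (auto simp: span2_def[of x y] intro!: span2_add span2_lsc)

text \<open>If \<open>x\<close> involves \<open>v\<close>, then \<open>v\<close> can be eliminated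
  from \<open>y\<close> with the help of \<open>x\<close>; what remains is a multiple
  \<open>e *\<^sub>l u\<close>, and \<open>e = 0\<close> would make \<open>y\<close> a multiple of
  \<open>x\<close>.\<close>

lemma span2_exchange_aux:
  assumes "ind2 x y" "x \<in> span2 u v" "y \<in> span2 u v"
  shows "u \<in> span2 x y"
proof -
  obtain a b c d where x: "x = a *\<^sub>l u + b *\<^sub>l v" and y: "y = c *\<^sub>l u + d *\<^sub>l v"
    using assms(2,3) by (auto simp: span2_def)
  show ?thesis
  proof (cases "b = 0")
    case True
    with x assms(1) have "a \<noteq> 0" by (auto simp: ind2_alt)
    with x True have "u = inverse a *\<^sub>l x" by simp
    then show ?thesis by (simp add: span2_lsc)
  next
    case b: False
    define e where "e = c - d * inverse b * a"
    have e: "e *\<^sub>l u = y - (d * inverse b) *\<^sub>l x"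
      using b by (simp add: x y e_def lsc_diff_left mult.assoc)
    have "e \<noteq> 0"
    proof
      assume "e = 0"
      with e have "y = (d * inverse b) *\<^sub>l x" by simp
      with assms(1) show False by (auto simp: ind2_alt)
    qed
    then have "u = inverse e *\<^sub>l e *\<^sub>l u" by simp
    also have "\<dots> = (- (inverse e * (d * inverse b))) *\<^sub>l x + inverse e *\<^sub>l y"
      unfolding e by (simp add: lsc_minus_left)
    finally show ?thesis by (metis span2I)
  qed
qed

lemma span2_commute: "span2 u v = span2 v u"
  unfolding span2_def by (metis add.commute)

lemma span2_exchange:
  assumes "ind2 x y" "x \<in> span2 u v" "y \<in> span2 u v"
  shows "span2 u v \<subseteq> span2 x y"
  using span2_exchange_aux[OF assms] span2_exchange_aux[OF assms(1), of v u] assms(2,3)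
  by (intro span2_mono) (simp_all add: span2_commute)

lemma ind2_lsc: "ind2 u v \<Longrightarrow> a \<noteq> 0 \<Longrightarrow> ind2 u (a *\<^sub>l v)"
  unfolding ind2_def by fastforce

lemma ind2_add_lsc: "ind2 u v \<Longrightarrow> ind2 u (v + a *\<^sub>l u)"
  unfolding ind2_def
proof (intro allI impI)
  fix x y assume i: "\<forall>x y. x *\<^sub>l u + y *\<^sub>l v = 0 \<longrightarrow> x = 0 \<and> y = 0"
    and e: "x *\<^sub>l u + y *\<^sub>l (v + a *\<^sub>l u) = 0"
  from e have "(x + y * a) *\<^sub>l u + y *\<^sub>l v = 0" by (simp add: lsc_add_left algebra_simps)
  with i have "x + y * a = 0 \<and> y = 0" by blast
  then show "x = 0 \<and> y = 0" by auto
qed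

lemma ind2_uminus: "ind2 u v \<Longrightarrow> ind2 u (- v)"
  using ind2_lsc[of u v "-1"] by (simp add: lsc_minus_left)

text \<open>Vectors represent points of a projective space; an axis of perspectivity yields a
  centre. Since each triangle is independent, the relation
  \<open>x23 = l *\<^sub>l x12 + m *\<^sub>l x13\<close> can be compared coefficient by coefficient
  in both. The two expressions for \<open>l *\<^sub>l x12\<close> then move the part of
  \<open>a1\<close>, \<open>b1\<close> to one side and that of \<open>a2\<close>, \<open>b2\<close>
  to the other, and the two expressions for \<open>m *\<^sub>l x13\<close> do the same with
  \<open>a3\<close>, \<open>b3\<close>. The common value is the centre \<open>e\<close>.\<close>

lemma desargues:
  assumes a: "ind3 a1 a2 a3" and b: "ind3 b1 b2 b3" and ab: "ind2 a1 b1"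
    and x12: "x12 \<in> span2 a1 a2" "x12 \<in> span2 b1 b2" "ind2 x12 a2"
    and x13: "x13 \<in> span2 a1 a3" "x13 \<in> span2 b1 b3" "ind2 x13 a3"
    and x23: "x23 \<in> span2 a2 a3" "x23 \<in> span2 b2 b3" "x23 \<noteq> 0"
    and col: "x23 \<in> span2 x12 x13"
  shows "\<exists>e. e \<noteq> 0 \<and> e \<in> span2 a1 b1 \<and> e \<in> span2 a2 b2 \<and> e \<in> span2 a3 b3"
proof -
  obtain p1 p2 q1 q2 where 12: "x12 = p1 *\<^sub>l a1 + p2 *\<^sub>l a2" "x12 = q1 *\<^sub>l b1 + q2 *\<^sub>l b2"
    using x12(1,2) by (elim span2E)
  obtain r1 r3 s1 s3 where 13: "x13 = r1 *\<^sub>l a1 + r3 *\<^sub>l a3" "x13 = s1 *\<^sub>l b1 + s3 *\<^sub>l b3"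
    using x13(1,2) by (elim span2E)
  obtain t2 t3 u2 u3 where 23: "x23 = t2 *\<^sub>l a2 + t3 *\<^sub>l a3" "x23 = u2 *\<^sub>l b2 + u3 *\<^sub>l b3"
    using x23(1,2) by (elim span2E)
  obtain l m where c: "x23 = l *\<^sub>l x12 + m *\<^sub>l x13" using col by (elim span2E)
  have "0 *\<^sub>l a1 + t2 *\<^sub>l a2 + t3 *\<^sub>l a3 = (l * p1 + m * r1) *\<^sub>l a1 + (l * p2) *\<^sub>l a2 + (m * r3) *\<^sub>l a3"
    using c by (simp add: 12(1) 13(1) 23(1) lsc_add_left algebra_simps)
  note A = ind3_eqD[OF a this]
  have "0 *\<^sub>l b1 + u2 *\<^sub>l b2 + u3 *\<^sub>l b3 = (l * q1 + m * s1) *\<^sub>l b1 + (l * q2) *\<^sub>l b2 + (m * s3) *\<^sub>l b3"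
    using c by (simp add: 12(2) 13(2) 23(2) lsc_add_left algebra_simps)
  note B = ind3_eqD[OF b this]
  define e where "e = (l * p1) *\<^sub>l a1 + (- (l * q1)) *\<^sub>l b1"
  \<comment> \<open>With \<open>l = 0\<close> the coefficient comparison leaves
    \<open>m *\<^sub>l x13\<close> without a component along \<open>a1\<close>, so
    \<open>x13\<close> would be a multiple of \<open>a3\<close>.\<close>
  have l: "l \<noteq> 0"
  proof
    assume l: "l = 0"
    with c x23(3) have "m \<noteq> 0" by auto
    with A l have "r1 = 0" by simp
    with 13(1) ind2_sym[OF x13(3)] show False unfolding ind2_alt by auto
  qed
  have "p1 \<noteq> 0" using 12(1) ind2_sym[OF x12(3)] by (auto simp: ind2_alt)
  with l ab have "e \<noteq> 0" unfolding e_def ind2_def by (metis mult_eq_0_iff)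
  moreover have "e \<in> span2 a1 b1" by (simp add: e_def span2I)
  moreover have "e = (- t2) *\<^sub>l a2 + u2 *\<^sub>l b2"
  proof -
    have "l *\<^sub>l (p1 *\<^sub>l a1 + p2 *\<^sub>l a2) = l *\<^sub>l (q1 *\<^sub>l b1 + q2 *\<^sub>l b2)" using 12 by simp
    then show ?thesis unfolding e_def A(2) B(2)
      by (simp add: lsc_minus_left algebra_simps)
  qed
  then have "e \<in> span2 a2 b2" by (simp add: span2I)
  moreover have "e = t3 *\<^sub>l a3 + (- u3) *\<^sub>l b3"
  proof -
    have "m *\<^sub>l (r1 *\<^sub>l a1 + r3 *\<^sub>l a3) = m *\<^sub>l (s1 *\<^sub>l b1 + s3 *\<^sub>l b3)" using 13 by simp
    moreover have "l * p1 = - (m * r1)" "l * q1 = - (m * s1)"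
      using A(1) B(1) by (simp_all add: eq_neg_iff_add_eq_0)
    ultimately show ?thesis unfolding e_def A(3) B(3)
      by (simp add: lsc_minus_left algebra_simps)
  qed
  then have "e \<in> span2 a3 b3" by (simp add: span2I)
  ultimately show ?thesis by blast
qed

text \<open>For three points at heights \<open>1\<close>, \<open>c2\<close>, \<open>c3\<close> the
  numbers \<open>t12\<close>, \<open>t13\<close>, \<open>t23\<close> are the affine parameters at
  which the joining lines reach height \<open>0\<close>. The last two equations express that the
  three points reached are collinear, with parameter \<open>s\<close>.\<close>

lemma homology_scalars:
  fixes c2 c3 :: "'a::division_ring"
  assumes "c2 \<noteq> 0" "c2 \<noteq> 1" "c3 \<noteq> 0" "c3 \<noteq> 1" "c2 \<noteq> c3"
  obtains t12 t13 t23 s where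
    "1 + t12 * (c2 - 1) = 0" "1 + t13 * (c3 - 1) = 0" "c2 + t23 * (c3 - c2) = 0"
    "s * t13 = t23" "(1 - s) * t12 = 1 - t23"
proof -
  define u where "u = inverse (c3 - c2)"
  define t12 where "t12 = - inverse (c2 - 1)"
  define t13 where "t13 = - inverse (c3 - 1)"
  define t23 where "t23 = - c2 * u"
  define s where "s = c2 * u * (c3 - 1)"
  have uc: "u * (c3 - c2) = 1" using assms by (simp add: u_def)
  have "1 - s = (1 - t23) * - (c2 - 1) + (c2 - c2 * (u * (c3 - c2)))"
    by (simp add: s_def t23_def algebra_simps)
  then have "(1 - s) * t12 = (1 - t23) * (- (c2 - 1) * t12)" using uc by (simp add: mult.assoc)
  also have "- (c2 - 1) * t12 = 1"
    using assms right_inverse[of "c2 - 1"] unfolding t12_def by (simp only: minus_mult_minus) simp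
  finally have "(1 - s) * t12 = 1 - t23" by simp
  moreover have "1 + t12 * (c2 - 1) = 0" "1 + t13 * (c3 - 1) = 0" "c2 + t23 * (c3 - c2) = 0" "s * t13 = t23"
    using assms uc by (simp_all add: t12_def t13_def t23_def s_def mult.assoc)
  ultimately show ?thesis using that by blast
qed

lemma ex_avoid3:
  assumes "infinite (UNIV :: 'a set) \<or> card (UNIV :: 'a set) \<ge> 4"
  shows "\<exists>c::'a. c \<noteq> x \<and> c \<noteq> y \<and> c \<noteq> z"
proof (rule ccontr)
  assume "\<not> ?thesis"
  then have e: "UNIV = {x, y, z}" by auto
  then have "finite (UNIV :: 'a set)" by (metis finite.emptyI finite.insertI)
  moreover have "card (UNIV :: 'a set) \<le> 3"
    using card_length[of "[x, y, z]"] by (simp add: e)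
  ultimately show False using assms by simp
qed

subsection \<open>Lineations\<close>

text \<open>The target is treated projectively: \<open>G y\<close> is a vector of homogeneous
  coordinates, and \<open>span2\<close> of two values is a projective line. This leaves room for
  images of the points at infinity of the affine source \<open>U\<close>.\<close>

locale lineation =
  fixes U :: "(nat \<Rightarrow> 'a::division_ring) set"
    and G :: "(nat \<Rightarrow> 'a) \<Rightarrow> nat \<Rightarrow> 'b::division_ring"
  assumes card4: "infinite (UNIV :: 'a set) \<or> card (UNIV :: 'a set) \<ge> 4"
    and U_add: "\<And>u v. u \<in> U \<Longrightarrow> v \<in> U \<Longrightarrow> u + v \<in> U"
    and U_lsc: "\<And>a u. u \<in> U \<Longrightarrow> a *\<^sub>l u \<in> U"
    and U_two: "\<exists>u\<in>U. \<exists>v\<in>U. ind2 u v"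
    and G_line: "\<And>y d a. y \<in> U \<Longrightarrow> d \<in> U \<Longrightarrow> G (y + a *\<^sub>l d) \<in> span2 (G y) (G (y + d))"
    and G_indep: "\<And>y v w. y \<in> U \<Longrightarrow> v \<in> U \<Longrightarrow> w \<in> U \<Longrightarrow> ind2 v w \<Longrightarrow>
      ind3 (G y) (G (y + v)) (G (y + w))"
begin

lemma U_zero [simp]: "0 \<in> U"
  using U_two U_lsc[of _ 0] by auto

lemma U_uminus: "u \<in> U \<Longrightarrow> - u \<in> U"
  using U_lsc[of u "-1"] by (simp add: lsc_minus_left)

lemma U_diff: "u \<in> U \<Longrightarrow> v \<in> U \<Longrightarrow> u - v \<in> U"
  using U_add[OF _ U_uminus, of u v] by simp

lemmas U_closed [simp] = U_add U_lsc U_uminus U_diff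

lemma ex_independent:
  assumes "d \<in> U" "d \<noteq> 0"
  shows "\<exists>w\<in>U. ind2 d w"
proof (rule ccontr)
  assume n: "\<not> ?thesis"
  obtain u v where uv: "u \<in> U" "v \<in> U" "ind2 u v" using U_two by blast
  from n assms have "\<forall>w\<in>U. \<exists>c. w = c *\<^sub>l d" by (auto simp: ind2_alt)
  with uv obtain a b where "u = a *\<^sub>l d" "v = b *\<^sub>l d" by meson
  moreover have "v = (b * inverse a) *\<^sub>l u" if "a \<noteq> 0"
    using calculation that by (simp add: mult.assoc)
  ultimately show False using uv(3) by (auto simp: ind2_alt)
qed

lemma G_distinct:
  assumes "y \<in> U" "z \<in> U" "y \<noteq> z"
  shows "ind2 (G y) (G z)"
proof -
  obtain w where "w \<in> U" "ind2 (z - y) w" using ex_independent[of "z - y"] assms by auto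
  with G_indep[of y "z - y" w] assms show ?thesis by (auto dest: ind3_ind2)
qed

lemma G_on:
  assumes "y \<in> U" "z \<in> U" "x = y + t *\<^sub>l (z - y)"
  shows "G x \<in> span2 (G y) (G z)"
proof -
  have "y + (z - y) = z" by simp
  then show ?thesis using G_line[OF assms(1), of "z - y" t] assms(2) U_diff[OF assms(2,1)]
    unfolding assms(3) by metis
qed

text \<open>The projective line that carries the image of the affine line through \<open>y\<close>
  with direction \<open>d\<close>. By \<open>Ln_shift\<close> it depends on that affine line only,
  not on the base point chosen on it.\<close>

definition Ln :: "(nat \<Rightarrow> 'a) \<Rightarrow> (nat \<Rightarrow> 'a) \<Rightarrow> (nat \<Rightarrow> 'b) set" where
  "Ln y d = span2 (G y) (G (y + d))"

lemma Ln_sub: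
  assumes "y \<in> U" "d \<in> U"
  shows "Ln (y + a *\<^sub>l d) (b *\<^sub>l d) \<subseteq> Ln y d"
  unfolding Ln_def using assms G_line[OF assms, of a] G_line[OF assms, of "a + b"]
  by (intro span2_mono) (simp_all add: lsc_add_left add.assoc)

lemma Ln_shift:
  assumes "y \<in> U" "d \<in> U"
  shows "Ln (y + a *\<^sub>l d) d \<subseteq> Ln y d" "Ln y d \<subseteq> Ln (y + a *\<^sub>l d) d"
  using Ln_sub[OF assms, of a 1] Ln_sub[of "y + a *\<^sub>l d" d "-a" 1] assms
  by (simp_all add: lsc_minus_left)

text \<open>
  The homology with centre \<open>d\<close> at infinity and coefficients \<open>1\<close>, \<open>c2\<close>, \<open>c3\<close> moves the triangle \<open>A1 1\<close>, \<open>A2 1\<close>, \<open>A3 1\<close>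
  to \<open>A1 k\<close>, \<open>A2 k\<close>, \<open>A3 k\<close>. Corresponding sides meet in the points \<open>X12\<close>, \<open>X13\<close>, \<open>X23\<close> on one line, whence the
  image lines are concurrent by Desargues' theorem. In the planar case the choice of \<open>c2\<close> keeps
  the triangle non-degenerate for every \<open>c3\<close>.
\<close>
lemma three_lines_aux:
  assumes y: "y \<in> U" and d: "d \<in> U" and w: "w \<in> U" and v: "v \<in> U"
    and dw: "ind2 d w" and dv: "ind2 d v" and dvw: "ind2 d (v - w)"
    and pl: "(\<exists>\<eta>. v = \<eta> *\<^sub>l w) \<or> ind3 d w v"
  shows "\<exists>e. e \<noteq> 0 \<and> e \<in> Ln y d \<and> e \<in> Ln (y + w) d \<and> e \<in> Ln (y + v) d"
proof -
  obtain k :: 'a where k: "k \<noteq> 0" "k \<noteq> 1" using ex_avoid3[OF card4] by metis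
  \<comment> \<open>In the spatial case \<open>\<eta>\<close> is arbitrary apart from avoiding
    \<open>0\<close> and \<open>1\<close>, which is all that \<open>c2\<close> needs.\<close>
  obtain \<eta> :: 'a where \<eta>: "\<eta> \<noteq> 0" "\<eta> \<noteq> 1" "v = \<eta> *\<^sub>l w \<or> ind3 d w v"
  proof (cases "\<exists>\<eta>. v = \<eta> *\<^sub>l w")
    case True
    then obtain \<eta> where e: "v = \<eta> *\<^sub>l w" by blast
    have "\<eta> \<noteq> 0" "\<eta> \<noteq> 1" using e dv dvw ind2_nonzero(2) by force+
    with e that show ?thesis by blast
  next
    case False
    with pl that k show ?thesis by blast
  qed
  define c2 where "c2 = 1 - inverse \<eta>"
  have c2: "c2 \<noteq> 0" "c2 \<noteq> 1"
    using \<eta>(1,2) by (auto simp: c2_def) (metis inverse_inverse_eq inverse_1)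
  obtain c3 :: 'a where c3: "c3 \<noteq> 0" "c3 \<noteq> 1" "c2 \<noteq> c3" using ex_avoid3[OF card4] by metis
  obtain t12 t13 t23 s where t: "1 + t12 * (c2 - 1) = 0" "1 + t13 * (c3 - 1) = 0"
    "c2 + t23 * (c3 - c2) = 0" "s * t13 = t23" "(1 - s) * t12 = 1 - t23"
    using homology_scalars[OF c2 c3] by blast
  define A1 A2 A3 where A: "A1 j = y + j *\<^sub>l d" "A2 j = y + w + (c2 * j) *\<^sub>l d" "A3 j = y + v + (c3 * j) *\<^sub>l d" for j
  define X12 X13 X23 where X: "X12 = y + t12 *\<^sub>l w" "X13 = y + t13 *\<^sub>l v" "X23 = y + w + t23 *\<^sub>l (v - w)"
  have AU: "A1 j \<in> U" "A2 j \<in> U" "A3 j \<in> U" for j using y d w v by (simp_all add: A)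
  have XU: "X12 \<in> U" "X13 \<in> U" "X23 \<in> U" using y w v by (simp_all add: X)
  have ind: "ind3 (G (A1 j)) (G (A2 j)) (G (A3 j))" if j: "j \<noteq> 0" for j
  proof -
    have "ind2 (w + ((c2 - 1) * j) *\<^sub>l d) (v + ((c3 - 1) * j) *\<^sub>l d)"
      unfolding ind2_def
    proof (intro allI impI)
      fix p q assume "p *\<^sub>l (w + ((c2 - 1) * j) *\<^sub>l d) + q *\<^sub>l (v + ((c3 - 1) * j) *\<^sub>l d) = 0"
      then have e: "((p * (c2 - 1) + q * (c3 - 1)) * j) *\<^sub>l d + p *\<^sub>l w + q *\<^sub>l v = 0"
        by (simp add: lsc_add_left lsc_diff_left algebra_simps)
      show "p = 0 \<and> q = 0"
      proof (cases "ind3 d w v")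
        case True
        with e show ?thesis unfolding ind3_def by blast
      next
        case False
        with \<eta> have "v = \<eta> *\<^sub>l w" by blast
        with e have "((p * (c2 - 1) + q * (c3 - 1)) * j) *\<^sub>l d + (p + q * \<eta>) *\<^sub>l w = 0"
          by (simp add: lsc_add_left algebra_simps)
        with dw have "(p * (c2 - 1) + q * (c3 - 1)) * j = 0" and p: "p + q * \<eta> = 0"
          unfolding ind2_def by blast+
        with j have "p * (c2 - 1) + q * (c3 - 1) = 0" by simp
        moreover from p have "p = - (q * \<eta>)" by (simp add: eq_neg_iff_add_eq_0)
        \<comment> \<open>Here \<open>p = - q \<eta>\<close> meets
          \<open>c2 - 1 = - inverse \<eta>\<close>, so that only \<open>q * c3\<close>
          survives.\<close>
        ultimately have "q * c3 = 0" using \<eta> by (simp add: c2_def mult.assoc algebra_simps)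
        with c3 p show ?thesis by simp
      qed
    qed
    moreover have "A2 j = A1 j + (w + ((c2 - 1) * j) *\<^sub>l d)" "A3 j = A1 j + (v + ((c3 - 1) * j) *\<^sub>l d)"
      by (simp_all add: A algebra_simps lsc_diff_left)
    ultimately show ?thesis
      using G_indep[OF AU(1), of "w + ((c2 - 1) * j) *\<^sub>l d" "v + ((c3 - 1) * j) *\<^sub>l d" j] d w v
      by simp
  qed
  have on: "X12 = A1 j + t12 *\<^sub>l (A2 j - A1 j)" "X13 = A1 j + t13 *\<^sub>l (A3 j - A1 j)"
    "X23 = A2 j + t23 *\<^sub>l (A3 j - A2 j)" for j
  proof -
    have "A1 j + t12 *\<^sub>l (A2 j - A1 j) = X12 + ((1 + t12 * (c2 - 1)) * j) *\<^sub>l d"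
      by (simp add: A X lsc_add_left lsc_diff_left algebra_simps)
    then show "X12 = A1 j + t12 *\<^sub>l (A2 j - A1 j)" using t by simp
    have "A1 j + t13 *\<^sub>l (A3 j - A1 j) = X13 + ((1 + t13 * (c3 - 1)) * j) *\<^sub>l d"
      by (simp add: A X lsc_add_left lsc_diff_left algebra_simps)
    then show "X13 = A1 j + t13 *\<^sub>l (A3 j - A1 j)" using t by simp
    have "A2 j + t23 *\<^sub>l (A3 j - A2 j) = X23 + ((c2 + t23 * (c3 - c2)) * j) *\<^sub>l d"
      by (simp add: A X lsc_add_left lsc_diff_left algebra_simps)
    then show "X23 = A2 j + t23 *\<^sub>l (A3 j - A2 j)" using t by simp
  qed
  have XA: "G X12 \<in> span2 (G (A1 j)) (G (A2 j))" "G X13 \<in> span2 (G (A1 j)) (G (A3 j))"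
    "G X23 \<in> span2 (G (A2 j)) (G (A3 j))" for j
    using G_on[OF AU(1,2) on(1)] G_on[OF AU(1,3) on(2)] G_on[OF AU(2,3) on(3)] by blast+
  have "X23 = X12 + s *\<^sub>l (X13 - X12)"
  proof -
    have "X12 + s *\<^sub>l (X13 - X12) = y + ((1 - s) * t12) *\<^sub>l w + (s * t13) *\<^sub>l v"
      by (simp add: X lsc_diff_left algebra_simps)
    also have "\<dots> = X23" unfolding t(4,5) by (simp add: X lsc_diff_left algebra_simps)
    finally show ?thesis by simp
  qed
  then have col: "G X23 \<in> span2 (G X12) (G X13)"
    using G_on XU by blast
  have "X12 \<noteq> A2 1"
  proof
    assume "X12 = A2 1"
    then have "c2 *\<^sub>l d + (1 - t12) *\<^sub>l w = 0" by (simp add: X A lsc_diff_left algebra_simps)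
    with dw c2 show False unfolding ind2_def by blast
  qed
  moreover have "X13 \<noteq> A3 1"
  proof
    assume "X13 = A3 1"
    then have "c3 *\<^sub>l d + (1 - t13) *\<^sub>l v = 0" by (simp add: X A lsc_diff_left algebra_simps)
    with dv c3 show False unfolding ind2_def by blast
  qed
  moreover have "A1 1 \<noteq> A1 k"
  proof
    assume "A1 1 = A1 k"
    then have "(k - 1) *\<^sub>l d = 0" by (simp add: A lsc_diff_left)
    with k dw ind2_nonzero show False by auto
  qed
  moreover have "G X23 \<noteq> 0"
  proof -
    have "X23 + d \<noteq> X23" using dw ind2_nonzero by auto
    then show ?thesis using G_distinct[of X23 "X23 + d"] XU d ind2_nonzero(1) by (metis U_add)
  qed
  ultimately obtain e where e: "e \<noteq> 0" "e \<in> span2 (G (A1 1)) (G (A1 k))"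
      "e \<in> span2 (G (A2 1)) (G (A2 k))" "e \<in> span2 (G (A3 1)) (G (A3 k))"
    using desargues[OF ind[of 1] ind[of k] _ XA(1)[of 1] XA(1)[of k] _ XA(2)[of 1] XA(2)[of k] _
      XA(3)[of 1] XA(3)[of k] _ col] G_distinct[of X12 "A2 1"] G_distinct[of X13 "A3 1"]
      G_distinct[of "A1 1" "A1 k"] AU XU k by auto
  have "span2 (G (y' + a *\<^sub>l d)) (G (y' + b *\<^sub>l d)) \<subseteq> Ln y' d" if "y' \<in> U" for y' a b
    unfolding Ln_def using G_line[OF that d] by (intro span2_mono) auto
  with e y w v show ?thesis unfolding A by (meson U_add subsetD)
qed

text \<open>If \<open>d\<close>, \<open>w\<close>, \<open>v\<close> are dependent, sliding the base
  point of the third line along \<open>d\<close> turns \<open>v\<close> into a multiple of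
  \<open>w\<close> without changing the image line. This leaves exactly the two cases of
  \<open>three_lines_aux\<close>.\<close>

lemma three_lines:
  assumes y: "y \<in> U" and d: "d \<in> U" and w: "w \<in> U" and v: "v \<in> U"
    and dw: "ind2 d w" and dv: "ind2 d v" and dvw: "ind2 d (v - w)"
  shows "\<exists>e. e \<noteq> 0 \<and> e \<in> Ln y d \<and> e \<in> Ln (y + w) d \<and> e \<in> Ln (y + v) d"
proof (cases "ind3 d w v")
  case True
  with three_lines_aux[OF assms] show ?thesis by blast
next
  case False
  then obtain a b c where abc: "a *\<^sub>l d + b *\<^sub>l w + c *\<^sub>l v = 0" "\<not> (a = 0 \<and> b = 0 \<and> c = 0)"
    unfolding ind3_def by blast
  have c: "c \<noteq> 0"
  proof
    assume "c = 0"
    with abc dw show False unfolding ind2_def by auto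
  qed
  have "inverse c *\<^sub>l (a *\<^sub>l d + b *\<^sub>l w + c *\<^sub>l v) = 0" using abc(1) by simp
  then have "v + (inverse c * a) *\<^sub>l d = (- (inverse c * b)) *\<^sub>l w"
    using c by (simp add: lsc_minus_left eq_neg_iff_add_eq_0 add_ac)
  then obtain v' p q where v': "v' = v + p *\<^sub>l d" "v' = q *\<^sub>l w" by blast
  have "v' - w = v - w + p *\<^sub>l d" by (simp add: v')
  then have "ind2 d (v' - w)" using ind2_add_lsc[OF dvw, of p] by (simp only:)
  moreover have "ind2 d v'" unfolding v'(1) by (rule ind2_add_lsc[OF dv])
  moreover have "v' \<in> U" using v d by (simp add: v')
  ultimately obtain e where e: "e \<noteq> 0" "e \<in> Ln y d" "e \<in> Ln (y + w) d" "e \<in> Ln (y + v') d"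
    using three_lines_aux[OF y d w _ dw, of v'] v'(2) by blast
  have "Ln (y + v') d \<subseteq> Ln (y + v) d"
    using Ln_shift(1)[of "y + v" d p] y v d by (simp add: v' add.assoc)
  with e show ?thesis by blast
qed

text \<open>Two independent common vectors would make the two image lines equal, so
  \<open>G z\<close> would lie on the line spanned by \<open>G y\<close> and
  \<open>G (y + d)\<close>, against \<open>G_indep\<close>.\<close>

lemma dependent_on_two_lines:
  assumes "y \<in> U" "z \<in> U" "d \<in> U" "ind2 d (z - y)"
    and "e \<in> Ln y d" "e \<in> Ln z d" "f \<in> Ln y d" "f \<in> Ln z d" "e \<noteq> 0"
  shows "\<exists>c. f = c *\<^sub>l e"
proof (rule ccontr)
  assume "\<not> ?thesis"
  with assms(9) have "ind2 e f" by (auto simp: ind2_alt)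
  with assms(6,8) have "Ln z d \<subseteq> span2 e f" unfolding Ln_def by (intro span2_exchange)
  moreover have "span2 e f \<subseteq> Ln y d" using assms unfolding Ln_def by (intro span2_mono)
  ultimately have "G z \<in> Ln y d"
    using span2_gen(1)[of "G z" "G (z + d)"] unfolding Ln_def by blast
  moreover have "ind3 (G y) (G (y + d)) (G (y + (z - y)))"
    using assms by (intro G_indep) auto
  ultimately show False using ind3_not_span(1) by (auto simp: Ln_def)
qed

text \<open>This vector represents the image of the point at infinity of direction \<open>d\<close>.
  The lines through \<open>0\<close> and \<open>w\<close> determine it up to a scalar, and
  \<open>three_lines\<close> applied to these two and any third parallel shows that the third passes
  through it as well.\<close>

lemma center:
  assumes d: "d \<in> U" "d \<noteq> 0"
  shows "\<exists>e. e \<noteq> 0 \<and> (\<forall>z\<in>U. e \<in> Ln z d)"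
proof -
  obtain w where w: "w \<in> U" "ind2 d w" using ex_independent[OF d] by blast
  \<comment> \<open>The line through \<open>t *\<^sub>l w\<close> only completes the triple that
    \<open>three_lines\<close> asks for.\<close>
  obtain t :: 'a where t: "t \<noteq> 0" "t \<noteq> 1" using ex_avoid3[OF card4] by metis
  have "ind2 d (t *\<^sub>l w - w)"
    using ind2_lsc[OF w(2), of "t - 1"] t by (simp add: lsc_diff_left)
  with three_lines[of 0 d w "t *\<^sub>l w"] w d t ind2_lsc obtain e where
    e: "e \<noteq> 0" "e \<in> Ln 0 d" "e \<in> Ln w d" by auto
  have "e \<in> Ln z d" if z: "z \<in> U" for z
  proof (cases "ind2 d z \<and> ind2 d (z - w)")
    case True
    with three_lines[of 0 d w z] z w d obtain f where
      f: "f \<noteq> 0" "f \<in> Ln 0 d" "f \<in> Ln w d" "f \<in> Ln z d" by auto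
    with dependent_on_two_lines[of 0 w d f e] e w d obtain c where "e = c *\<^sub>l f" by auto
    with f show ?thesis unfolding Ln_def by (simp add: span2_lsc)
  next
    case False
    with d have "(\<exists>c. z = c *\<^sub>l d) \<or> (\<exists>c. z - w = c *\<^sub>l d)" by (auto simp: ind2_alt)
    then show ?thesis
    proof
      assume "\<exists>c. z = c *\<^sub>l d"
      then show ?thesis using Ln_shift(2)[of 0 d] e d by auto
    next
      assume "\<exists>c. z - w = c *\<^sub>l d"
      then obtain c where "z = w + c *\<^sub>l d" by (metis add.commute diff_add_cancel)
      then show ?thesis using Ln_shift(2)[of w d c] e d w by auto
    qed
  qed
  with e show ?thesis by blast
qed

section \<open>Images of points at infinity and their additivity\<close>

abbreviation "g0 \<equiv> G 0"

text \<open>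
  \<open>h y\<close> is the image of the point at infinity of direction \<open>y\<close>, scaled such that \<open>G y\<close> is
  proportional to \<open>G 0 + h y\<close>.
\<close>
definition hspec :: "(nat \<Rightarrow> 'a) \<Rightarrow> (nat \<Rightarrow> 'b) \<Rightarrow> bool" where
  "hspec y h \<longleftrightarrow> (\<exists>c. c \<noteq> 0 \<and> G y = c *\<^sub>l (g0 + h)) \<and> (\<forall>z\<in>U. h \<in> Ln z y)"

text \<open>The centre \<open>e\<close> is proportional neither to \<open>G 0\<close> nor to
  \<open>G y\<close>: it lies on the image of the parallel through \<open>w\<close>, which misses
  both by \<open>G_indep\<close>. Hence both coefficients in
  \<open>e = a *\<^sub>l g0 + b *\<^sub>l G y\<close> are nonzero, and \<open>e\<close> can be
  scaled to have coefficient \<open>-1\<close> at \<open>g0\<close>.\<close>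

lemma ex_hspec:
  assumes y: "y \<in> U" "y \<noteq> 0"
  shows "\<exists>h. hspec y h"
proof -
  obtain e where e: "e \<noteq> 0" "\<And>z. z \<in> U \<Longrightarrow> e \<in> Ln z y" using center[OF y] by blast
  obtain w where w: "w \<in> U" "ind2 y w" using ex_independent[OF y] by blast
  obtain a b where ab: "e = a *\<^sub>l g0 + b *\<^sub>l G y"
    using e(2)[of 0] y by (auto simp: Ln_def elim: span2E)
  have dw: "ind2 y (y - w)"
    using ind2_add_lsc[OF ind2_uminus[OF w(2)], of 1] by simp
  have "a \<noteq> 0"
  proof
    assume "a = 0"
    with ab e have "b \<noteq> 0" by auto
    with ab \<open>a = 0\<close> have "G y = inverse b *\<^sub>l e" by simp
    then have "G y \<in> span2 (G w) (G (w + y))" using e(2)[OF w(1)] by (simp add: Ln_def span2_lsc)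
    moreover have "ind3 (G w) (G (w + y)) (G (w + (y - w)))" using dw w y by (intro G_indep) auto
    ultimately show False using ind3_not_span by auto
  qed
  have "b \<noteq> 0"
  proof
    assume "b = 0"
    with ab \<open>a \<noteq> 0\<close> have "g0 = inverse a *\<^sub>l e" by simp
    then have "g0 \<in> span2 (G w) (G (w + y))" using e(2)[OF w(1)] by (simp add: Ln_def span2_lsc)
    moreover have "ind3 (G w) (G (w + y)) (G (w + (- w)))"
      using ind2_uminus[OF w(2)] w y by (intro G_indep) auto
    ultimately show False using ind3_not_span by auto
  qed
  define h where "h = (- inverse a) *\<^sub>l e"
  have "G y = (- (inverse b * a)) *\<^sub>l (g0 + h)"
  proof -
    have "(- (inverse b * a)) *\<^sub>l (g0 + h) = (- (inverse b * a)) *\<^sub>l g0 + inverse b *\<^sub>l e"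
      using \<open>a \<noteq> 0\<close> by (simp add: h_def lsc_minus_left mult.assoc)
    also have "\<dots> = G y" using \<open>b \<noteq> 0\<close> by (simp add: ab lsc_minus_left)
    finally show ?thesis by simp
  qed
  moreover have "- (inverse b * a) \<noteq> 0" using \<open>a \<noteq> 0\<close> \<open>b \<noteq> 0\<close> by simp
  moreover have "h \<in> Ln z y" if "z \<in> U" for z
    using e(2)[OF that] unfolding h_def Ln_def by (rule span2_lsc)
  ultimately show ?thesis unfolding hspec_def by blast
qed

definition h :: "(nat \<Rightarrow> 'a) \<Rightarrow> nat \<Rightarrow> 'b" where
  "h y = (if y = 0 then 0 else SOME h. hspec y h)"

lemma h_zero [simp]: "h 0 = 0"
  by (simp add: h_def)

lemma h_spec: "y \<in> U \<Longrightarrow> y \<noteq> 0 \<Longrightarrow> hspec y (h y)"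
  unfolding h_def using someI_ex[OF ex_hspec] by simp

lemma G_h: "y \<in> U \<Longrightarrow> \<exists>c. c \<noteq> 0 \<and> G y = c *\<^sub>l (g0 + h y)"
  using h_spec[of y] by (cases "y = 0") (auto simp: hspec_def intro: exI[of _ 1])

lemma h_Ln: "y \<in> U \<Longrightarrow> y \<noteq> 0 \<Longrightarrow> z \<in> U \<Longrightarrow> h y \<in> Ln z y"
  using h_spec[of y] by (auto simp: hspec_def)

lemma h_ind3:
  assumes "y \<in> U" "z \<in> U" "ind2 y z"
  shows "ind3 g0 (h y) (h z)"
  unfolding ind3_def
proof (intro allI impI)
  fix a b c assume e: "a *\<^sub>l g0 + b *\<^sub>l h y + c *\<^sub>l h z = 0"
  obtain p q where p: "p \<noteq> 0" "G y = p *\<^sub>l (g0 + h y)" and q: "q \<noteq> 0" "G z = q *\<^sub>l (g0 + h z)"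
    using G_h assms by metis
  have "(a - b - c) *\<^sub>l g0 + (b * inverse p) *\<^sub>l G y + (c * inverse q) *\<^sub>l G z
      = a *\<^sub>l g0 + b *\<^sub>l h y + c *\<^sub>l h z"
    using p q by (simp add: lsc_diff_left mult.assoc)
  with e have "(a - b - c) *\<^sub>l g0 + (b * inverse p) *\<^sub>l G y + (c * inverse q) *\<^sub>l G z = 0" by simp
  moreover have "ind3 g0 (G y) (G z)" using G_indep[of 0 y z] assms by simp
  ultimately have "a - b - c = 0 \<and> b * inverse p = 0 \<and> c * inverse q = 0" unfolding ind3_def by blast
  then show "a = 0 \<and> b = 0 \<and> c = 0" using p q by auto
qed

lemma h_ind2: "y \<in> U \<Longrightarrow> y \<noteq> 0 \<Longrightarrow> ind2 g0 (h y)"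
  using ex_independent[of y] h_ind3 ind3_ind2(1) by blast

lemma h_nonzero: "y \<in> U \<Longrightarrow> y \<noteq> 0 \<Longrightarrow> h y \<noteq> 0"
  using h_ind2 ind2_nonzero by blast

text \<open>Both directions have the same point at infinity: \<open>h y\<close> and
  \<open>h (a *\<^sub>l y)\<close> lie on the image lines through \<open>0\<close> and through
  \<open>w\<close>, which share only one point.\<close>

lemma h_parallel:
  assumes y: "y \<in> U" "y \<noteq> 0"
  shows "\<exists>c. h (a *\<^sub>l y) = c *\<^sub>l h y"
proof (cases "a = 0")
  case True
  then show ?thesis by (intro exI[of _ 0]) simp
next
  case False
  obtain w where w: "w \<in> U" "ind2 y w" using ex_independent[OF y] by blast
  have "h (a *\<^sub>l y) \<in> Ln z y" if "z \<in> U" for z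
    using h_Ln[of "a *\<^sub>l y" z] Ln_sub[of z y 0 a] False y that by auto
  then show ?thesis
    using dependent_on_two_lines[of 0 w y "h y" "h (a *\<^sub>l y)"] h_Ln[OF y] h_nonzero[OF y] w y by simp
qed

text \<open>In the parallelogram \<open>0\<close>, \<open>y\<close>, \<open>z\<close>,
  \<open>y + z\<close> the vector \<open>G (y + z)\<close> lies on the line joining
  \<open>G y\<close> to \<open>h z\<close> and on the line joining \<open>G z\<close> to
  \<open>h y\<close>. Independence of \<open>g0\<close>, \<open>h y\<close>, \<open>h z\<close>
  makes it proportional to \<open>g0 + h y + h z\<close>. So only the scale \<open>\<rho>\<close> of
  the normalization is open, and the second equation ties it to \<open>z\<close> alone.\<close>

lemma h_sum_aux:
  assumes y: "y \<in> U" and z: "z \<in> U" and yz: "ind2 y z"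
  shows "\<exists>\<rho>. h (y + z) = (\<rho> - 1) *\<^sub>l g0 + \<rho> *\<^sub>l (h y + h z) \<and> h (- z) = (- \<rho>) *\<^sub>l h z"
proof -
  note nz = ind2_nonzero[OF yz]
  note i3 = h_ind3[OF y z yz]
  obtain cy where cy: "cy \<noteq> 0" "G y = cy *\<^sub>l (g0 + h y)" using G_h[OF y] by blast
  obtain cz where cz: "cz \<noteq> 0" "G z = cz *\<^sub>l (g0 + h z)" using G_h[OF z] by blast
  have "\<exists>p q. G (y + z) = p *\<^sub>l (g0 + h y) + q *\<^sub>l h z"
  proof -
    obtain a b where ab: "h z = a *\<^sub>l G y + b *\<^sub>l G (y + z)"
      using h_Ln[OF z nz(2) y] by (auto simp: Ln_def elim: span2E)
    have "b \<noteq> 0"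
    proof
      assume "b = 0"
      with ab cy have "0 *\<^sub>l g0 + 0 *\<^sub>l h y + 1 *\<^sub>l h z = (a * cy) *\<^sub>l g0 + (a * cy) *\<^sub>l h y + 0 *\<^sub>l h z"
        by simp
      from ind3_eqD(3)[OF i3 this] show False by simp
    qed
    have "inverse b *\<^sub>l h z = inverse b *\<^sub>l (a *\<^sub>l G y + b *\<^sub>l G (y + z))" using ab by simp
    then have "G (y + z) = (- (inverse b * a * cy)) *\<^sub>l (g0 + h y) + inverse b *\<^sub>l h z"
      using \<open>b \<noteq> 0\<close> by (simp add: cy(2) lsc_minus_left mult.assoc)
    then show ?thesis by blast
  qed
  then obtain p q where pq: "G (y + z) = p *\<^sub>l (g0 + h y) + q *\<^sub>l h z" by blast
  have "\<exists>p q. G (y + z) = p *\<^sub>l (g0 + h z) + q *\<^sub>l h y"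
  proof -
    obtain a b where ab: "h y = a *\<^sub>l G z + b *\<^sub>l G (y + z)"
      using h_Ln[OF y nz(1) z] by (auto simp: Ln_def add.commute elim: span2E)
    have "b \<noteq> 0"
    proof
      assume "b = 0"
      with ab cz have "0 *\<^sub>l g0 + 1 *\<^sub>l h y + 0 *\<^sub>l h z = (a * cz) *\<^sub>l g0 + 0 *\<^sub>l h y + (a * cz) *\<^sub>l h z"
        by simp
      from ind3_eqD(2)[OF i3 this] show False by simp
    qed
    have "inverse b *\<^sub>l h y = inverse b *\<^sub>l (a *\<^sub>l G z + b *\<^sub>l G (y + z))" using ab by simp
    then have "G (y + z) = (- (inverse b * a * cz)) *\<^sub>l (g0 + h z) + inverse b *\<^sub>l h y"
      using \<open>b \<noteq> 0\<close> by (simp add: cz(2) lsc_minus_left mult.assoc)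
    then show ?thesis by blast
  qed
  then obtain p' q' where pq': "G (y + z) = p' *\<^sub>l (g0 + h z) + q' *\<^sub>l h y" by blast
  have "p *\<^sub>l g0 + p *\<^sub>l h y + q *\<^sub>l h z = p' *\<^sub>l g0 + q' *\<^sub>l h y + p' *\<^sub>l h z"
    using pq pq' by (simp add: algebra_simps)
  note e = ind3_eqD[OF i3 this]
  have yz0: "y + z \<noteq> 0"
    using yz by (auto simp: ind2_alt eq_neg_iff_add_eq_0[symmetric] dest: spec[of _ "-1"] simp: lsc_minus_left add.commute)
  obtain c where c: "c \<noteq> 0" "G (y + z) = c *\<^sub>l (g0 + h (y + z))" using G_h[of "y + z"] y z by auto
  define \<rho> where "\<rho> = inverse c * p"
  have "inverse c *\<^sub>l c *\<^sub>l (g0 + h (y + z)) = inverse c *\<^sub>l (p *\<^sub>l (g0 + h y) + p *\<^sub>l h z)"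
    using pq c e by simp
  then have "g0 + h (y + z) = \<rho> *\<^sub>l g0 + \<rho> *\<^sub>l h y + \<rho> *\<^sub>l h z"
    using c by (simp add: \<rho>_def)
  then have \<rho>: "h (y + z) = (\<rho> - 1) *\<^sub>l g0 + \<rho> *\<^sub>l (h y + h z)"
    by (simp add: lsc_diff_left algebra_simps)
  obtain \<kappa> where \<kappa>: "h (- z) = \<kappa> *\<^sub>l h z"
    using h_parallel[OF z nz(2), of "-1"] by (auto simp: lsc_minus_left)
  obtain m where m: "m \<noteq> 0" "G (- z) = m *\<^sub>l (g0 + h (- z))" using G_h[of "- z"] z by auto
  \<comment> \<open>The direction \<open>y + z\<close> leads from \<open>- z\<close> to
    \<open>y\<close>, so its point at infinity lies on the line joining their images.\<close>
  obtain a b where "h (y + z) = a *\<^sub>l G (- z) + b *\<^sub>l G y"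
    using h_Ln[of "y + z" "- z"] y z yz0 by (auto simp: Ln_def elim: span2E)
  then have "(\<rho> - 1) *\<^sub>l g0 + \<rho> *\<^sub>l h y + \<rho> *\<^sub>l h z
      = (a * m + b * cy) *\<^sub>l g0 + (b * cy) *\<^sub>l h y + (a * m * \<kappa>) *\<^sub>l h z"
    by (simp add: \<rho> m cy \<kappa> lsc_add_left mult.assoc algebra_simps)
  note f = ind3_eqD[OF i3 this]
  then have "a * m = -1" by (simp add: algebra_simps eq_neg_iff_add_eq_0)
  with f have "\<rho> = - \<kappa>" by simp
  with \<kappa> \<rho> show ?thesis by (intro exI[of _ \<rho>]) simp
qed

text \<open>
  The scalar \<open>\<rho>\<close> measuring the failure of additivity is the same for \<open>y\<close>, \<open>z\<close> and \<open>a *\<^sub>l y\<close>. Evaluating \<open>h\<close>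
  at \<open>y + z + a *\<^sub>l y\<close> with both bracketings gives \<open>\<rho> = 1\<close>.
\<close>
lemma h_add_indep:
  assumes y: "y \<in> U" and z: "z \<in> U" and yz: "ind2 y z"
  shows "h (y + z) = h y + h z"
proof -
  \<comment> \<open>By this relation a nonzero vector alone determines \<open>\<rho>\<close>, so
    pairs that share a vector share the scalar.\<close>
  define R where "R y \<rho> \<longleftrightarrow> h (- y) = (- \<rho>) *\<^sub>l h y" for y \<rho>
  have R_unique: "\<rho> = \<rho>'" if "R y \<rho>" "R y \<rho>'" "y \<in> U" "y \<noteq> 0" for y \<rho> \<rho>'
  proof -
    have "(\<rho> - \<rho>') *\<^sub>l h y = 0" using that by (simp add: R_def lsc_diff_left lsc_minus_left)
    then show ?thesis using h_nonzero[OF that(3,4)] unfolding lsc_eq_0_iff by simp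
  qed
  have step: "\<exists>\<rho>. h (y + z) = (\<rho> - 1) *\<^sub>l g0 + \<rho> *\<^sub>l (h y + h z) \<and> R y \<rho> \<and> R z \<rho>"
    if yz: "y \<in> U" "z \<in> U" "ind2 y z" for y z
  proof -
    obtain \<rho> where \<rho>: "h (y + z) = (\<rho> - 1) *\<^sub>l g0 + \<rho> *\<^sub>l (h y + h z)" "R z \<rho>"
      using h_sum_aux[OF yz] by (auto simp: R_def)
    obtain \<rho>' where \<rho>': "h (z + y) = (\<rho>' - 1) *\<^sub>l g0 + \<rho>' *\<^sub>l (h z + h y)" "R y \<rho>'"
      using h_sum_aux[OF yz(2,1) ind2_sym[OF yz(3)]] by (auto simp: R_def)
    have "(\<rho> - 1) *\<^sub>l g0 + \<rho> *\<^sub>l h y + \<rho> *\<^sub>l h z = (\<rho>' - 1) *\<^sub>l g0 + \<rho>' *\<^sub>l h y + \<rho>' *\<^sub>l h z"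
      using \<rho>(1) \<rho>'(1) by (simp add: algebra_simps)
    from ind3_eqD(2)[OF h_ind3[OF yz] this] \<rho> \<rho>' show ?thesis by auto
  qed
  have stepR: "h (y + z) = (\<rho> - 1) *\<^sub>l g0 + \<rho> *\<^sub>l (h y + h z) \<and> R y \<rho> \<and> R z \<rho>"
    if "y \<in> U" "z \<in> U" "ind2 y z" "R y \<rho> \<or> R z \<rho>" for y z \<rho>
    using step[OF that(1-3)] that(4) R_unique[OF _ _ that(1) ind2_nonzero(1)[OF that(3)]]
      R_unique[OF _ _ that(2) ind2_nonzero(2)[OF that(3)]] by blast
  obtain \<rho> where \<rho>: "h (y + z) = (\<rho> - 1) *\<^sub>l g0 + \<rho> *\<^sub>l (h y + h z)" "R y \<rho>" "R z \<rho>"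
    using step[OF y z yz] by blast
  obtain a :: 'a where a: "a \<noteq> 0" "a \<noteq> 1" using ex_avoid3[OF card4] by metis
  have zy: "ind2 z y" by (rule ind2_sym[OF yz])
  have ay: "a *\<^sub>l y \<in> U" using y by simp
  have i1: "ind2 z (a *\<^sub>l y)" using ind2_lsc[OF zy a(1)] .
  have i2: "ind2 y (z + a *\<^sub>l y)" using ind2_add_lsc[OF yz] .
  have "ind2 y (z + 1 *\<^sub>l y)" using ind2_add_lsc[OF yz] .
  then have "ind2 (y + z) y" by (simp add: add.commute ind2_sym)
  then have i3: "ind2 (y + z) (a *\<^sub>l y)" using ind2_lsc a(1) by blast
  obtain \<kappa> where \<kappa>: "h (a *\<^sub>l y) = \<kappa> *\<^sub>l h y" using h_parallel[OF y ind2_nonzero(1)[OF yz]] by blast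
  from stepR[OF z ay i1, of \<rho>] \<rho>
  have s1: "h (z + a *\<^sub>l y) = (\<rho> - 1) *\<^sub>l g0 + \<rho> *\<^sub>l (h z + h (a *\<^sub>l y))" "R (a *\<^sub>l y) \<rho>" by blast+
  from stepR[OF y _ i2, of \<rho>] \<rho> z ay
  have s2: "h (y + (z + a *\<^sub>l y)) = (\<rho> - 1) *\<^sub>l g0 + \<rho> *\<^sub>l (h y + h (z + a *\<^sub>l y))" by (meson U_add)
  from stepR[OF _ ay i3, of \<rho>] s1(2) y z
  have s3: "h (y + z + a *\<^sub>l y) = (\<rho> - 1) *\<^sub>l g0 + \<rho> *\<^sub>l (h (y + z) + h (a *\<^sub>l y))" by (meson U_add)
  have "(\<rho> - 1 + \<rho> * (\<rho> - 1)) *\<^sub>l g0 + (\<rho> + \<rho> * \<rho> * \<kappa>) *\<^sub>l h y + (\<rho> * \<rho>) *\<^sub>l h z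
      = (\<rho> - 1 + \<rho> * (\<rho> - 1)) *\<^sub>l g0 + (\<rho> * \<rho> + \<rho> * \<kappa>) *\<^sub>l h y + (\<rho> * \<rho>) *\<^sub>l h z"
    using s2 s3 by (simp add: s1(1) \<rho>(1) \<kappa> lsc_add_left lsc_diff_left mult.assoc algebra_simps)
  from ind3_eqD(2)[OF h_ind3[OF y z yz] this]
  have "\<rho> * (1 - \<rho>) * (1 - \<kappa>) = 0" by (simp add: algebra_simps)
  moreover have "\<kappa> \<noteq> 1"
  proof
    assume "\<kappa> = 1"
    then have e: "h (a *\<^sub>l y) = h y" using \<kappa> by simp
    obtain p q where "p \<noteq> 0" "G y = p *\<^sub>l (g0 + h y)" "G (a *\<^sub>l y) = q *\<^sub>l (g0 + h (a *\<^sub>l y))"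
      using G_h[OF y] G_h[OF ay] by blast
    then have "G (a *\<^sub>l y) = (q * inverse p) *\<^sub>l G y" by (simp add: e mult.assoc)
    moreover have "y \<noteq> a *\<^sub>l y"
    proof
      assume "y = a *\<^sub>l y"
      then have "(a - 1) *\<^sub>l y = 0" by (simp add: lsc_diff_left)
      with a ind2_nonzero[OF yz] show False by simp
    qed
    ultimately show False using G_distinct[OF y ay] by (auto simp: ind2_alt)
  qed
  moreover have "\<rho> \<noteq> 0"
  proof
    assume "\<rho> = 0"
    with \<rho>(2) have "h (- y) = 0" by (simp add: R_def)
    with h_nonzero[of "- y"] y ind2_nonzero[OF yz] show False by simp
  qed
  ultimately have "\<rho> = 1" by auto
  with \<rho>(1) show ?thesis by simp
qed

text \<open>For proportional nonzero \<open>y\<close> and \<open>z\<close> an independent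
  \<open>w\<close> is inserted: \<open>y + w + z\<close> is expanded once as
  \<open>y + (w + z)\<close> and once as \<open>w + (y + z)\<close>, where only sums of independent
  vectors occur.\<close>

lemma h_add:
  assumes y: "y \<in> U" and z: "z \<in> U"
  shows "h (y + z) = h y + h z"
proof (cases "y = 0 \<or> z = 0 \<or> ind2 y z")
  case True
  then show ?thesis using h_add_indep[OF y z] by auto
next
  case False
  then obtain a where a: "z = a *\<^sub>l y" "y \<noteq> 0" "z \<noteq> 0" by (auto simp: ind2_alt)
  obtain w where w: "w \<in> U" "ind2 y w" using ex_independent[OF y a(2)] by blast
  have wy: "ind2 w y" using ind2_sym[OF w(2)] .
  have i1: "ind2 w (c *\<^sub>l y)" if "c \<noteq> 0" for c using ind2_lsc[OF wy that] .
  have a0: "a \<noteq> 0" using a by auto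
  have "h (y + (w + a *\<^sub>l y)) = h y + h (w + a *\<^sub>l y)"
    using y w by (intro h_add_indep ind2_add_lsc) auto
  also have "h (w + a *\<^sub>l y) = h w + h z" using i1[OF a0] w y unfolding a(1) by (intro h_add_indep) auto
  finally have e: "h (y + (w + a *\<^sub>l y)) = h y + (h w + h z)" .
  have "h (w + (1 + a) *\<^sub>l y) = h w + h ((1 + a) *\<^sub>l y)"
    using i1[of "1 + a"] w y by (cases "1 + a = 0") (auto intro!: h_add_indep)
  moreover have "w + (1 + a) *\<^sub>l y = y + (w + a *\<^sub>l y)" "(1 + a) *\<^sub>l y = y + z"
    by (simp_all add: lsc_add_left a algebra_simps)
  ultimately show ?thesis using e by (simp add: algebra_simps)
qed

text \<open>The factor with which \<open>h\<close> responds to a scalar \<open>a\<close> could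
  depend on the vector. Comparing \<open>h (a *\<^sub>l (y + z))\<close> with the sum of the two
  images shows that independent vectors have equal factors; proportional ones are linked through a
  third vector.\<close>

lemma semilinear:
  "\<exists>\<tau> h. (\<forall>x y. \<tau> (x + y) = \<tau> x + \<tau> y) \<and> (\<forall>x y. \<tau> (x * y) = \<tau> x * \<tau> y) \<and> \<tau> 1 = (1 :: 'b) \<and>
     (\<forall>y\<in>U. \<forall>z\<in>U. h (y + z) = h y + h z) \<and> (\<forall>a. \<forall>y\<in>U. h (a *\<^sub>l y) = \<tau> a *\<^sub>l h y) \<and>
     (\<forall>y\<in>U. \<exists>c. c \<noteq> 0 \<and> G y = c *\<^sub>l (G 0 + h y))"
proof -
  define \<mu> where "\<mu> a y = (SOME c. h (a *\<^sub>l y) = c *\<^sub>l h y)" for a y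
  have \<mu>: "h (a *\<^sub>l y) = \<mu> a y *\<^sub>l h y" if "y \<in> U" "y \<noteq> 0" for a y
    unfolding \<mu>_def using h_parallel[OF that] by (rule someI_ex)
  have \<mu>_indep: "\<mu> a y = \<mu> a z" if yz: "y \<in> U" "z \<in> U" "ind2 y z" for a y z
  proof -
    have s: "y + z \<noteq> 0"
    proof
      assume "y + z = 0"
      then have "1 *\<^sub>l y + 1 *\<^sub>l z = 0" by simp
      with yz(3) show False unfolding ind2_def by (metis zero_neq_one)
    qed
    have "h (a *\<^sub>l (y + z)) = h (a *\<^sub>l y) + h (a *\<^sub>l z)" using h_add[of "a *\<^sub>l y" "a *\<^sub>l z"] yz by simp
    then have "\<mu> a (y + z) *\<^sub>l h y + \<mu> a (y + z) *\<^sub>l h z = \<mu> a y *\<^sub>l h y + \<mu> a z *\<^sub>l h z"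
      using \<mu>[of "y + z" a] \<mu>[of y a] \<mu>[of z a] yz s ind2_nonzero[OF yz(3)] h_add[of y z] by simp
    from ind2_eqD[OF ind3_ind2(3)[OF h_ind3[OF yz]] this] show ?thesis by simp
  qed
  obtain u v where uv: "u \<in> U" "v \<in> U" "ind2 u v" using U_two by blast
  define \<tau> where "\<tau> a = \<mu> a u" for a
  have \<mu>_const: "\<mu> a y = \<tau> a" if y: "y \<in> U" "y \<noteq> 0" for a y
  proof (cases "ind2 u y")
    case True
    then show ?thesis using \<mu>_indep[OF uv(1) y(1)] by (simp add: \<tau>_def)
  next
    case False
    then obtain c where c: "y = c *\<^sub>l u" using ind2_nonzero(1)[OF uv(3)] by (auto simp: ind2_alt)
    with y have "c \<noteq> 0" by auto
    then have "ind2 v y" unfolding c using ind2_lsc[OF ind2_sym[OF uv(3)]] by simp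
    then show ?thesis using \<mu>_indep[OF uv(2) y(1)] \<mu>_indep[OF uv] by (simp add: \<tau>_def)
  qed
  have hs: "h (a *\<^sub>l y) = \<tau> a *\<^sub>l h y" if "y \<in> U" for a y
    using \<mu>[OF that] \<mu>_const[OF that] by (cases "y = 0") auto
  have hu: "h u \<noteq> 0" using h_nonzero[OF uv(1)] ind2_nonzero[OF uv(3)] by blast
  have cancel: "p = q" if "p *\<^sub>l h u = q *\<^sub>l h u" for p q
  proof -
    from that have "(p - q) *\<^sub>l h u = 0" by (simp add: lsc_diff_left)
    with hu show ?thesis by simp
  qed
  have "\<tau> (x + y) = \<tau> x + \<tau> y" for x y
    using hs[OF uv(1), of "x + y"] h_add[of "x *\<^sub>l u" "y *\<^sub>l u"] hs[OF uv(1)] uv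
    by (intro cancel) (simp add: lsc_add_left)
  moreover have "\<tau> (x * y) = \<tau> x * \<tau> y" for x y
    using hs[OF uv(1), of "x * y"] hs[of "y *\<^sub>l u" x] hs[OF uv(1), of y] uv
    by (intro cancel) simp
  moreover have "\<tau> 1 = 1"
    using hs[OF uv(1), of 1] by (intro cancel) simp
  ultimately show ?thesis using h_add hs G_h by blast
qed

end

subsection \<open>Opposite ring and rank one matrices\<close>

text \<open>Transposition reverses products of entries and therefore respects matrix multiplication
  only when the entries are moved to the opposite ring. This type lets results on columns be read
  off from results on rows.\<close>

typedef 'a opp = "UNIV :: 'a set"
  morphisms unop op
  by blast

lemma unop_inject_iff: "x = y \<longleftrightarrow> unop x = unop y"
  by (simp add: unop_inject)

lemma unop_op [simp]: "unop (op x) = x"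
  by (simp add: op_inverse)

lemma op_unop [simp]: "op (unop x) = x"
  by (rule unop_inverse)

instantiation opp :: (division_ring) division_ring
begin

definition "0 = op 0"
definition "1 = op 1"
definition "x + y = op (unop x + unop y)"
definition "x - y = op (unop x - unop y)"
definition "- x = op (- unop x)"
definition "x * y = op (unop y * unop x)"
definition "inverse x = op (inverse (unop x))"
definition "x div y = op (inverse (unop y) * unop x)"

instance
  by standard
    (auto simp: unop_inject_iff zero_opp_def one_opp_def plus_opp_def minus_opp_def uminus_opp_def
      times_opp_def inverse_opp_def divide_opp_def algebra_simps)

end

lemma unop_simps [simp]:
  "unop 0 = 0" "unop 1 = 1" "unop (x + y) = unop x + unop y" "unop (x - y) = unop x - unop y"
  "unop (- x) = - unop x" "unop (x * y) = unop y * unop x" "unop (inverse x) = inverse (unop x)"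
  for x y :: "'a::division_ring opp"
  by (simp_all add: zero_opp_def one_opp_def plus_opp_def minus_opp_def uminus_opp_def
      times_opp_def inverse_opp_def)

lemma op_simps [simp]:
  "op 0 = 0" "op 1 = 1" "op (x + y) = op x + op y" "op (x - y) = op x - op y"
  "op (- x) = - op x" "op (x * y) = op y * op x" "op (inverse x) = inverse (op x)"
  for x y :: "'a::division_ring"
  by (simp_all add: unop_inject_iff)

lemma op_eq_0_iff [simp]: "op x = 0 \<longleftrightarrow> x = 0" "unop y = 0 \<longleftrightarrow> y = 0"
  for x :: "'a::division_ring"
  by (auto simp: unop_inject_iff)

lemma unop_sum: "unop (\<Sum>i\<in>I. f i) = (\<Sum>i\<in>I. unop (f i))" for f :: "'i \<Rightarrow> 'a::division_ring opp"
  by (induction I rule: infinite_finite_induct) auto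

lemma card_opp:
  assumes "infinite (UNIV :: 'a set) \<or> card (UNIV :: 'a set) \<ge> 4"
  shows "infinite (UNIV :: 'a opp set) \<or> card (UNIV :: 'a opp set) \<ge> 4"
proof -
  have "bij (op :: 'a \<Rightarrow> 'a opp)" by (rule bijI') (auto simp: op_inject intro: op_unop[symmetric])
  with assms show ?thesis using bij_betw_finite bij_betw_same_card by metis
qed

section \<open>Outer products\<close>

definition rsc :: "(nat \<Rightarrow> 'a::times) \<Rightarrow> 'a \<Rightarrow> nat \<Rightarrow> 'a" (infixl "*\<^sub>r" 75) where
  "v *\<^sub>r a = (\<lambda>i. v i * a)"

lemma rsc_apply [simp]: "(v *\<^sub>r a) i = v i * a"
  by (simp add: rsc_def)

lemma rsc_simps [simp]:
  "(v *\<^sub>r a) *\<^sub>r b = v *\<^sub>r (a * b)" "v *\<^sub>r 1 = v" "v *\<^sub>r 0 = 0" "0 *\<^sub>r a = 0"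
  "(u + v) *\<^sub>r a = u *\<^sub>r a + v *\<^sub>r a" "(u - v) *\<^sub>r a = u *\<^sub>r a - v *\<^sub>r a"
  for v :: "nat \<Rightarrow> 'a::ring_1"
  by (auto simp: fun_eq_iff mult.assoc algebra_simps)

lemma rsc_eq_0_iff [simp]: "u *\<^sub>r a = 0 \<longleftrightarrow> a = 0 \<or> u = 0" for u :: "nat \<Rightarrow> 'a::division_ring"
  by (auto simp: fun_eq_iff)

lemma rsc_fvec [simp]: "u \<in> fvec n \<Longrightarrow> u *\<^sub>r a \<in> fvec n" for u :: "nat \<Rightarrow> 'a::division_ring"
  by (auto simp: fvec_def)

definition outer :: "(nat \<Rightarrow> 'a::times) \<Rightarrow> (nat \<Rightarrow> 'a) \<Rightarrow> nat \<Rightarrow> nat \<Rightarrow> 'a" where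
  "outer x y = (\<lambda>i j. x i * y j)"

lemma outer_apply [simp]: "outer x y i j = x i * y j"
  by (simp add: outer_def)

lemma outer_simps [simp]:
  "outer 0 y = 0" "outer x 0 = 0" "outer (- x) y = - outer x y" "outer x (- y) = - outer x y"
  for x :: "nat \<Rightarrow> 'a::division_ring"
  by (auto simp: fun_eq_iff)

lemma outer_add: "outer (x + x') y = outer x y + outer x' y" "outer x (y + y') = outer x y + outer x y'"
  for x :: "nat \<Rightarrow> 'a::division_ring"
  by (auto simp: fun_eq_iff algebra_simps)

lemma outer_diff: "outer (x - x') y = outer x y - outer x' y" "outer x (y - y') = outer x y - outer x y'"
  for x :: "nat \<Rightarrow> 'a::division_ring"
  by (auto simp: fun_eq_iff algebra_simps)

lemma outer_rsc: "outer (x *\<^sub>r a) y = outer x (a *\<^sub>l y)" for x :: "nat \<Rightarrow> 'a::division_ring"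
  by (auto simp: fun_eq_iff mult.assoc)

lemma outer_eq_0_iff [simp]: "outer x y = 0 \<longleftrightarrow> x = 0 \<or> y = 0" for x :: "nat \<Rightarrow> 'a::division_ring"
  by (auto simp: fun_eq_iff)

lemma outer_fmat [simp]: "x \<in> fvec m \<Longrightarrow> y \<in> fvec n \<Longrightarrow> outer x y \<in> fmat m n"
  for x :: "nat \<Rightarrow> 'a::division_ring"
  by (auto simp: fmat_def fvec_def)

lemma outer_eq_rowD:
  fixes p :: "nat \<Rightarrow> 'a::division_ring"
  assumes "outer p w = outer u q" "p \<noteq> 0"
  shows "\<exists>s. w = s *\<^sub>l q"
proof -
  obtain i where i: "p i \<noteq> 0" using assms(2) by (rule fun_nonzeroE)
  have "w j = (inverse (p i) * u i) * q j" for j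
  proof -
    have "inverse (p i) * (p i * w j) = inverse (p i) * (u i * q j)"
      using fun_cong[OF fun_cong[OF assms(1)], of i j] by simp
    then show ?thesis using i by (simp add: mult.assoc[symmetric])
  qed
  then show ?thesis by (intro exI[of _ "inverse (p i) * u i"]) (auto simp: fun_eq_iff)
qed

lemma outer_eq_colD:
  fixes p :: "nat \<Rightarrow> 'a::division_ring"
  assumes "outer p w = outer u q" "w \<noteq> 0"
  shows "\<exists>s. p = u *\<^sub>r s"
proof -
  obtain j where j: "w j \<noteq> 0" using assms(2) by (rule fun_nonzeroE)
  have "p i = u i * (q j * inverse (w j))" for i
  proof -
    have "p i * w j * inverse (w j) = u i * q j * inverse (w j)"
      using fun_cong[OF fun_cong[OF assms(1)], of i j] by simp
    then show ?thesis using j by (simp add: mult.assoc)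
  qed
  then show ?thesis by (intro exI[of _ "q j * inverse (w j)"]) (auto simp: fun_eq_iff)
qed

lemma outer_cancel:
  fixes p :: "nat \<Rightarrow> 'a::division_ring"
  shows "p \<noteq> 0 \<Longrightarrow> outer p w = outer p w' \<longleftrightarrow> w = w'" "w \<noteq> 0 \<Longrightarrow> outer p w = outer p' w \<longleftrightarrow> p = p'"
proof -
  assume "p \<noteq> 0"
  have "outer p w = outer p w' \<longleftrightarrow> outer p (w - w') = 0" by (simp only: outer_diff right_minus_eq)
  with \<open>p \<noteq> 0\<close> show "outer p w = outer p w' \<longleftrightarrow> w = w'" by simp
next
  assume "w \<noteq> 0"
  have "outer p w = outer p' w \<longleftrightarrow> outer (p - p') w = 0" by (simp only: outer_diff right_minus_eq)
  with \<open>w \<noteq> 0\<close> show "outer p w = outer p' w \<longleftrightarrow> p = p'" by simp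
qed

text \<open>Columns \<open>k\<close> and \<open>l\<close> of the equation are combined so that
  \<open>x\<close> cancels; as \<open>v\<close> is no multiple of \<open>y\<close>, this exhibits
  \<open>u\<close> as a right multiple of \<open>a\<close>. Column \<open>k\<close> then does the
  same for \<open>x\<close>, and two right multiples of \<open>a\<close> are multiples of each
  other.\<close>

lemma outer_sum_rank_one:
  fixes x :: "nat \<Rightarrow> 'a::division_ring"
  assumes e: "outer x y + outer u v = outer a b" and yv: "ind2 y v" and x: "x \<noteq> 0"
  shows "\<exists>c. u = x *\<^sub>r c"
proof -
  obtain k where k: "y k \<noteq> 0" using ind2_nonzero(1)[OF yv] by (rule fun_nonzeroE)
  define t where "t = v k * inverse (y k)"
  have "v \<noteq> t *\<^sub>l y" using yv by (auto simp: ind2_alt)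
  then have "v - t *\<^sub>l y \<noteq> 0" by simp
  then obtain l where l: "(v - t *\<^sub>l y) l \<noteq> 0" by (rule fun_nonzeroE)
  define s where "s = v l - t * y l"
  have s: "s \<noteq> 0" using l by (simp add: s_def)
  have E: "x i * y j + u i * v j = a i * b j" for i j
    using fun_cong[OF fun_cong[OF e], of i j] by simp
  have "u i = a i * ((b l - b k * inverse (y k) * y l) * inverse s)" for i
  proof -
    have "x i * y k * (inverse (y k) * y l) + u i * v k * (inverse (y k) * y l) = a i * b k * (inverse (y k) * y l)"
      using arg_cong[OF E[of i k], of "\<lambda>z. z * (inverse (y k) * y l)"] by (simp add: distrib_right)
    then have "x i * y l + u i * t * y l = a i * (b k * inverse (y k) * y l)"
      using k by (simp add: t_def mult.assoc mult.assoc[of "y k" "inverse (y k)", symmetric])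
    with E[of i l] have "u i * s = a i * (b l - b k * inverse (y k) * y l)"
      by (simp add: s_def right_diff_distrib mult.assoc) (metis add_diff_cancel_left)
    then have "u i * s * inverse s = a i * (b l - b k * inverse (y k) * y l) * inverse s" by simp
    then show ?thesis using s by (simp add: mult.assoc)
  qed
  then obtain c2 where c2: "u = a *\<^sub>r c2" by (metis ext rsc_apply)
  have "x i = a i * ((b k - c2 * v k) * inverse (y k))" for i
  proof -
    have "x i * y k = a i * (b k - c2 * v k)"
      using E[of i k] by (simp add: c2 right_diff_distrib mult.assoc) (metis add_diff_cancel_right')
    then have "x i * y k * inverse (y k) = a i * (b k - c2 * v k) * inverse (y k)" by simp
    then show ?thesis using k by (simp add: mult.assoc)
  qed
  then obtain c1 where c1: "x = a *\<^sub>r c1" by (metis ext rsc_apply)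
  with x have "c1 \<noteq> 0" by auto
  then have "u = x *\<^sub>r (inverse c1 * c2)"
    by (simp add: c1 c2 mult.assoc[symmetric])
  then show ?thesis by blast
qed

text \<open>Up to the index range, \<open>Rset p\<close> and \<open>Cset q\<close> with nonzero
  vectors are the maximal cliques through \<open>0\<close>, of type one and type two. Members of the
  first have all columns in the right line of \<open>p\<close>, members of the second all rows in
  the left line of \<open>q\<close>.\<close>

definition Rset :: "(nat \<Rightarrow> 'a::division_ring) \<Rightarrow> (nat \<Rightarrow> nat \<Rightarrow> 'a) set" where
  "Rset p = {outer p w | w. True}"

definition Cset :: "(nat \<Rightarrow> 'a::division_ring) \<Rightarrow> (nat \<Rightarrow> nat \<Rightarrow> 'a) set" where
  "Cset q = {outer w q | w. True}"

lemma RsetE: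
  assumes "B \<in> Rset p"
  obtains w where "B = outer p w"
  using assms by (auto simp: Rset_def)

lemma CsetE:
  assumes "B \<in> Cset q"
  obtains w where "B = outer w q"
  using assms by (auto simp: Cset_def)

lemma Rset_eq:
  assumes "B \<in> Rset p" "B \<in> Rset p'" "B \<noteq> 0"
  shows "Rset p = Rset p'"
proof -
  have "Rset p \<subseteq> Rset p'" if BR: "B \<in> Rset p" "B \<in> Rset p'" for p p'
  proof -
    obtain w w' where w: "B = outer p w" "B = outer p' w'" using BR by (elim RsetE)
    with assms(3) have "w \<noteq> 0" by auto
    with outer_eq_colD[of p w p' w'] w obtain s where "p = p' *\<^sub>r s" by auto
    then show ?thesis by (auto simp: Rset_def outer_rsc)
  qed
  with assms show ?thesis by blast
qed

lemma Cset_eq: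
  assumes "B \<in> Cset q" "B \<in> Cset q'" "B \<noteq> 0"
  shows "Cset q = Cset q'"
proof -
  have "Cset q \<subseteq> Cset q'" if BR: "B \<in> Cset q" "B \<in> Cset q'" for q q'
  proof -
    obtain w w' where w: "B = outer w q" "B = outer w' q'" using BR by (elim CsetE)
    with assms(3) have "w \<noteq> 0" by auto
    with outer_eq_rowD[of w q w' q'] w obtain s where "q = s *\<^sub>l q'" by auto
    then show ?thesis by (auto simp: Cset_def outer_rsc[symmetric])
  qed
  with assms show ?thesis by blast
qed

lemma zero_Rset [simp]: "0 \<in> Rset p" "0 \<in> Cset q"
  unfolding Rset_def Cset_def by (auto intro: exI[of _ 0])

subsection \<open>Cliques of rank one matrices\<close>

lemma rank_one_difference:
  assumes "outer p q - outer u v = outer a b" "outer p q \<noteq> 0"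
  shows "outer u v \<in> Rset p \<or> outer u v \<in> Cset q"
proof (cases "ind2 q v")
  case True
  with assms outer_sum_rank_one[of p q "-u" v a b] obtain c where "- u = p *\<^sub>r c" by auto
  then have "u = p *\<^sub>r (- c)" by (auto simp: fun_eq_iff) (metis minus_equation_iff)
  then show ?thesis by (auto simp: outer_rsc Rset_def)
next
  case False
  with assms(2) obtain c where "v = c *\<^sub>l q" by (auto simp: ind2_alt)
  then show ?thesis by (auto simp: outer_rsc[symmetric] Cset_def)
qed

text \<open>Relative to a fixed nonzero member \<open>outer p q\<close>, every member lies in
  \<open>Rset p\<close> or in \<open>Cset q\<close>. If one of them, \<open>outer u q\<close>,
  leaves \<open>Rset p\<close>, then a member outside \<open>Cset q\<close> would lie in both
  \<open>Rset p\<close> and \<open>Rset u\<close> and force these to coincide.\<close>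

lemma clique_in_Rset_or_Cset:
  assumes r1: "\<And>B. B \<in> S \<Longrightarrow> \<exists>u v. B = outer u v"
    and adj: "\<And>B C. B \<in> S \<Longrightarrow> C \<in> S \<Longrightarrow> \<exists>u v. B - C = outer u v"
  shows "(\<exists>p. p \<noteq> 0 \<and> S \<subseteq> Rset p) \<or> (\<exists>q. q \<noteq> 0 \<and> S \<subseteq> Cset q)"
proof (cases "S \<subseteq> {0}")
  case True
  then show ?thesis by (intro disjI1 exI[of _ "ev 0"]) auto
next
  case False
  then obtain p q where pq: "outer p q \<in> S" "outer p q \<noteq> 0" using r1 by blast
  have pair: "C \<in> Rset p \<or> C \<in> Cset q" if "outer p q \<in> S" "C \<in> S" "outer p q \<noteq> 0" for p q C
    using r1[OF that(2)] adj[OF that(1,2)] rank_one_difference that(3) by metis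
  show ?thesis
  proof (cases "S \<subseteq> Rset p")
    case True
    with pq show ?thesis by auto
  next
    case False
    then obtain B where B: "B \<in> S" "B \<notin> Rset p" by blast
    with pair[OF pq(1) B(1) pq(2)] obtain u where u: "B = outer u q" by (auto simp: Cset_def)
    have B0: "outer u q \<noteq> 0" using B u by (metis zero_Rset(1))
    have "C \<in> Cset q" if C: "C \<in> S" for C
    proof (rule ccontr)
      assume n: "C \<notin> Cset q"
      then have "C \<noteq> 0" by auto
      moreover have "C \<in> Rset p" "C \<in> Rset u"
        using n pair[OF pq(1) C pq(2)] pair[of u q C] B B0 C u by auto
      ultimately have "Rset p = Rset u" by (intro Rset_eq)
      with B u show False by (auto simp: Rset_def)
    qed
    with pq show ?thesis by auto
  qed
qed

text \<open>
  Abstracts from \<open>F\<close>, \<open>F'\<close> being the two types of maximal cliques: if one row and one column go into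
  cliques of the same type, then everything lies in one clique of each type.
\<close>
lemma two_families:
  fixes \<psi> :: "'x \<Rightarrow> 'y \<Rightarrow> 'c::zero"
  assumes F: "\<And>M M' B. M \<in> F \<Longrightarrow> M' \<in> F \<Longrightarrow> B \<in> M \<Longrightarrow> B \<in> M' \<Longrightarrow> B \<noteq> 0 \<Longrightarrow> M = M'"
    and F': "\<And>M M' B. M \<in> F' \<Longrightarrow> M' \<in> F' \<Longrightarrow> B \<in> M \<Longrightarrow> B \<in> M' \<Longrightarrow> B \<noteq> 0 \<Longrightarrow> M = M'"
    and ne: "F' \<noteq> {}"
    and nz: "\<And>x y. x \<in> X \<Longrightarrow> y \<in> Y \<Longrightarrow> \<psi> x y \<noteq> 0"
    and X: "\<And>x. x \<in> X \<Longrightarrow> \<exists>M\<in>F \<union> F'. \<forall>y\<in>Y. \<psi> x y \<in> M"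
    and Y: "\<And>y. y \<in> Y \<Longrightarrow> \<exists>M\<in>F \<union> F'. \<forall>x\<in>X. \<psi> x y \<in> M"
    and x0: "x0 \<in> X" "M0 \<in> F" "\<forall>y\<in>Y. \<psi> x0 y \<in> M0"
    and y0: "y0 \<in> Y" "M1 \<in> F" "\<forall>x\<in>X. \<psi> x y0 \<in> M1"
  shows "\<exists>M\<in>F. \<exists>N\<in>F'. \<forall>x\<in>X. \<forall>y\<in>Y. \<psi> x y \<in> M \<union> N"
proof -
  have M: "M1 = M0" using F[of M1 M0 "\<psi> x0 y0"] x0 y0 nz by blast
  have out: "\<exists>N\<in>F'. (\<forall>y'\<in>Y. \<psi> x y' \<in> N) \<and> (\<forall>x'\<in>X. \<psi> x' y \<in> N)"
    if xy: "x \<in> X" "y \<in> Y" "\<psi> x y \<notin> M0" for x y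
  proof -
    obtain N where N: "N \<in> F \<union> F'" "\<forall>y\<in>Y. \<psi> x y \<in> N" using X[OF xy(1)] by blast
    have "N \<notin> F"
    proof
      assume "N \<in> F"
      then have "N = M0" using F[of N M0 "\<psi> x y0"] x0 y0 nz[OF xy(1) y0(1)] N M xy(1) by blast
      with N xy show False by blast
    qed
    moreover obtain N' where N': "N' \<in> F \<union> F'" "\<forall>x\<in>X. \<psi> x y \<in> N'" using Y[OF xy(2)] by blast
    have "N' \<notin> F"
    proof
      assume "N' \<in> F"
      then have "N' = M0" using F[of N' M0 "\<psi> x0 y"] x0 nz[OF x0(1) xy(2)] N' xy(2) by blast
      with N' xy show False by blast
    qed
    ultimately have "N \<in> F'" "N' \<in> F'" using N N' by auto
    moreover have "N = N'" using F'[of N N' "\<psi> x y"] calculation N(2) N'(2) xy nz by blast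
    ultimately show ?thesis using N N' by blast
  qed
  show ?thesis
  proof (cases "\<forall>x\<in>X. \<forall>y\<in>Y. \<psi> x y \<in> M0")
    case True
    with ne x0(2) show ?thesis by blast
  next
    case False
    then obtain x1 y1 where 1: "x1 \<in> X" "y1 \<in> Y" "\<psi> x1 y1 \<notin> M0" by blast
    obtain N where N: "N \<in> F'" "\<forall>y'\<in>Y. \<psi> x1 y' \<in> N" using out[OF 1] by blast
    have "\<psi> x y \<in> M0 \<union> N" if xy: "x \<in> X" "y \<in> Y" for x y
    proof (rule ccontr)
      assume n: "\<psi> x y \<notin> M0 \<union> N"
      then obtain N' where N': "N' \<in> F'" "\<forall>y'\<in>Y. \<psi> x y' \<in> N'" "\<forall>x'\<in>X. \<psi> x' y \<in> N'"
        using out[OF xy] by blast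
      have "N' = N" using F'[of N' N "\<psi> x1 y"] N N' 1 xy nz by blast
      with n N' xy show False by blast
    qed
    with N x0(2) show ?thesis by blast
  qed
qed

section \<open>Row and column types at points of rank at most one\<close>

definition Rk1 :: "nat \<Rightarrow> nat \<Rightarrow> (nat \<Rightarrow> nat \<Rightarrow> 'a::division_ring) set" where
  "Rk1 m n = {outer x y | x y. x \<in> fvec m \<and> y \<in> fvec n}"

lemma Rk1I [simp]: "x \<in> fvec m \<Longrightarrow> y \<in> fvec n \<Longrightarrow> outer x y \<in> Rk1 m n"
  by (auto simp: Rk1_def)

lemma Rk1_fmat: "A \<in> Rk1 m n \<Longrightarrow> A \<in> fmat m n"
  by (auto simp: Rk1_def)

lemma zero_Rk1 [simp]: "0 \<in> Rk1 m n"
  using Rk1I[of 0 m 0 n] by simp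

text \<open>Everything is translated so that \<open>\<phi> A\<close> becomes \<open>0\<close>;
  maximal sets through \<open>\<phi> A\<close> then appear as \<open>Rset p\<close> and
  \<open>Cset q\<close>. The condition \<open>A \<in> Rk1 m n\<close> in \<open>nondeg\<close>
  mirrors the rank condition in the definition of degeneracy.\<close>

locale nondegenerate_hom =
  fixes m n :: nat and \<phi> :: "(nat \<Rightarrow> nat \<Rightarrow> 'a::division_ring) \<Rightarrow> nat \<Rightarrow> nat \<Rightarrow> 'b::division_ring"
  assumes mn: "m \<ge> 2" "n \<ge> 2"
    and phi_zero: "\<phi> 0 = 0"
    and phi_adj: "\<And>A x y. A \<in> fmat m n \<Longrightarrow> x \<in> fvec m \<Longrightarrow> y \<in> fvec n \<Longrightarrow> x \<noteq> 0 \<Longrightarrow> y \<noteq> 0 \<Longrightarrow>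
      \<exists>u v. u \<noteq> 0 \<and> v \<noteq> 0 \<and> \<phi> (A + outer x y) - \<phi> A = outer u v"
    and nondeg: "\<And>A p q. A \<in> Rk1 m n \<Longrightarrow> p \<noteq> 0 \<Longrightarrow> q \<noteq> 0 \<Longrightarrow>
      \<exists>x\<in>fvec m. \<exists>y\<in>fvec n. \<phi> (A + outer x y) - \<phi> A \<notin> Rset p \<union> Cset q"
begin

text \<open>The prefix names the set of matrices through \<open>A\<close> in the source, the final
  letter the type of clique that receives its image.\<close>

definition rowR where "rowR A x \<longleftrightarrow> (\<exists>p. p \<noteq> 0 \<and> (\<forall>y\<in>fvec n. \<phi> (A + outer x y) - \<phi> A \<in> Rset p))"
definition rowC where "rowC A x \<longleftrightarrow> (\<exists>q. q \<noteq> 0 \<and> (\<forall>y\<in>fvec n. \<phi> (A + outer x y) - \<phi> A \<in> Cset q))"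
definition colR where "colR A y \<longleftrightarrow> (\<exists>p. p \<noteq> 0 \<and> (\<forall>x\<in>fvec m. \<phi> (A + outer x y) - \<phi> A \<in> Rset p))"
definition colC where "colC A y \<longleftrightarrow> (\<exists>q. q \<noteq> 0 \<and> (\<forall>x\<in>fvec m. \<phi> (A + outer x y) - \<phi> A \<in> Cset q))"

definition straight where
  "straight A \<longleftrightarrow> (\<forall>x\<in>fvec m - {0}. rowR A x) \<and> (\<forall>y\<in>fvec n - {0}. colC A y)"
definition twisted where
  "twisted A \<longleftrightarrow> (\<forall>x\<in>fvec m - {0}. rowC A x) \<and> (\<forall>y\<in>fvec n - {0}. colR A y)"

lemma phi_rank_one:
  assumes "A \<in> fmat m n" "x \<in> fvec m" "y \<in> fvec n"
  shows "\<exists>u v. \<phi> (A + outer x y) - \<phi> A = outer u v"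
proof (cases "x = 0 \<or> y = 0")
  case True
  then have "\<phi> (A + outer x y) - \<phi> A = outer 0 0" by auto
  then show ?thesis by blast
next
  case False
  with phi_adj[OF assms] show ?thesis by blast
qed

lemma row_dichotomy:
  assumes A: "A \<in> fmat m n" and x: "x \<in> fvec m"
  shows "rowR A x \<or> rowC A x"
proof -
  have "(\<exists>p. p \<noteq> 0 \<and> (\<lambda>y. \<phi> (A + outer x y) - \<phi> A) ` fvec n \<subseteq> Rset p) \<or>
        (\<exists>q. q \<noteq> 0 \<and> (\<lambda>y. \<phi> (A + outer x y) - \<phi> A) ` fvec n \<subseteq> Cset q)"
  proof (rule clique_in_Rset_or_Cset)
    fix B assume "B \<in> (\<lambda>y. \<phi> (A + outer x y) - \<phi> A) ` fvec n"
    then show "\<exists>u v. B = outer u v" using phi_rank_one[OF A x] by auto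
  next
    fix B C assume "B \<in> (\<lambda>y. \<phi> (A + outer x y) - \<phi> A) ` fvec n" "C \<in> (\<lambda>y. \<phi> (A + outer x y) - \<phi> A) ` fvec n"
    then obtain y z where yz: "y \<in> fvec n" "z \<in> fvec n"
      "B = \<phi> (A + outer x y) - \<phi> A" "C = \<phi> (A + outer x z) - \<phi> A" by auto
    have "A + outer x y = (A + outer x z) + outer x (y - z)" by (simp add: outer_diff)
    with yz phi_rank_one[of "A + outer x z" x "y - z"] A x show "\<exists>u v. B - C = outer u v" by simp
  qed
  then show ?thesis by (auto simp: rowR_def rowC_def)
qed

lemma col_dichotomy:
  assumes A: "A \<in> fmat m n" and y: "y \<in> fvec n"
  shows "colR A y \<or> colC A y"
proof -
  have "(\<exists>p. p \<noteq> 0 \<and> (\<lambda>x. \<phi> (A + outer x y) - \<phi> A) ` fvec m \<subseteq> Rset p) \<or>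
        (\<exists>q. q \<noteq> 0 \<and> (\<lambda>x. \<phi> (A + outer x y) - \<phi> A) ` fvec m \<subseteq> Cset q)"
  proof (rule clique_in_Rset_or_Cset)
    fix B assume "B \<in> (\<lambda>x. \<phi> (A + outer x y) - \<phi> A) ` fvec m"
    then show "\<exists>u v. B = outer u v" using phi_rank_one[OF A _ y] by auto
  next
    fix B C assume "B \<in> (\<lambda>x. \<phi> (A + outer x y) - \<phi> A) ` fvec m" "C \<in> (\<lambda>x. \<phi> (A + outer x y) - \<phi> A) ` fvec m"
    then obtain x z where xz: "x \<in> fvec m" "z \<in> fvec m"
      "B = \<phi> (A + outer x y) - \<phi> A" "C = \<phi> (A + outer z y) - \<phi> A" by auto
    have "A + outer x y = (A + outer z y) + outer (x - z) y" by (simp add: outer_diff)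
    with xz phi_rank_one[of "A + outer z y" "x - z" y] A y show "\<exists>u v. B - C = outer u v" by simp
  qed
  then show ?thesis by (auto simp: colR_def colC_def)
qed

text \<open>A row and a column sent into cliques of the same type would, by
  \<open>two_families\<close>, confine all differences at \<open>A\<close> to one
  \<open>Rset p\<close> and one \<open>Cset q\<close>, which \<open>nondeg\<close> forbids. The
  second claim is the first with the two families exchanged.\<close>

lemma no_mixed:
  assumes A: "A \<in> Rk1 m n" and x: "x \<in> fvec m" "x \<noteq> 0" and y: "y \<in> fvec n" "y \<noteq> 0"
  shows "\<not> (rowR A x \<and> colR A y)" "\<not> (rowC A x \<and> colC A y)"
proof -
  define \<psi> where "\<psi> x y = \<phi> (A + outer x y) - \<phi> A" for x y
  define F where "F = Rset ` {p :: nat \<Rightarrow> 'b. p \<noteq> 0}"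
  define F' where "F' = Cset ` {p :: nat \<Rightarrow> 'b. p \<noteq> 0}"
  have AM: "A \<in> fmat m n" by (rule Rk1_fmat[OF A])
  have F: "M = M'" if "M \<in> F" "M' \<in> F" "B \<in> M" "B \<in> M'" "B \<noteq> 0" for M M' B
    using that Rset_eq unfolding F_def by blast
  have F': "M = M'" if "M \<in> F'" "M' \<in> F'" "B \<in> M" "B \<in> M'" "B \<noteq> 0" for M M' B
    using that Cset_eq unfolding F'_def by blast
  have ne: "F \<noteq> {}" "F' \<noteq> {}" unfolding F_def F'_def using ev_nonzero by blast+
  have nz: "\<psi> x y \<noteq> 0" if "x \<in> fvec m - {0}" "y \<in> fvec n - {0}" for x y
    using phi_adj[OF AM, of x y] that unfolding \<psi>_def by fastforce
  have X: "\<exists>M\<in>F \<union> F'. \<forall>y\<in>fvec n - {0}. \<psi> x y \<in> M" if "x \<in> fvec m - {0}" for x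
    using row_dichotomy[OF AM, of x] that unfolding rowR_def rowC_def F_def F'_def \<psi>_def by blast
  have Y: "\<exists>M\<in>F \<union> F'. \<forall>x\<in>fvec m - {0}. \<psi> x y \<in> M" if "y \<in> fvec n - {0}" for y
    using col_dichotomy[OF AM, of y] that unfolding colR_def colC_def F_def F'_def \<psi>_def by blast
  have contra: False if MN: "M \<in> F" "N \<in> F'" "\<forall>x\<in>fvec m - {0}. \<forall>y\<in>fvec n - {0}. \<psi> x y \<in> M \<union> N" for M N
  proof -
    obtain p q where pq: "p \<noteq> 0" "q \<noteq> 0" "M = Rset p" "N = Cset q" using MN unfolding F_def F'_def by blast
    from nondeg[OF A pq(1,2)] obtain x y where xy: "x \<in> fvec m" "y \<in> fvec n" "\<psi> x y \<notin> M \<union> N"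
      unfolding \<psi>_def pq by blast
    moreover have "x \<noteq> 0" "y \<noteq> 0" using xy pq by (auto simp: \<psi>_def)
    ultimately show False using MN by blast
  qed
  show "\<not> (rowR A x \<and> colR A y)"
  proof
    assume rc: "rowR A x \<and> colR A y"
    then obtain M0 M1 where M0: "M0 \<in> F" "\<forall>y\<in>fvec n - {0}. \<psi> x y \<in> M0"
      and M1: "M1 \<in> F" "\<forall>x\<in>fvec m - {0}. \<psi> x y \<in> M1"
      unfolding rowR_def colR_def F_def \<psi>_def by blast
    have "\<exists>M\<in>F. \<exists>N\<in>F'. \<forall>x\<in>fvec m - {0}. \<forall>y\<in>fvec n - {0}. \<psi> x y \<in> M \<union> N"
      by (rule two_families[of F F' _ _ \<psi> x M0 y M1]) ((fact F F' ne nz X Y M0 M1 | use x y in simp)+)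
    with contra show False by blast
  qed
  show "\<not> (rowC A x \<and> colC A y)"
  proof
    assume rc: "rowC A x \<and> colC A y"
    then obtain M0 M1 where M0: "M0 \<in> F'" "\<forall>y\<in>fvec n - {0}. \<psi> x y \<in> M0"
      and M1: "M1 \<in> F'" "\<forall>x\<in>fvec m - {0}. \<psi> x y \<in> M1"
      unfolding rowC_def colC_def F'_def \<psi>_def by blast
    note X' = X[unfolded Un_commute[of F F']] and Y' = Y[unfolded Un_commute[of F F']]
    have "\<exists>N\<in>F'. \<exists>M\<in>F. \<forall>x\<in>fvec m - {0}. \<forall>y\<in>fvec n - {0}. \<psi> x y \<in> N \<union> M"
      by (rule two_families[of F' F _ _ \<psi> x M0 y M1]) ((fact F F' ne nz X' Y' M0 M1 | use x y in simp)+)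
    then obtain N M where "N \<in> F'" "M \<in> F"
      "\<forall>x\<in>fvec m - {0}. \<forall>y\<in>fvec n - {0}. \<psi> x y \<in> N \<union> M" by blast
    with contra[of M N] show False unfolding Un_commute[of M N] by blast
  qed
qed

lemma ex_nonzero: "ev 0 \<in> fvec m - {0 :: nat \<Rightarrow> 'a}" "ev 0 \<in> fvec n - {0 :: nat \<Rightarrow> 'a}"
  using mn by auto

text \<open>A single row suffices: by \<open>no_mixed\<close> it forces the type of every column,
  and a column in turn forces the type of every row.\<close>

lemma straight_if_rowR:
  assumes A: "A \<in> Rk1 m n" and x: "x \<in> fvec m - {0}" "rowR A x"
  shows "straight A"
proof -
  have "colC A y" if "y \<in> fvec n - {0}" for y
    using no_mixed(1)[OF A, of x y] x that col_dichotomy[OF Rk1_fmat[OF A], of y] by auto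
  moreover from this have "rowR A x" if "x \<in> fvec m - {0}" for x
    using no_mixed(2)[OF A, of x "ev 0"] ex_nonzero(2) that row_dichotomy[OF Rk1_fmat[OF A], of x] by auto
  ultimately show ?thesis by (simp add: straight_def)
qed

lemma twisted_if_rowC:
  assumes A: "A \<in> Rk1 m n" and x: "x \<in> fvec m - {0}" "rowC A x"
  shows "twisted A"
proof -
  have "colR A y" if "y \<in> fvec n - {0}" for y
    using no_mixed(2)[OF A, of x y] x that col_dichotomy[OF Rk1_fmat[OF A], of y] by auto
  moreover from this have "rowC A x" if "x \<in> fvec m - {0}" for x
    using no_mixed(1)[OF A, of x "ev 0"] ex_nonzero(2) that row_dichotomy[OF Rk1_fmat[OF A], of x] by auto
  ultimately show ?thesis by (simp add: twisted_def)
qed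

text \<open>The type cannot change from point to point: for \<open>A = outer x y\<close> the row at
  \<open>A\<close> in direction \<open>x\<close> is the same set of matrices as the row at
  \<open>0\<close>, so its image keeps its type after translation.\<close>

lemma straight_or_twisted:
  "(\<forall>A\<in>Rk1 m n. straight A) \<or> (\<forall>A\<in>Rk1 m n. twisted A)"
proof -
  have ow: "(0 :: nat \<Rightarrow> nat \<Rightarrow> 'a) + B = B" for B by simp
  consider "straight 0" | "twisted 0"
    using row_dichotomy[of 0 "ev 0"] straight_if_rowR[of 0 "ev 0"] twisted_if_rowC[of 0 "ev 0"]
      ex_nonzero(1) by auto
  then show ?thesis
  proof cases
    case 1
    have "straight A" if A: "A \<in> Rk1 m n" for A
    proof (cases "A = 0")
      case False
      obtain x y where xy: "x \<in> fvec m" "y \<in> fvec n" "A = outer x y" using A by (auto simp: Rk1_def)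
      with False have x: "x \<in> fvec m - {0}" by auto
      with 1 have "rowR 0 x" unfolding straight_def by blast
      then obtain p where p: "p \<noteq> 0" "\<forall>y\<in>fvec n. \<phi> (outer x y) \<in> Rset p"
        unfolding rowR_def ow phi_zero by auto
      have "\<phi> (A + outer x z) - \<phi> A \<in> Rset p" if "z \<in> fvec n" for z
      proof -
        have "\<phi> (outer x (y + z)) \<in> Rset p" "\<phi> (outer x y) \<in> Rset p" using p xy that by auto
        then obtain w w' where "\<phi> (outer x (y + z)) = outer p w" "\<phi> (outer x y) = outer p w'"
          by (auto simp: Rset_def)
        then have "\<phi> (A + outer x z) - \<phi> A = outer p (w - w')" by (simp add: xy outer_add outer_diff)
        then show ?thesis by (auto simp: Rset_def)
      qed
      with p have "rowR A x" by (auto simp: rowR_def)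
      with straight_if_rowR[OF A x] show ?thesis .
    qed (use 1 in simp)
    then show ?thesis by blast
  next
    case 2
    have "twisted A" if A: "A \<in> Rk1 m n" for A
    proof (cases "A = 0")
      case False
      obtain x y where xy: "x \<in> fvec m" "y \<in> fvec n" "A = outer x y" using A by (auto simp: Rk1_def)
      with False have x: "x \<in> fvec m - {0}" by auto
      with 2 have "rowC 0 x" unfolding twisted_def by blast
      then obtain q where q: "q \<noteq> 0" "\<forall>y\<in>fvec n. \<phi> (outer x y) \<in> Cset q"
        unfolding rowC_def ow phi_zero by auto
      have "\<phi> (A + outer x z) - \<phi> A \<in> Cset q" if "z \<in> fvec n" for z
      proof -
        have "\<phi> (outer x (y + z)) \<in> Cset q" "\<phi> (outer x y) \<in> Cset q" using q xy that by auto
        then obtain w w' where "\<phi> (outer x (y + z)) = outer w q" "\<phi> (outer x y) = outer w' q"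
          by (auto simp: Cset_def)
        then have "\<phi> (A + outer x z) - \<phi> A = outer (w - w') q" by (simp add: xy outer_add outer_diff)
        then show ?thesis by (auto simp: Cset_def)
      qed
      with q have "rowC A x" by (auto simp: rowC_def)
      with twisted_if_rowC[OF A x] show ?thesis .
    qed (use 2 in simp)
    then show ?thesis by blast
  qed
qed

end

subsection \<open>Affine lineations with full image\<close>

definition rhom :: "('a::division_ring \<Rightarrow> 'b::division_ring) \<Rightarrow> bool" where
  "rhom \<tau> \<longleftrightarrow> (\<forall>x y. \<tau> (x + y) = \<tau> x + \<tau> y) \<and> (\<forall>x y. \<tau> (x * y) = \<tau> x * \<tau> y) \<and> \<tau> 1 = 1"

lemma rhom_simps:
  assumes "rhom \<tau>"
  shows "\<tau> (x + y) = \<tau> x + \<tau> y" "\<tau> (x * y) = \<tau> x * \<tau> y" "\<tau> 1 = 1" "\<tau> 0 = 0" "\<tau> (- x) = - \<tau> x"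
    "\<tau> (x - y) = \<tau> x - \<tau> y" "\<tau> x = 0 \<longleftrightarrow> x = 0"
proof -
  show 1: "\<tau> (x + y) = \<tau> x + \<tau> y" "\<tau> (x * y) = \<tau> x * \<tau> y" "\<tau> 1 = 1" for x y
    using assms by (auto simp: rhom_def)
  show z: "\<tau> 0 = 0" using 1(1)[of 0 0] by simp
  show m: "\<tau> (- x) = - \<tau> x" for x using 1(1)[of x "-x"] z by (simp add: eq_neg_iff_add_eq_0 add.commute)
  show "\<tau> (x - y) = \<tau> x - \<tau> y" using 1(1)[of x "-y"] m by simp
  show "\<tau> x = 0 \<longleftrightarrow> x = 0"
  proof
    assume x: "\<tau> x = 0"
    show "x = 0"
    proof (rule ccontr)
      assume "x \<noteq> 0"
      then have "\<tau> x * \<tau> (inverse x) = 1" by (simp flip: 1)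
      with x show False by simp
    qed
  qed (simp add: z)
qed

lemma rhom_inverse: "rhom \<tau> \<Longrightarrow> \<tau> (inverse x) = inverse (\<tau> x)"
proof (cases "x = 0")
  case False
  assume t: "rhom \<tau>"
  then have "\<tau> x * \<tau> (inverse x) = 1" using False by (simp flip: rhom_simps(2)[OF t] add: rhom_simps(3)[OF t])
  then show ?thesis by (rule inverse_unique[symmetric])
qed (simp add: rhom_simps)

lemma rhom_inj: "rhom \<tau> \<Longrightarrow> \<tau> x = \<tau> y \<longleftrightarrow> x = y"
  using rhom_simps(6,7)[of \<tau>] by (metis right_minus_eq)

definition slin :: "nat \<Rightarrow> ('a::division_ring \<Rightarrow> 'b::division_ring) \<Rightarrow> ((nat \<Rightarrow> 'a) \<Rightarrow> nat \<Rightarrow> 'b) \<Rightarrow> bool" where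
  "slin n \<tau> h \<longleftrightarrow> (\<forall>y\<in>fvec n. \<forall>z\<in>fvec n. h (y + z) = h y + h z) \<and> (\<forall>a. \<forall>y\<in>fvec n. h (a *\<^sub>l y) = \<tau> a *\<^sub>l h y)"

definition sform :: "nat \<Rightarrow> ('a::division_ring \<Rightarrow> 'b::division_ring) \<Rightarrow> ((nat \<Rightarrow> 'a) \<Rightarrow> 'b) \<Rightarrow> bool" where
  "sform n \<tau> l \<longleftrightarrow> (\<forall>y\<in>fvec n. \<forall>z\<in>fvec n. l (y + z) = l y + l z) \<and> (\<forall>a. \<forall>y\<in>fvec n. l (a *\<^sub>l y) = \<tau> a * l y)"

definition lsub :: "(nat \<Rightarrow> 'a::division_ring) set \<Rightarrow> bool" where
  "lsub S \<longleftrightarrow> 0 \<in> S \<and> (\<forall>u\<in>S. \<forall>v\<in>S. u + v \<in> S) \<and> (\<forall>a. \<forall>u\<in>S. a *\<^sub>l u \<in> S)"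

lemma lsub_diff: "lsub S \<Longrightarrow> u \<in> S \<Longrightarrow> v \<in> S \<Longrightarrow> u - v \<in> S"
  unfolding lsub_def by (metis diff_conv_add_uminus lsc_minus_left lsc_one)

lemma lsub_span: "lsub {\<Sum>i\<in>I. c i *\<^sub>l u i | c. True}"
  unfolding lsub_def
proof (intro conjI allI ballI)
  show "0 \<in> {\<Sum>i\<in>I. c i *\<^sub>l u i |c. True}" by (auto intro!: exI[of _ "\<lambda>_. 0"])
next
  fix x y assume "x \<in> {\<Sum>i\<in>I. c i *\<^sub>l u i |c. True}" "y \<in> {\<Sum>i\<in>I. c i *\<^sub>l u i |c. True}"
  then obtain c d where "x = (\<Sum>i\<in>I. c i *\<^sub>l u i)" "y = (\<Sum>i\<in>I. d i *\<^sub>l u i)" by auto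
  then have "x + y = (\<Sum>i\<in>I. (c i + d i) *\<^sub>l u i)" by (simp add: lsc_add_left sum.distrib)
  then show "x + y \<in> {\<Sum>i\<in>I. c i *\<^sub>l u i |c. True}"
    by (intro CollectI exI[of _ "\<lambda>i. c i + d i"]) simp
next
  fix a x assume "x \<in> {\<Sum>i\<in>I. c i *\<^sub>l u i |c. True}"
  then obtain c where "x = (\<Sum>i\<in>I. c i *\<^sub>l u i)" by auto
  then have "a *\<^sub>l x = (\<Sum>i\<in>I. (a * c i) *\<^sub>l u i)" by (simp add: lsc_sum_right)
  then show "a *\<^sub>l x \<in> {\<Sum>i\<in>I. c i *\<^sub>l u i |c. True}"
    by (intro CollectI exI[of _ "\<lambda>i. a * c i"]) simp
qed

lemma span_gen:
  fixes u :: "'i \<Rightarrow> nat \<Rightarrow> 'a::division_ring"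
  assumes "finite I" "k \<in> I"
  shows "u k \<in> {\<Sum>i\<in>I. c i *\<^sub>l u i | c. True}"
proof -
  have "(\<Sum>i\<in>I. (if i = k then 1 else 0) *\<^sub>l u i) = (\<Sum>i\<in>I. if i = k then u k else 0)"
    by (rule sum.cong) auto
  also have "\<dots> = u k" using assms by simp
  finally have "u k = (\<Sum>i\<in>I. (if i = k then 1 else 0) *\<^sub>l u i)" by simp
  then show ?thesis by (intro CollectI exI[of _ "\<lambda>i. if i = k then 1 else 0"]) simp
qed

lemma lind_scale:
  assumes "lind I w" "\<And>i. i \<in> I \<Longrightarrow> s i \<noteq> 0"
  shows "lind I (\<lambda>i. s i *\<^sub>l w i)"
  unfolding lind_def
proof (intro allI impI ballI)
  fix c i assume "(\<Sum>i\<in>I. c i *\<^sub>l s i *\<^sub>l w i) = 0" "i \<in> I"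
  then have "c i * s i = 0" using lindD[OF assms(1), of "\<lambda>i. c i * s i" i] by simp
  with assms(2) \<open>i \<in> I\<close> show "c i = 0" by auto
qed

lemma lind_cong: "(\<And>i. i \<in> I \<Longrightarrow> v i = w i) \<Longrightarrow> lind I v \<longleftrightarrow> lind I w"
  unfolding lind_def by (metis (no_types, lifting) sum.cong)

definition hcons :: "'a \<Rightarrow> (nat \<Rightarrow> 'a) \<Rightarrow> nat \<Rightarrow> 'a" where
  "hcons c v = (\<lambda>i. case i of 0 \<Rightarrow> c | Suc j \<Rightarrow> v j)"

lemma hcons_simps [simp]: "hcons c v 0 = c" "hcons c v (Suc j) = v j"
  by (simp_all add: hcons_def)

lemma hcons_ops:
  "a *\<^sub>l hcons c v = hcons (a * c) (a *\<^sub>l v)"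
  "hcons c v + hcons c' v' = hcons (c + c') (v + v')"
  "hcons c v = 0 \<longleftrightarrow> c = 0 \<and> v = 0"
  "hcons c v = hcons c' v' \<longleftrightarrow> c = c' \<and> v = v'"
  for c c' :: "'a::division_ring"
proof -
  show "a *\<^sub>l hcons c v = hcons (a * c) (a *\<^sub>l v)" "hcons c v + hcons c' v' = hcons (c + c') (v + v')"
    by (auto simp: hcons_def fun_eq_iff split: nat.split)
  show "hcons c v = hcons c' v' \<longleftrightarrow> c = c' \<and> v = v'" for c' v'
  proof
    assume e: "hcons c v = hcons c' v'"
    show "c = c' \<and> v = v'" using fun_cong[OF e, of 0] fun_cong[OF e, of "Suc _"] by auto
  qed simp
  moreover have "hcons 0 0 = (0 :: nat \<Rightarrow> 'a)"
    by (auto simp: hcons_def fun_eq_iff split: nat.split)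
  ultimately show "hcons c v = 0 \<longleftrightarrow> c = 0 \<and> v = 0" by metis
qed

text \<open>Unlike in the locale \<open>lineation\<close>, preservation of independence is a consequence here.\<close>
locale affine_lineation =
  fixes n :: nat and g :: "(nat \<Rightarrow> 'a::division_ring) \<Rightarrow> nat \<Rightarrow> 'b::division_ring" and ys
  assumes card4: "infinite (UNIV :: 'a set) \<or> card (UNIV :: 'a set) \<ge> 4"
    and n2: "n \<ge> 2"
    and g_zero: "g 0 = 0"
    and g_line: "\<And>y d. y \<in> fvec n \<Longrightarrow> d \<in> fvec n \<Longrightarrow> \<exists>q. \<forall>a. \<exists>c. g (y + a *\<^sub>l d) - g y = c *\<^sub>l q"
    and g_inj: "inj_on g (fvec n)"
    and ys: "\<And>i. i < n \<Longrightarrow> ys i \<in> fvec n"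
    and full: "lind {..<n} (\<lambda>i. g (ys i))"
begin

text \<open>Recentring at \<open>A\<close> gives every point the role of the origin; independence
  has to be shown at all base points.\<close>

definition gA where "gA A v = g (A + v) - g A"

lemma ex_t: "\<exists>t::'a. t \<noteq> 0 \<and> t \<noteq> 1"
  using ex_avoid3[OF card4, of 0 1 1] by auto

lemma gA_line:
  assumes "A \<in> fvec n" "y \<in> fvec n" "d \<in> fvec n" "d \<noteq> 0"
  shows "\<exists>t. gA A (y + a *\<^sub>l d) - gA A y = t *\<^sub>l (gA A (y + d) - gA A y)"
proof -
  obtain q where q: "\<And>a. \<exists>c. g (A + y + a *\<^sub>l d) - g (A + y) = c *\<^sub>l q"
    using g_line[of "A + y" d] assms by auto
  obtain c c1 where c: "g (A + y + a *\<^sub>l d) - g (A + y) = c *\<^sub>l q"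
    "g (A + y + 1 *\<^sub>l d) - g (A + y) = c1 *\<^sub>l q" using q by meson
  have "c1 \<noteq> 0"
  proof
    assume "c1 = 0"
    with c have "g (A + y + d) = g (A + y)" by simp
    with inj_onD[OF g_inj, of "A + y + d" "A + y"] assms show False by simp
  qed
  then have "c *\<^sub>l q = (c * inverse c1) *\<^sub>l c1 *\<^sub>l q" by (simp add: mult.assoc)
  then show ?thesis using c by (intro exI[of _ "c * inverse c1"]) (simp add: gA_def add.assoc)
qed

lemma gA_0 [simp]: "gA A 0 = 0"
  by (simp add: gA_def)

lemma preimage_lsc:
  assumes "lsub S" "A \<in> fvec n" "v \<in> fvec n" "gA A v \<in> S"
  shows "gA A (a *\<^sub>l v) \<in> S"
proof (cases "v = 0")
  case False
  with gA_line[OF assms(2) _ assms(3), of 0 a] obtain t where "gA A (a *\<^sub>l v) = t *\<^sub>l gA A v" by auto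
  with assms show ?thesis by (auto simp: lsub_def)
qed (use assms in \<open>simp add: lsub_def\<close>)

text \<open>Preimages of subspaces are closed under addition because \<open>u + v\<close> is a point
  of the line joining a multiple of \<open>u\<close> to a multiple of \<open>v\<close>. The
  multiples are \<open>inverse (1 - t)\<close> and \<open>inverse t\<close>, which is why
  \<open>t\<close> must differ from \<open>0\<close> and \<open>1\<close>.\<close>

lemma preimage_add:
  assumes S: "lsub S" and A: "A \<in> fvec n" and u: "u \<in> fvec n" "gA A u \<in> S" and v: "v \<in> fvec n" "gA A v \<in> S"
  shows "gA A (u + v) \<in> S"
proof -
  obtain t :: 'a where t: "t \<noteq> 0" "t \<noteq> 1" using ex_t by blast
  define u' where "u' = inverse (1 - t) *\<^sub>l u"
  define v' where "v' = inverse t *\<^sub>l v"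
  have uv: "u + v = u' + t *\<^sub>l (v' - u')"
  proof -
    have "u' + t *\<^sub>l (v' - u') = (1 - t) *\<^sub>l u' + t *\<^sub>l v'" by (simp add: lsc_diff_left algebra_simps)
    then show ?thesis using t by (simp add: u'_def v'_def del: lsc_diff_right)
  qed
  have S': "gA A u' \<in> S" "gA A v' \<in> S" using preimage_lsc[OF S A] u v by (auto simp: u'_def v'_def)
  show ?thesis
  proof (cases "v' = u'")
    case False
    then obtain s where "gA A (u + v) - gA A u' = s *\<^sub>l (gA A (u' + (v' - u')) - gA A u')"
      using gA_line[OF A, of u' "v' - u'" t] u v unfolding uv by (auto simp: u'_def v'_def)
    moreover have "u' + (v' - u') = v'" by simp
    ultimately have "gA A (u + v) = gA A u' + s *\<^sub>l (gA A v' - gA A u')" by (metis add.commute diff_add_cancel)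
    with S S' lsub_diff[OF S] show ?thesis by (auto simp only: lsub_def)
  qed (use uv S' in simp)
qed

lemma preimage_sum:
  assumes S: "lsub S" and A: "A \<in> fvec n" and f: "\<And>i. i \<in> I \<Longrightarrow> f i \<in> fvec n \<and> gA A (f i) \<in> S"
  shows "gA A (\<Sum>i\<in>I. f i) \<in> S"
proof -
  have "(\<Sum>i\<in>I. f i) \<in> fvec n \<and> gA A (\<Sum>i\<in>I. f i) \<in> S"
    using f
  proof (induction I rule: infinite_finite_induct)
    case (insert x F)
    have fx: "f x \<in> fvec n" "gA A (f x) \<in> S" using insert.prems[of x] by simp_all
    have "sum f F \<in> fvec n \<and> gA A (sum f F) \<in> S" by (rule insert.IH) (rule insert.prems, rule insertI2)
    then have F: "sum f F \<in> fvec n" "gA A (sum f F) \<in> S" by (rule conjunct1, rule conjunct2)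
    show ?case unfolding sum.insert[OF insert.hyps(1,2)]
      by (rule conjI[OF fvec_closed(2)[OF fx(1) F(1)] preimage_add[OF S A fx F]])
  qed (use S in \<open>auto simp: lsub_def\<close>)
  then show ?thesis by blast
qed

lemma preimage_all:
  assumes S: "lsub S" and A: "A \<in> fvec n" and e: "\<And>i. i < n \<Longrightarrow> gA A (ev i) \<in> S" and v: "v \<in> fvec n"
  shows "gA A v \<in> S"
proof -
  have "gA A (\<Sum>i<n. v i *\<^sub>l ev i) \<in> S" using e preimage_lsc[OF S A] by (intro preimage_sum[OF S A]) auto
  then show ?thesis using fvec_expand[OF v] by simp
qed

text \<open>A subspace containing the recentred images of the unit vectors contains the whole
  recentred image, hence also the independent vectors \<open>g (ys i)\<close>. If \<open>n\<close>
  vectors span it, the exchange lemma makes them independent.\<close>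

lemma lind_in_lsub:
  assumes S: "\<And>i. i < n \<Longrightarrow> gA A (ev i) \<in> {\<Sum>i<n. c i *\<^sub>l u i | c. True}" and A: "A \<in> fvec n"
  shows "lind {..<n} u"
proof -
  let ?S = "{\<Sum>i<n. c i *\<^sub>l u i | c. True}"
  have "g (ys i) \<in> ?S" if "i < n" for i
  proof -
    have e: "g (ys i) = gA A (ys i - A) - gA A (0 - A)" by (simp add: gA_def g_zero)
    have "gA A (ys i - A) \<in> ?S"
      by (rule preimage_all[OF lsub_span A S]) (assumption, rule fvec_closed(3)[OF ys[OF that] A])
    moreover have "gA A (0 - A) \<in> ?S"
      by (rule preimage_all[OF lsub_span A S]) (assumption, rule fvec_closed(3)[OF fvec_closed(1) A])
    ultimately show ?thesis unfolding e by (rule lsub_diff[OF lsub_span])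
  qed
  then have "\<forall>i\<in>{..<n}. \<exists>c. g (ys i) = (\<Sum>j<n. c j *\<^sub>l u j)" by auto
  then obtain C where "\<And>i. i \<in> {..<n} \<Longrightarrow> g (ys i) = (\<Sum>j<n. C i j *\<^sub>l u j)" by metis
  with lind_exchange[OF _ full, of C u] show ?thesis by simp
qed

lemma lind_gA: "A \<in> fvec n \<Longrightarrow> lind {..<n} (\<lambda>i. gA A (ev i))"
  by (rule lind_in_lsub) (rule span_gen, simp_all)

text \<open>If two independent vectors had parallel images, the image of a suitable basis would be
  spanned by a family of \<open>n\<close> vectors one of which is \<open>0\<close>. By
  \<open>lind_in_lsub\<close> that family would be independent.\<close>

lemma ind2_gA:
  assumes A: "A \<in> fvec n" and y: "y \<in> fvec n" and z: "z \<in> fvec n" and yz: "ind2 y z"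
  shows "ind2 (gA A y) (gA A z)"
proof (rule ccontr)
  assume n: "\<not> ?thesis"
  have "gA A y \<noteq> 0"
    using inj_onD[OF g_inj, of "A + y" A] A y ind2_nonzero[OF yz] by (auto simp: gA_def)
  with n obtain c where c: "gA A z = c *\<^sub>l gA A y" by (auto simp: ind2_alt)
  obtain k where k: "y k \<noteq> 0" using ind2_nonzero(1)[OF yz] by (rule fun_nonzeroE)
  define z' where "z' = z - (z k * inverse (y k)) *\<^sub>l y"
  have "z' \<noteq> 0" using yz by (auto simp: z'_def ind2_alt)
  then obtain l where l: "z' l \<noteq> 0" by (rule fun_nonzeroE)
  have z'k: "z' k = 0" using k by (simp add: z'_def mult.assoc)
  with l have kl: "k \<noteq> l" by auto
  have z': "z' \<in> fvec n" using y z by (simp add: z'_def)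
  have "k < n" if "v \<in> fvec n" "v k \<noteq> 0" for v :: "nat \<Rightarrow> 'a" and k
    using that unfolding fvec_def by (metis (mono_tags, lifting) mem_Collect_eq not_le)
  note kn = this[OF y k] this[OF z' l]
  \<comment> \<open>The vectors \<open>y\<close> and \<open>z'\<close> take the places of the unit
    vectors at \<open>k\<close> and \<open>l\<close>; since the image of \<open>z\<close> is assumed
    to be a multiple of that of \<open>y\<close>, place \<open>l\<close> can hold
    \<open>0\<close>.\<close>
  define u where "u = (\<lambda>i. gA A (ev i))(k := gA A y, l := 0)"
  let ?S = "{\<Sum>i<n. c i *\<^sub>l u i | c. True}"
  note S = lsub_span[where I = "{..<n}" and u = u]
  have uS: "u i \<in> ?S" if "i < n" for i using that by (intro span_gen) auto
  have yS: "gA A y \<in> ?S" using uS[OF kn(1)] kl by (simp add: u_def)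
  then have zS: "gA A z \<in> ?S" using S unfolding c by (auto simp only: lsub_def)
  have z'S: "gA A z' \<in> ?S"
    using preimage_add[OF S A z zS _ preimage_lsc[OF S A y yS], of "- (z k * inverse (y k))"] y
    by (simp add: z'_def lsc_minus_left)
  have eS: "gA A (ev i) \<in> ?S" if "i < n" "i \<noteq> k" "i \<noteq> l" for i using uS[OF that(1)] that by (simp add: u_def)
  \<comment> \<open>Recovers a unit vector from a vector with nonzero entry at \<open>j\<close> once
    its other unit vectors are accounted for: first \<open>ev l\<close> from \<open>z'\<close>,
    whose entry at \<open>k\<close> is \<open>0\<close>, then \<open>ev k\<close> from
    \<open>y\<close>.\<close>
  have strip: "gA A (ev j) \<in> ?S"
    if v: "v \<in> fvec n" "gA A v \<in> ?S" "v j \<noteq> 0" "j < n" and o: "\<And>i. i < n \<Longrightarrow> i \<noteq> j \<Longrightarrow> v i \<noteq> 0 \<Longrightarrow> gA A (ev i) \<in> ?S" for v j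
  proof -
    define r where "r = (\<Sum>i\<in>{..<n} - {j}. (- v i) *\<^sub>l (ev i :: nat \<Rightarrow> 'a))"
    have r: "r \<in> fvec n" unfolding r_def by (rule fvec_sum) auto
    have "gA A ((- v i) *\<^sub>l ev i) \<in> ?S" if "i < n" "i \<noteq> j" for i
    proof (cases "v i = 0")
      case True
      then show ?thesis using S by (simp add: lsub_def)
    next
      case False
      then show ?thesis using o[OF that] that preimage_lsc[OF S A] by simp
    qed
    then have "gA A r \<in> ?S" unfolding r_def by (intro preimage_sum[OF S A]) auto
    then have m: "gA A (v + r) \<in> ?S" using preimage_add[OF S A v(1,2) r] by blast
    have vr: "v + r = v j *\<^sub>l ev j"
    proof -
      have "v = (\<Sum>i<n. v i *\<^sub>l ev i)" by (rule fvec_expand[OF v(1)])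
      also have "\<dots> = v j *\<^sub>l ev j + (\<Sum>i\<in>{..<n} - {j}. v i *\<^sub>l ev i)"
        by (rule sum.remove) (use v(4) in auto)
      finally have "v + r = (v j *\<^sub>l ev j + (\<Sum>i\<in>{..<n} - {j}. v i *\<^sub>l ev i)) + r"
        by (rule arg_cong)
      also have "\<dots> = v j *\<^sub>l ev j + (\<Sum>i\<in>{..<n} - {j}. v i *\<^sub>l ev i + (- v i) *\<^sub>l ev i)"
        by (simp only: r_def sum.distrib add.assoc)
      also have "\<dots> = v j *\<^sub>l ev j"
        by (simp only: lsc_minus_left right_minus sum.neutral_const add_0_right)
      finally show ?thesis .
    qed
    have "v j *\<^sub>l ev j \<in> fvec n" using v(4) by simp
    from preimage_lsc[OF S A this m[unfolded vr], of "inverse (v j)"] show ?thesis using v(3) by simp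
  qed
  have lS: "gA A (ev l) \<in> ?S" using strip[OF z' z'S l kn(2)] eS z'k by blast
  have kS: "gA A (ev k) \<in> ?S" using strip[OF y yS k kn(1)] eS lS by blast
  have "gA A (ev i) \<in> ?S" if "i < n" for i
    using eS[OF that] kS lS by (cases "i = k"; cases "i = l") simp_all
  then have "lind {..<n} u" by (rule lind_in_lsub[OF _ A])
  then show False using lind_nonzero[of "{..<n}" u l] kn by (simp add: u_def)
qed

text \<open>The target is embedded as the affine hyperplane on which the zeroth coordinate is \<open>1\<close>.\<close>
sublocale lineation "fvec n" "\<lambda>y. hcons 1 (g y)"
proof
  show "infinite (UNIV :: 'a set) \<or> card (UNIV :: 'a set) \<ge> 4" by (rule card4)
  have "ind2 (ev 0 :: nat \<Rightarrow> 'a) (ev 1)"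
    unfolding ind2_alt by (auto simp: ev_def fun_eq_iff)
  then show "\<exists>u\<in>fvec n. \<exists>v\<in>fvec n. ind2 u (v :: nat \<Rightarrow> 'a)"
    using n2 by (intro bexI[of _ "ev 0"] bexI[of _ "ev 1"]) auto
next
  fix y d :: "nat \<Rightarrow> 'a" and a assume yd: "y \<in> fvec n" "d \<in> fvec n"
  show "hcons 1 (g (y + a *\<^sub>l d)) \<in> span2 (hcons 1 (g y)) (hcons 1 (g (y + d)))"
  proof (cases "d = 0")
    case False
    from gA_line[OF _ yd False, of 0 a] obtain t where "g (y + a *\<^sub>l d) - g y = t *\<^sub>l (g (y + d) - g y)"
      by (auto simp: gA_def g_zero)
    then have e: "g (y + a *\<^sub>l d) = g y + t *\<^sub>l (g (y + d) - g y)" by (metis add.commute diff_add_cancel)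
    have "hcons 1 (g (y + a *\<^sub>l d)) = (1 - t) *\<^sub>l hcons 1 (g y) + t *\<^sub>l hcons 1 (g (y + d))"
      unfolding e by (simp add: hcons_ops lsc_diff_left algebra_simps)
    then show ?thesis by (simp add: span2I)
  qed simp
next
  fix y v w :: "nat \<Rightarrow> 'a" assume a: "y \<in> fvec n" "v \<in> fvec n" "w \<in> fvec n" "ind2 v w"
  note i = ind2_gA[OF a]
  show "ind3 (hcons 1 (g y)) (hcons 1 (g (y + v))) (hcons 1 (g (y + w)))"
    unfolding ind3_def
  proof (intro allI impI)
    fix p q r assume "p *\<^sub>l hcons 1 (g y) + q *\<^sub>l hcons 1 (g (y + v)) + r *\<^sub>l hcons 1 (g (y + w)) = 0"
    then have s: "p + q + r = 0" "p *\<^sub>l g y + q *\<^sub>l g (y + v) + r *\<^sub>l g (y + w) = 0"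
      by (simp_all add: hcons_ops)
    have "q *\<^sub>l gA y v + r *\<^sub>l gA y w = (p *\<^sub>l g y + q *\<^sub>l g (y + v) + r *\<^sub>l g (y + w)) - (p + q + r) *\<^sub>l g y"
      by (simp add: gA_def lsc_add_left algebra_simps)
    also have "\<dots> = 0" unfolding s by simp
    finally have "q = 0 \<and> r = 0" using i unfolding ind2_def by blast
    with s show "p = 0 \<and> q = 0 \<and> r = 0" by simp
  qed
qed (rule fvec_closed; assumption)+

text \<open>The homogeneous vector splits into coordinate zero, giving the form \<open>l\<close>,
  and the rest, giving \<open>h\<close>. As coordinate zero of \<open>hcons 1 (g y)\<close> is
  \<open>1\<close>, the unknown factor has to be the inverse of \<open>1 + l y\<close>.\<close>

lemma fractional_semilinear:
  "\<exists>\<tau> h l. rhom \<tau> \<and> slin n \<tau> h \<and> sform n \<tau> l \<and>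
     (\<forall>y\<in>fvec n. 1 + l y \<noteq> 0 \<and> g y = inverse (1 + l y) *\<^sub>l h y) \<and>
     (\<forall>y\<in>fvec n. \<forall>z\<in>fvec n. ind2 y z \<longrightarrow> ind2 (h y) (h z))"
proof -
  obtain \<tau> H where \<tau>: "\<forall>x y. \<tau> (x + y) = \<tau> x + \<tau> y" "\<forall>x y. \<tau> (x * y) = \<tau> x * \<tau> y" "\<tau> 1 = (1 :: 'b)"
    and H: "\<forall>y\<in>fvec n. \<forall>z\<in>fvec n. H (y + z) = H y + H z" "\<forall>a. \<forall>y\<in>fvec n. H (a *\<^sub>l y) = \<tau> a *\<^sub>l H y"
    and G: "\<forall>y\<in>fvec n. \<exists>c. c \<noteq> 0 \<and> hcons 1 (g y) = c *\<^sub>l (hcons 1 (g 0) + H y)"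
    using semilinear by blast
  define l where "l y = H y 0" for y
  define h where "h y = (\<lambda>j. H y (Suc j))" for y
  have "rhom \<tau>" using \<tau> by (simp add: rhom_def)
  moreover have "slin n \<tau> h" using H by (auto simp: slin_def h_def fun_eq_iff)
  moreover have "sform n \<tau> l" using H by (auto simp: sform_def l_def)
  moreover have G': "1 + l y \<noteq> 0 \<and> g y = inverse (1 + l y) *\<^sub>l h y" if "y \<in> fvec n" for y
  proof -
    obtain c where c: "c \<noteq> 0" "hcons 1 (g y) = c *\<^sub>l (hcons 1 (g 0) + H y)" using G \<open>y \<in> fvec n\<close> by blast
    have 1: "c * (1 + l y) = 1" using fun_cong[OF c(2), of 0] by (simp add: l_def distrib_left)
    then have "1 + l y \<noteq> 0" by auto
    moreover have "inverse (1 + l y) = c"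
      unfolding inverse_unique[OF 1, symmetric] by (rule inverse_inverse_eq)
    moreover have "g y = c *\<^sub>l h y"
      using fun_cong[OF c(2), of "Suc _"] by (auto simp: h_def g_zero fun_eq_iff)
    ultimately show ?thesis by simp
  qed
  moreover have "ind2 (h y) (h z)" if yz: "y \<in> fvec n" "z \<in> fvec n" "ind2 y z" for y z
  proof -
    have "ind2 (g y) (g z)" using ind2_gA[of 0 y z] yz by (simp add: gA_def g_zero)
    moreover have "h y = (1 + l y) *\<^sub>l g y" "h z = (1 + l z) *\<^sub>l g z" using G' yz by simp_all
    moreover have "1 + l y \<noteq> 0" "1 + l z \<noteq> 0" using G' yz by blast+
    ultimately show ?thesis
      using ind2_lsc[OF ind2_sym[OF ind2_lsc[of "g y" "g z" "1 + l z"]], of "1 + l y"] ind2_sym by auto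
  qed
  ultimately show ?thesis by blast
qed

lemma lind_g: "lind {..<n} (\<lambda>i. g (ev i))"
  using lind_gA[of 0] by (simp add: gA_def g_zero)

end

subsection \<open>Homomorphisms on rank one matrices\<close>

definition vop :: "(nat \<Rightarrow> 'a) \<Rightarrow> nat \<Rightarrow> 'a opp" where
  "vop v = (\<lambda>i. op (v i))"

definition vun :: "(nat \<Rightarrow> 'a opp) \<Rightarrow> nat \<Rightarrow> 'a" where
  "vun v = (\<lambda>i. unop (v i))"

definition mop :: "(nat \<Rightarrow> nat \<Rightarrow> 'a) \<Rightarrow> nat \<Rightarrow> nat \<Rightarrow> 'a opp" where
  "mop M = (\<lambda>i j. op (M j i))"

definition mun :: "(nat \<Rightarrow> nat \<Rightarrow> 'a opp) \<Rightarrow> nat \<Rightarrow> nat \<Rightarrow> 'a" where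
  "mun M = (\<lambda>i j. unop (M j i))"

lemma vop_vun [simp]: "vop (vun v) = v" "vun (vop w) = w"
  by (auto simp: vop_def vun_def)

lemma mop_mun [simp]: "mop (mun M) = M" "mun (mop N) = N"
  by (auto simp: mop_def mun_def)

lemma vop_simps [simp]:
  "vop 0 = 0" "vop (u + v) = vop u + vop v" "vop (u - v) = vop u - vop v" "vop (u *\<^sub>r a) = op a *\<^sub>l vop u"
  for u v :: "nat \<Rightarrow> 'a::division_ring"
  by (auto simp: vop_def fun_eq_iff)

lemma vun_simps [simp]:
  "vun 0 = 0" "vun (u + v) = vun u + vun v" "vun (u - v) = vun u - vun v" "vun (a *\<^sub>l u) = vun u *\<^sub>r unop a"
  for u v :: "nat \<Rightarrow> 'a::division_ring opp"
  by (auto simp: vun_def fun_eq_iff)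

lemma vop_eq_iff [simp]: "vop u = vop v \<longleftrightarrow> u = v"
  by (metis vop_vun(2))

lemma vun_eq_iff [simp]: "vun u = vun v \<longleftrightarrow> u = v"
  by (metis vop_vun(1))

lemma vop_eq_0_iff [simp]: "vop u = 0 \<longleftrightarrow> u = 0" "vun v = 0 \<longleftrightarrow> v = 0" for u :: "nat \<Rightarrow> 'a::division_ring"
  using vop_eq_iff[of u 0] vun_eq_iff[of v 0] by simp_all

lemma vop_fvec [simp]: "vop u \<in> fvec n \<longleftrightarrow> u \<in> fvec n" "vun v \<in> fvec n \<longleftrightarrow> v \<in> fvec n"
  for u :: "nat \<Rightarrow> 'a::division_ring"
  by (auto simp: vop_def vun_def fvec_def)

lemma vop_ev [simp]: "vop (ev i) = ev i" "vun (ev i) = (ev i :: nat \<Rightarrow> 'a::division_ring)"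
  by (auto simp: vop_def vun_def ev_def)

lemma mop_simps [simp]:
  "mop 0 = 0" "mop (A + B) = mop A + mop B" "mop (A - B) = mop A - mop B" "mop (outer x y) = outer (vop y) (vop x)"
  for A B :: "nat \<Rightarrow> nat \<Rightarrow> 'a::division_ring"
  by (auto simp: mop_def fun_eq_iff vop_def)

lemma mun_simps [simp]:
  "mun 0 = 0" "mun (A + B) = mun A + mun B" "mun (A - B) = mun A - mun B" "mun (outer x y) = outer (vun y) (vun x)"
  for A B :: "nat \<Rightarrow> nat \<Rightarrow> 'a::division_ring opp"
  by (auto simp: mun_def fun_eq_iff vun_def)

lemma mop_eq_iff [simp]: "mop A = mop B \<longleftrightarrow> A = B"
  by (metis mop_mun(2))

lemma mun_Rk1 [simp]: "mun A \<in> Rk1 m n \<longleftrightarrow> A \<in> Rk1 n m"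
proof -
  have "mun A \<in> Rk1 m n" if A: "A \<in> Rk1 n m" for A :: "nat \<Rightarrow> nat \<Rightarrow> 'a opp"
  proof -
    obtain x y where "x \<in> fvec n" "y \<in> fvec m" "A = outer x y" using A by (auto simp: Rk1_def)
    then show ?thesis by simp
  qed
  moreover have "A \<in> Rk1 n m" if A: "mun A \<in> Rk1 m n"
  proof -
    obtain x y where "x \<in> fvec m" "y \<in> fvec n" "mun A = outer x y" using A by (auto simp: Rk1_def)
    then have "A = outer (vop y) (vop x)" by (metis mop_simps(4) mop_mun(1))
    with \<open>x \<in> _\<close> \<open>y \<in> _\<close> show ?thesis by simp
  qed
  ultimately show ?thesis by blast
qed

lemma mop_Cset: "mop B \<in> Rset (vop q)" if "B \<in> Cset q" for B :: "nat \<Rightarrow> nat \<Rightarrow> 'a::division_ring"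
  using that by (elim CsetE) (auto simp: Rset_def)

lemma mop_Rset: "mop B \<in> Cset (vop q)" if "B \<in> Rset q" for B :: "nat \<Rightarrow> nat \<Rightarrow> 'a::division_ring"
  using that by (elim RsetE) (auto simp: Cset_def)

text \<open>Columns are right vectors, so their independence is expressed as left independence over
  the opposite ring; hence \<open>vop\<close> in \<open>col_dim\<close>.\<close>

locale straight_hom =
  fixes m n :: nat and \<phi> :: "(nat \<Rightarrow> nat \<Rightarrow> 'a::division_ring) \<Rightarrow> nat \<Rightarrow> nat \<Rightarrow> 'b::division_ring"
  assumes card4: "infinite (UNIV :: 'a set) \<or> card (UNIV :: 'a set) \<ge> 4"
    and mn: "m \<ge> 2" "n \<ge> 2"
    and phi_zero: "\<phi> 0 = 0"
    and phi_neq: "\<And>A x y. A \<in> Rk1 m n \<Longrightarrow> x \<in> fvec m \<Longrightarrow> y \<in> fvec n \<Longrightarrow> x \<noteq> 0 \<Longrightarrow> y \<noteq> 0 \<Longrightarrow>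
      \<phi> (A + outer x y) \<noteq> \<phi> A"
    and row: "\<And>A x. A \<in> Rk1 m n \<Longrightarrow> x \<in> fvec m \<Longrightarrow> x \<noteq> 0 \<Longrightarrow>
      \<exists>p. \<forall>y\<in>fvec n. \<phi> (A + outer x y) - \<phi> A \<in> Rset p"
    and col: "\<And>A y. A \<in> Rk1 m n \<Longrightarrow> y \<in> fvec n \<Longrightarrow> y \<noteq> 0 \<Longrightarrow>
      \<exists>q. \<forall>x\<in>fvec m. \<phi> (A + outer x y) - \<phi> A \<in> Cset q"
    and row_dim: "\<exists>p ys w. p \<noteq> 0 \<and> (\<forall>i<n. ys i \<in> fvec n \<and> \<phi> (outer (ev 0) (ys i)) = outer p (w i)) \<and>
      lind {..<n} w"
    and col_dim: "\<exists>q xs w. q \<noteq> 0 \<and> (\<forall>i<m. xs i \<in> fvec m \<and> \<phi> (outer (xs i) (ev 0)) = outer (w i) q) \<and>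
      lind {..<m} (\<lambda>i. vop (w i))"
begin

lemma ev0 [simp]: "ev 0 \<in> fvec m" "ev 0 \<in> fvec n" "ev 1 \<in> fvec n"
  using mn by auto

text \<open>Each row is an affine lineation \<open>g x\<close>. The dimension hypothesis gives full
  image for \<open>x = ev 0\<close> only; columns through \<open>0\<close> show that
  \<open>g x y\<close> is proportional to \<open>g (ev 0) y\<close>, which carries full image over
  to all rows and allows one \<open>h\<close> and one \<open>\<tau>\<close> for all
  \<open>x\<close>.\<close>

lemma row_form:
  "\<exists>\<tau> h P l. rhom \<tau> \<and> slin n \<tau> h \<and> lind {..<n} (\<lambda>i. h (ev i)) \<and> (\<forall>y\<in>fvec n - {0}. h y \<noteq> 0) \<and>
     (\<forall>x\<in>fvec m - {0}. P x \<noteq> 0 \<and> sform n \<tau> (l x) \<and>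
       (\<forall>y\<in>fvec n. 1 + l x y \<noteq> 0 \<and> \<phi> (outer x y) = outer (P x) (inverse (1 + l x y) *\<^sub>l h y)))"
proof -
  have nz: "\<phi> (outer x y) \<noteq> 0" if "x \<in> fvec m" "y \<in> fvec n" "x \<noteq> 0" "y \<noteq> 0" for x y
    using phi_neq[OF zero_Rk1 that] by (simp add: phi_zero)
  have "\<forall>x\<in>fvec m - {0}. \<exists>p. \<forall>y\<in>fvec n. \<phi> (outer x y) \<in> Rset p"
    using row[OF zero_Rk1] by (simp add: phi_zero)
  then obtain p where p: "\<forall>x\<in>fvec m - {0}. \<forall>y\<in>fvec n. \<phi> (outer x y) \<in> Rset (p x)" by metis
  then have "\<forall>x\<in>fvec m - {0}. \<forall>y\<in>fvec n. \<exists>w. \<phi> (outer x y) = outer (p x) w" by (auto simp: Rset_def)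
  then obtain g where "\<forall>x\<in>fvec m - {0}. \<forall>y\<in>fvec n. \<phi> (outer x y) = outer (p x) (g x y)" by metis
  then have g: "\<phi> (outer x y) = outer (p x) (g x y)" if "x \<in> fvec m" "x \<noteq> 0" "y \<in> fvec n" for x y
    using that by blast
  have p0: "p x \<noteq> 0" if "x \<in> fvec m" "x \<noteq> 0" for x
    using nz[OF that(1) ev0(2) that(2)] g[OF that ev0(2)] by auto
  have g_zero: "g x 0 = 0" if "x \<in> fvec m" "x \<noteq> 0" for x
    using g[OF that, of 0] p0[OF that] by (simp add: phi_zero)
  \<comment> \<open>Within row \<open>x\<close> the points \<open>y + a *\<^sub>l d\<close> belong
    to the column at \<open>outer x y\<close> with direction \<open>d\<close>, since the scalar can
    be moved to \<open>x\<close>. Columns have images with a common row vector.\<close>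
  have g_line: "\<exists>q. \<forall>a. \<exists>c. g x (y + a *\<^sub>l d) - g x y = c *\<^sub>l q"
    if x: "x \<in> fvec m" "x \<noteq> 0" and y: "y \<in> fvec n" and d: "d \<in> fvec n" for x y d
  proof (cases "d = 0")
    case True
    then show ?thesis by (intro exI[of _ 0]) auto
  next
    case False
    obtain q where q: "\<forall>x'\<in>fvec m. \<phi> (outer x y + outer x' d) - \<phi> (outer x y) \<in> Cset q"
      using col[OF Rk1I[OF x(1) y] d False] by blast
    have "\<exists>c. g x (y + a *\<^sub>l d) - g x y = c *\<^sub>l q" for a
    proof -
      have "\<phi> (outer x (y + a *\<^sub>l d)) - \<phi> (outer x y) \<in> Cset q"
        using q x(1) by (auto simp: outer_add outer_rsc[symmetric])
      then obtain w where "\<phi> (outer x (y + a *\<^sub>l d)) - \<phi> (outer x y) = outer w q" by (rule CsetE)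
      then have "outer (p x) (g x (y + a *\<^sub>l d) - g x y) = outer w q"
        using g[OF x] y d by (simp add: outer_diff)
      from outer_eq_rowD[OF this p0[OF x]] show ?thesis .
    qed
    then show ?thesis by blast
  qed
  have g_inj: "inj_on (g x) (fvec n)" if x: "x \<in> fvec m" "x \<noteq> 0" for x
  proof (rule inj_onI, rule ccontr)
    fix y z assume yz: "y \<in> fvec n" "z \<in> fvec n" "g x y = g x z" "y \<noteq> z"
    have "outer x y = outer x z + outer x (y - z)" by (simp add: outer_diff)
    with phi_neq[of "outer x z" x "y - z"] x yz have "\<phi> (outer x y) \<noteq> \<phi> (outer x z)" by simp
    with g x yz show False by simp
  qed
  have lin: "affine_lineation n (g x) ys"
    if "x \<in> fvec m" "x \<noteq> 0" "\<And>i. i < n \<Longrightarrow> ys i \<in> fvec n" "lind {..<n} (\<lambda>i. g x (ys i))" for x ys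
    by unfold_locales (use that g_zero g_line g_inj mn card4 in blast)+
  obtain p' ys w where w: "p' \<noteq> 0" "\<And>i. i < n \<Longrightarrow> ys i \<in> fvec n"
      "\<And>i. i < n \<Longrightarrow> \<phi> (outer (ev 0) (ys i)) = outer p' (w i)" "lind {..<n} w"
    using row_dim by blast
  have "\<exists>s. s \<noteq> 0 \<and> g (ev 0) (ys i) = s *\<^sub>l w i" if i: "i < n" for i
  proof -
    have e: "outer (p (ev 0)) (g (ev 0) (ys i)) = outer p' (w i)"
      using w i g[of "ev 0" "ys i"] by simp
    from outer_eq_rowD[OF e] p0[of "ev 0"] obtain s where s: "g (ev 0) (ys i) = s *\<^sub>l w i" by auto
    have "w i \<noteq> 0" using lind_nonzero[OF w(4)] i by simp
    with e w(1) have "outer (p (ev 0)) (g (ev 0) (ys i)) \<noteq> 0" by simp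
    with s show ?thesis by auto
  qed
  then obtain s where s: "\<And>i. i < n \<Longrightarrow> s i \<noteq> 0 \<and> g (ev 0) (ys i) = s i *\<^sub>l w i" by metis
  have "lind {..<n} (\<lambda>i. s i *\<^sub>l w i)" using w(4) s by (intro lind_scale) auto
  then have "lind {..<n} (\<lambda>i. g (ev 0) (ys i))"
    using lind_cong[of "{..<n}" "\<lambda>i. g (ev 0) (ys i)" "\<lambda>i. s i *\<^sub>l w i"] s by simp
  then interpret L0: affine_lineation n "g (ev 0)" ys
    using w by (intro lin) auto
  obtain \<tau> h l0 where H: "rhom \<tau>" "slin n \<tau> h" "sform n \<tau> l0"
    "\<And>y. y \<in> fvec n \<Longrightarrow> 1 + l0 y \<noteq> 0 \<and> g (ev 0) y = inverse (1 + l0 y) *\<^sub>l h y"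
    "\<And>y z. y \<in> fvec n \<Longrightarrow> z \<in> fvec n \<Longrightarrow> ind2 y z \<Longrightarrow> ind2 (h y) (h z)"
    using L0.fractional_semilinear by blast
  have g0nz: "g x y \<noteq> 0" if "x \<in> fvec m" "x \<noteq> 0" "y \<in> fvec n" "y \<noteq> 0" for x y
    using nz[OF that(1,3,2,4)] g[OF that(1-3)] by auto
  have hnz: "h y \<noteq> 0" if "y \<in> fvec n" "y \<noteq> 0" for y
    using g0nz[of "ev 0" y] H(4)[OF that(1)] that by auto
  have "lind {..<n} (\<lambda>i. (1 + l0 (ev i)) *\<^sub>l g (ev 0) (ev i))"
    using L0.lind_g H(4) by (intro lind_scale) auto
  then have hl: "lind {..<n} (\<lambda>i. h (ev i))"
    using lind_cong[of "{..<n}" "\<lambda>i. h (ev i)" "\<lambda>i. (1 + l0 (ev i)) *\<^sub>l g (ev 0) (ev i)"] H(4) by simp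
  \<comment> \<open>Both \<open>outer (ev 0) y\<close> and \<open>outer x y\<close> lie in the
    column of \<open>y\<close> at \<open>0\<close>, so the rows of their images are multiples of one
    vector.\<close>
  have gh: "\<exists>s. s \<noteq> 0 \<and> g x y = s *\<^sub>l h y" if x: "x \<in> fvec m" "x \<noteq> 0" and y: "y \<in> fvec n" "y \<noteq> 0" for x y
  proof -
    obtain q where q: "\<forall>x\<in>fvec m. \<phi> (outer x y) \<in> Cset q"
      using col[OF zero_Rk1 y] by (auto simp: phi_zero)
    have "outer (p (ev 0)) (g (ev 0) y) \<in> Cset q"
      unfolding g[OF ev0(1) ev_nonzero y(1), symmetric] using q ev0(1) by blast
    then obtain w where w: "outer (p (ev 0)) (g (ev 0) y) = outer w q" by (rule CsetE)
    have "outer (p x) (g x y) \<in> Cset q"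
      unfolding g[OF x y(1), symmetric] using q x(1) by blast
    then obtain w' where w': "outer (p x) (g x y) = outer w' q" by (rule CsetE)
    from outer_eq_rowD[OF w] p0[of "ev 0"] obtain s where s: "g (ev 0) y = s *\<^sub>l q" by auto
    from outer_eq_rowD[OF w'] p0[OF x] obtain s' where s': "g x y = s' *\<^sub>l q" by auto
    have "s \<noteq> 0" using s g0nz[of "ev 0" y] y by auto
    then have "g x y = (s' * inverse s) *\<^sub>l g (ev 0) y" by (simp add: s s' mult.assoc)
    also have "\<dots> = (s' * inverse s * inverse (1 + l0 y)) *\<^sub>l h y" using H(4)[OF y(1)] by simp
    finally show ?thesis using g0nz[OF x y] by (metis lsc_eq_0_iff)
  qed
  have "\<exists>P l. P \<noteq> 0 \<and> sform n \<tau> l \<and> (\<forall>y\<in>fvec n. 1 + l y \<noteq> 0 \<and> \<phi> (outer x y) = outer P (inverse (1 + l y) *\<^sub>l h y))"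
    if x: "x \<in> fvec m" "x \<noteq> 0" for x
  proof -
    have "\<forall>i\<in>{..<n}. \<exists>s. s \<noteq> 0 \<and> g x (ev i) = s *\<^sub>l h (ev i)" using gh[OF x] by auto
    then obtain s where s: "\<And>i. i < n \<Longrightarrow> s i \<noteq> 0 \<and> g x (ev i) = s i *\<^sub>l h (ev i)" by (metis lessThan_iff)
    have "lind {..<n} (\<lambda>i. s i *\<^sub>l h (ev i))" using hl s by (intro lind_scale) auto
    then have "lind {..<n} (\<lambda>i. g x (ev i))"
      using lind_cong[of "{..<n}" "\<lambda>i. g x (ev i)" "\<lambda>i. s i *\<^sub>l h (ev i)"] s by simp
    then interpret Lx: affine_lineation n "g x" ev
      using x by (intro lin) auto
    obtain \<tau>' h' l where H': "rhom \<tau>'" "slin n \<tau>' h'" "sform n \<tau>' l"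
      "\<And>y. y \<in> fvec n \<Longrightarrow> 1 + l y \<noteq> 0 \<and> g x y = inverse (1 + l y) *\<^sub>l h' y"
      using Lx.fractional_semilinear by blast
    have "\<exists>\<mu>. h' y = \<mu> *\<^sub>l h y" if y: "y \<in> fvec n" "y \<noteq> 0" for y
    proof -
      obtain s where "g x y = s *\<^sub>l h y" using gh[OF x y] by blast
      moreover have "h' y = (1 + l y) *\<^sub>l g x y" using H'(4)[OF y(1)] by simp
      ultimately have "h' y = ((1 + l y) * s) *\<^sub>l h y" by simp
      then show ?thesis by blast
    qed
    then obtain \<mu> where \<mu>: "\<And>y. y \<in> fvec n \<Longrightarrow> y \<noteq> 0 \<Longrightarrow> h' y = \<mu> y *\<^sub>l h y" by metis
    \<comment> \<open>Additivity of both \<open>h\<close> and \<open>h'\<close>, together with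
      independence of the images, makes the ratio the same for independent vectors.\<close>
    have \<mu>_ind: "\<mu> y = \<mu> z" if yz: "y \<in> fvec n" "z \<in> fvec n" "ind2 y z" for y z
    proof -
      have s: "y + z \<noteq> 0"
      proof
        assume "y + z = 0"
        then have "1 *\<^sub>l y + 1 *\<^sub>l z = 0" by simp
        with yz(3) show False unfolding ind2_def by (metis zero_neq_one)
      qed
      note yz0 = ind2_nonzero[OF yz(3)]
      have "h' (y + z) = h' y + h' z" "h (y + z) = h y + h z" using H(2) H'(2) yz by (auto simp: slin_def)
      then have "\<mu> (y + z) *\<^sub>l h y + \<mu> (y + z) *\<^sub>l h z = \<mu> y *\<^sub>l h y + \<mu> z *\<^sub>l h z"
        using \<mu>[of "y + z"] \<mu>[of y] \<mu>[of z] s yz yz0 by simp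
      from ind2_eqD[OF H(5)[OF yz] this] show ?thesis by simp
    qed
    define \<mu>0 where "\<mu>0 = \<mu> (ev 0)"
    have e01: "ind2 (ev 0 :: nat \<Rightarrow> 'a) (ev 1)"
      unfolding ind2_alt by (auto simp: ev_def fun_eq_iff)
    have \<mu>_const: "\<mu> y = \<mu>0" if y: "y \<in> fvec n" "y \<noteq> 0" for y
    proof (cases "ind2 (ev 0) y")
      case True
      then show ?thesis using \<mu>_ind[OF ev0(2) y(1)] by (simp add: \<mu>0_def)
    next
      case False
      then obtain c where c: "y = c *\<^sub>l ev 0" using ev_nonzero by (auto simp: ind2_alt)
      with y have "c \<noteq> 0" by auto
      then have "ind2 (ev 1) y" unfolding c using ind2_lsc[OF ind2_sym[OF e01]] by simp
      then show ?thesis using \<mu>_ind[OF ev0(3) y(1)] \<mu>_ind[OF ev0(2,3) e01] by (simp add: \<mu>0_def)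
    qed
    have h0: "h 0 = 0" "h' 0 = 0"
      using H(2) H'(2) fvec_closed(1)[of n] unfolding slin_def by (metis add_cancel_left_left)+
    have h': "h' y = \<mu>0 *\<^sub>l h y" if "y \<in> fvec n" for y
      using \<mu>[OF that] \<mu>_const[OF that] h0 by (cases "y = 0") auto
    have h'nz: "h' y \<noteq> 0" if "y \<in> fvec n" "y \<noteq> 0" for y
      using g0nz[OF x that] H'(4)[OF that(1)] by auto
    have \<mu>0: "\<mu>0 \<noteq> 0" using h'nz[of "ev 0"] h'[of "ev 0"] by auto
    have \<tau>': "\<tau>' a * \<mu>0 = \<mu>0 * \<tau> a" for a
    proof -
      have "h' (a *\<^sub>l ev 0) = \<tau>' a *\<^sub>l h' (ev 0)" "h (a *\<^sub>l ev 0) = \<tau> a *\<^sub>l h (ev 0)"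
        using H(2) H'(2) ev0(2) unfolding slin_def by blast+
      then have "(\<tau>' a * \<mu>0 - \<mu>0 * \<tau> a) *\<^sub>l h (ev 0) = 0"
        using h'[of "a *\<^sub>l ev 0"] h'[of "ev 0"] by (simp add: lsc_diff_left)
      then show ?thesis using hnz[of "ev 0"] by simp
    qed
    have \<tau>'': "inverse \<mu>0 * \<tau>' a = \<tau> a * inverse \<mu>0" for a
    proof -
      have "inverse \<mu>0 * (\<tau>' a * \<mu>0) * inverse \<mu>0 = inverse \<mu>0 * (\<mu>0 * \<tau> a) * inverse \<mu>0" by (simp only: \<tau>')
      then show ?thesis using \<mu>0 by (simp add: mult.assoc) (simp flip: mult.assoc add: \<mu>0)
    qed
    \<comment> \<open>The constant ratio \<open>\<mu>0\<close> is absorbed into the column vector;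
      carrying it past the denominator conjugates the form and turns \<open>\<tau>'\<close> into
      \<open>\<tau>\<close>.\<close>
    define l' where "l' y = inverse \<mu>0 * l y * \<mu>0" for y
    have "sform n \<tau> l'"
      unfolding sform_def
    proof (intro conjI ballI allI)
      fix y z :: "nat \<Rightarrow> 'a" assume "y \<in> fvec n" "z \<in> fvec n"
      then show "l' (y + z) = l' y + l' z" using H'(3) by (simp add: sform_def l'_def algebra_simps)
    next
      fix a and y :: "nat \<Rightarrow> 'a" assume "y \<in> fvec n"
      then have "l' (a *\<^sub>l y) = (inverse \<mu>0 * \<tau>' a) * l y * \<mu>0"
        using H'(3) by (simp add: sform_def l'_def mult.assoc)
      then show "l' (a *\<^sub>l y) = \<tau> a * l' y" by (simp add: \<tau>'' l'_def mult.assoc)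
    qed
    moreover have "1 + l' y \<noteq> 0 \<and> \<phi> (outer x y) = outer (p x *\<^sub>r \<mu>0) (inverse (1 + l' y) *\<^sub>l h y)"
      if y: "y \<in> fvec n" for y
    proof -
      have e: "1 + l' y = inverse \<mu>0 * (1 + l y) * \<mu>0" using \<mu>0 by (simp add: l'_def algebra_simps)
      have nz: "1 + l y \<noteq> 0" using H'(4)[OF y] by simp
      have "\<mu>0 * inverse (1 + l' y) = inverse (1 + l y) * \<mu>0"
        unfolding e using \<mu>0 nz by (simp add: nonzero_inverse_mult_distrib mult.assoc[symmetric])
      then have "outer (p x *\<^sub>r \<mu>0) (inverse (1 + l' y) *\<^sub>l h y) = outer (p x) (inverse (1 + l y) *\<^sub>l h' y)"
        by (simp add: outer_rsc h'[OF y])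
      then show ?thesis using e nz \<mu>0 g[OF x y] H'(4)[OF y] by simp
    qed
    moreover have "p x *\<^sub>r \<mu>0 \<noteq> 0" using p0[OF x] \<mu>0 by simp
    ultimately show ?thesis by blast
  qed
  then have "\<forall>x\<in>fvec m - {0}. \<exists>P l. P \<noteq> 0 \<and> sform n \<tau> l \<and> (\<forall>y\<in>fvec n. 1 + l y \<noteq> 0 \<and> \<phi> (outer x y) = outer P (inverse (1 + l y) *\<^sub>l h y))"
    by blast
  then obtain P l where "\<forall>x\<in>fvec m - {0}. P x \<noteq> 0 \<and> sform n \<tau> (l x) \<and>
     (\<forall>y\<in>fvec n. 1 + l x y \<noteq> 0 \<and> \<phi> (outer x y) = outer (P x) (inverse (1 + l x y) *\<^sub>l h y))" by metis
  with H(1,2) hl hnz show ?thesis by blast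
qed

end

text \<open>Transposing twice ends in \<open>'a opp opp\<close>, which is a type different from
  \<open>'a\<close>; independence has to be transported along this identification.\<close>

lemma lind_vop_vop:
  fixes w :: "'i \<Rightarrow> nat \<Rightarrow> 'a::division_ring"
  assumes "lind I w"
  shows "lind I (\<lambda>i. vop (vop (w i)))"
  unfolding lind_def
proof (intro allI impI)
  fix c :: "'i \<Rightarrow> 'a opp opp" assume s: "(\<Sum>i\<in>I. c i *\<^sub>l vop (vop (w i))) = 0"
  have "(\<Sum>i\<in>I. unop (unop (c i)) *\<^sub>l w i) j = 0" for j
  proof -
    have "unop (unop ((\<Sum>i\<in>I. c i *\<^sub>l vop (vop (w i))) j)) = 0" unfolding s by simp
    then show ?thesis by (simp add: unop_sum vop_def)
  qed
  then have "(\<Sum>i\<in>I. unop (unop (c i)) *\<^sub>l w i) = 0" by (intro ext) (simp only: fun_zero_apply)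
  then have "\<forall>i\<in>I. unop (unop (c i)) = 0"
    using lindD[OF assms, of "\<lambda>i. unop (unop (c i))"] by blast
  then show "\<forall>i\<in>I. c i = 0" by simp
qed

text \<open>Transposing source and target into their opposite rings exchanges rows with columns on
  both sides, so straightness is preserved with \<open>m\<close> and \<open>n\<close>
  exchanged.\<close>

lemma straight_hom_opp:
  fixes \<phi> :: "(nat \<Rightarrow> nat \<Rightarrow> 'a::division_ring) \<Rightarrow> nat \<Rightarrow> nat \<Rightarrow> 'b::division_ring"
  assumes "straight_hom m n \<phi>"
  shows "straight_hom n m (\<lambda>M. mop (\<phi> (mun M)))"
proof -
  interpret straight_hom m n \<phi> by fact
  show ?thesis
  proof
    show "infinite (UNIV :: 'a opp set) \<or> card (UNIV :: 'a opp set) \<ge> 4" by (rule card_opp[OF card4])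
    show "n \<ge> 2" "m \<ge> 2" by (rule mn)+
    show "mop (\<phi> (mun 0)) = 0" by (simp add: phi_zero)
  next
    fix A :: "nat \<Rightarrow> nat \<Rightarrow> 'a opp" and x y :: "nat \<Rightarrow> 'a opp"
    assume "A \<in> Rk1 n m" "x \<in> fvec n" "y \<in> fvec m" "x \<noteq> 0" "y \<noteq> 0"
    then show "mop (\<phi> (mun (A + outer x y))) \<noteq> mop (\<phi> (mun A))"
      using phi_neq[of "mun A" "vun y" "vun x"] by simp
  next
    fix A :: "nat \<Rightarrow> nat \<Rightarrow> 'a opp" and x :: "nat \<Rightarrow> 'a opp"
    assume "A \<in> Rk1 n m" "x \<in> fvec n" "x \<noteq> 0"
    then obtain q where q: "\<forall>y\<in>fvec m. \<phi> (mun A + outer y (vun x)) - \<phi> (mun A) \<in> Cset q"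
      using col[of "mun A" "vun x"] by auto
    show "\<exists>p. \<forall>y\<in>fvec m. mop (\<phi> (mun (A + outer x y))) - mop (\<phi> (mun A)) \<in> Rset p"
    proof (intro exI ballI)
      fix y :: "nat \<Rightarrow> 'a opp" assume "y \<in> fvec m"
      with q have "\<phi> (mun A + outer (vun y) (vun x)) - \<phi> (mun A) \<in> Cset q" by simp
      from mop_Cset[OF this] show "mop (\<phi> (mun (A + outer x y))) - mop (\<phi> (mun A)) \<in> Rset (vop q)" by simp
    qed
  next
    fix A :: "nat \<Rightarrow> nat \<Rightarrow> 'a opp" and y :: "nat \<Rightarrow> 'a opp"
    assume "A \<in> Rk1 n m" "y \<in> fvec m" "y \<noteq> 0"
    then obtain p where p: "\<forall>x\<in>fvec n. \<phi> (mun A + outer (vun y) x) - \<phi> (mun A) \<in> Rset p"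
      using row[of "mun A" "vun y"] by auto
    show "\<exists>q. \<forall>x\<in>fvec n. mop (\<phi> (mun (A + outer x y))) - mop (\<phi> (mun A)) \<in> Cset q"
    proof (intro exI ballI)
      fix x :: "nat \<Rightarrow> 'a opp" assume "x \<in> fvec n"
      with p have "\<phi> (mun A + outer (vun y) (vun x)) - \<phi> (mun A) \<in> Rset p" by simp
      from mop_Rset[OF this] show "mop (\<phi> (mun (A + outer x y))) - mop (\<phi> (mun A)) \<in> Cset (vop p)" by simp
    qed
  next
    obtain q xs w where w: "q \<noteq> 0" "\<forall>i<m. xs i \<in> fvec m \<and> \<phi> (outer (xs i) (ev 0)) = outer (w i) q"
      "lind {..<m} (\<lambda>i. vop (w i))" using col_dim by blast
    show "\<exists>p ys w. p \<noteq> 0 \<and> (\<forall>i<m. ys i \<in> fvec m \<and> mop (\<phi> (mun (outer (ev 0) (ys i)))) = outer p (w i)) \<and> lind {..<m} w"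
      by (rule exI[of _ "vop q"], rule exI[of _ "\<lambda>i. vop (xs i)"], rule exI[of _ "\<lambda>i. vop (w i)"])
        (use w in simp)
  next
    obtain p ys w where w: "p \<noteq> 0" "\<forall>i<n. ys i \<in> fvec n \<and> \<phi> (outer (ev 0) (ys i)) = outer p (w i)"
      "lind {..<n} w" using row_dim by blast
    from lind_vop_vop[OF w(3)]
    show "\<exists>q xs w. q \<noteq> 0 \<and> (\<forall>i<n. xs i \<in> fvec n \<and> mop (\<phi> (mun (outer (xs i) (ev 0)))) = outer (w i) q) \<and>
        lind {..<n} (\<lambda>i. vop (w i))"
      by (intro exI[of _ "vop p"], intro exI[of _ "\<lambda>i. vop (ys i)"], intro exI[of _ "\<lambda>i. vop (w i)"])
        (use w in simp)
  qed
qed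

context straight_hom
begin

text \<open>This is \<open>row_form\<close> of the transposed map, read back in the original rings;
  the scalars therefore change to the right-hand side.\<close>

lemma col_form:
  "\<exists>\<sigma> k Q r. rhom \<sigma> \<and> (\<forall>x\<in>fvec m. \<forall>z\<in>fvec m. k (x + z) = k x + k z) \<and>
     (\<forall>a. \<forall>x\<in>fvec m. k (x *\<^sub>r a) = k x *\<^sub>r \<sigma> a) \<and>
     lind {..<m} (\<lambda>i. vop (k (ev i))) \<and> (\<forall>x\<in>fvec m - {0}. k x \<noteq> 0) \<and>
     (\<forall>y\<in>fvec n - {0}. Q y \<noteq> 0 \<and>
       (\<forall>x\<in>fvec m. \<forall>z\<in>fvec m. r y (x + z) = r y x + r y z) \<and>
       (\<forall>a. \<forall>x\<in>fvec m. r y (x *\<^sub>r a) = r y x * \<sigma> a) \<and>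
       (\<forall>x\<in>fvec m. 1 + r y x \<noteq> 0 \<and> \<phi> (outer x y) = outer (k x *\<^sub>r inverse (1 + r y x)) (Q y)))"
proof -
  interpret o: straight_hom n m "\<lambda>M. mop (\<phi> (mun M))"
    by (rule straight_hom_opp) unfold_locales
  obtain \<tau> h P l where \<tau>: "rhom \<tau>" and h: "slin m \<tau> h" "lind {..<m} (\<lambda>i. h (ev i))"
    "\<forall>x\<in>fvec m - {0}. h x \<noteq> 0"
    and P: "\<forall>y\<in>fvec n - {0}. P y \<noteq> 0 \<and> sform m \<tau> (l y) \<and> (\<forall>x\<in>fvec m. 1 + l y x \<noteq> 0 \<and>
       mop (\<phi> (mun (outer y x))) = outer (P y) (inverse (1 + l y x) *\<^sub>l h x))"
    using o.row_form by blast
  define \<sigma> where "\<sigma> a = unop (\<tau> (op a))" for a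
  define k where "k x = vun (h (vop x))" for x
  define r where "r y x = unop (l (vop y) (vop x))" for y x
  define Q where "Q y = vun (P (vop y))" for y
  have "rhom \<sigma>" using rhom_simps[OF \<tau>] by (simp add: rhom_def \<sigma>_def)
  moreover have "\<forall>x\<in>fvec m. \<forall>z\<in>fvec m. k (x + z) = k x + k z" "\<forall>a. \<forall>x\<in>fvec m. k (x *\<^sub>r a) = k x *\<^sub>r \<sigma> a"
    using h(1) by (simp_all add: slin_def k_def \<sigma>_def)
  moreover have "lind {..<m} (\<lambda>i. vop (k (ev i)))" using h(2) by (simp add: k_def)
  moreover have "\<forall>x\<in>fvec m - {0}. k x \<noteq> 0" using h(3) by (simp add: k_def)
  moreover have "Q y \<noteq> 0 \<and> (\<forall>x\<in>fvec m. \<forall>z\<in>fvec m. r y (x + z) = r y x + r y z) \<and>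
       (\<forall>a. \<forall>x\<in>fvec m. r y (x *\<^sub>r a) = r y x * \<sigma> a) \<and>
       (\<forall>x\<in>fvec m. 1 + r y x \<noteq> 0 \<and> \<phi> (outer x y) = outer (k x *\<^sub>r inverse (1 + r y x)) (Q y))"
    if y: "y \<in> fvec n - {0}" for y
  proof -
    have Py: "P (vop y) \<noteq> 0" "sform m \<tau> (l (vop y))" "\<And>x. x \<in> fvec m \<Longrightarrow> 1 + l (vop y) x \<noteq> 0 \<and>
       mop (\<phi> (mun (outer (vop y) x))) = outer (P (vop y)) (inverse (1 + l (vop y) x) *\<^sub>l h x)"
    proof -
      have "vop y \<in> fvec n - {0}" using y by simp
      from bspec[OF P this] show "P (vop y) \<noteq> 0" "sform m \<tau> (l (vop y))" "\<And>x. x \<in> fvec m \<Longrightarrow> 1 + l (vop y) x \<noteq> 0 \<and>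
       mop (\<phi> (mun (outer (vop y) x))) = outer (P (vop y)) (inverse (1 + l (vop y) x) *\<^sub>l h x)" by blast+
    qed
    have "1 + r y x \<noteq> 0 \<and> \<phi> (outer x y) = outer (k x *\<^sub>r inverse (1 + r y x)) (Q y)" if x: "x \<in> fvec m" for x
    proof
      have "vop x \<in> fvec m" using x by simp
      note e = Py(3)[OF this]
      from e have "unop (1 + l (vop y) (vop x)) \<noteq> 0" unfolding op_eq_0_iff by blast
      then show "1 + r y x \<noteq> 0" by (simp add: r_def)
      from e have "mun (mop (\<phi> (mun (outer (vop y) (vop x))))) =
        mun (outer (P (vop y)) (inverse (1 + l (vop y) (vop x)) *\<^sub>l h (vop x)))" by simp
      then show "\<phi> (outer x y) = outer (k x *\<^sub>r inverse (1 + r y x)) (Q y)"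
        by (simp add: k_def r_def Q_def)
    qed
    with Py(1,2) show ?thesis by (simp add: Q_def sform_def r_def \<sigma>_def)
  qed
  ultimately show ?thesis by blast
qed

text \<open>The row form and the column form describe the same matrix, so \<open>P x\<close> is
  \<open>k x\<close> times a scalar \<open>\<alpha> x\<close> and \<open>Q y\<close> is a scalar
  \<open>\<beta> y\<close> times \<open>h y\<close>. The point is that \<open>\<alpha>\<close> and
  \<open>\<beta>\<close> are one constant \<open>c\<close>; then \<open>c\<close> intertwines
  \<open>\<tau>\<close> and \<open>\<sigma>\<close> and is absorbed into \<open>k\<close>, while
  \<open>r\<close> conjugated by \<open>c\<close> becomes the form \<open>B\<close>.\<close>

lemma rank_one_form:
  "\<exists>\<tau> h k B. rhom \<tau> \<and> slin n \<tau> h \<and> (\<forall>x\<in>fvec m. \<forall>z\<in>fvec m. k (x + z) = k x + k z) \<and>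
     (\<forall>a. \<forall>x\<in>fvec m. k (x *\<^sub>r a) = k x *\<^sub>r \<tau> a) \<and>
     lind {..<n} (\<lambda>i. h (ev i)) \<and> lind {..<m} (\<lambda>i. vop (k (ev i))) \<and>
     (\<forall>x\<in>fvec m. sform n \<tau> (B x)) \<and>
     (\<forall>y\<in>fvec n. (\<forall>x\<in>fvec m. \<forall>z\<in>fvec m. B (x + z) y = B x y + B z y) \<and>
       (\<forall>a. \<forall>x\<in>fvec m. B (x *\<^sub>r a) y = B x y * \<tau> a)) \<and>
     (\<forall>x\<in>fvec m. \<forall>y\<in>fvec n. 1 + B x y \<noteq> 0 \<and>
       \<phi> (outer x y) = outer (k x) (inverse (1 + B x y) *\<^sub>l h y))"
proof -
  obtain \<tau> h P l where \<tau>: "rhom \<tau>" and h: "slin n \<tau> h" "lind {..<n} (\<lambda>i. h (ev i))"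
    "\<And>y. y \<in> fvec n \<Longrightarrow> y \<noteq> 0 \<Longrightarrow> h y \<noteq> 0"
    and P': "\<forall>x\<in>fvec m - {0}. P x \<noteq> 0 \<and> sform n \<tau> (l x) \<and> (\<forall>y\<in>fvec n. 1 + l x y \<noteq> 0 \<and>
       \<phi> (outer x y) = outer (P x) (inverse (1 + l x y) *\<^sub>l h y))"
    using row_form by blast
  have P: "P x \<noteq> 0" "sform n \<tau> (l x)" "y \<in> fvec n \<Longrightarrow> 1 + l x y \<noteq> 0"
    "y \<in> fvec n \<Longrightarrow> \<phi> (outer x y) = outer (P x) (inverse (1 + l x y) *\<^sub>l h y)"
    if "x \<in> fvec m" "x \<noteq> 0" for x y
    using P' that by blast+
  obtain \<sigma> k Q r where \<sigma>: "rhom \<sigma>"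
    and k: "\<And>x z. x \<in> fvec m \<Longrightarrow> z \<in> fvec m \<Longrightarrow> k (x + z) = k x + k z"
      "\<And>a x. x \<in> fvec m \<Longrightarrow> k (x *\<^sub>r a) = k x *\<^sub>r \<sigma> a"
      "lind {..<m} (\<lambda>i. vop (k (ev i)))" "\<And>x. x \<in> fvec m \<Longrightarrow> x \<noteq> 0 \<Longrightarrow> k x \<noteq> 0"
    and Q': "\<forall>y\<in>fvec n - {0}. Q y \<noteq> 0 \<and>
       (\<forall>x\<in>fvec m. \<forall>z\<in>fvec m. r y (x + z) = r y x + r y z) \<and>
       (\<forall>a. \<forall>x\<in>fvec m. r y (x *\<^sub>r a) = r y x * \<sigma> a) \<and>
       (\<forall>x\<in>fvec m. 1 + r y x \<noteq> 0 \<and> \<phi> (outer x y) = outer (k x *\<^sub>r inverse (1 + r y x)) (Q y))"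
    using col_form by (elim exE conjE) blast
  have Q: "Q y \<noteq> 0" "x \<in> fvec m \<Longrightarrow> z \<in> fvec m \<Longrightarrow> r y (x + z) = r y x + r y z"
      "x \<in> fvec m \<Longrightarrow> r y (x *\<^sub>r a) = r y x * \<sigma> a" "x \<in> fvec m \<Longrightarrow> 1 + r y x \<noteq> 0"
      "x \<in> fvec m \<Longrightarrow> \<phi> (outer x y) = outer (k x *\<^sub>r inverse (1 + r y x)) (Q y)"
    if "y \<in> fvec n" "y \<noteq> 0" for x z y a
    using Q' that by blast+
  have "\<exists>s. P x = k x *\<^sub>r s" if x: "x \<in> fvec m" "x \<noteq> 0" for x
  proof -
    have "outer (P x) (inverse (1 + l x (ev 0)) *\<^sub>l h (ev 0)) = outer (k x *\<^sub>r inverse (1 + r (ev 0) x)) (Q (ev 0))"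
      using P(4)[OF x, of "ev 0"] Q(5)[of "ev 0" x] x by simp
    from outer_eq_colD[OF this] obtain s where "P x = k x *\<^sub>r inverse (1 + r (ev 0) x) *\<^sub>r s"
      using P(3)[OF x, of "ev 0"] h(3)[of "ev 0"] by auto
    then have "P x = k x *\<^sub>r (inverse (1 + r (ev 0) x) * s)" by simp
    then show ?thesis by blast
  qed
  then obtain \<alpha> where \<alpha>: "\<And>x. x \<in> fvec m \<Longrightarrow> x \<noteq> 0 \<Longrightarrow> P x = k x *\<^sub>r \<alpha> x" by metis
  have "\<exists>s. Q y = s *\<^sub>l h y" if y: "y \<in> fvec n" "y \<noteq> 0" for y
  proof -
    have "outer (k (ev 0) *\<^sub>r inverse (1 + r y (ev 0))) (Q y) = outer (P (ev 0)) (inverse (1 + l (ev 0) y) *\<^sub>l h y)"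
      using P(4)[of "ev 0" y] Q(5)[OF y, of "ev 0"] y by simp
    from outer_eq_rowD[OF this] obtain s where "Q y = s *\<^sub>l inverse (1 + l (ev 0) y) *\<^sub>l h y"
      using Q(4)[OF y, of "ev 0"] k(4)[of "ev 0"] by auto
    then have "Q y = (s * inverse (1 + l (ev 0) y)) *\<^sub>l h y" by simp
    then show ?thesis by blast
  qed
  then obtain \<beta> where \<beta>: "\<And>y. y \<in> fvec n \<Longrightarrow> y \<noteq> 0 \<Longrightarrow> Q y = \<beta> y *\<^sub>l h y" by metis
  have \<alpha>0: "\<alpha> x \<noteq> 0" if "x \<in> fvec m" "x \<noteq> 0" for x
    using \<alpha>[OF that] P(1)[OF that] by auto
  have lcancel: "p = q" if "p *\<^sub>l h y = q *\<^sub>l h y" "y \<in> fvec n" "y \<noteq> 0" for p q y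
  proof -
    from that(1) have "(p - q) *\<^sub>l h y = 0" by (simp add: lsc_diff_left)
    with h(3) that show ?thesis by simp
  qed
  \<comment> \<open>Equality of the two descriptions of \<open>\<phi> (outer x y)\<close> after
    clearing both denominators.\<close>
  have key: "\<beta> y * (1 + l x y) = (1 + r y x) * \<alpha> x"
    if x: "x \<in> fvec m" "x \<noteq> 0" and y: "y \<in> fvec n" "y \<noteq> 0" for x y
  proof -
    have "outer (k x) ((\<alpha> x * inverse (1 + l x y)) *\<^sub>l h y) = outer (k x) ((inverse (1 + r y x) * \<beta> y) *\<^sub>l h y)"
      using P(4)[OF x y(1)] Q(5)[OF y x(1)] \<alpha>[OF x] \<beta>[OF y] by (simp add: outer_rsc)
    then have "\<alpha> x * inverse (1 + l x y) = inverse (1 + r y x) * \<beta> y"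
      using k(4)[OF x] lcancel[OF _ y] by (simp add: outer_cancel)
    then have "(1 + r y x) * (\<alpha> x * inverse (1 + l x y)) * (1 + l x y) = (1 + r y x) * (inverse (1 + r y x) * \<beta> y) * (1 + l x y)"
      by simp
    then show ?thesis using P(3)[OF x y(1)] Q(4)[OF y x(1)] by (simp add: mult.assoc) (simp flip: mult.assoc)
  qed
  \<comment> \<open>The row form is evaluated on
    \<open>outer (x *\<^sub>r a) y = outer x (a *\<^sub>l y)\<close> in both readings; comparing
    them shows how \<open>\<alpha>\<close> and \<open>l\<close> react to scaling of
    \<open>x\<close>.\<close>
  have scale: "\<sigma> a * \<alpha> (x *\<^sub>r a) = \<alpha> x * \<tau> a" "y \<in> fvec n \<Longrightarrow> l (x *\<^sub>r a) y = l x y * \<tau> a"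
    if x: "x \<in> fvec m" "x \<noteq> 0" and a: "a \<noteq> 0" for x a y
  proof -
    have xa: "x *\<^sub>r a \<in> fvec m" "x *\<^sub>r a \<noteq> 0" using x a by auto
    have \<tau>a: "\<tau> a \<noteq> 0" using a rhom_simps(7)[OF \<tau>] by simp
    have e: "outer (P (x *\<^sub>r a)) (inverse (1 + l (x *\<^sub>r a) y) *\<^sub>l h y)
        = outer (P x) ((inverse (1 + \<tau> a * l x y) * \<tau> a) *\<^sub>l h y)" if y: "y \<in> fvec n" for y
    proof -
      have "\<phi> (outer (x *\<^sub>r a) y) = \<phi> (outer x (a *\<^sub>l y))" by (simp add: outer_rsc)
      moreover have "h (a *\<^sub>l y) = \<tau> a *\<^sub>l h y" "l x (a *\<^sub>l y) = \<tau> a * l x y"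
        using h(1) P(2)[OF x] y by (auto simp: slin_def sform_def)
      ultimately show ?thesis using P(4)[OF xa y] P(4)[OF x, of "a *\<^sub>l y"] y by simp
    qed
    from outer_eq_colD[OF e[of "ev 0"]] obtain c where c: "P (x *\<^sub>r a) = P x *\<^sub>r c"
      using P(3)[OF xa, of "ev 0"] h(3)[of "ev 0"] by auto
    with P(1)[OF xa] have c0: "c \<noteq> 0" by auto
    \<comment> \<open>\<open>N\<close> is additive in \<open>y\<close>, yet has the same value at
      every nonzero \<open>y\<close>. Evaluating it at \<open>ev 0\<close>, \<open>ev 1\<close> and
      their sum shows that this value is \<open>0\<close>, which determines
      \<open>c\<close>.\<close>
    define N where "N y = l (x *\<^sub>r a) y * inverse c - l x y" for y
    have N: "N y = inverse (\<tau> a) - inverse c" if y: "y \<in> fvec n" "y \<noteq> 0" for y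
    proof -
      have "l x (a *\<^sub>l y) = \<tau> a * l x y" using P(2)[OF x] y by (auto simp: sform_def)
      then have nz: "1 + \<tau> a * l x y \<noteq> 0" using P(3)[OF x, of "a *\<^sub>l y"] y by auto
      note nz' = P(3)[OF xa y(1)]
      have "outer (P x) ((c * inverse (1 + l (x *\<^sub>r a) y)) *\<^sub>l h y) = outer (P x) ((inverse (1 + \<tau> a * l x y) * \<tau> a) *\<^sub>l h y)"
        using e[OF y(1)] c by (simp add: outer_rsc)
      then have "c * inverse (1 + l (x *\<^sub>r a) y) = inverse (1 + \<tau> a * l x y) * \<tau> a"
        using P(1)[OF x] lcancel[OF _ y] by (simp add: outer_cancel)
      then have "inverse (c * inverse (1 + l (x *\<^sub>r a) y)) = inverse (inverse (1 + \<tau> a * l x y) * \<tau> a)" by simp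
      then have "(1 + l (x *\<^sub>r a) y) * inverse c = inverse (\<tau> a) * (1 + \<tau> a * l x y)"
        using nz nz' c0 \<tau>a by (simp add: nonzero_inverse_mult_distrib)
      then show ?thesis using \<tau>a
        by (simp add: N_def distrib_left distrib_right mult.assoc[symmetric] algebra_simps)
    qed
    have Nadd: "N (y + z) = N y + N z" if "y \<in> fvec n" "z \<in> fvec n" for y z
      using P(2)[OF x] P(2)[OF xa] that by (simp add: sform_def N_def algebra_simps)
    have "ev 0 + ev 1 \<noteq> (0 :: nat \<Rightarrow> 'a)" by (auto simp: ev_def fun_eq_iff intro: exI[of _ 0])
    note N3 = N[OF ev0(2) ev_nonzero] N[OF ev0(3) ev_nonzero] N[OF fvec_closed(2)[OF ev0(2,3)] this]
    have "inverse (\<tau> a) - inverse c = (inverse (\<tau> a) - inverse c) + (inverse (\<tau> a) - inverse c)"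
      using Nadd[OF ev0(2,3)] unfolding N3 .
    then have "inverse (\<tau> a) - inverse c = 0" by (metis add.right_neutral add_left_cancel)
    then have c\<tau>: "c = \<tau> a" and N0: "\<And>y. y \<in> fvec n \<Longrightarrow> y \<noteq> 0 \<Longrightarrow> N y = 0" using N by auto
    have "k x *\<^sub>r (\<sigma> a * \<alpha> (x *\<^sub>r a)) = k x *\<^sub>r (\<alpha> x * \<tau> a)"
      using c \<alpha>[OF x] \<alpha>[OF xa] k(2)[OF x(1), of a] by (simp add: c\<tau>)
    then have "outer (k x) ((\<sigma> a * \<alpha> (x *\<^sub>r a)) *\<^sub>l h (ev 0)) = outer (k x) ((\<alpha> x * \<tau> a) *\<^sub>l h (ev 0))"
      by (simp only: outer_rsc[symmetric])
    then show "\<sigma> a * \<alpha> (x *\<^sub>r a) = \<alpha> x * \<tau> a"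
      using k(4)[OF x] lcancel[of _ "ev 0"] by (simp add: outer_cancel)
    assume y: "y \<in> fvec n"
    show "l (x *\<^sub>r a) y = l x y * \<tau> a"
    proof (cases "y = 0")
      case True
      have "l z 0 = 0" if "z \<in> fvec m" "z \<noteq> 0" for z
        using P(2)[OF that] fvec_closed(1)[of n] unfolding sform_def by (metis add_cancel_left_left)
      with x xa True show ?thesis by simp
    next
      case False
      from N0[OF y this] have "l (x *\<^sub>r a) y * inverse c * c = l x y * c" by (simp add: N_def)
      then show ?thesis using c0 by (simp add: c\<tau> mult.assoc)
    qed
  qed
  \<comment> \<open>In \<open>key\<close> for \<open>x *\<^sub>r a\<close> with
    \<open>a = inverse b\<close>, multiplied by \<open>\<tau> b\<close>, the terms with
    \<open>l\<close> and \<open>r\<close> are the same as in \<open>key\<close> for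
    \<open>x\<close>. Subtraction leaves only the constant terms.\<close>
  have diff: "\<beta> y * (\<tau> b - 1) = (\<sigma> b - 1) * \<alpha> x"
    if x: "x \<in> fvec m" "x \<noteq> 0" and y: "y \<in> fvec n" "y \<noteq> 0" and b: "b \<noteq> 0" for x y b
  proof -
    define a where "a = inverse b"
    have a: "a \<noteq> 0" using b by (simp add: a_def)
    have \<tau>a: "\<tau> a \<noteq> 0" "\<sigma> a \<noteq> 0" using a rhom_simps(7)[OF \<tau>] rhom_simps(7)[OF \<sigma>] by simp_all
    have inv: "inverse (\<tau> a) = \<tau> b" "inverse (\<sigma> a) = \<sigma> b"
      by (simp_all add: a_def rhom_inverse[OF \<tau>] rhom_inverse[OF \<sigma>])
    have xa: "x *\<^sub>r a \<in> fvec m" "x *\<^sub>r a \<noteq> 0" using x a by auto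
    have s: "\<alpha> (x *\<^sub>r a) = \<sigma> b * (\<alpha> x * \<tau> a)"
    proof -
      have "inverse (\<sigma> a) * (\<sigma> a * \<alpha> (x *\<^sub>r a)) = inverse (\<sigma> a) * (\<alpha> x * \<tau> a)" using scale(1)[OF x a] by simp
      then show ?thesis using \<tau>a by (simp add: inv mult.assoc[symmetric]) (simp add: inv[symmetric])
    qed
    have "\<beta> y * (1 + l x y * \<tau> a) = (1 + r y x * \<sigma> a) * \<alpha> (x *\<^sub>r a)"
      using key[OF xa y] scale(2)[OF x a y(1)] Q(3)[OF y x(1)] by simp
    also have "\<dots> = \<sigma> b * \<alpha> x * \<tau> a + r y x * (\<alpha> x * \<tau> a)"
      using scale(1)[OF x a] s by (simp add: distrib_right mult.assoc)
    finally have "\<beta> y * (1 + l x y * \<tau> a) * \<tau> b = (\<sigma> b * \<alpha> x * \<tau> a + r y x * (\<alpha> x * \<tau> a)) * \<tau> b" by simp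
    moreover have "\<tau> a * \<tau> b = 1" using \<tau>a by (simp flip: inv)
    ultimately have e: "\<beta> y * \<tau> b + \<beta> y * l x y = \<sigma> b * \<alpha> x + r y x * \<alpha> x"
      by (simp add: distrib_left distrib_right mult.assoc)
    have "\<beta> y * (\<tau> b - 1) = (\<beta> y * \<tau> b + \<beta> y * l x y) - \<beta> y * (1 + l x y)"
      by (simp add: algebra_simps)
    also have "\<dots> = (\<sigma> b * \<alpha> x + r y x * \<alpha> x) - (1 + r y x) * \<alpha> x"
      by (simp only: e key[OF x y])
    also have "\<dots> = (\<sigma> b - 1) * \<alpha> x" by (simp add: algebra_simps)
    finally show ?thesis .
  qed
  \<comment> \<open>Both \<open>b\<close> and \<open>1 + b\<close> have to be nonzero: the instances
    of \<open>diff\<close> at these two scalars differ exactly by \<open>\<beta> y\<close> and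
    \<open>\<alpha> x\<close>.\<close>
  obtain b :: 'a where b: "b \<noteq> 0" "b \<noteq> -1" using ex_avoid3[OF card4] by metis
  have \<alpha>\<beta>: "\<alpha> x = \<beta> y" if x: "x \<in> fvec m" "x \<noteq> 0" and y: "y \<in> fvec n" "y \<noteq> 0" for x y
  proof -
    have "1 + b \<noteq> 0" using b by (simp add: add_eq_0_iff)
    from diff[OF x y this] diff[OF x y b(1)]
    have "\<beta> y * \<tau> b = \<sigma> b * \<alpha> x" "\<beta> y * (\<tau> b - 1) = (\<sigma> b - 1) * \<alpha> x"
      by (simp_all add: rhom_simps[OF \<tau>] rhom_simps[OF \<sigma>])
    then show ?thesis by (simp add: algebra_simps)
  qed
  define c where "c = \<alpha> (ev 0)"
  have c: "\<alpha> x = c" "\<beta> y = c" if "x \<in> fvec m" "x \<noteq> 0" "y \<in> fvec n" "y \<noteq> 0" for x y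
    using \<alpha>\<beta>[of "ev 0" "ev 0"] \<alpha>\<beta>[of "ev 0" y] \<alpha>\<beta>[of x "ev 0"] that by (simp_all add: c_def)
  have c0: "c \<noteq> 0" using \<alpha>0[of "ev 0"] by (simp add: c_def)
  have c\<tau>: "c * \<tau> a = \<sigma> a * c" for a
    using diff[of "ev 0" "ev 0" a] c[of "ev 0" "ev 0"]
    by (cases "a = 0") (simp_all add: rhom_simps[OF \<tau>] rhom_simps[OF \<sigma>] algebra_simps)
  \<comment> \<open>Nothing is known about \<open>r y\<close> at \<open>y = 0\<close>, so the value
    there is set by hand.\<close>
  define B where "B x y = (if y = 0 then 0 else inverse c * r y x * c)" for x y
  have Bl: "B x y = l x y" if x: "x \<in> fvec m" "x \<noteq> 0" and y: "y \<in> fvec n" for x y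
  proof (cases "y = 0")
    case True
    have "l x 0 = 0"
      using P(2)[OF x] fvec_closed(1)[of n] unfolding sform_def by (metis add_cancel_left_left)
    with True show ?thesis by (simp add: B_def)
  next
    case False
    have "c * l x y = r y x * c" using key[OF x y False] c[OF x y False] by (simp add: algebra_simps)
    then have "inverse c * (c * l x y) = B x y" using False by (simp add: B_def mult.assoc)
    moreover have "inverse c * (c * l x y) = l x y" using c0 by (simp add: mult.assoc[symmetric])
    ultimately show ?thesis by simp
  qed
  have r0: "r y 0 = 0" if "y \<in> fvec n" "y \<noteq> 0" for y
    using Q(2)[OF that, of 0 0] by simp
  have B0: "B 0 y = 0" if "y \<in> fvec n" for y using r0[OF that] by (simp add: B_def)
  define k' where "k' x = k x *\<^sub>r c" for x
  have k0: "k 0 = 0" using k(1)[of 0 0] by simp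
  have h0: "h 0 = 0" using h(1) fvec_closed(1)[of n] unfolding slin_def by (metis add_cancel_left_left)
  have "k' (x + z) = k' x + k' z" if "x \<in> fvec m" "z \<in> fvec m" for x z
    using k(1)[OF that] by (simp add: k'_def)
  moreover have "k' (x *\<^sub>r a) = k' x *\<^sub>r \<tau> a" if "x \<in> fvec m" for x a
    using k(2)[OF that] by (simp add: k'_def c\<tau>)
  moreover have "lind {..<m} (\<lambda>i. vop (k' (ev i)))"
    using lind_scale[OF k(3), of "\<lambda>_. op c"] c0 by (simp add: k'_def)
  moreover have "sform n \<tau> (B x)" if "x \<in> fvec m" for x
    using P(2)[OF that] Bl[OF that] B0 by (cases "x = 0") (simp_all add: sform_def)
  moreover have "B (x + z) y = B x y + B z y" if "x \<in> fvec m" "z \<in> fvec m" "y \<in> fvec n" for x z y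
    using Q(2)[OF that(3) _ that(1,2)] by (simp add: B_def algebra_simps)
  moreover have "B (x *\<^sub>r a) y = B x y * \<tau> a" if "x \<in> fvec m" "y \<in> fvec n" for x y a
    using Q(3)[OF that(2) _ that(1)] by (simp add: B_def mult.assoc c\<tau>)
  moreover have "1 + B x y \<noteq> 0 \<and> \<phi> (outer x y) = outer (k' x) (inverse (1 + B x y) *\<^sub>l h y)"
    if "x \<in> fvec m" "y \<in> fvec n" for x y
  proof (cases "x = 0")
    case True
    then show ?thesis using B0[OF that(2)] by (simp add: k'_def k0 phi_zero)
  next
    case False
    have "P x = k' x" using \<alpha>[OF that(1) False] c(1)[OF that(1) False, of "ev 0"] by (simp add: k'_def)
    then show ?thesis using Bl[OF that(1) False that(2)] P(3,4)[OF that(1) False that(2)] by simp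
  qed
  ultimately show ?thesis using \<tau> h(1,2) by blast
qed

end

subsection \<open>From rank one to all matrices\<close>

definition mv :: "nat \<Rightarrow> (nat \<Rightarrow> nat \<Rightarrow> 'a::semiring_0) \<Rightarrow> (nat \<Rightarrow> 'a) \<Rightarrow> nat \<Rightarrow> 'a" where
  "mv N A u = (\<lambda>i. \<Sum>l<N. A i l * u l)"

definition vm :: "nat \<Rightarrow> (nat \<Rightarrow> 'a::semiring_0) \<Rightarrow> (nat \<Rightarrow> nat \<Rightarrow> 'a) \<Rightarrow> nat \<Rightarrow> 'a" where
  "vm N u A = (\<lambda>j. \<Sum>l<N. u l * A l j)"

lemma mm_outer: "mm N A (outer u v) = outer (mv N A u) v" "mm N (outer u v) A = outer u (vm N v A)"
  by (auto simp: mm_def mv_def vm_def fun_eq_iff sum_distrib_left sum_distrib_right mult.assoc)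

lemma mv_mm: "mv N (mm N A B) u = mv N A (mv N B u)"
proof
  fix i
  have "mv N (mm N A B) u i = (\<Sum>l<N. \<Sum>k<N. A i k * B k l * u l)"
    by (simp add: mv_def mm_def sum_distrib_right)
  also have "\<dots> = (\<Sum>k<N. \<Sum>l<N. A i k * (B k l * u l))"
    by (subst sum.swap) (simp add: mult.assoc)
  finally show "mv N (mm N A B) u i = mv N A (mv N B u) i"
    by (simp add: mv_def sum_distrib_left)
qed

lemma vm_mm: "vm N u (mm N A B) = vm N (vm N u A) B"
proof
  fix j
  have "vm N (vm N u A) B j = (\<Sum>l<N. \<Sum>k<N. u k * A k l * B l j)"
    by (simp add: vm_def sum_distrib_right)
  also have "\<dots> = (\<Sum>k<N. \<Sum>l<N. u k * (A k l * B l j))"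
    by (subst sum.swap) (simp add: mult.assoc)
  finally show "vm N u (mm N A B) j = vm N (vm N u A) B j"
    by (simp add: vm_def mm_def sum_distrib_left)
qed

lemma mv_add: "mv N (A + B) u = mv N A u + mv N B u" "mv N A (u + v) = mv N A u + mv N A v"
  for A B :: "nat \<Rightarrow> nat \<Rightarrow> 'a::ring"
  by (auto simp: mv_def fun_eq_iff algebra_simps sum.distrib)

lemma mv_diff: "mv N (A - B) u = mv N A u - mv N B u" "mv N A (u - v) = mv N A u - mv N A v"
  for A B :: "nat \<Rightarrow> nat \<Rightarrow> 'a::ring"
  by (auto simp: mv_def fun_eq_iff algebra_simps sum_subtractf)

lemma vm_add: "vm N u (A + B) = vm N u A + vm N u B" "vm N (u + v) A = vm N u A + vm N v A"
  for A B :: "nat \<Rightarrow> nat \<Rightarrow> 'a::ring"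
  by (auto simp: vm_def fun_eq_iff algebra_simps sum.distrib)

lemma vm_diff: "vm N u (A - B) = vm N u A - vm N u B" "vm N (u - v) A = vm N u A - vm N v A"
  for A B :: "nat \<Rightarrow> nat \<Rightarrow> 'a::ring"
  by (auto simp: vm_def fun_eq_iff algebra_simps sum_subtractf)

lemma mv_zero [simp]: "mv N A 0 = 0" "vm N 0 A = 0" for A :: "nat \<Rightarrow> nat \<Rightarrow> 'a::ring"
  by (auto simp: mv_def vm_def fun_eq_iff)

lemma vm_lsc: "vm N (a *\<^sub>l u) A = a *\<^sub>l vm N u A" for A :: "nat \<Rightarrow> nat \<Rightarrow> 'a::ring"
  by (auto simp: vm_def fun_eq_iff sum_distrib_left mult.assoc)

lemma fmat_mono: "A \<in> fmat m n \<Longrightarrow> m \<le> m' \<Longrightarrow> n \<le> n' \<Longrightarrow> A \<in> fmat m' n'"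
  unfolding fmat_def mem_Collect_eq by (meson less_le_trans)

lemma rhom_comp_eq_0: "rhom \<tau> \<Longrightarrow> (\<lambda>i. \<tau> (x i)) = (0 :: nat \<Rightarrow> _) \<longleftrightarrow> x = 0"
  by (auto simp: fun_eq_iff rhom_simps)

lemma rhom_parallel_left:
  assumes \<tau>: "rhom \<tau>" and e: "(\<lambda>i. \<tau> (w i)) = c *\<^sub>l (\<lambda>i. \<tau> (v i))" and v: "v \<noteq> 0"
  shows "\<exists>c. w = c *\<^sub>l v"
proof -
  obtain k where k: "v k \<noteq> 0" using v by (rule fun_nonzeroE)
  have "\<tau> (w k) = c * \<tau> (v k)" using fun_cong[OF e, of k] by simp
  then have "c = \<tau> (w k * inverse (v k))"
    using k rhom_simps(7)[OF \<tau>] by (simp add: rhom_simps(2)[OF \<tau>] rhom_inverse[OF \<tau>] mult.assoc)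
  with e have wi: "w i = w k * inverse (v k) * v i" for i
    using fun_cong[OF e, of i] by (simp add: rhom_inj[OF \<tau>] flip: rhom_simps(2)[OF \<tau>])
  show ?thesis by (intro exI[of _ "w k * inverse (v k)"] ext) (unfold lsc_apply, rule wi)
qed

lemma rhom_parallel_right:
  assumes \<tau>: "rhom \<tau>" and e: "(\<lambda>i. \<tau> (w i)) = (\<lambda>i. \<tau> (v i)) *\<^sub>r c" and v: "v \<noteq> 0"
  shows "\<exists>c. w = v *\<^sub>r c"
proof -
  obtain k where k: "v k \<noteq> 0" using v by (rule fun_nonzeroE)
  have "inverse (\<tau> (v k)) * \<tau> (w k) = inverse (\<tau> (v k)) * (\<tau> (v k) * c)" using fun_cong[OF e, of k] by simp
  then have "c = \<tau> (inverse (v k) * w k)"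
    using k rhom_simps(7)[OF \<tau>] by (simp add: rhom_simps(2)[OF \<tau>] rhom_inverse[OF \<tau>] mult.assoc[symmetric])
  with e have wi: "w i = v i * (inverse (v k) * w k)" for i
    using fun_cong[OF e, of i] by (simp add: rhom_inj[OF \<tau>] flip: rhom_simps(2)[OF \<tau>])
  show ?thesis by (intro exI[of _ "inverse (v k) * w k"] ext) (unfold rsc_apply, rule wi)
qed

text \<open>The hypothesis reads \<open>(1 + X L) Y = X\<close>. Therefore
  \<open>(1 + X L) (1 - Y L) = 1 + X L - X L = 1\<close>; a right inverse of a square matrix is
  two-sided, and multiplying \<open>(1 + X L) Y = X\<close> by it gives the mirrored
  equation.\<close>

lemma quasi_inverse:
  fixes X Y L :: "nat \<Rightarrow> nat \<Rightarrow> 'a::division_ring"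
  assumes X: "X \<in> fmat m n" and Y: "Y \<in> fmat m n" and L: "L \<in> fmat n m"
    and E: "Y + mm m (mm n X L) Y = X"
  shows "mm m (idm m + mm n X L) (idm m - mm n Y L) = idm m"
    and "mm m (idm m - mm n Y L) (idm m + mm n X L) = idm m"
    and "Y + mm m (mm n Y L) X = X"
proof -
  define A where "A = idm m + mm n X L"
  define B where "B = idm m - mm n Y L"
  have XL: "mm n X L \<in> fmat m m" "mm n Y L \<in> fmat m m" by (rule mm_fmat[OF X L], rule mm_fmat[OF Y L])
  have AB: "A \<in> fmat m m" "B \<in> fmat m m"
    unfolding A_def B_def by (rule fmat_closed(2)[OF idm_fmat XL(1)], rule fmat_closed(3)[OF idm_fmat XL(2)])
  note i = mm_id_left[OF _ order_refl] mm_id_right[OF _ order_refl]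
  have "mm m A B = idm m + mm n X L - mm n (Y + mm m (mm n X L) Y) L"
    unfolding A_def B_def mm_add_left mm_diff_right i(1)[OF idm_fmat] i(1)[OF XL(2)] i(2)[OF XL(1)] mm_assoc
    by (simp add: algebra_simps i(2)[OF L])
  then show *: "mm m (idm m + mm n X L) (idm m - mm n Y L) = idm m" unfolding E A_def B_def by simp
  then show **: "mm m (idm m - mm n Y L) (idm m + mm n X L) = idm m"
    using mm_right_inverse_left[OF AB] unfolding A_def B_def by simp
  have "mm m A Y = X" unfolding A_def mm_add_left i(1)[OF Y] by (rule E)
  then have "mm m B X = mm m (mm m B A) Y" by (simp add: mm_assoc)
  also have "\<dots> = Y" using ** i(1)[OF Y] by (simp add: A_def B_def)
  finally have "X - mm m (mm n Y L) X = Y" unfolding B_def mm_diff_left i(1)[OF X] .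
  then show "Y + mm m (mm n Y L) X = X" by (metis diff_add_cancel)
qed

text \<open>
  Both sides are padded to size \<open>N\<close>, so that a single dimension occurs in the products.
\<close>
locale normalized_hom =
  fixes m n N :: nat and \<tau> :: "'a::division_ring \<Rightarrow> 'b::division_ring"
    and L :: "nat \<Rightarrow> nat \<Rightarrow> 'b" and \<psi> :: "(nat \<Rightarrow> nat \<Rightarrow> 'a) \<Rightarrow> nat \<Rightarrow> nat \<Rightarrow> 'b"
  assumes le: "m \<le> N" "n \<le> N" and \<tau>: "rhom \<tau>" and L: "L \<in> fmat n m"
    and psi_mat: "\<And>X. X \<in> fmat m n \<Longrightarrow> \<psi> X \<in> fmat N N"
    and psi_adj: "\<And>A x y. A \<in> fmat m n \<Longrightarrow> x \<in> fvec m \<Longrightarrow> y \<in> fvec n \<Longrightarrow>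
      \<exists>u v. \<psi> (A + outer x y) - \<psi> A = outer u v"
    and psi_row: "\<And>A x. A \<in> Rk1 m n \<Longrightarrow> x \<in> fvec m \<Longrightarrow> x \<noteq> 0 \<Longrightarrow>
      \<exists>p. \<forall>y\<in>fvec n. \<psi> (A + outer x y) - \<psi> A \<in> Rset p"
    and psi_rank_one: "\<And>x y. x \<in> fvec m \<Longrightarrow> y \<in> fvec n \<Longrightarrow>
      \<psi> (outer x y) + mm N (mm N (outer (\<lambda>i. \<tau> (x i)) (\<lambda>j. \<tau> (y j))) L) (\<psi> (outer x y))
        = outer (\<lambda>i. \<tau> (x i)) (\<lambda>j. \<tau> (y j))"
begin

definition ct :: "(nat \<Rightarrow> 'a) \<Rightarrow> nat \<Rightarrow> 'b" where "ct x = (\<lambda>i. \<tau> (x i))"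
definition mt :: "(nat \<Rightarrow> nat \<Rightarrow> 'a) \<Rightarrow> nat \<Rightarrow> nat \<Rightarrow> 'b" where "mt X = (\<lambda>i j. \<tau> (X i j))"

text \<open>The defect of \<open>\<psi> X = (1 + X L)\<^sup>-\<^sup>1 X\<close>, where \<open>\<tau>\<close> is applied to \<open>X\<close>.\<close>
definition D :: "(nat \<Rightarrow> nat \<Rightarrow> 'a) \<Rightarrow> nat \<Rightarrow> nat \<Rightarrow> 'b" where
  "D X = \<psi> X + mm N (mm N (mt X) L) (\<psi> X) - mt X"

lemma mt_simps: "mt (A + B) = mt A + mt B" "mt (A - B) = mt A - mt B" "mt (outer x y) = outer (ct x) (ct y)"
  by (auto simp: mt_def ct_def fun_eq_iff rhom_simps[OF \<tau>])

lemma ct_simps: "ct (x + y) = ct x + ct y" "ct (x - y) = ct x - ct y" "ct x = 0 \<longleftrightarrow> x = 0"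
  using rhom_comp_eq_0[OF \<tau>, of x] by (auto simp: ct_def fun_eq_iff rhom_simps[OF \<tau>])

lemma mt_fmat: "X \<in> fmat m n \<Longrightarrow> mt X \<in> fmat m n"
  by (auto simp: mt_def fmat_def rhom_simps[OF \<tau>])

lemma D_left:
  assumes X: "X \<in> fmat m n" and D: "D X = 0"
  shows "\<psi> X + mm N (mm N (\<psi> X) L) (mt X) = mt X"
  using quasi_inverse(3)[OF fmat_mono[OF mt_fmat[OF X] le] psi_mat[OF X] fmat_mono[OF L le(2,1)]] D
  by (simp add: D_def)

text \<open>These are \<open>(1 - Y L) x\<close> and \<open>w (1 - L Y)\<close>. When
  \<open>Y = \<psi> Z\<close> and \<open>Z\<close> has no defect, they equal
  \<open>(1 + Z L)\<^sup>-\<^sup>1 x\<close> and \<open>w (1 + L Z)\<^sup>-\<^sup>1\<close>, where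
  \<open>\<tau>\<close> is applied to \<open>Z\<close>.\<close>

definition pv where "pv Y x = x - mv N (mm N Y L) x"
definition qv where "qv w Y = w - vm N w (mm N L Y)"

text \<open>A resolvent identity: matrices without defect satisfy
  \<open>Y1 - Y2 = (1 - Y1 L) (B1 - B2) (1 - L Y2)\<close>. When \<open>B1 - B2\<close> is an outer
  product, the outer factors act on its two vectors separately. The second version results from
  exchanging the two matrices.\<close>

lemma psi_difference:
  assumes X1: "X1 \<in> fmat m n" "D X1 = 0" and X2: "X2 \<in> fmat m n" "D X2 = 0"
    and e: "X1 = X2 + outer x w"
  shows "\<psi> X1 - \<psi> X2 = outer (pv (\<psi> X1) (ct x)) (qv (ct w) (\<psi> X2))"
    "\<psi> X1 - \<psi> X2 = outer (pv (\<psi> X2) (ct x)) (qv (ct w) (\<psi> X1))"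
proof -
  have gen: "Y1 - Y2 = mm N (A - mm N (mm N Y1 L) A) (idm N) - mm N (A - mm N (mm N Y1 L) A) (mm N L Y2)"
    if "A = B1 - B2" "Y1 + mm N (mm N Y1 L) B1 = B1" "Y2 + mm N (mm N B2 L) Y2 = B2"
      "B1 \<in> fmat N N" "B2 \<in> fmat N N" "Y1 \<in> fmat N N" for A B1 B2 Y1 Y2 :: "nat \<Rightarrow> nat \<Rightarrow> 'b"
  proof -
    have 1: "B1 - mm N (mm N Y1 L) B1 = Y1" using that(2) by (metis add_diff_cancel_right')
    have 2: "B2 - mm N B2 (mm N L Y2) = Y2" using that(3) by (metis add_diff_cancel_right' mm_assoc)
    have AN: "A \<in> fmat N N" unfolding that(1) by (rule fmat_closed(3)[OF that(4,5)])
    note AN = AN mm_fmat[OF mm_fmat[OF that(6) fmat_mono[OF L le(2,1)]] AN]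
    define C where "C = A - mm N (mm N Y1 L) A"
    have C: "C = Y1 - (B2 - mm N (mm N Y1 L) B2)"
      unfolding C_def that(1) mm_diff_right using 1 by (simp add: algebra_simps)
    have CN: "C \<in> fmat N N" unfolding C_def by (rule fmat_closed(3)[OF AN])
    have Y2: "mm N B2 (mm N L Y2) = B2 - Y2" using 2 by (metis add_diff_cancel_left' diff_add_cancel)
    have "mm N C (mm N L Y2) = mm N Y1 (mm N L Y2) - (B2 - Y2 - mm N Y1 (mm N L (B2 - Y2)))"
      unfolding C mm_diff_left mm_assoc Y2 ..
    also have "\<dots> = C - (Y1 - Y2)"
      unfolding C mm_diff_right mm_assoc by (simp add: algebra_simps)
    finally show ?thesis unfolding C_def[symmetric] mm_id_right[OF CN order_refl] by simp
  qed
  have M: "mt X1 \<in> fmat N N" "mt X2 \<in> fmat N N" "\<psi> X1 \<in> fmat N N" "\<psi> X2 \<in> fmat N N"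
    using fmat_mono[OF mt_fmat le] psi_mat X1 X2 by blast+
  have E: "\<psi> X1 + mm N (mm N (mt X1) L) (\<psi> X1) = mt X1" "\<psi> X2 + mm N (mm N (mt X2) L) (\<psi> X2) = mt X2"
    using X1(2) X2(2) by (simp_all add: D_def)
  note E' = D_left[OF X1] D_left[OF X2]
  have m: "outer (ct x) (ct w) = mt X1 - mt X2" by (simp add: e mt_simps)
  then have m': "outer (ct x) (- ct w) = mt X2 - mt X1" by simp
  have 1: "outer a b - mm N Y (outer a b) = outer (a - mv N Y a) b"
    for a b :: "nat \<Rightarrow> 'b" and Y
    by (simp add: mm_outer outer_diff)
  have 2: "mm N (outer a b) (idm N) - mm N (outer a b) Y = outer a (b - vm N b Y)" 
    if "outer a b \<in> fmat N N" for a b :: "nat \<Rightarrow> 'b" and Y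
    using that by (simp add: mm_outer(2)[of N a b Y] mm_id_right outer_diff)
  note dm = fmat_closed(3)[OF M(1,2)] fmat_closed(3)[OF M(2,1)]
  have N1: "outer (pv (\<psi> X1) (ct x)) (ct w) \<in> fmat N N" "outer (pv (\<psi> X2) (ct x)) (- ct w) \<in> fmat N N"
    unfolding pv_def 1[symmetric] m m'
    by (rule fmat_closed(3)[OF dm(1) mm_fmat[OF mm_fmat[OF M(3) fmat_mono[OF L le(2,1)]] dm(1)]],
        rule fmat_closed(3)[OF dm(2) mm_fmat[OF mm_fmat[OF M(4) fmat_mono[OF L le(2,1)]] dm(2)]])
  show "\<psi> X1 - \<psi> X2 = outer (pv (\<psi> X1) (ct x)) (qv (ct w) (\<psi> X2))"
    unfolding pv_def qv_def
    using gen[OF m E'(1) E(2) M(1,2,3)] unfolding 1 2[OF N1(1)[unfolded pv_def]] .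
  have "\<psi> X2 - \<psi> X1 = outer (pv (\<psi> X2) (ct x)) (qv (- ct w) (\<psi> X1))"
    unfolding pv_def qv_def
    using gen[OF m' E'(2) E(1) M(2,1,4)] unfolding 1 2[OF N1(2)[unfolded pv_def]] .
  moreover have "qv (- ct w) (\<psi> X1) = - qv (ct w) (\<psi> X1)"
    using vm_diff(2)[of N 0 "ct w"] by (simp add: qv_def)
  ultimately show "\<psi> X1 - \<psi> X2 = outer (pv (\<psi> X2) (ct x)) (qv (ct w) (\<psi> X1))"
    by (metis minus_diff_eq minus_minus outer_simps(4))
qed

lemma pv_inverse:
  assumes Z: "Z \<in> fmat m n" "D Z = 0"
  shows "pv (\<psi> Z) x + mv N (mm N (mt Z) L) (pv (\<psi> Z) x) = x"
proof -
  have E: "\<psi> Z + mm N (mm N (mt Z) L) (\<psi> Z) = mt Z" using Z(2) by (simp add: D_def)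
  have "mv N (mm N (\<psi> Z) L) x + mv N (mm N (mt Z) L) (mv N (mm N (\<psi> Z) L) x)
      = mv N (mm N (\<psi> Z + mm N (mm N (mt Z) L) (\<psi> Z)) L) x"
    by (simp add: mv_add mm_add_left mm_assoc flip: mv_mm)
  then show ?thesis unfolding E pv_def by (simp add: mv_diff algebra_simps)
qed

lemma qv_inverse:
  assumes Z: "Z \<in> fmat m n" "D Z = 0"
  shows "qv w (\<psi> Z) + vm N (qv w (\<psi> Z)) (mm N L (mt Z)) = w"
proof -
  note E = D_left[OF Z]
  have "vm N w (mm N L (\<psi> Z)) + vm N (vm N w (mm N L (\<psi> Z))) (mm N L (mt Z))
      = vm N w (mm N L (\<psi> Z + mm N (mm N (\<psi> Z) L) (mt Z)))"
    by (simp add: vm_add mm_add_right mm_assoc flip: vm_mm)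
  then show ?thesis unfolding E qv_def by (simp add: vm_diff algebra_simps)
qed

text \<open>The difference to \<open>\<psi> Z\<close> has column
  \<open>(1 + Z L)\<^sup>-\<^sup>1 x\<close>; multiplication by \<open>1 + Z L\<close> in the defect
  restores \<open>x\<close>, and all remaining terms have column \<open>x\<close> as well.\<close>

lemma D_in_Rset:
  assumes Z: "Z \<in> fmat m n" "D Z = 0" and r: "\<psi> (Z + outer x y) - \<psi> Z \<in> Rset (pv (\<psi> Z) (ct x))"
  shows "D (Z + outer x y) \<in> Rset (ct x)"
proof -
  obtain v where v: "\<psi> (Z + outer x y) - \<psi> Z = outer (pv (\<psi> Z) (ct x)) v" using r by (rule RsetE)
  let ?Y = "\<psi> (Z + outer x y)" and ?p = "pv (\<psi> Z) (ct x)"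
  have Y: "?Y = \<psi> Z + outer ?p v" using v by (metis add.commute diff_add_cancel)
  have "D (Z + outer x y) = ?Y + mm N (mm N (mt Z) L) ?Y + mm N (mm N (outer (ct x) (ct y)) L) ?Y - mt Z - outer (ct x) (ct y)"
    by (simp add: D_def mt_simps mm_add_left algebra_simps)
  also have "?Y + mm N (mm N (mt Z) L) ?Y = \<psi> Z + mm N (mm N (mt Z) L) (\<psi> Z) + outer (?p + mv N (mm N (mt Z) L) ?p) v"
    unfolding Y by (simp add: mm_add_right mm_outer outer_add algebra_simps)
  also have "\<dots> = mt Z + outer (ct x) v" using Z(2) pv_inverse[OF Z, of "ct x"] by (simp add: D_def)
  also have "mt Z + outer (ct x) v + mm N (mm N (outer (ct x) (ct y)) L) ?Y - mt Z - outer (ct x) (ct y)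
      = outer (ct x) (v + vm N (vm N (ct y) L) ?Y - ct y)"
    by (simp add: mm_outer outer_add outer_diff algebra_simps)
  finally show ?thesis unfolding Rset_def by blast
qed

lemma outer_sum_fmat:
  fixes x y :: "'i \<Rightarrow> nat \<Rightarrow> 'a"
  assumes "\<And>i. i \<in> I \<Longrightarrow> x i \<in> fvec m" "\<And>i. i \<in> I \<Longrightarrow> y i \<in> fvec n"
  shows "(\<Sum>i\<in>I. outer (x i) (y i)) \<in> fmat m n"
  using assms
proof (induction I rule: infinite_finite_induct)
  case (insert i F)
  have "(\<Sum>i\<in>F. outer (x i) (y i)) \<in> fmat m n"
    by (rule insert.IH) (rule insert.prems, erule insertI2)+
  then show ?case unfolding sum.insert[OF insert.hyps(1,2)]
    by (rule fmat_closed(2)[OF outer_fmat[OF insert.prems[OF insertI1]]])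
qed simp_all

text \<open>
  Removing the summand \<open>t\<close> from a minimal sum leaves a matrix without defect, so the defect of the
  sum has column space spanned by \<open>x t\<close>. Two independent choices of \<open>x t\<close> force it to vanish.
\<close>
lemma D_outer_sum:
  fixes x y :: "nat \<Rightarrow> nat \<Rightarrow> 'a"
  assumes "finite I" "\<And>i. i \<in> I \<Longrightarrow> x i \<in> fvec m" "\<And>i. i \<in> I \<Longrightarrow> y i \<in> fvec n"
  shows "D (\<Sum>i\<in>I. outer (x i) (y i)) = 0"
  using assms
proof (induction "card I" arbitrary: I x y rule: less_induct)
  case less
  note fin = less.prems(1) and xm = less.prems(2) and yn = less.prems(3)
  define X where "X = (\<Sum>i\<in>I. outer (x i) (y i))"
  have XM: "X \<in> fmat m n" unfolding X_def by (rule outer_sum_fmat[OF xm yn])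
  have rank_one: "D (outer a b) = 0" if "a \<in> fvec m" "b \<in> fvec n" for a b
    using psi_rank_one[OF that] by (simp add: D_def mt_simps ct_def)
  \<comment> \<open>Summands with proportional columns or proportional rows can be merged, which
    shortens the sum. In the last case there are at least two summands and no such pair.\<close>
  consider "I = {}" | i where "I = {i}" | i j c where "i \<in> I" "j \<in> I" "i \<noteq> j" "x j = x i *\<^sub>r c"
    | i j c where "i \<in> I" "j \<in> I" "i \<noteq> j" "y j = c *\<^sub>l y i"
    | "I \<noteq> {}" "\<forall>i. I \<noteq> {i}" "\<forall>i\<in>I. \<forall>j\<in>I. i \<noteq> j \<longrightarrow> (\<forall>c. x j \<noteq> x i *\<^sub>r c) \<and> (\<forall>c. y j \<noteq> c *\<^sub>l y i)"
    by blast
  then have "D X = 0"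
  proof cases
    case 1
    then show ?thesis using rank_one[of 0 0] by (simp add: X_def)
  next
    case (2 i)
    then show ?thesis using rank_one[of "x i" "y i"] xm yn by (simp add: X_def)
  next
    case (3 i j c)
    define y' where "y' = y(i := y i + c *\<^sub>l y j)"
    have "D (\<Sum>l\<in>I - {j}. outer (x l) (y' l)) = 0"
      using 3 fin xm yn by (intro less.hyps card_Diff1_less) (auto simp: y'_def)
    moreover have "(\<Sum>l\<in>I - {j}. outer (x l) (y' l)) = X"
    proof -
      have i: "i \<in> I - {j}" "finite (I - {j})" using 3 fin by auto
      have "X = outer (x j) (y j) + (outer (x i) (y i) + (\<Sum>l\<in>I - {j} - {i}. outer (x l) (y l)))"
        unfolding X_def sum.remove[OF fin 3(2)] sum.remove[OF i(2,1)] ..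
      also have "outer (x j) (y j) = outer (x i) (c *\<^sub>l y j)" unfolding 3(4) by (rule outer_rsc)
      also have "(\<Sum>l\<in>I - {j} - {i}. outer (x l) (y l)) = (\<Sum>l\<in>I - {j} - {i}. outer (x l) (y' l))"
        by (rule sum.cong) (auto simp: y'_def)
      also have "outer (x i) (c *\<^sub>l y j) + (outer (x i) (y i) + (\<Sum>l\<in>I - {j} - {i}. outer (x l) (y' l)))
          = outer (x i) (y' i) + (\<Sum>l\<in>I - {j} - {i}. outer (x l) (y' l))"
        by (simp only: y'_def fun_upd_same outer_add add_ac)
      also have "\<dots> = (\<Sum>l\<in>I - {j}. outer (x l) (y' l))" by (rule sum.remove[OF i(2,1), symmetric])
      finally show ?thesis by simp
    qed
    ultimately show ?thesis by simp
  next
    case (4 i j c)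
    define x' where "x' = x(i := x i + x j *\<^sub>r c)"
    have "D (\<Sum>l\<in>I - {j}. outer (x' l) (y l)) = 0"
      using 4 fin xm yn by (intro less.hyps card_Diff1_less) (auto simp: x'_def)
    moreover have "(\<Sum>l\<in>I - {j}. outer (x' l) (y l)) = X"
    proof -
      have i: "i \<in> I - {j}" "finite (I - {j})" using 4 fin by auto
      have "X = outer (x j) (y j) + (outer (x i) (y i) + (\<Sum>l\<in>I - {j} - {i}. outer (x l) (y l)))"
        unfolding X_def sum.remove[OF fin 4(2)] sum.remove[OF i(2,1)] ..
      also have "outer (x j) (y j) = outer (x j *\<^sub>r c) (y i)" unfolding 4(4) by (rule outer_rsc[symmetric])
      also have "(\<Sum>l\<in>I - {j} - {i}. outer (x l) (y l)) = (\<Sum>l\<in>I - {j} - {i}. outer (x' l) (y l))"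
        by (rule sum.cong) (auto simp: x'_def)
      also have "outer (x j *\<^sub>r c) (y i) + (outer (x i) (y i) + (\<Sum>l\<in>I - {j} - {i}. outer (x' l) (y l)))
          = outer (x' i) (y i) + (\<Sum>l\<in>I - {j} - {i}. outer (x' l) (y l))"
        by (simp only: x'_def fun_upd_same outer_add add_ac)
      also have "\<dots> = (\<Sum>l\<in>I - {j}. outer (x' l) (y l))" by (rule sum.remove[OF i(2,1), symmetric])
      finally show ?thesis by simp
    qed
    ultimately show ?thesis by simp
  next
    case 5
    have xp: "x j \<noteq> x i *\<^sub>r c" and yp: "y j \<noteq> c *\<^sub>l y i" if "i \<in> I" "j \<in> I" "i \<noteq> j" for i j c
      using 5 that by blast+
    have other: "\<exists>j\<in>I. j \<noteq> i" if "i \<in> I" for i using 5(2) that by blast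
    have nz: "x i \<noteq> 0" "y i \<noteq> 0" if i: "i \<in> I" for i
    proof -
      obtain j where j: "j \<in> I" "j \<noteq> i" using other[OF i] by blast
      show "x i \<noteq> 0" "y i \<noteq> 0" using xp[of j i 0] yp[of j i 0] j i by auto
    qed
    have R: "D X \<in> Rset (ct (x t))" if t: "t \<in> I" for t
    proof -
      define Z where "Z = (\<Sum>i\<in>I - {t}. outer (x i) (y i))"
      have Z: "Z \<in> fmat m n" unfolding Z_def by (rule outer_sum_fmat) (use xm yn in auto)
      have DZ: "D Z = 0" unfolding Z_def
        using card_Diff1_less[OF fin t] fin xm yn by (intro less.hyps) auto
      have XZ: "X = Z + outer (x t) (y t)"
        unfolding X_def Z_def sum.remove[OF fin t] by (rule add.commute)
      define p where "p = pv (\<psi> Z) (ct (x t))"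
      \<comment> \<open>Comparison points: \<open>Z + outer (x t) (y j)\<close> absorbs the
        additional column into summand \<open>j\<close>, so it is again a sum over
        \<open>I - {t}\<close> and has no defect by induction.\<close>
      define W where "W j = \<psi> (Z + outer (x t) (y j)) - \<psi> Z" for j
      define q where "q j = qv (ct (y j)) (\<psi> Z)" for j
      have W: "W j \<in> Rset p" "W j \<in> Cset (q j)" "W j \<noteq> 0" if j: "j \<in> I" "j \<noteq> t" for j
      proof -
        let ?Z' = "Z + outer (x t) (y j)"
        define x' where "x' = x(j := x j + x t)"
        have jI: "j \<in> I - {t}" "finite (I - {t})" using j fin by auto
        have "Z = outer (x j) (y j) + (\<Sum>l\<in>I - {t} - {j}. outer (x l) (y l))"
          unfolding Z_def by (rule sum.remove[OF jI(2,1)])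
        also have "(\<Sum>l\<in>I - {t} - {j}. outer (x l) (y l)) = (\<Sum>l\<in>I - {t} - {j}. outer (x' l) (y l))"
          by (rule sum.cong) (auto simp: x'_def)
        finally have "?Z' = outer (x' j) (y j) + (\<Sum>l\<in>I - {t} - {j}. outer (x' l) (y l))"
          by (simp only: x'_def fun_upd_same outer_add add_ac)
        also have "\<dots> = (\<Sum>l\<in>I - {t}. outer (x' l) (y l))" by (rule sum.remove[OF jI(2,1), symmetric])
        finally have e: "?Z' = (\<Sum>l\<in>I - {t}. outer (x' l) (y l))" .
        have DZ': "D ?Z' = 0" unfolding e
          using card_Diff1_less[OF fin t] fin xm yn t j by (intro less.hyps) (auto simp: x'_def)
        have Z': "?Z' \<in> fmat m n" using Z xm[OF t] yn[OF j(1)] by simp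
        note d = psi_difference[OF Z' DZ' Z DZ refl]
        show "W j \<in> Rset p" using d(2) by (auto simp: W_def p_def Rset_def)
        show "W j \<in> Cset (q j)" using d(1) by (auto simp: W_def q_def Cset_def)
        have "pv (\<psi> ?Z') (ct (x t)) \<noteq> 0"
        proof
          assume "pv (\<psi> ?Z') (ct (x t)) = 0"
          with pv_inverse[OF Z' DZ', of "ct (x t)"] have "ct (x t) = 0" by simp
          with nz[OF t] show False by (simp add: ct_simps)
        qed
        moreover have "qv (ct (y j)) (\<psi> Z) \<noteq> 0"
        proof
          assume "qv (ct (y j)) (\<psi> Z) = 0"
          with qv_inverse[OF Z DZ, of "ct (y j)"] have "ct (y j) = 0" by simp
          with nz[OF j(1)] show False by (simp add: ct_simps)
        qed
        ultimately show "W j \<noteq> 0" using d(1) by (simp add: W_def)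
      qed
      obtain j where j: "j \<in> I" "j \<noteq> t" using other[OF t] by blast
      define V where "V = \<psi> X - \<psi> Z"
      have "V \<in> Rset p"
      \<comment> \<open>With two summands there is only one comparison point, but then
        \<open>Z\<close> has rank one and the row at \<open>Z\<close> is known to go into a single
        \<open>Rset\<close>.\<close>
      proof (cases "I = {t, j}")
        case True
        have "Z = outer (x j) (y j)" using j True by (simp add: Z_def insert_Diff_if)
        then have "Z \<in> Rk1 m n" using xm yn j by simp
        with psi_row[of Z "x t"] xm[OF t] nz[OF t] obtain p0 where
          p0: "\<forall>y\<in>fvec n. \<psi> (Z + outer (x t) y) - \<psi> Z \<in> Rset p0" by blast
        have "W j \<in> Rset p0" using p0 yn[OF j(1)] by (simp add: W_def)
        then have "Rset p0 = Rset p" using W[OF j] by (intro Rset_eq)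
        with p0 yn[OF t] show ?thesis by (simp add: V_def XZ)
      next
        case False
        then obtain j' where j': "j' \<in> I" "j' \<noteq> t" "j' \<noteq> j" using j t by blast
        \<comment> \<open>\<open>X\<close> and the comparison point for \<open>l\<close> lie in one
          row through \<open>Z\<close>, so \<open>V\<close> and \<open>W l\<close> differ by an
          outer product. If \<open>V\<close> avoided \<open>Rset p\<close>, two different
          \<open>l\<close> would put it in two sets \<open>Cset (q l)\<close> and make two of the
          row vectors proportional.\<close>
        have mem: "V \<in> Rset p \<or> V \<in> Cset (q l)" if l: "l \<in> I" "l \<noteq> t" for l
        proof -
          obtain w where w: "W l = outer p w" using W(1)[OF l] by (rule RsetE)
          obtain w' where w': "W l = outer w' (q l)" using W(2)[OF l] by (rule CsetE)
          from outer_eq_rowD[of p w w' "q l"] w w' W(3)[OF l] obtain s where s: "w = s *\<^sub>l q l" by auto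
          obtain u v where uv: "V = outer u v"
            using psi_adj[OF Z xm[OF t] yn[OF t]] unfolding V_def XZ by blast
          have "Z + outer (x t) (y l) = X + outer (x t) (y l - y t)"
            unfolding XZ by (simp add: outer_diff)
          then obtain a b where "\<psi> (Z + outer (x t) (y l)) - \<psi> X = outer a b"
            using psi_adj[OF XM xm[OF t], of "y l - y t"] yn[OF l(1)] yn[OF t] by auto
          then have "outer p w - outer u v = outer a b"
            using w uv by (simp add: W_def V_def) (metis diff_diff_eq2 diff_add_cancel)
          from rank_one_difference[OF this] W(3)[OF l] w uv have "V \<in> Rset p \<or> V \<in> Cset w" by auto
          then show ?thesis unfolding s by (auto simp: Cset_def outer_rsc[symmetric])
        qed
        show ?thesis
        proof (rule ccontr)
          assume n: "V \<notin> Rset p"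
          then have "V \<noteq> 0" by auto
          moreover have "V \<in> Cset (q j)" "V \<in> Cset (q j')" using n mem j j' by blast+
          then obtain a b where ab: "V = outer a (q j)" "V = outer b (q j')" by (elim CsetE)
          ultimately have "a \<noteq> 0" by auto
          with outer_eq_rowD[of a "q j" b "q j'"] ab obtain s where s: "q j = s *\<^sub>l q j'" by auto
          have "ct (y j) = s *\<^sub>l ct (y j')"
            using qv_inverse[OF Z DZ, of "ct (y j)"] qv_inverse[OF Z DZ, of "ct (y j')"] s
            unfolding q_def by (metis lsc_add_right vm_lsc)
          from rhom_parallel_left[OF \<tau> this[unfolded ct_def] nz(2)[OF j'(1)]] yp[OF j'(1) j(1) j'(3)]
          show False by blast
        qed
      qed
      then show ?thesis unfolding XZ V_def p_def by (intro D_in_Rset[OF Z DZ])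
    qed
    obtain t where t: "t \<in> I" using 5 by blast
    obtain s where s: "s \<in> I" "s \<noteq> t" using other[OF t] by blast
    show ?thesis
    proof (rule ccontr)
      assume n: "D X \<noteq> 0"
      obtain a b where ab: "D X = outer (ct (x s)) a" "D X = outer (ct (x t)) b"
        using R[OF t] R[OF s(1)] by (elim RsetE)
      with n have "a \<noteq> 0" by auto
      with outer_eq_colD[of "ct (x s)" a "ct (x t)" b] ab obtain c where "ct (x s) = ct (x t) *\<^sub>r c" by auto
      from rhom_parallel_right[OF \<tau> this[unfolded ct_def] nz(1)[OF t]] xp[OF t s(1)] s(2) show False by blast
    qed
  qed
  then show ?case by (simp add: X_def)
qed

lemma D_zero:
  assumes X: "X \<in> fmat m n"
  shows "D X = 0"
proof -
  have "X i \<in> fvec n" for i using X by (auto simp: fmat_def fvec_def)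
  then have "D (\<Sum>i\<in>{..<m}. outer (ev i) (X i)) = 0" by (intro D_outer_sum) auto
  moreover have "(\<Sum>i\<in>{..<m}. outer (ev i) (X i)) = X"
  proof (intro ext)
    fix a b
    have "(\<Sum>i<m. ev i a * X i b) = (\<Sum>i<m. if i = a then X a b else 0)"
      by (rule sum.cong) (auto simp: ev_def)
    then show "(\<Sum>i\<in>{..<m}. outer (ev i) (X i)) a b = X a b" using X by (auto simp: fmat_def)
  qed
  ultimately show ?thesis by simp
qed

end

section \<open>Normal form of straight homomorphisms\<close>

lemma mm_restrict: "A \<in> fmat m k \<Longrightarrow> k \<le> N \<Longrightarrow> mm N A B = mm k A B"
  unfolding mm_def fmat_def by (intro ext sum.mono_neutral_right) auto

lemma mv_id: "u \<in> fvec N \<Longrightarrow> mv N (idm N) u = u" for u :: "nat \<Rightarrow> 'a::division_ring"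
proof
  fix i assume u: "u \<in> fvec N"
  have "mv N (idm N) u i = (\<Sum>l<N. if l = i then u i else 0)"
    unfolding mv_def by (rule sum.cong) (auto simp: idm_def)
  then show "mv N (idm N) u i = u i" using u by (auto simp: fvec_def)
qed

lemma vm_id: "u \<in> fvec N \<Longrightarrow> vm N u (idm N) = u" for u :: "nat \<Rightarrow> 'a::division_ring"
proof
  fix i assume u: "u \<in> fvec N"
  have "vm N u (idm N) i = (\<Sum>l<N. if l = i then u i else 0)"
    unfolding vm_def by (rule sum.cong) (auto simp: idm_def)
  then show "vm N u (idm N) i = u i" using u by (auto simp: fvec_def)
qed

lemma outer_fmatD:
  fixes u v :: "nat \<Rightarrow> 'a::division_ring"
  assumes "outer u v \<in> fmat m n" "u \<noteq> 0" "v \<noteq> 0"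
  shows "u \<in> fvec m" "v \<in> fvec n"
proof -
  obtain i j where ij: "u i \<noteq> 0" "v j \<noteq> 0" using assms(2,3) by (meson fun_nonzeroE)
  have z: "u a * v b = 0" if "\<not> (a < m \<and> b < n)" for a b
    using assms(1) that unfolding fmat_def mem_Collect_eq outer_def by blast
  show "u \<in> fvec m" unfolding fvec_def
  proof (intro CollectI allI impI)
    fix a assume "m \<le> a"
    then show "u a = 0" using z[of a j] ij by simp
  qed
  show "v \<in> fvec n" unfolding fvec_def
  proof (intro CollectI allI impI)
    fix b assume "n \<le> b"
    then show "v b = 0" using z[of i b] ij by simp
  qed
qed

lemma extend_rows:
  fixes h :: "nat \<Rightarrow> nat \<Rightarrow> 'a::division_ring"
  assumes "lind {..<n} h" "\<And>i. i < n \<Longrightarrow> h i \<in> fvec N"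
  shows "n \<le> N \<and> (\<exists>H\<in>fmat N N. \<exists>Hi\<in>fmat N N. mm N H Hi = idm N \<and> mm N Hi H = idm N \<and> (\<forall>i<n. H i = h i))"
proof -
  have n: "n \<le> N" using lind_le_dim[OF assms(1)] assms(2) by simp
  obtain H0 where H0: "lind {..<N} H0" "\<forall>i<N. H0 i \<in> fvec N" "\<forall>i<n. H0 i = h i"
    using lind_extend[OF assms] by blast
  define H where "H i = (if i < N then H0 i else 0)" for i
  have "lind {..<N} H" using H0(1) lind_cong[of "{..<N}" H H0] by (simp add: H_def)
  moreover have H: "H \<in> fmat N N"
    using H0(2) unfolding fmat_def fvec_def H_def by auto
  ultimately obtain Hi where "Hi \<in> fmat N N" "mm N Hi H = idm N" "mm N H Hi = idm N"
    using lind_inverse by blast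
  moreover have "\<forall>i<n. H i = h i" using n H0(3) by (simp add: H_def)
  ultimately show ?thesis using n H by blast
qed

lemma mm_mun: "mm N (mun A) (mun B) = mun (mm N B A)"
  for A :: "nat \<Rightarrow> nat \<Rightarrow> 'a::division_ring opp"
  by (auto simp: mm_def mun_def fun_eq_iff unop_sum)

lemma mun_idm: "mun (idm N) = (idm N :: nat \<Rightarrow> nat \<Rightarrow> 'a::division_ring)"
  by (auto simp: mun_def idm_def fun_eq_iff)

lemma mun_fmat: "A \<in> fmat m n \<Longrightarrow> mun A \<in> fmat n m" for A :: "nat \<Rightarrow> nat \<Rightarrow> 'a::division_ring opp"
  unfolding fmat_def mun_def by auto

lemma extend_cols:
  fixes k :: "nat \<Rightarrow> nat \<Rightarrow> 'a::division_ring"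
  assumes "lind {..<m} (\<lambda>i. vop (k i))" "\<And>i. i < m \<Longrightarrow> k i \<in> fvec N"
  shows "m \<le> N \<and> (\<exists>K\<in>fmat N N. \<exists>Ki\<in>fmat N N. mm N K Ki = idm N \<and> mm N Ki K = idm N \<and> (\<forall>i<m. \<forall>a. K a i = k i a))"
proof -
  have "\<And>i. i < m \<Longrightarrow> vop (k i) \<in> fvec N" using assms(2) by simp
  from extend_rows[OF assms(1) this] obtain H Hi where H: "m \<le> N" "H \<in> fmat N N" "Hi \<in> fmat N N"
    "mm N H Hi = idm N" "mm N Hi H = idm N" "\<forall>i<m. H i = vop (k i)" by blast
  have "mm N (mun H) (mun Hi) = idm N" "mm N (mun Hi) (mun H) = idm N"
    using H by (simp_all add: mm_mun mun_idm)
  moreover have "\<forall>i<m. \<forall>a. mun H a i = k i a" using H(6) by (simp add: mun_def vop_def)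
  ultimately show ?thesis using H(1) mun_fmat[OF H(2)] mun_fmat[OF H(3)] by blast
qed

lemma additive_sum:
  fixes h :: "(nat \<Rightarrow> 'a::division_ring) \<Rightarrow> 'c::ab_group_add"
  assumes "\<And>y z. y \<in> fvec n \<Longrightarrow> z \<in> fvec n \<Longrightarrow> h (y + z) = h y + h z" "\<And>i. i \<in> I \<Longrightarrow> f i \<in> fvec n"
  shows "h (\<Sum>i\<in>I. f i) = (\<Sum>i\<in>I. h (f i))"
proof -
  have h0: "h 0 = 0" using assms(1)[of 0 0] by simp
  show ?thesis using assms(2)
  proof (induction I rule: infinite_finite_induct)
    case (insert x F)
    have "h (f x + sum f F) = h (f x) + h (sum f F)"
      by (rule assms(1)) (use insert.prems in \<open>auto intro!: fvec_sum simp only:\<close>)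
    moreover have "h (sum f F) = (\<Sum>i\<in>F. h (f i))"
      by (rule insert.IH) (rule insert.prems, erule insertI2)
    ultimately show ?case unfolding sum.insert[OF insert.hyps(1,2)] by (simp only:)
  qed (simp_all only: sum.infinite sum.empty h0 not_False_eq_True)
qed

lemma vm_outer: "vm N w (outer a z) = (\<Sum>l<N. w l * a l) *\<^sub>l z" for z :: "nat \<Rightarrow> 'a::ring"
  by (auto simp: vm_def fun_eq_iff sum_distrib_right mult.assoc)

text \<open>The independent vectors \<open>h (ev j)\<close> and \<open>k (ev i)\<close> are
  completed to invertible matrices \<open>H\<close> and \<open>K\<close>. After multiplication by
  their inverses both maps become entrywise application of \<open>\<tau>\<close>, and
  \<open>B\<close> is given by a matrix, which brings the situation of
  \<open>normalized_hom\<close>.\<close>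

lemma straight_hom_form:
  fixes \<phi> :: "(nat \<Rightarrow> nat \<Rightarrow> 'a::division_ring) \<Rightarrow> nat \<Rightarrow> nat \<Rightarrow> 'b::division_ring"
  assumes S: "straight_hom m n \<phi>"
    and bd: "\<And>X. X \<in> fmat m n \<Longrightarrow> \<phi> X \<in> fmat m' n'"
    and adj: "\<forall>A\<in>fmat m n. \<forall>x\<in>fvec m. \<forall>y\<in>fvec n.
      \<exists>u v. \<phi> (A + outer x y) - \<phi> A = outer u v"
  shows "m \<le> m' \<and> n \<le> n' \<and> (\<exists>\<tau> L K Ki H Hi. rhom \<tau> \<and> L \<in> fmat n m \<and>
    K \<in> fmat m' m' \<and> Ki \<in> fmat m' m' \<and> mm m' K Ki = idm m' \<and> mm m' Ki K = idm m' \<and>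
    H \<in> fmat n' n' \<and> Hi \<in> fmat n' n' \<and> mm n' H Hi = idm n' \<and> mm n' Hi H = idm n' \<and>
    (\<forall>X\<in>fmat m n. \<exists>Y\<in>fmat m n. \<phi> X = mm m' K (mm n' Y H) \<and>
      Y + mm m (mm n (\<lambda>i j. \<tau> (X i j)) L) Y = (\<lambda>i j. \<tau> (X i j)) \<and>
      Y + mm m (mm n Y L) (\<lambda>i j. \<tau> (X i j)) = (\<lambda>i j. \<tau> (X i j))))"
proof -
  interpret straight_hom m n \<phi> by fact
  obtain \<tau> h k B where \<tau>: "rhom \<tau>" and hs: "slin n \<tau> h"
    and k: "\<forall>x\<in>fvec m. \<forall>z\<in>fvec m. k (x + z) = k x + k z" "\<forall>a. \<forall>x\<in>fvec m. k (x *\<^sub>r a) = k x *\<^sub>r \<tau> a"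
    and ind: "lind {..<n} (\<lambda>i. h (ev i))" "lind {..<m} (\<lambda>i. vop (k (ev i)))"
    and Bs: "\<forall>x\<in>fvec m. sform n \<tau> (B x)"
    and Bx: "\<forall>y\<in>fvec n. (\<forall>x\<in>fvec m. \<forall>z\<in>fvec m. B (x + z) y = B x y + B z y) \<and>
       (\<forall>a. \<forall>x\<in>fvec m. B (x *\<^sub>r a) y = B x y * \<tau> a)"
    and form: "\<forall>x\<in>fvec m. \<forall>y\<in>fvec n. 1 + B x y \<noteq> 0 \<and>
       \<phi> (outer x y) = outer (k x) (inverse (1 + B x y) *\<^sub>l h y)"
    using rank_one_form by (elim exE conjE) blast
  have hnz: "h (ev j) \<noteq> 0" if "j < n" for j using lind_nonzero[OF ind(1)] that by simp
  have knz: "k (ev i) \<noteq> 0" if "i < m" for i using lind_nonzero[OF ind(2)] that by auto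
  \<comment> \<open>The earlier lemmas put no bound on the indices of \<open>h\<close> and
    \<open>k\<close>; it is read off from the values of \<open>\<phi>\<close> at matrix
    units.\<close>
  have bnd: "k (ev i) \<in> fvec m' \<and> h (ev j) \<in> fvec n'" if ij: "i < m" "j < n" for i j
  proof -
    have e: "1 + B (ev i) (ev j) \<noteq> 0"
      "\<phi> (outer (ev i) (ev j)) = outer (k (ev i)) (inverse (1 + B (ev i) (ev j)) *\<^sub>l h (ev j))"
      using form ij by simp_all
    have "outer (ev i) (ev j :: nat \<Rightarrow> 'a) \<in> fmat m n" using ij by (intro outer_fmat ev_fvec)
    from bd[OF this, unfolded e(2)] have m: "outer (k (ev i)) (inverse (1 + B (ev i) (ev j)) *\<^sub>l h (ev j)) \<in> fmat m' n'" .
    have nz: "inverse (1 + B (ev i) (ev j)) *\<^sub>l h (ev j) \<noteq> 0" using e(1) hnz[OF ij(2)] by simp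
    note o = outer_fmatD[OF m knz[OF ij(1)] nz]
    have "(1 + B (ev i) (ev j)) *\<^sub>l inverse (1 + B (ev i) (ev j)) *\<^sub>l h (ev j) \<in> fvec n'"
      by (rule fvec_closed(5)[OF o(2)])
    with o(1) e(1) show ?thesis by simp
  qed
  have m0: "0 < m" "0 < n" using mn by auto
  have kb: "k (ev i) \<in> fvec m'" if "i < m" for i using bnd[OF that m0(2)] by simp
  have hb: "h (ev j) \<in> fvec n'" if "j < n" for j using bnd[OF m0(1) that] by simp
  obtain H Hi where nn: "n \<le> n'" and H: "H \<in> fmat n' n'" "Hi \<in> fmat n' n'" "mm n' H Hi = idm n'" "mm n' Hi H = idm n'"
    "\<forall>i<n. H i = h (ev i)" using extend_rows[OF ind(1) hb] by blast
  obtain K Ki where mm: "m \<le> m'" and K: "K \<in> fmat m' m'" "Ki \<in> fmat m' m'" "mm m' K Ki = idm m'" "mm m' Ki K = idm m'"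
    "\<forall>i<m. \<forall>a. K a i = k (ev i) a" using extend_cols[OF ind(2) kb] by blast
  define ct where "ct x = (\<lambda>i::nat. \<tau> (x i))" for x
  have ctv: "ct x \<in> fvec a" if "x \<in> fvec a" for x a
    using that by (auto simp: ct_def fvec_def rhom_simps[OF \<tau>])
  have mono: "x \<in> fvec b" if "x \<in> fvec a" "a \<le> b" for x :: "nat \<Rightarrow> 'b" and a b
    using that by (auto simp: fvec_def)
  have hH: "h y = vm n' (ct y) H" if y: "y \<in> fvec n" for y
  proof -
    have "h y = h (\<Sum>j<n. y j *\<^sub>l ev j)" using fvec_expand[OF y] by simp
    also have "\<dots> = (\<Sum>j<n. h (y j *\<^sub>l ev j))"
    proof (rule additive_sum[where n = n])
      show "h (u + v) = h u + h v" if "u \<in> fvec n" "v \<in> fvec n" for u v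
        using hs that unfolding slin_def by blast
      show "y j *\<^sub>l ev j \<in> fvec n" if "j \<in> {..<n}" for j
        by (rule fvec_closed(5)[OF ev_fvec]) (use that in simp)
    qed
    also have "\<dots> = (\<Sum>j<n. ct y j *\<^sub>l H j)"
      using hs H(5) by (intro sum.cong) (auto simp: slin_def ct_def)
    also have "\<dots> = (\<Sum>j<n'. ct y j *\<^sub>l H j)"
      using nn ctv[OF y] by (intro sum.mono_neutral_left) (auto simp: fvec_def)
    finally show ?thesis by (auto simp: vm_def fun_eq_iff)
  qed
  have ev_rsc: "a *\<^sub>l ev i = ev i *\<^sub>r a" for a :: 'a and i
    by (auto simp: ev_def fun_eq_iff)
  have kK: "k x = mv m' K (ct x)" if x: "x \<in> fvec m" for x
  proof -
    have "k x = k (\<Sum>j<m. x j *\<^sub>l ev j)" using fvec_expand[OF x] by simp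
    also have "\<dots> = (\<Sum>j<m. k (x j *\<^sub>l ev j))"
    proof (rule additive_sum[where n = m])
      show "k (u + v) = k u + k v" if "u \<in> fvec m" "v \<in> fvec m" for u v
        using that k(1) by blast
      show "x j *\<^sub>l ev j \<in> fvec m" if "j \<in> {..<m}" for j
        by (rule fvec_closed(5)[OF ev_fvec]) (use that in simp)
    qed
    also have "\<dots> = (\<Sum>j<m. k (ev j) *\<^sub>r ct x j)"
      using k(2) by (intro sum.cong) (auto simp: ct_def ev_rsc)
    finally have "k x a = (\<Sum>j<m. K a j * ct x j)" for a using K(5) by simp
    also have "(\<Sum>j<m. K a j * ct x j) = (\<Sum>j<m'. K a j * ct x j)" for a
      using mm ctv[OF x] by (intro sum.mono_neutral_left) (auto simp: fvec_def)
    finally show ?thesis by (auto simp: mv_def fun_eq_iff)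
  qed
  define N where "N = max m' n'"
  have N: "m' \<le> N" "n' \<le> N" "m \<le> N" "n \<le> N" using mm nn by (auto simp: N_def)
  \<comment> \<open>The first index belongs to \<open>y\<close>: in \<open>B x y\<close> the entries
    of \<open>y\<close> stand to the left of \<open>L\<close> and those of \<open>x\<close> to the
    right.\<close>
  define L where "L = (\<lambda>j i. if j < n \<and> i < m then B (ev i) (ev j) else 0)"
  have L: "L \<in> fmat n m" by (auto simp: L_def fmat_def)
  have BL: "B x y = (\<Sum>i<N. vm N (ct y) L i * ct x i)" if x: "x \<in> fvec m" and y: "y \<in> fvec n" for x y
  proof -
    have xi: "B x (ev j) = (\<Sum>i<m. L j i * ct x i)" if j: "j < n" for j
    proof -
      have "B x (ev j) = B (\<Sum>i<m. x i *\<^sub>l ev i) (ev j)" using fvec_expand[OF x] by simp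
      also have "\<dots> = (\<Sum>i<m. B (x i *\<^sub>l ev i) (ev j))"
    proof (rule additive_sum[where n = m and h = "\<lambda>x. B x (ev j)"])
      show "B (u + v) (ev j) = B u (ev j) + B v (ev j)" if "u \<in> fvec m" "v \<in> fvec m" for u v
        using that Bx ev_fvec[OF j] by blast
      show "x i *\<^sub>l ev i \<in> fvec m" if "i \<in> {..<m}" for i
        by (rule fvec_closed(5)[OF ev_fvec]) (use that in simp)
    qed
      also have "\<dots> = (\<Sum>i<m. L j i * ct x i)"
        using Bx j by (intro sum.cong) (auto simp: L_def ct_def ev_rsc)
      finally show ?thesis .
    qed
    have "B x y = B x (\<Sum>j<n. y j *\<^sub>l ev j)" using fvec_expand[OF y] by simp
    also have "\<dots> = (\<Sum>j<n. B x (y j *\<^sub>l ev j))"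
    proof (rule additive_sum[where n = n])
      show "B x (u + v) = B x u + B x v" if "u \<in> fvec n" "v \<in> fvec n" for u v
        using that Bs x unfolding sform_def by blast
      show "y j *\<^sub>l ev j \<in> fvec n" if "j \<in> {..<n}" for j
        by (rule fvec_closed(5)[OF ev_fvec]) (use that in simp)
    qed
    also have "\<dots> = (\<Sum>j<n. ct y j * (\<Sum>i<m. L j i * ct x i))"
      using Bs x xi by (intro sum.cong) (auto simp: sform_def ct_def)
    also have "\<dots> = (\<Sum>i<m. (\<Sum>j<n. ct y j * L j i) * ct x i)"
      unfolding sum_distrib_left sum_distrib_right by (subst sum.swap) (simp add: mult.assoc)
    also have "\<dots> = (\<Sum>i<m. vm N (ct y) L i * ct x i)"
    proof (rule sum.cong[OF refl])
      fix i
      have "(\<Sum>j<n. ct y j * L j i) = (\<Sum>j<N. ct y j * L j i)"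
        using N L by (intro sum.mono_neutral_left) (auto simp: L_def)
      then show "(\<Sum>j<n. ct y j * L j i) * ct x i = vm N (ct y) L i * ct x i" by (simp add: vm_def)
    qed
    also have "\<dots> = (\<Sum>i<N. vm N (ct y) L i * ct x i)"
      using N ctv[OF x] by (intro sum.mono_neutral_left) (auto simp: fvec_def)
    finally show ?thesis .
  qed
  define \<psi> where "\<psi> X = mm m' Ki (mm n' (\<phi> X) Hi)" for X
  have psi_outer: "mm m' Ki (mm n' (outer u v) Hi) = outer (mv m' Ki u) (vm n' v Hi)" for u v
    by (simp add: mm_outer)
  have psi_diff: "\<psi> X - \<psi> X' = mm m' Ki (mm n' (\<phi> X - \<phi> X') Hi)" for X X'
    by (simp add: \<psi>_def mm_diff_left mm_diff_right)
  have psi_bd: "\<psi> X \<in> fmat m' n'" if "X \<in> fmat m n" for X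
    unfolding \<psi>_def by (rule mm_fmat[OF K(2) mm_fmat[OF bd[OF that] H(2)]])
  interpret normalized_hom m n N \<tau> L \<psi>
  proof
    show "m \<le> N" "n \<le> N" "rhom \<tau>" "L \<in> fmat n m" by (fact N \<tau> L)+
  next
    fix X :: "nat \<Rightarrow> nat \<Rightarrow> 'a" assume "X \<in> fmat m n"
    then show "\<psi> X \<in> fmat N N" by (rule fmat_mono[OF psi_bd N(1,2)])
  next
    fix A :: "nat \<Rightarrow> nat \<Rightarrow> 'a" and x y :: "nat \<Rightarrow> 'a" assume "A \<in> fmat m n" "x \<in> fvec m" "y \<in> fvec n"
    with adj obtain u v where "\<phi> (A + outer x y) - \<phi> A = outer u v" by blast
    then show "\<exists>u v. \<psi> (A + outer x y) - \<psi> A = outer u v"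
      unfolding psi_diff using psi_outer by metis
  next
    fix A :: "nat \<Rightarrow> nat \<Rightarrow> 'a" and x :: "nat \<Rightarrow> 'a" assume "A \<in> Rk1 m n" "x \<in> fvec m" "x \<noteq> 0"
    from row[OF this] obtain p where p: "\<forall>y\<in>fvec n. \<phi> (A + outer x y) - \<phi> A \<in> Rset p" by blast
    show "\<exists>p. \<forall>y\<in>fvec n. \<psi> (A + outer x y) - \<psi> A \<in> Rset p"
    proof (intro exI ballI)
      fix y :: "nat \<Rightarrow> 'a" assume "y \<in> fvec n"
      with p have "\<phi> (A + outer x y) - \<phi> A \<in> Rset p" by blast
      then obtain w where "\<phi> (A + outer x y) - \<phi> A = outer p w" by (rule RsetE)
      then show "\<psi> (A + outer x y) - \<psi> A \<in> Rset (mv m' Ki p)"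
        unfolding psi_diff psi_outer Rset_def by (auto simp: psi_outer)
    qed
  next
    fix x y :: "nat \<Rightarrow> 'a" assume x: "x \<in> fvec m" and y: "y \<in> fvec n"
    define b where "b = B x y"
    have b: "1 + b \<noteq> 0" "\<phi> (outer x y) = outer (k x) (inverse (1 + b) *\<^sub>l h y)"
      using form x y by (auto simp: b_def)
    have "mv m' Ki (k x) = ct x"
      unfolding kK[OF x] mv_mm[symmetric] K(4) by (rule mv_id[OF mono[OF ctv[OF x] mm]])
    moreover have "vm n' (h y) Hi = ct y"
      unfolding hH[OF y] vm_mm[symmetric] H(3) by (rule vm_id[OF mono[OF ctv[OF y] nn]])
    ultimately have ps: "\<psi> (outer x y) = outer (ct x) (inverse (1 + b) *\<^sub>l ct y)"
      unfolding \<psi>_def b(2) psi_outer vm_lsc by simp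
    have "mm N (mm N (outer (ct x) (ct y)) L) (\<psi> (outer x y)) = outer (ct x) (b *\<^sub>l inverse (1 + b) *\<^sub>l ct y)"
      unfolding ps mm_outer(2) vm_outer b_def BL[OF x y] ..
    then have "\<psi> (outer x y) + mm N (mm N (outer (ct x) (ct y)) L) (\<psi> (outer x y))
        = outer (ct x) ((1 + b) *\<^sub>l inverse (1 + b) *\<^sub>l ct y)"
      by (simp only: ps outer_add lsc_add_left lsc_one)
    then show "\<psi> (outer x y) + mm N (mm N (outer (\<lambda>i. \<tau> (x i)) (\<lambda>j. \<tau> (y j))) L) (\<psi> (outer x y))
        = outer (\<lambda>i. \<tau> (x i)) (\<lambda>j. \<tau> (y j))"
      using b(1) by (simp add: ct_def[symmetric])
  qed
  have "\<exists>Y\<in>fmat m n. \<phi> X = mm m' K (mm n' Y H) \<and>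
      Y + mm m (mm n (\<lambda>i j. \<tau> (X i j)) L) Y = (\<lambda>i j. \<tau> (X i j)) \<and>
      Y + mm m (mm n Y L) (\<lambda>i j. \<tau> (X i j)) = (\<lambda>i j. \<tau> (X i j))" if X: "X \<in> fmat m n" for X
  proof (rule bexI[of _ "\<psi> X"], intro conjI)
    have mt: "mt X = (\<lambda>i j. \<tau> (X i j))" by (simp add: mt_def)
    have XM: "mt X \<in> fmat m n" by (rule mt_fmat[OF X])
    note D = D_zero[OF X]
    have YN: "\<psi> X \<in> fmat N N" by (rule fmat_mono[OF psi_bd[OF X] N(1,2)])
    have E: "\<psi> X + mm N (mm N (mt X) L) (\<psi> X) = mt X" using D by (simp add: D_def)
    note E' = D_left[OF X D]
    have 1: "\<psi> X = mt X - mm N (mm N (mt X) L) (\<psi> X)" using E by (metis add_diff_cancel_right')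
    have 2: "\<psi> X = mt X - mm N (mm N (\<psi> X) L) (mt X)" using E' by (metis add_diff_cancel_right')
    \<comment> \<open>The two forms of the equation bound the support separately: in the first every
      term has its rows bounded by \<open>m\<close>, in the second every term has its columns
      bounded by \<open>n\<close>.\<close>
    have "\<psi> X \<in> fmat m N"
      by (subst 1) (intro fmat_closed(3) mm_fmat[OF mm_fmat[OF XM L] YN] fmat_mono[OF XM order_refl N(4)])
    moreover have "\<psi> X \<in> fmat N n"
      by (subst 2) (intro fmat_closed(3) mm_fmat[OF mm_fmat[OF YN L] XM] fmat_mono[OF XM N(3) order_refl])
    ultimately show YM: "\<psi> X \<in> fmat m n" unfolding fmat_def by blast
    have r: "mm N (mt X) L = mm n (mt X) L" "mm N (\<psi> X) L = mm n (\<psi> X) L"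
      by (rule mm_restrict[OF XM N(4)], rule mm_restrict[OF YM N(4)])
    have r1: "mm N (mm n (mt X) L) (\<psi> X) = mm m (mm n (mt X) L) (\<psi> X)"
      by (rule mm_restrict[OF mm_fmat[OF XM L] N(3)])
    have r2: "mm N (mm n (\<psi> X) L) (mt X) = mm m (mm n (\<psi> X) L) (mt X)"
      by (rule mm_restrict[OF mm_fmat[OF YM L] N(3)])
    show "\<psi> X + mm m (mm n (\<lambda>i j. \<tau> (X i j)) L) (\<psi> X) = (\<lambda>i j. \<tau> (X i j))"
      using E unfolding r r1 unfolding mt .
    show "\<psi> X + mm m (mm n (\<psi> X) L) (\<lambda>i j. \<tau> (X i j)) = (\<lambda>i j. \<tau> (X i j))"
      using E' unfolding r r2 unfolding mt .
    have "mm m' K (mm n' (\<psi> X) H) = mm m' (mm m' K Ki) (mm n' (\<phi> X) (mm n' Hi H))"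
      unfolding \<psi>_def mm_assoc ..
    also have "\<dots> = \<phi> X"
      unfolding K(3) H(4) mm_id_right[OF bd[OF X] order_refl] by (rule mm_id_left[OF bd[OF X] order_refl])
    finally show "\<phi> X = mm m' K (mm n' (\<psi> X) H)" by simp
  qed
  with mm nn \<tau> L K(1-4) H(1-4) show ?thesis by blast
qed

subsection \<open>Transfer to matrices with carrier\<close>

definition ff :: "'a::zero mat \<Rightarrow> nat \<Rightarrow> nat \<Rightarrow> 'a" where
  "ff A = (\<lambda>i j. if i < dim_row A \<and> j < dim_col A then A $$ (i, j) else 0)"

definition mf :: "nat \<Rightarrow> nat \<Rightarrow> (nat \<Rightarrow> nat \<Rightarrow> 'a) \<Rightarrow> 'a mat" where
  "mf m n X = mat m n (\<lambda>(i, j). X i j)"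

lemma mf_carrier [simp]: "mf m n X \<in> carrier_mat m n"
  by (simp add: mf_def)

lemma ff_fmat: "A \<in> carrier_mat m n \<Longrightarrow> ff A \<in> fmat m n"
  by (auto simp: ff_def fmat_def)

lemma ff_mf: "X \<in> fmat m n \<Longrightarrow> ff (mf m n X) = X"
  by (auto simp: ff_def mf_def fmat_def fun_eq_iff)

lemma mf_ff: "A \<in> carrier_mat m n \<Longrightarrow> mf m n (ff A) = A"
  by (intro eq_matI) (auto simp: ff_def mf_def)

lemma ff_inject: "A \<in> carrier_mat m n \<Longrightarrow> B \<in> carrier_mat m n \<Longrightarrow> ff A = ff B \<longleftrightarrow> A = B"
  by (metis mf_ff)

lemma ff_add: "A \<in> carrier_mat m n \<Longrightarrow> B \<in> carrier_mat m n \<Longrightarrow> ff (A + B) = ff A + ff B"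
  for A B :: "'a::division_ring mat"
  by (auto simp: ff_def fun_eq_iff)

lemma ff_diff: "A \<in> carrier_mat m n \<Longrightarrow> B \<in> carrier_mat m n \<Longrightarrow> ff (A - B) = ff A - ff B"
  for A B :: "'a::division_ring mat"
  by (auto simp: ff_def fun_eq_iff)

lemma ff_zero [simp]: "ff (0\<^sub>m m n) = (0 :: nat \<Rightarrow> nat \<Rightarrow> 'a::division_ring)"
  by (auto simp: ff_def fun_eq_iff)

lemma ff_one: "ff (1\<^sub>m n) = (idm n :: nat \<Rightarrow> nat \<Rightarrow> 'a::division_ring)"
  by (auto simp: ff_def fun_eq_iff idm_def)

lemma ff_mult:
  fixes A B :: "'a::division_ring mat"
  assumes "A \<in> carrier_mat m k" "B \<in> carrier_mat k n"
  shows "ff (A * B) = mm k (ff A) (ff B)"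
proof (intro ext)
  fix i j
  show "ff (A * B) i j = mm k (ff A) (ff B) i j"
    using assms
    by (cases "i < m"; cases "j < n")
      (auto simp: ff_def mm_def scalar_prod_def lessThan_atLeast0 intro!: sum.cong)
qed

lemma ff_eq_0_iff: "A \<in> carrier_mat m n \<Longrightarrow> ff A = 0 \<longleftrightarrow> A = 0\<^sub>m m n" for A :: "'a::division_ring mat"
  using ff_inject[of A m n "0\<^sub>m m n"] by simp

lemma GL_iff: "A \<in> GL n \<longleftrightarrow> A \<in> carrier_mat n n \<and> (\<exists>B\<in>carrier_mat n n. B * A = 1\<^sub>m n \<and> A * B = 1\<^sub>m n)"
  by (auto simp: GL_def Units_def ring_mat_simps)

lemma mat_inv_GL:
  assumes "A \<in> GL n"
  shows "mat_inv n A \<in> carrier_mat n n" "mat_inv n A * A = 1\<^sub>m n" "A * mat_inv n A = 1\<^sub>m n"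
proof -
  interpret semiring "ring_mat TYPE('a) n ()" by (rule semiring_mat)
  have A: "A \<in> Units (ring_mat TYPE('a) n ())" using assms by (simp add: GL_def)
  from Units_inv_closed[OF A] Units_l_inv[OF A] Units_r_inv[OF A]
  show "mat_inv n A \<in> carrier_mat n n" "mat_inv n A * A = 1\<^sub>m n" "A * mat_inv n A = 1\<^sub>m n"
    by (simp_all add: mat_inv_def ring_mat_simps)
qed

lemma mf_mult:
  fixes A B :: "nat \<Rightarrow> nat \<Rightarrow> 'a::division_ring"
  assumes "A \<in> fmat m k" "B \<in> fmat k n"
  shows "mf m k A * mf k n B = mf m n (mm k A B)"
proof -
  have "ff (mf m k A * mf k n B) = mm k A B"
    unfolding ff_mult[OF mf_carrier mf_carrier] ff_mf[OF assms(1)] ff_mf[OF assms(2)] ..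
  then show ?thesis 
    using mf_ff[OF mult_carrier_mat[OF mf_carrier[of m k A] mf_carrier[of k n B]]] by simp
qed

lemma mf_idm: "mf n n (idm n) = (1\<^sub>m n :: 'a::division_ring mat)"
  unfolding ff_one[symmetric] by (rule mf_ff) simp

lemma mf_GL:
  fixes K :: "nat \<Rightarrow> nat \<Rightarrow> 'a::division_ring"
  assumes "K \<in> fmat n n" "Ki \<in> fmat n n" "mm n K Ki = idm n" "mm n Ki K = idm n"
  shows "mf n n K \<in> GL n"
proof -
  have "mf n n K * mf n n Ki = 1\<^sub>m n" "mf n n Ki * mf n n K = 1\<^sub>m n"
    unfolding mf_mult[OF assms(1,2)] mf_mult[OF assms(2,1)] assms(3,4) mf_idm by (rule refl)+
  then show ?thesis unfolding GL_iff using mf_carrier by blast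
qed

section \<open>Rank, adjacency and the standard maximal sets in carrier matrices\<close>

lemma finite_rank_set:
  "finite {card S | S. S \<subseteq> mat_of_row ` set (rows A) \<and> left_lin_indep 1 (dim_col A) S}"
proof -
  have "{card S | S. S \<subseteq> mat_of_row ` set (rows A) \<and> left_lin_indep 1 (dim_col A) S}
      \<subseteq> card ` Pow (mat_of_row ` set (rows A))" by auto
  then show ?thesis by (rule finite_subset) simp
qed

lemma rank_le_iff:
  "rank A \<le> k \<longleftrightarrow> (\<forall>S. S \<subseteq> mat_of_row ` set (rows A) \<longrightarrow> left_lin_indep 1 (dim_col A) S \<longrightarrow> card S \<le> k)"
proof -
  have "left_lin_indep 1 (dim_col A) {}" by (simp add: left_lin_indep_def)
  then have "{card S | S. S \<subseteq> mat_of_row ` set (rows A) \<and> left_lin_indep 1 (dim_col A) S} \<noteq> {}" by blast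
  then show ?thesis unfolding rank_def by (subst Max_le_iff[OF finite_rank_set]) auto
qed

lemma left_lin_indepD:
  assumes "left_lin_indep m n S" "finite F" "F \<subseteq> S"
    and "\<And>i j. i < m \<Longrightarrow> j < n \<Longrightarrow> (\<Sum>X\<in>F. c X * X $$ (i, j)) = 0" "X \<in> F"
  shows "c X = 0"
  using assms unfolding left_lin_indep_def by blast

lemma right_lin_indepD:
  assumes "right_lin_indep m n S" "finite F" "F \<subseteq> S"
    and "\<And>i j. i < m \<Longrightarrow> j < n \<Longrightarrow> (\<Sum>X\<in>F. X $$ (i, j) * c X) = 0" "X \<in> F"
  shows "c X = 0"
  using assms unfolding right_lin_indep_def by blast

lemma left_lin_indep_single:
  assumes "r \<in> carrier_mat 1 n" "r \<noteq> 0\<^sub>m 1 n"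
  shows "left_lin_indep 1 n {r}"
  unfolding left_lin_indep_def
proof (intro conjI allI impI)
  show "{r} \<subseteq> carrier_mat 1 n" using assms by simp
  fix F and c :: "'a mat \<Rightarrow> 'a"
  assume F: "finite F \<and> F \<subseteq> {r} \<and> (\<forall>i<1. \<forall>j<n. (\<Sum>X\<in>F. c X * X $$ (i, j)) = 0)"
  obtain j where j: "j < n" "r $$ (0, j) \<noteq> 0"
  proof (rule ccontr)
    assume "\<not> thesis"
    with that have "\<forall>j<n. r $$ (0, j) = 0" by blast
    then have "r = 0\<^sub>m 1 n" using assms(1) by (intro eq_matI) auto
    with assms show False by simp
  qed
  from F have "F = {} \<or> F = {r}" by blast
  then show "\<forall>X\<in>F. c X = 0"
  proof
    assume "F = {r}"
    with F j have "c r * r $$ (0, j) = 0" by auto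
    with j \<open>F = {r}\<close> show ?thesis by simp
  qed simp
qed

text \<open>Relative to one nonzero row every other row is a left multiple of it, and the factors
  form the column vector. Conversely, two rows of an outer product are left multiples of one vector
  and cannot be independent.\<close>

lemma rank_le_1_iff:
  fixes A :: "'a::division_ring mat"
  assumes A: "A \<in> carrier_mat m n"
  shows "rank A \<le> 1 \<longleftrightarrow> ff A \<in> Rk1 m n"
proof
  have row: "mat_of_row (row A i) \<in> carrier_mat 1 n" "mat_of_row (row A i) \<in> mat_of_row ` set (rows A)"
    "\<And>j. j < n \<Longrightarrow> mat_of_row (row A i) $$ (0, j) = A $$ (i, j)" if "i < m" for i
    using A that by (auto simp: rows_def)
  assume "rank A \<le> 1"
  then have le: "\<And>S. S \<subseteq> mat_of_row ` set (rows A) \<Longrightarrow> left_lin_indep 1 n S \<Longrightarrow> card S \<le> 1"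
    using A unfolding rank_le_iff by auto
  show "ff A \<in> Rk1 m n"
  proof (cases "A = 0\<^sub>m m n")
    case True
    then show ?thesis by simp
  next
    case False
    then obtain p q where pq: "p < m" "q < n" "A $$ (p, q) \<noteq> 0"
      using A by (metis (no_types, lifting) carrier_matD eq_matI index_zero_mat)
    define r where "r i = mat_of_row (row A i)" for i
    have ri: "r i \<in> carrier_mat 1 n" "r i \<in> mat_of_row ` set (rows A)"
      "\<And>j. j < n \<Longrightarrow> r i $$ (0, j) = A $$ (i, j)" if "i < m" for i
      using row[OF that] by (simp_all add: r_def)
    have "\<exists>c. \<forall>j<n. A $$ (i, j) = c * A $$ (p, j)" if i: "i < m" for i
    \<comment> \<open>The rank counts a set of rows, so equal rows collapse to one element and
      cannot be tested as a pair.\<close>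
    proof (cases "r i = r p")
      case True
      then have "\<forall>j<n. A $$ (i, j) = 1 * A $$ (p, j)" using ri(3)[OF i] ri(3)[OF pq(1)] by auto
      then show ?thesis by blast
    next
      case ne: False
      have "\<not> left_lin_indep 1 n {r p, r i}"
        using le[of "{r p, r i}"] ri(2)[OF i] ri(2)[OF pq(1)] ne by auto
      then obtain F c where F: "finite F" "F \<subseteq> {r p, r i}" "\<forall>j<n. (\<Sum>X\<in>F. c X * X $$ (0, j)) = 0" "\<exists>X\<in>F. c X \<noteq> 0"
        using ri(1)[OF i] ri(1)[OF pq(1)] unfolding left_lin_indep_def by auto
      define d where "d X = (if X \<in> F then c X else 0)" for X
      have "(\<Sum>X\<in>F. c X * X $$ (0, j)) = (\<Sum>X\<in>{r p, r i}. d X * X $$ (0, j))" for j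
        using F(2) by (intro sum.mono_neutral_cong_left) (auto simp: d_def)
      then have s: "d (r p) * A $$ (p, j) + d (r i) * A $$ (i, j) = 0" if "j < n" for j
        using F(3) that ne ri(3)[OF i that] ri(3)[OF pq(1) that] by auto
      have "d (r i) \<noteq> 0"
      proof
        assume z: "d (r i) = 0"
        with s[OF pq(2)] pq(3) have "d (r p) = 0" by simp
        with z F(2,4) show False by (auto simp: d_def split: if_splits)
      qed
      have "A $$ (i, j) = (- inverse (d (r i)) * d (r p)) * A $$ (p, j)" if "j < n" for j
      proof -
        have "d (r i) * A $$ (i, j) = - (d (r p) * A $$ (p, j))"
          using s[OF that] by (simp add: eq_neg_iff_add_eq_0 add.commute)
        then have "inverse (d (r i)) * (d (r i) * A $$ (i, j)) = inverse (d (r i)) * - (d (r p) * A $$ (p, j))" by simp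
        then show ?thesis using \<open>d (r i) \<noteq> 0\<close> by (simp add: mult.assoc[symmetric])
      qed
      then show ?thesis by blast
    qed
    then obtain x where x: "\<And>i j. i < m \<Longrightarrow> j < n \<Longrightarrow> A $$ (i, j) = x i * A $$ (p, j)" by metis
    have "ff A = outer (\<lambda>i. if i < m then x i else 0) (\<lambda>j. if j < n then A $$ (p, j) else 0)"
    proof (intro ext)
      fix i j
      show "ff A i j = outer (\<lambda>i. if i < m then x i else 0) (\<lambda>j. if j < n then A $$ (p, j) else 0) i j"
        using A x[of i j] by (simp add: ff_def)
    qed
    moreover have "(\<lambda>i. if i < m then x i else 0) \<in> fvec m" "(\<lambda>j. if j < n then A $$ (p, j) else 0) \<in> fvec n"
      by (auto simp: fvec_def)
    ultimately show ?thesis unfolding Rk1_def by blast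
  qed
next
  assume "ff A \<in> Rk1 m n"
  then obtain x y where xy: "ff A = outer x y" by (auto simp: Rk1_def)
  have ent: "A $$ (i, j) = x i * y j" if "i < m" "j < n" for i j
    using fun_cong[OF fun_cong[OF xy, of i], of j] A that by (simp add: ff_def)
  show "rank A \<le> 1"
    unfolding rank_le_iff
  proof (intro allI impI, rule ccontr)
    fix S assume S: "S \<subseteq> mat_of_row ` set (rows A)" "left_lin_indep 1 (dim_col A) S" "\<not> card S \<le> 1"
    then have "finite S" using finite_subset by fastforce
    with S(3) obtain r s where rs: "r \<in> S" "s \<in> S" "r \<noteq> s" by (metis One_nat_def card_le_Suc0_iff_eq)
    have el: "\<exists>i<m. t = mat_of_row (row A i)" if "t \<in> S" for t
    proof -
      have "t \<in> mat_of_row ` set (rows A)" using S(1) that by blast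
      then show ?thesis using A by (auto simp: rows_def)
    qed
    from el[OF rs(1)] el[OF rs(2)] obtain i k where
      ik: "i < m" "k < m" "r = mat_of_row (row A i)" "s = mat_of_row (row A k)" by blast
    have rj: "r $$ (0, j) = x i * y j" "s $$ (0, j) = x k * y j" if "j < n" for j
      using ik A ent that by simp_all
    have indep: "c r = 0 \<and> c s = 0" if "\<forall>j<n. c r * r $$ (0, j) + c s * s $$ (0, j) = 0" for c
    proof -
      have "c X = 0" if X: "X \<in> {r, s}" for X
      proof (rule left_lin_indepD[OF S(2) _ _ _ X])
        show "finite {r, s}" "{r, s} \<subseteq> S" using rs by simp_all
        fix i j :: nat assume "i < 1" "j < dim_col A"
        then show "(\<Sum>X\<in>{r, s}. c X * X $$ (i, j)) = 0"
          using \<open>\<forall>j<n. _ j\<close> rs(3) A by simp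
      qed
      then show ?thesis by simp
    qed
    show False
    proof (cases "x i = 0")
      case True
      have "(1::'a) = 0"
        using indep[of "\<lambda>X. if X = r then 1 else 0"] rj True rs(3) by auto
      then show False by simp
    next
      case False
      \<comment> \<open>The coefficient at \<open>r\<close> cancels \<open>y j\<close> against its
        multiple \<open>x k * inverse (x i)\<close>, giving a relation whose coefficient at
        \<open>s\<close> is \<open>1\<close>.\<close>
      define c where "c X = (if X = r then - (x k * inverse (x i)) else 1)" for X
      have "c r * r $$ (0, j) + c s * s $$ (0, j) = 0" if "j < n" for j
      proof -
        have "inverse (x i) * (x i * y j) = y j" using False by (simp add: mult.assoc[symmetric])
        then show ?thesis using rj[OF that] rs(3) by (simp add: c_def mult.assoc)
      qed
      with indep[of c] have "c s = 0" by blast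
      then show False using rs(3) by (simp add: c_def)
    qed
  qed
qed

lemma rank_eq_1_iff:
  fixes A :: "'a::division_ring mat"
  assumes A: "A \<in> carrier_mat m n"
  shows "rank A = 1 \<longleftrightarrow> ff A \<in> Rk1 m n \<and> ff A \<noteq> 0"
proof -
  have "rank A \<le> 0 \<longleftrightarrow> A = 0\<^sub>m m n"
  proof
    assume r: "rank A \<le> 0"
    show "A = 0\<^sub>m m n"
    proof (rule ccontr)
      assume "A \<noteq> 0\<^sub>m m n"
      then obtain p q where pq: "p < m" "q < n" "A $$ (p, q) \<noteq> 0"
        using A by (metis (no_types, lifting) carrier_matD eq_matI index_zero_mat)
      define r where "r = mat_of_row (row A p)"
      have r1: "r \<in> carrier_mat 1 n" "r $$ (0, q) \<noteq> 0" using A pq by (auto simp: r_def)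
      then have "r \<noteq> 0\<^sub>m 1 n" using pq by auto
      from left_lin_indep_single[OF r1(1) this] have "left_lin_indep 1 (dim_col A) {r}" using A by simp
      moreover have "{r} \<subseteq> mat_of_row ` set (rows A)" using A pq by (auto simp: r_def rows_def)
      ultimately have "card {r} \<le> 0" using \<open>rank A \<le> 0\<close> unfolding rank_le_iff by blast
      then show False by simp
    qed
  next
    assume A0: "A = 0\<^sub>m m n"
    show "rank A \<le> 0" unfolding rank_le_iff
    proof (intro allI impI)
      fix S assume S: "S \<subseteq> mat_of_row ` set (rows A)" "left_lin_indep 1 (dim_col A) S"
      have "S = {}"
      proof (rule ccontr)
        assume "S \<noteq> {}"
        then obtain s where s: "s \<in> S" by blast
        then obtain i where "i < m" "s = mat_of_row (row A i)" using S(1) A by (auto simp: rows_def)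
        then have s0: "s $$ (0, j) = 0" if "j < n" for j using A0 that by simp
        have "(1::'a) = 0"
          by (rule left_lin_indepD[OF S(2), of "{s}" "\<lambda>_. 1" s]) (use s s0 A in auto)
        then show False by simp
      qed
      then show "card S \<le> 0" by simp
    qed
  qed
  then show ?thesis using rank_le_1_iff[OF A] ff_eq_0_iff[OF A] by linarith
qed

lemma adjacent_iff:
  fixes A B :: "'a::division_ring mat"
  assumes "A \<in> carrier_mat m n" "B \<in> carrier_mat m n"
  shows "adjacent A B \<longleftrightarrow> ff A - ff B \<in> Rk1 m n \<and> ff A \<noteq> ff B"
proof -
  have "A - B \<in> carrier_mat m n" using assms(2) by (rule minus_carrier_mat)
  from rank_eq_1_iff[OF this] show ?thesis by (simp add: adjacent_def ff_diff[OF assms])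
qed

lemma first_row_mats_iff:
  "F \<in> first_row_mats m n \<longleftrightarrow> F \<in> carrier_mat m n \<and> (\<exists>y\<in>fvec n. ff F = outer (ev 0) y)"
  if "0 < m" for F :: "'a::division_ring mat"
proof
  assume "F \<in> first_row_mats m n"
  then obtain x where F: "F = mat m n (\<lambda>(i, j). if i = 0 then x j else 0)" by (auto simp: first_row_mats_def)
  have Fc: "F \<in> carrier_mat m n" unfolding F by (rule mat_carrier)
  have "ff F = outer (ev 0) (\<lambda>j. if j < n then x j else 0)"
    using that by (auto simp: F ff_def ev_def fun_eq_iff)
  moreover have "(\<lambda>j. if j < n then x j else 0) \<in> fvec n" by (auto simp: fvec_def)
  ultimately show "F \<in> carrier_mat m n \<and> (\<exists>y\<in>fvec n. ff F = outer (ev 0) y)"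
    using Fc by blast
next
  assume a: "F \<in> carrier_mat m n \<and> (\<exists>y\<in>fvec n. ff F = outer (ev 0) y)"
  then obtain y where y: "ff F = outer (ev 0) y" by blast
  have "F = mat m n (\<lambda>(i, j). if i = 0 then y j else 0)"
  proof (rule eq_matI)
    fix i j assume "i < dim_row (mat m n (\<lambda>(i, j). if i = 0 then y j else 0))" "j < dim_col (mat m n (\<lambda>(i, j). if i = 0 then y j else 0))"
    then show "F $$ (i, j) = mat m n (\<lambda>(i, j). if i = 0 then y j else 0) $$ (i, j)"
      using fun_cong[OF fun_cong[OF y, of i], of j] a by (auto simp: ff_def ev_def)
  qed (use a in auto)
  then show "F \<in> first_row_mats m n" unfolding first_row_mats_def by blast
qed

lemma first_col_mats_iff:
  "F \<in> first_col_mats m n \<longleftrightarrow> F \<in> carrier_mat m n \<and> (\<exists>x\<in>fvec m. ff F = outer x (ev 0))"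
  if "0 < n" for F :: "'a::division_ring mat"
proof
  assume "F \<in> first_col_mats m n"
  then obtain x where F: "F = mat m n (\<lambda>(i, j). if j = 0 then x i else 0)" by (auto simp: first_col_mats_def)
  have Fc: "F \<in> carrier_mat m n" unfolding F by (rule mat_carrier)
  have "ff F = outer (\<lambda>i. if i < m then x i else 0) (ev 0)"
    using that by (auto simp: F ff_def ev_def fun_eq_iff)
  moreover have "(\<lambda>i. if i < m then x i else 0) \<in> fvec m" by (auto simp: fvec_def)
  ultimately show "F \<in> carrier_mat m n \<and> (\<exists>x\<in>fvec m. ff F = outer x (ev 0))"
    using Fc by blast
next
  assume a: "F \<in> carrier_mat m n \<and> (\<exists>x\<in>fvec m. ff F = outer x (ev 0))"
  then obtain y where y: "ff F = outer y (ev 0)" by blast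
  have "F = mat m n (\<lambda>(i, j). if j = 0 then y i else 0)"
  proof (rule eq_matI)
    fix i j assume "i < dim_row (mat m n (\<lambda>(i, j). if j = 0 then y i else 0))" "j < dim_col (mat m n (\<lambda>(i, j). if j = 0 then y i else 0))"
    then show "F $$ (i, j) = mat m n (\<lambda>(i, j). if j = 0 then y i else 0) $$ (i, j)"
      using fun_cong[OF fun_cong[OF y, of i], of j] a by (auto simp: ff_def ev_def)
  qed (use a in auto)
  then show "F \<in> first_col_mats m n" unfolding first_col_mats_def by blast
qed

lemma mv_ev: "k < N \<Longrightarrow> mv N A (ev k) = (\<lambda>i. A i k)" for A :: "nat \<Rightarrow> nat \<Rightarrow> 'a::division_ring"
proof
  fix i assume k: "k < N"
  have "mv N A (ev k) i = (\<Sum>l<N. if l = k then A i k else 0)"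
    unfolding mv_def by (rule sum.cong) (auto simp: ev_def)
  then show "mv N A (ev k) i = A i k" using k by simp
qed

lemma vm_ev: "k < N \<Longrightarrow> vm N (ev k) A = A k" for A :: "nat \<Rightarrow> nat \<Rightarrow> 'a::division_ring"
proof
  fix i assume k: "k < N"
  have "vm N (ev k) A i = (\<Sum>l<N. if l = k then A k i else 0)"
    unfolding vm_def by (rule sum.cong) (auto simp: ev_def)
  then show "vm N (ev k) A i = A k i" using k by simp
qed

lemma lind_single: "v \<noteq> 0 \<Longrightarrow> lind {..<Suc 0} (\<lambda>_. v)"
  by (simp add: lind_def lessThan_Suc)

lemma ex_GL_col:
  fixes p :: "nat \<Rightarrow> 'a::division_ring"
  assumes "p \<in> fvec N" "p \<noteq> 0" "0 < N"
  shows "\<exists>P\<in>GL N. mv N (ff P) (ev 0) = p"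
proof -
  have "lind {..<Suc 0} (\<lambda>i. vop p)" using assms(2) by (intro lind_single) simp
  from extend_cols[OF this assms(1)] obtain K Ki where K: "K \<in> fmat N N" "Ki \<in> fmat N N"
    "mm N K Ki = idm N" "mm N Ki K = idm N" "\<forall>a. K a 0 = p a" by auto
  have "mv N (ff (mf N N K)) (ev 0) = p" unfolding ff_mf[OF K(1)] mv_ev[OF assms(3)] using K(5) by (intro ext) simp
  with mf_GL[OF K(1-4)] show ?thesis by blast
qed

lemma ex_GL_row:
  fixes q :: "nat \<Rightarrow> 'a::division_ring"
  assumes "q \<in> fvec N" "q \<noteq> 0" "0 < N"
  shows "\<exists>Q\<in>GL N. vm N (ev 0) (ff Q) = q"
proof -
  from extend_rows[OF lind_single[OF assms(2)] assms(1)] obtain K Ki where K: "K \<in> fmat N N" "Ki \<in> fmat N N"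
    "mm N K Ki = idm N" "mm N Ki K = idm N" "K 0 = q" by auto
  have "vm N (ev 0) (ff (mf N N K)) = q" unfolding ff_mf[OF K(1)] vm_ev[OF assms(3)] by (rule K(5))
  with mf_GL[OF K(1-4)] show ?thesis by blast
qed

lemma outer_in_fmat_bounded:
  fixes p w :: "nat \<Rightarrow> 'a::division_ring"
  assumes "outer p w \<in> fmat m n" "p \<noteq> 0"
  shows "w \<in> fvec n"
  using outer_fmatD(2)[OF assms] by (cases "w = 0") auto

lemma outer_in_fmat_bounded':
  fixes q w :: "nat \<Rightarrow> 'a::division_ring"
  assumes "outer w q \<in> fmat m n" "q \<noteq> 0"
  shows "w \<in> fvec m"
  using outer_fmatD(1)[OF assms(1) _ assms(2)] by (cases "w = 0") auto

lemma ev_not_parallel: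
  fixes q :: "nat \<Rightarrow> 'a::division_ring"
  assumes "ev 0 = s *\<^sub>l q" "ev (Suc 0) = t *\<^sub>l q"
  shows False
proof -
  have e: "s * q 0 = 1" "s * q 1 = 0" "t * q 0 = 0" "t * q 1 = 1"
    using fun_cong[OF assms(1), of 0] fun_cong[OF assms(1), of 1] fun_cong[OF assms(2), of 0] fun_cong[OF assms(2), of 1]
    by (simp_all add: ev_def)
  from e(1) have "q 0 \<noteq> 0" by auto
  with e(3) have "t = 0" by simp
  with e(4) show False by simp
qed

subsection \<open>Maximal sets and non-degeneracy\<close>

text \<open>An invertible \<open>P\<close> with first column \<open>p\<close> produces the required
  form. For maximality, a larger adjacent set, recentred at \<open>C\<close>, lies in some
  \<open>Rset\<close> or \<open>Cset\<close>; it contains \<open>outer p (ev 0)\<close> and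
  \<open>outer p (ev 1)\<close>, which rules out \<open>Cset\<close> and identifies the other with
  \<open>Rset p\<close>.\<close>

lemma maximal_set_row_line:
  fixes C :: "'a::division_ring mat"
  assumes mn: "2 \<le> m" "2 \<le> n" and p: "p \<in> fvec m" "p \<noteq> 0" and C: "C \<in> carrier_mat m n"
  shows "maximal_type_one m n {B \<in> carrier_mat m n. ff B - ff C \<in> Rset p}" (is "maximal_type_one m n ?S")
proof -
  have m0: "0 < m" using mn by simp
  obtain P where P: "P \<in> GL m" "mv m (ff P) (ev 0) = p" using ex_GL_col[OF p m0] by blast
  have Pc: "P \<in> carrier_mat m m" using P(1) by (simp add: GL_iff)
  have PF: "ff (P * F + C) = outer p y + ff C" "P * F + C \<in> carrier_mat m n"
    if F: "F \<in> carrier_mat m n" "ff F = outer (ev 0) y" for F :: "'a mat" and y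
  proof -
    have c: "P * F \<in> carrier_mat m n" using Pc F by simp
    show "ff (P * F + C) = outer p y + ff C"
      unfolding ff_add[OF c C] ff_mult[OF Pc F(1)] F(2) mm_outer P(2) ..
    show "P * F + C \<in> carrier_mat m n" using c C by simp
  qed
  have eq: "?S = (\<lambda>X. P * X + C) ` first_row_mats m n"
  proof
    show "?S \<subseteq> (\<lambda>X. P * X + C) ` first_row_mats m n"
    proof
      fix B assume B: "B \<in> ?S"
      then obtain w where w: "ff B - ff C = outer p w" by (auto elim: RsetE)
      have "ff B - ff C \<in> fmat m n" using B C by (intro fmat_closed(3) ff_fmat) auto
      then have wn: "w \<in> fvec n" unfolding w by (rule outer_in_fmat_bounded[OF _ p(2)])
      define F where "F = mf m n (outer (ev 0) w)"
      have F: "F \<in> carrier_mat m n" "ff F = outer (ev 0) w"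
        unfolding F_def using wn m0 by (auto intro!: ff_mf outer_fmat)
      have "ff B = outer p w + ff C" using w by (metis diff_add_cancel)
      then have "ff (P * F + C) = ff B" using PF(1)[OF F] by simp
      then have "B = P * F + C" using ff_inject[OF PF(2)[OF F], of B] B by simp
      moreover have "F \<in> first_row_mats m n" unfolding first_row_mats_iff[OF m0] using F wn by blast
      ultimately show "B \<in> (\<lambda>X. P * X + C) ` first_row_mats m n" by blast
    qed
    show "(\<lambda>X. P * X + C) ` first_row_mats m n \<subseteq> ?S"
    proof (rule image_subsetI)
      fix F :: "'a mat" assume "F \<in> first_row_mats m n"
      then obtain y where F: "F \<in> carrier_mat m n" "ff F = outer (ev 0) y" unfolding first_row_mats_iff[OF m0] by blast
      show "P * F + C \<in> ?S" using PF[OF F] by (auto simp: Rset_def)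
    qed
  qed
  have adjS: "adjacent_set m n ?S"
    unfolding adjacent_set_def
  proof (intro conjI ballI impI)
    show "?S \<noteq> {}" using C by (auto intro!: exI[of _ C])
    show "?S \<subseteq> carrier_mat m n" by blast
    fix A B assume AB: "A \<in> ?S" "B \<in> ?S" "A \<noteq> B"
    then obtain v w where vw: "ff A - ff C = outer p v" "ff B - ff C = outer p w" by (auto elim!: RsetE)
    have "ff A - ff B = (ff A - ff C) - (ff B - ff C)" by simp
    then have d: "ff A - ff B = outer p (v - w)" by (simp only: vw outer_diff)
    moreover have "ff A - ff B \<in> fmat m n" using AB by (intro fmat_closed(3) ff_fmat) auto
    ultimately have "v - w \<in> fvec n" using outer_in_fmat_bounded[OF _ p(2)] by metis
    then have "ff A - ff B \<in> Rk1 m n" unfolding d by (rule Rk1I[OF p(1)])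
    then show "adjacent A B" using AB ff_inject[of A m n B] by (subst adjacent_iff[of _ m n]) auto
  qed
  moreover have "\<not> (\<exists>T. adjacent_set m n T \<and> ?S \<subset> T)"
  proof
    assume "\<exists>T. adjacent_set m n T \<and> ?S \<subset> T"
    then obtain T D where T: "adjacent_set m n T" "?S \<subseteq> T" "D \<in> T" "D \<notin> ?S" by blast
    have Tc: "B \<in> carrier_mat m n" if "B \<in> T" for B using T(1) that by (auto simp: adjacent_set_def)
    have CT: "C \<in> T" using T(2) C by auto
    have df: "\<exists>u v. ff A - ff B = outer u v" if "A \<in> T" "B \<in> T" for A B
    proof (cases "A = B")
      case True
      then have "ff A - ff B = outer 0 0" by simp
      then show ?thesis by blast
    next
      case False
      then have "adjacent A B" using T(1) that by (auto simp: adjacent_set_def)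
      then have "ff A - ff B \<in> Rk1 m n" using adjacent_iff[OF Tc[OF that(1)] Tc[OF that(2)]] by simp
      then show ?thesis by (auto simp: Rk1_def)
    qed
    have "(\<exists>p. p \<noteq> 0 \<and> (\<lambda>B. ff B - ff C) ` T \<subseteq> Rset p) \<or> (\<exists>q. q \<noteq> 0 \<and> (\<lambda>B. ff B - ff C) ` T \<subseteq> Cset q)"
    proof (rule clique_in_Rset_or_Cset)
      fix B :: "nat \<Rightarrow> nat \<Rightarrow> 'a" assume "B \<in> (\<lambda>B. ff B - ff C) ` T"
      then show "\<exists>u v. B = outer u v" using df[OF _ CT] by auto
    next
      fix B B' assume "B \<in> (\<lambda>B. ff B - ff C) ` T" "B' \<in> (\<lambda>B. ff B - ff C) ` T"
      then obtain E E' where E: "E \<in> T" "E' \<in> T" "B = ff E - ff C" "B' = ff E' - ff C" by blast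
      from df[OF E(1,2)] obtain u v where "ff E - ff E' = outer u v" by blast
      then have "B - B' = outer u v" unfolding E(3,4) by simp
      then show "\<exists>u v. B - B' = outer u v" by blast
    qed
    moreover have mem: "outer p w \<in> (\<lambda>B. ff B - ff C) ` T" if w: "w \<in> fvec n" for w
    proof -
      have o: "outer p w + ff C \<in> fmat m n" by (rule fmat_closed(2)[OF outer_fmat[OF p(1) w] ff_fmat[OF C]])
      have "mf m n (outer p w + ff C) \<in> ?S" unfolding mem_Collect_eq ff_mf[OF o] by (auto simp: Rset_def)
      then have "mf m n (outer p w + ff C) \<in> T" using T(2) by blast
      moreover have "ff (mf m n (outer p w + ff C)) - ff C = outer p w" unfolding ff_mf[OF o] by simp
      ultimately show ?thesis by (metis image_eqI)
    qed
    have e01: "ev 0 \<in> fvec n" "ev (Suc 0) \<in> fvec n" using mn by auto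
    ultimately show False
    proof (elim disjE exE conjE)
      fix q assume q: "(\<lambda>B. ff B - ff C) ` T \<subseteq> Cset q"
      then have "outer p (ev 0) \<in> Cset q" "outer p (ev (Suc 0)) \<in> Cset q" using mem e01 by blast+
      then obtain a b where "outer p (ev 0) = outer a q" "outer p (ev (Suc 0)) = outer b q" by (elim CsetE)
      with outer_eq_rowD[OF _ p(2)] ev_not_parallel show False by metis
    next
      fix r assume r: "(\<lambda>B. ff B - ff C) ` T \<subseteq> Rset r"
      then have "outer p (ev 0) \<in> Rset r" using mem e01 by blast
      moreover have "outer p (ev 0) \<in> Rset p" by (auto simp: Rset_def)
      moreover have "outer p (ev 0) \<noteq> 0" using p(2) by simp
      ultimately have "Rset r = Rset p" by (rule Rset_eq)
      then have "ff D - ff C \<in> Rset p" using r T(3) by blast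
      with T(4) Tc[OF T(3)] show False by blast
    qed
  qed
  ultimately have "maximal_set m n ?S" by (simp add: maximal_set_def)
  then show ?thesis unfolding maximal_type_one_def using eq P(1) C by blast
qed

text \<open>The mirror image, with an invertible \<open>Q\<close> whose first row is
  \<open>q\<close>. The two columns \<open>ev 0\<close> and \<open>ev 1\<close> exclude an
  \<open>Rset\<close>, and right proportionality is reduced to left proportionality by
  \<open>vop\<close>.\<close>

lemma maximal_set_col_line:
  fixes C :: "'a::division_ring mat"
  assumes mn: "2 \<le> m" "2 \<le> n" and q: "q \<in> fvec n" "q \<noteq> 0" and C: "C \<in> carrier_mat m n"
  shows "maximal_type_two m n {B \<in> carrier_mat m n. ff B - ff C \<in> Cset q}" (is "maximal_type_two m n ?S")
proof -
  have n0: "0 < n" using mn by simp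
  obtain Q where Q: "Q \<in> GL n" "vm n (ev 0) (ff Q) = q" using ex_GL_row[OF q n0] by blast
  have Qc: "Q \<in> carrier_mat n n" using Q(1) by (simp add: GL_iff)
  have PF: "ff (F * Q + C) = outer y q + ff C" "F * Q + C \<in> carrier_mat m n"
    if F: "F \<in> carrier_mat m n" "ff F = outer y (ev 0)" for F :: "'a mat" and y
  proof -
    have c: "F * Q \<in> carrier_mat m n" using Qc F by simp
    show "ff (F * Q + C) = outer y q + ff C"
      unfolding ff_add[OF c C] ff_mult[OF F(1) Qc] F(2) mm_outer Q(2) ..
    show "F * Q + C \<in> carrier_mat m n" using c C by simp
  qed
  have eq: "?S = (\<lambda>X. X * Q + C) ` first_col_mats m n"
  proof
    show "?S \<subseteq> (\<lambda>X. X * Q + C) ` first_col_mats m n"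
    proof
      fix B assume B: "B \<in> ?S"
      then obtain w where w: "ff B - ff C = outer w q" by (auto elim: CsetE)
      have "ff B - ff C \<in> fmat m n" using B C by (intro fmat_closed(3) ff_fmat) auto
      then have wm: "w \<in> fvec m" unfolding w by (rule outer_in_fmat_bounded'[OF _ q(2)])
      define F where "F = mf m n (outer w (ev 0))"
      have F: "F \<in> carrier_mat m n" "ff F = outer w (ev 0)"
        unfolding F_def using wm n0 by (auto intro!: ff_mf outer_fmat)
      have "ff B = outer w q + ff C" using w by (metis diff_add_cancel)
      then have "ff (F * Q + C) = ff B" using PF(1)[OF F] by simp
      then have "B = F * Q + C" using ff_inject[OF PF(2)[OF F], of B] B by simp
      moreover have "F \<in> first_col_mats m n" unfolding first_col_mats_iff[OF n0] using F wm by blast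
      ultimately show "B \<in> (\<lambda>X. X * Q + C) ` first_col_mats m n" by blast
    qed
    show "(\<lambda>X. X * Q + C) ` first_col_mats m n \<subseteq> ?S"
    proof (rule image_subsetI)
      fix F :: "'a mat" assume "F \<in> first_col_mats m n"
      then obtain y where F: "F \<in> carrier_mat m n" "ff F = outer y (ev 0)" unfolding first_col_mats_iff[OF n0] by blast
      show "F * Q + C \<in> ?S" using PF[OF F] by (auto simp: Cset_def)
    qed
  qed
  have adjS: "adjacent_set m n ?S"
    unfolding adjacent_set_def
  proof (intro conjI ballI impI)
    show "?S \<noteq> {}" using C by (auto intro!: exI[of _ C])
    show "?S \<subseteq> carrier_mat m n" by blast
    fix A B assume AB: "A \<in> ?S" "B \<in> ?S" "A \<noteq> B"
    then obtain v w where vw: "ff A - ff C = outer v q" "ff B - ff C = outer w q" by (auto elim!: CsetE)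
    have "ff A - ff B = (ff A - ff C) - (ff B - ff C)" by simp
    then have d: "ff A - ff B = outer (v - w) q" by (simp only: vw outer_diff)
    moreover have "ff A - ff B \<in> fmat m n" using AB by (intro fmat_closed(3) ff_fmat) auto
    ultimately have "v - w \<in> fvec m" using outer_in_fmat_bounded'[OF _ q(2)] by metis
    then have "ff A - ff B \<in> Rk1 m n" unfolding d by (rule Rk1I[OF _ q(1)])
    then show "adjacent A B" using AB ff_inject[of A m n B] by (subst adjacent_iff[of _ m n]) auto
  qed
  moreover have "\<not> (\<exists>T. adjacent_set m n T \<and> ?S \<subset> T)"
  proof
    assume "\<exists>T. adjacent_set m n T \<and> ?S \<subset> T"
    then obtain T D where T: "adjacent_set m n T" "?S \<subseteq> T" "D \<in> T" "D \<notin> ?S" by blast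
    have Tc: "B \<in> carrier_mat m n" if "B \<in> T" for B using T(1) that by (auto simp: adjacent_set_def)
    have CT: "C \<in> T" using T(2) C by auto
    have df: "\<exists>u v. ff A - ff B = outer u v" if "A \<in> T" "B \<in> T" for A B
    proof (cases "A = B")
      case True
      then have "ff A - ff B = outer 0 0" by simp
      then show ?thesis by blast
    next
      case False
      then have "adjacent A B" using T(1) that by (auto simp: adjacent_set_def)
      then have "ff A - ff B \<in> Rk1 m n" using adjacent_iff[OF Tc[OF that(1)] Tc[OF that(2)]] by simp
      then show ?thesis by (auto simp: Rk1_def)
    qed
    have "(\<exists>p. p \<noteq> 0 \<and> (\<lambda>B. ff B - ff C) ` T \<subseteq> Rset p) \<or> (\<exists>q. q \<noteq> 0 \<and> (\<lambda>B. ff B - ff C) ` T \<subseteq> Cset q)"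
    proof (rule clique_in_Rset_or_Cset)
      fix B :: "nat \<Rightarrow> nat \<Rightarrow> 'a" assume "B \<in> (\<lambda>B. ff B - ff C) ` T"
      then show "\<exists>u v. B = outer u v" using df[OF _ CT] by auto
    next
      fix B B' assume "B \<in> (\<lambda>B. ff B - ff C) ` T" "B' \<in> (\<lambda>B. ff B - ff C) ` T"
      then obtain E E' where E: "E \<in> T" "E' \<in> T" "B = ff E - ff C" "B' = ff E' - ff C" by blast
      from df[OF E(1,2)] obtain u v where "ff E - ff E' = outer u v" by blast
      then have "B - B' = outer u v" unfolding E(3,4) by simp
      then show "\<exists>u v. B - B' = outer u v" by blast
    qed
    moreover have mem: "outer w q \<in> (\<lambda>B. ff B - ff C) ` T" if w: "w \<in> fvec m" for w
    proof -
      have o: "outer w q + ff C \<in> fmat m n" by (rule fmat_closed(2)[OF outer_fmat[OF w q(1)] ff_fmat[OF C]])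
      have "mf m n (outer w q + ff C) \<in> ?S" unfolding mem_Collect_eq ff_mf[OF o] by (auto simp: Cset_def)
      then have "mf m n (outer w q + ff C) \<in> T" using T(2) by blast
      moreover have "ff (mf m n (outer w q + ff C)) - ff C = outer w q" unfolding ff_mf[OF o] by simp
      ultimately show ?thesis by (metis image_eqI)
    qed
    have e01: "ev 0 \<in> fvec m" "ev (Suc 0) \<in> fvec m" using mn by auto
    ultimately show False
    proof (elim disjE exE conjE)
      fix r assume r: "(\<lambda>B. ff B - ff C) ` T \<subseteq> Rset r"
      then have "outer (ev 0) q \<in> Rset r" "outer (ev (Suc 0)) q \<in> Rset r" using mem e01 by blast+
      then obtain a b where ab: "outer (ev 0) q = outer r a" "outer (ev (Suc 0)) q = outer r b" by (elim RsetE)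
      from outer_eq_colD[OF ab(1) q(2)] outer_eq_colD[OF ab(2) q(2)] obtain s t
        where st: "ev 0 = r *\<^sub>r s" "ev (Suc 0) = r *\<^sub>r t" by blast
      have "vop (ev 0) = op s *\<^sub>l vop r" "vop (ev (Suc 0)) = op t *\<^sub>l vop r"
        unfolding st vop_simps(4) by (rule refl)+
      then show False unfolding vop_ev by (rule ev_not_parallel)
    next
      fix r assume r: "(\<lambda>B. ff B - ff C) ` T \<subseteq> Cset r"
      then have "outer (ev 0) q \<in> Cset r" using mem e01 by blast
      moreover have "outer (ev 0) q \<in> Cset q" by (auto simp: Cset_def)
      moreover have "outer (ev 0) q \<noteq> 0" using q(2) by simp
      ultimately have "Cset r = Cset q" by (rule Cset_eq)
      then have "ff D - ff C \<in> Cset q" using r T(3) by blast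
      with T(4) Tc[OF T(3)] show False by blast
    qed
  qed
  ultimately have "maximal_set m n ?S" by (simp add: maximal_set_def)
  then show ?thesis unfolding maximal_type_two_def using eq Q(1) C by blast
qed

text \<open>If all differences at a point lay in \<open>Rset p\<close> or \<open>Cset q\<close>, the
  two maximal sets through the image of that point would witness degeneracy. The obstacle is that
  the locale allows \<open>p\<close> and \<open>q\<close> of unbounded support.\<close>

lemma nondegenerate_hom_ff:
  fixes \<phi> :: "'a::division_ring mat \<Rightarrow> 'b::division_ring mat"
  assumes mn: "m \<ge> 2" "n \<ge> 2" "m' \<ge> 2" "n' \<ge> 2"
    and hom: "graph_hom m n m' n' \<phi>" and nd: "\<not> degenerate m n m' n' \<phi>"
    and z: "\<phi> (0\<^sub>m m n) = 0\<^sub>m m' n'"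
  shows "nondegenerate_hom m n (\<lambda>X. ff (\<phi> (mf m n X)))"
proof -
  define \<Phi> where "\<Phi> X = ff (\<phi> (mf m n X))" for X
  have car: "\<phi> A \<in> carrier_mat m' n'" if "A \<in> carrier_mat m n" for A
    using hom that by (auto simp: graph_hom_def)
  have bd: "\<Phi> X \<in> fmat m' n'" for X unfolding \<Phi>_def by (rule ff_fmat[OF car[OF mf_carrier]])
  have "nondegenerate_hom m n \<Phi>"
  proof
    show "m \<ge> 2" "n \<ge> 2" by fact+
    have "mf m n (0 :: nat \<Rightarrow> nat \<Rightarrow> 'a) = 0\<^sub>m m n" by (intro eq_matI) (auto simp: mf_def)
    then show "\<Phi> 0 = 0" by (simp add: \<Phi>_def z)
  next
    fix A :: "nat \<Rightarrow> nat \<Rightarrow> 'a" and x y :: "nat \<Rightarrow> 'a"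
    assume a: "A \<in> fmat m n" "x \<in> fvec m" "y \<in> fvec n" "x \<noteq> 0" "y \<noteq> 0"
    have o: "A + outer x y \<in> fmat m n" by (rule fmat_closed(2)[OF a(1) outer_fmat[OF a(2,3)]])
    have "adjacent (mf m n (A + outer x y)) (mf m n A)"
      unfolding adjacent_iff[OF mf_carrier mf_carrier] ff_mf[OF a(1)] ff_mf[OF o] using a by simp
    then have "adjacent (\<phi> (mf m n (A + outer x y))) (\<phi> (mf m n A))"
      using hom by (simp add: graph_hom_def)
    then have "\<Phi> (A + outer x y) - \<Phi> A \<in> Rk1 m' n'" "\<Phi> (A + outer x y) \<noteq> \<Phi> A"
      unfolding adjacent_iff[OF car[OF mf_carrier] car[OF mf_carrier]] by (simp_all add: \<Phi>_def)
    moreover from this(1) obtain u v where uv: "\<Phi> (A + outer x y) - \<Phi> A = outer u v" by (auto simp: Rk1_def)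
    ultimately have "outer u v \<noteq> 0" by (metis right_minus_eq)
    then have "u \<noteq> 0 \<and> v \<noteq> 0" by auto
    with uv show "\<exists>u v. u \<noteq> 0 \<and> v \<noteq> 0 \<and> \<Phi> (A + outer x y) - \<Phi> A = outer u v" by blast
  next
    fix A :: "nat \<Rightarrow> nat \<Rightarrow> 'a" and p q :: "nat \<Rightarrow> 'b"
    assume A: "A \<in> Rk1 m n" and p: "p \<noteq> 0" and q: "q \<noteq> 0"
    show "\<exists>x\<in>fvec m. \<exists>y\<in>fvec n. \<Phi> (A + outer x y) - \<Phi> A \<notin> Rset p \<union> Cset q"
    proof (rule ccontr)
      assume "\<not> ?thesis"
      then have all: "\<Phi> (A + outer x y) - \<Phi> A \<in> Rset p \<union> Cset q" if "x \<in> fvec m" "y \<in> fvec n" for x y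
        using that by blast
      \<comment> \<open>If \<open>p\<close> leaves the index range, \<open>0\<close> is the only
        bounded element of \<open>Rset p\<close>, so any bounded nonzero vector can take its place.
        The same holds for \<open>q\<close>.\<close>
      define p' where "p' = (if p \<in> fvec m' then p else ev 0)"
      define q' where "q' = (if q \<in> fvec n' then q else ev 0)"
      have p': "p' \<in> fvec m'" "p' \<noteq> 0" and q': "q' \<in> fvec n'" "q' \<noteq> 0"
        using p q mn by (auto simp: p'_def q'_def)
      have pp: "B \<in> Rset p'" if B: "B \<in> Rset p" "B \<in> fmat m' n'" for B
      proof (cases "B = 0")
        case False
        obtain w where w: "B = outer p w" using B(1) by (rule RsetE)
        with False have "w \<noteq> 0" by auto
        then have "p \<in> fvec m'" using outer_fmatD(1) B(2) p unfolding w by blast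
        with B show ?thesis by (simp add: p'_def)
      qed simp
      have qq: "B \<in> Cset q'" if B: "B \<in> Cset q" "B \<in> fmat m' n'" for B
      proof (cases "B = 0")
        case False
        obtain w where w: "B = outer w q" using B(1) by (rule CsetE)
        with False have "w \<noteq> 0" by auto
        then have "q \<in> fvec n'" using outer_fmatD(2) B(2) q unfolding w by blast
        with B show ?thesis by (simp add: q'_def)
      qed simp
      have AM: "A \<in> fmat m n" by (rule Rk1_fmat[OF A])
      define a where "a = mf m n A"
      have a: "a \<in> carrier_mat m n" "ff a = A" by (simp_all add: a_def ff_mf[OF AM])
      define M where "M = {B \<in> carrier_mat m' n'. ff B - ff (\<phi> a) \<in> Rset p'}"
      define K where "K = {B \<in> carrier_mat m' n'. ff B - ff (\<phi> a) \<in> Cset q'}"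
      have "maximal_type_one m' n' M" unfolding M_def by (rule maximal_set_row_line[OF mn(3,4) p' car[OF a(1)]])
      moreover have "maximal_type_two m' n' K" unfolding K_def by (rule maximal_set_col_line[OF mn(3,4) q' car[OF a(1)]])
      moreover have "rank a \<le> 1" using rank_le_1_iff[OF a(1)] A a(2) by simp
      moreover have "\<phi> a \<in> M \<inter> K" using car[OF a(1)] by (simp add: M_def K_def)
      moreover have "\<phi> ` {X \<in> carrier_mat m n. rank (X - a) \<le> 1} \<subseteq> M \<union> K"
      proof (rule image_subsetI)
        fix X assume "X \<in> {X \<in> carrier_mat m n. rank (X - a) \<le> 1}"
        then have X: "X \<in> carrier_mat m n" "rank (X - a) \<le> 1" by auto
        have "X - a \<in> carrier_mat m n" using a(1) by (rule minus_carrier_mat)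
        from rank_le_1_iff[OF this] X have "ff X - A \<in> Rk1 m n" by (simp add: ff_diff[OF X(1) a(1)] a(2))
        then obtain x y where xy: "x \<in> fvec m" "y \<in> fvec n" "ff X - A = outer x y" by (auto simp: Rk1_def)
        then have "ff X = A + outer x y" by (metis add.commute diff_add_cancel)
        then have X': "X = mf m n (A + outer x y)" using mf_ff[OF X(1)] by simp
        have "\<Phi> (A + outer x y) - \<Phi> A \<in> Rset p' \<union> Cset q'"
          using all[OF xy(1,2)] pp qq fmat_closed(3)[OF bd bd] by blast
        then show "\<phi> X \<in> M \<union> K"
          using car[OF X(1)] unfolding M_def K_def X' a_def \<Phi>_def by blast
      qed
      ultimately have "degenerate m n m' n' \<phi>" unfolding degenerate_def using a(1) by blast
      with nd show False by contradiction
    qed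
  qed
  then show ?thesis by (simp add: \<Phi>_def[abs_def])
qed

text \<open>
  Full dimension rules out one type of maximal set, because maximal sets of different type that
  share a point meet in parallel matrices only.
\<close>
lemma not_lind_parallel:
  fixes d :: nat
  assumes "lind {..<d} w" "2 \<le> d" "\<And>i. i < d \<Longrightarrow> \<exists>s. w i = s *\<^sub>l v"
  shows False
proof -
  have "\<forall>i\<in>{..<d}. \<exists>s. w i = (\<Sum>j\<in>{0::nat}. s *\<^sub>l v)" using assms(3) by simp
  then obtain s where "\<And>i. i \<in> {..<d} \<Longrightarrow> w i = (\<Sum>j\<in>{0::nat}. s i *\<^sub>l v)" by metis
  from not_lind_in_span[where J = "{0::nat}" and I = "{..<d}", OF _ _ _ this] assms(1,2) show False by simp
qed

text \<open>Extracts from the dimension what the proof uses: \<open>d\<close> members of the set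
  with a common column or a common row, the other factors being independent. Multiplication by
  \<open>P\<close> or \<open>Q\<close> undoes the move into the first row or column.\<close>

lemma has_adj_dim_cases:
  fixes S :: "'a::division_ring mat set"
  assumes S: "has_adj_dim m n S d" and mn: "0 < m" "0 < n"
  obtains (row) p b w where "p \<noteq> 0" "\<And>i. i < d \<Longrightarrow> b i \<in> S \<and> ff (b i) = outer p (w i)" "lind {..<d} w"
  | (col) q b w where "q \<noteq> 0" "\<And>i. i < d \<Longrightarrow> b i \<in> S \<and> ff (b i) = outer (w i) q"
      "lind {..<d} (\<lambda>i. vop (w i))"
proof -
  have Sc: "X \<in> carrier_mat m n" if "X \<in> S" for X
    using S that by (auto simp: has_adj_dim_def adjacent_set_def)
  from S consider
    (1) P T B where "P \<in> GL m" "T = (\<lambda>X. mat_inv m P * X) ` S" "T \<subseteq> first_row_mats m n"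
      "B \<subseteq> T" "left_lin_indep m n B" "finite B" "card B = d"
    | (2) Q T B where "Q \<in> GL n" "T = (\<lambda>X. X * mat_inv n Q) ` S" "T \<subseteq> first_col_mats m n"
      "B \<subseteq> T" "right_lin_indep m n B" "finite B" "card B = d"
    unfolding has_adj_dim_def by blast
  then show ?thesis
  proof cases
    case 1
    obtain e where e: "bij_betw e {..<d} B"
      using ex_bij_betw_nat_finite[OF 1(6)] unfolding 1(7) lessThan_atLeast0 by blast
    have eB: "e i \<in> B" if "i < d" for i using bij_betwE[OF e] that by blast
    have "\<exists>b y. b \<in> S \<and> e i = mat_inv m P * b \<and> ff (e i) = outer (ev 0) y" if "i < d" for i
    proof -
      have "e i \<in> T" "e i \<in> first_row_mats m n" using eB[OF that] 1(3,4) by blast+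
      then show ?thesis unfolding first_row_mats_iff[OF mn(1)] 1(2) by blast
    qed
    then obtain b w where bw: "\<And>i. i < d \<Longrightarrow> b i \<in> S \<and> e i = mat_inv m P * b i \<and> ff (e i) = outer (ev 0) (w i)"
      by metis
    note Pi = mat_inv_GL[OF 1(1)]
    have Pc: "P \<in> carrier_mat m m" using 1(1) by (simp add: GL_iff)
    \<comment> \<open>The first column of \<open>P\<close>: it is what multiplication by
      \<open>P\<close> makes of the common column \<open>ev 0\<close>.\<close>
    define p where "p = mv m (ff P) (ev 0)"
    have "mv m (ff (mat_inv m P)) p = mv m (ff (mat_inv m P * P)) (ev 0)"
      unfolding p_def mv_mm[symmetric] ff_mult[OF Pi(1) Pc] ..
    also have "\<dots> = ev 0" unfolding Pi(2) ff_one by (rule mv_id[OF ev_fvec[OF mn(1)]])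
    finally have "p \<noteq> 0" by auto
    moreover have "b i \<in> S \<and> ff (b i) = outer p (w i)" if i: "i < d" for i
    proof -
      note bi = bw[OF i]
      have bc: "b i \<in> carrier_mat m n" using bi Sc by blast
      have ec: "e i \<in> carrier_mat m n" using bi mult_carrier_mat[OF Pi(1) bc] by simp
      have "P * e i = (P * mat_inv m P) * b i" using bi assoc_mult_mat[OF Pc Pi(1) bc] by simp
      also have "\<dots> = b i" unfolding Pi(3) by (rule left_mult_one_mat[OF bc])
      finally have "ff (b i) = mm m (ff P) (ff (e i))" using ff_mult[OF Pc ec] by simp
      then have "ff (b i) = outer p (w i)" unfolding conjunct2[OF conjunct2[OF bi]] mm_outer p_def .
      then show ?thesis using bi by blast
    qed
    moreover have "lind {..<d} w"
      unfolding lind_def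
    proof (intro allI impI ballI)
      fix c i assume s: "(\<Sum>i<d. c i *\<^sub>l w i) = 0" and i: "i \<in> {..<d}"
      \<comment> \<open>Coefficients indexed by numbers are relabelled by the matrices in
        \<open>B\<close>, as the definition of independence expects.\<close>
      define c' where "c' X = c (inv_into {..<d} e X)" for X
      have ce: "c' (e i) = c i" if "i < d" for i
        using bij_betw_imp_inj_on[OF e] that by (simp add: c'_def inv_into_f_f)
      have "c' (e i) = 0"
      proof (rule left_lin_indepD[OF 1(5,6) order_refl])
        show "e i \<in> B" using eB i by simp
        fix r j assume rj: "r < m" "j < n"
        have "(\<Sum>X\<in>B. c' X * X $$ (r, j)) = (\<Sum>i<d. c' (e i) * e i $$ (r, j))"
          by (rule sum.reindex_bij_betw[OF e, symmetric])
        also have "\<dots> = (\<Sum>i<d. (if r = 0 then c i * w i j else 0))"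
        proof (rule sum.cong[OF refl])
          fix i assume "i \<in> {..<d}"
          then have i: "i < d" by simp
          have "e i \<in> carrier_mat m n" using bw[OF i] Sc mult_carrier_mat[OF Pi(1)] by metis
          then have "e i $$ (r, j) = ff (e i) r j" using rj by (simp add: ff_def)
          also have "\<dots> = ev 0 r * w i j" unfolding conjunct2[OF conjunct2[OF bw[OF i]]] by simp
          finally show "c' (e i) * e i $$ (r, j) = (if r = 0 then c i * w i j else 0)"
            using ce[OF i] by (simp add: ev_def)
        qed
        also have "\<dots> = 0" using fun_cong[OF s, of j] by (cases "r = 0") simp_all
        finally show "(\<Sum>X\<in>B. c' X * X $$ (r, j)) = 0" .
      qed
      then show "c i = 0" using ce i by simp
    qed
    ultimately show ?thesis by (rule row)
  next
    case 2
    obtain e where e: "bij_betw e {..<d} B"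
      using ex_bij_betw_nat_finite[OF 2(6)] unfolding 2(7) lessThan_atLeast0 by blast
    have eB: "e i \<in> B" if "i < d" for i using bij_betwE[OF e] that by blast
    have "\<exists>b y. b \<in> S \<and> e i = b * mat_inv n Q \<and> ff (e i) = outer y (ev 0)" if "i < d" for i
    proof -
      have "e i \<in> T" "e i \<in> first_col_mats m n" using eB[OF that] 2(3,4) by blast+
      then show ?thesis unfolding first_col_mats_iff[OF mn(2)] 2(2) by blast
    qed
    then obtain b w where bw: "\<And>i. i < d \<Longrightarrow> b i \<in> S \<and> e i = b i * mat_inv n Q \<and> ff (e i) = outer (w i) (ev 0)"
      by metis
    note Qi = mat_inv_GL[OF 2(1)]
    have Qc: "Q \<in> carrier_mat n n" using 2(1) by (simp add: GL_iff)
    define q where "q = vm n (ev 0) (ff Q)"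
    have "vm n q (ff (mat_inv n Q)) = vm n (ev 0) (ff (Q * mat_inv n Q))"
      unfolding q_def vm_mm[symmetric] ff_mult[OF Qc Qi(1)] ..
    also have "\<dots> = ev 0" unfolding Qi(3) ff_one by (rule vm_id[OF ev_fvec[OF mn(2)]])
    finally have "q \<noteq> 0" by auto
    moreover have "b i \<in> S \<and> ff (b i) = outer (w i) q" if i: "i < d" for i
    proof -
      note bi = bw[OF i]
      have bc: "b i \<in> carrier_mat m n" using bi Sc by blast
      have ec: "e i \<in> carrier_mat m n" using bi mult_carrier_mat[OF bc Qi(1)] by simp
      have "e i * Q = b i * (mat_inv n Q * Q)" using bi assoc_mult_mat[OF bc Qi(1) Qc] by simp
      also have "\<dots> = b i" unfolding Qi(2) by (rule right_mult_one_mat[OF bc])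
      finally have "ff (b i) = mm n (ff (e i)) (ff Q)" using ff_mult[OF ec Qc] by simp
      then have "ff (b i) = outer (w i) q" unfolding conjunct2[OF conjunct2[OF bi]] mm_outer q_def .
      then show ?thesis using bi by blast
    qed
    moreover have "lind {..<d} (\<lambda>i. vop (w i))"
      unfolding lind_def
    proof (intro allI impI ballI)
      fix c i assume s: "(\<Sum>i<d. c i *\<^sub>l vop (w i)) = 0" and i: "i \<in> {..<d}"
      define c' where "c' X = unop (c (inv_into {..<d} e X))" for X
      have ce: "c' (e i) = unop (c i)" if "i < d" for i
        using bij_betw_imp_inj_on[OF e] that by (simp add: c'_def inv_into_f_f)
      have "c' (e i) = 0"
      proof (rule right_lin_indepD[OF 2(5,6) order_refl])
        show "e i \<in> B" using eB i by simp
        fix r j assume rj: "r < m" "j < n"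
        have "(\<Sum>X\<in>B. X $$ (r, j) * c' X) = (\<Sum>i<d. e i $$ (r, j) * c' (e i))"
          by (rule sum.reindex_bij_betw[OF e, symmetric])
        also have "\<dots> = (\<Sum>i<d. (if j = 0 then w i r * unop (c i) else 0))"
        proof (rule sum.cong[OF refl])
          fix i assume "i \<in> {..<d}"
          then have i: "i < d" by simp
          have "e i \<in> carrier_mat m n" using bw[OF i] Sc mult_carrier_mat[OF _ Qi(1)] by metis
          then have "e i $$ (r, j) = ff (e i) r j" using rj by (simp add: ff_def)
          also have "\<dots> = w i r * ev 0 j" unfolding conjunct2[OF conjunct2[OF bw[OF i]]] by simp
          finally show "e i $$ (r, j) * c' (e i) = (if j = 0 then w i r * unop (c i) else 0)"
            using ce[OF i] by (simp add: ev_def)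
        qed
        also have "\<dots> = 0"
        proof -
          have "unop ((\<Sum>i<d. c i *\<^sub>l vop (w i)) r) = 0" unfolding s by simp
          then have "(\<Sum>i<d. w i r * unop (c i)) = 0" by (simp add: unop_sum vop_def)
          then show ?thesis by (cases "j = 0") simp_all
        qed
        finally show "(\<Sum>X\<in>B. X $$ (r, j) * c' X) = 0" .
      qed
      then show "c i = 0" using ce i by simp
    qed
    ultimately show ?thesis by (rule col)
  qed
qed

section \<open>Block form, invertibility and surjective homomorphisms\<close>

lemma corner_carrier:
  assumes "Y \<in> carrier_mat p q" "p \<le> p'" "q \<le> q'"
  shows "corner p q p' q' Y \<in> carrier_mat p' q'"
  using assms unfolding corner_def by (intro carrier_matI) auto

lemma ff_corner:
  fixes Y :: "'a::division_ring mat"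
  assumes "Y \<in> carrier_mat p q" "p \<le> p'" "q \<le> q'"
  shows "ff (corner p q p' q' Y) = ff Y"
proof (intro ext)
  fix i j
  show "ff (corner p q p' q' Y) i j = ff Y i j"
    using assms by (auto simp: ff_def corner_def)
qed

lemma rhom_nonzero_ring_hom: "rhom \<tau> \<Longrightarrow> nonzero_ring_hom \<tau>"
  unfolding nonzero_ring_hom_def rhom_def by (metis zero_neq_one)

lemma nonzero_ring_hom_rhom:
  assumes "nonzero_ring_hom \<tau>"
  shows "rhom \<tau>"
proof -
  obtain x where x: "\<tau> x \<noteq> 0" using assms by (auto simp: nonzero_ring_hom_def)
  have "\<tau> 1 * \<tau> x = 1 * \<tau> x" using assms by (metis mult_1 nonzero_ring_hom_def)
  with x have "\<tau> 1 = 1" by simp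
  with assms show ?thesis by (simp add: rhom_def nonzero_ring_hom_def)
qed

lemma ff_map_mat: "rhom \<tau> \<Longrightarrow> ff (map_mat \<tau> X) = (\<lambda>i j. \<tau> (ff X i j))"
  by (auto simp: ff_def fun_eq_iff rhom_simps)

lemma quasi_inverse_GL:
  fixes X Y L :: "nat \<Rightarrow> nat \<Rightarrow> 'a::division_ring"
  assumes X: "X \<in> fmat m n" and Y: "Y \<in> fmat m n" and L: "L \<in> fmat n m"
    and E: "Y + mm m (mm n X L) Y = X"
  shows "1\<^sub>m m + mf m n X * mf n m L \<in> GL m"
    and "mat_inv m (1\<^sub>m m + mf m n X * mf n m L) * mf m n X = mf m n Y"
proof -
  have XL: "mm n X L \<in> fmat m m" "mm n Y L \<in> fmat m m" by (rule mm_fmat[OF X L], rule mm_fmat[OF Y L])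
  have A: "idm m + mm n X L \<in> fmat m m" by (rule fmat_closed(2)[OF idm_fmat XL(1)])
  have B: "idm m - mm n Y L \<in> fmat m m" by (rule fmat_closed(3)[OF idm_fmat XL(2)])
  have eq: "1\<^sub>m m + mf m n X * mf n m L = mf m m (idm m + mm n X L)"
    unfolding mf_mult[OF X L] by (intro eq_matI) (auto simp: mf_def idm_def)
  show GL: "1\<^sub>m m + mf m n X * mf n m L \<in> GL m"
    unfolding eq by (rule mf_GL[OF A B quasi_inverse(1,2)[OF X Y L E]])
  note inv = mat_inv_GL[OF GL] and c = conjunct1[OF GL[unfolded GL_iff]]
  have "(1\<^sub>m m + mf m n X * mf n m L) * mf m n Y = mf m n X"
    unfolding eq mf_mult[OF A Y] mm_add_left mm_id_left[OF Y order_refl] E ..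
  then have "mat_inv m (1\<^sub>m m + mf m n X * mf n m L) * mf m n X
      = mat_inv m (1\<^sub>m m + mf m n X * mf n m L) * (1\<^sub>m m + mf m n X * mf n m L) * mf m n Y"
    using assoc_mult_mat[OF inv(1) c mf_carrier[of m n Y]] by simp
  also have "\<dots> = mf m n Y" unfolding inv(2) by (rule left_mult_one_mat[OF mf_carrier])
  finally show "mat_inv m (1\<^sub>m m + mf m n X * mf n m L) * mf m n X = mf m n Y" .
qed

text \<open>Reading the equation back from the opposite ring by \<open>mun\<close> reverses all
  products: \<open>L\<close> moves to the left of \<open>X\<close>, and the inverse to its
  right.\<close>

lemma quasi_inverse_GL':
  fixes X Y L :: "nat \<Rightarrow> nat \<Rightarrow> 'a::division_ring opp"
  assumes X: "X \<in> fmat m n" and Y: "Y \<in> fmat m n" and L: "L \<in> fmat n m"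
    and E: "Y + mm m (mm n X L) Y = X"
  shows "1\<^sub>m m + mf m n (mun L) * mf n m (mun X) \<in> GL m"
    and "mf n m (mun X) * mat_inv m (1\<^sub>m m + mf m n (mun L) * mf n m (mun X)) = mf n m (mun Y)"
proof -
  have XL: "mm n X L \<in> fmat m m" "mm n Y L \<in> fmat m m" by (rule mm_fmat[OF X L], rule mm_fmat[OF Y L])
  have A: "idm m + mm n X L \<in> fmat m m" by (rule fmat_closed(2)[OF idm_fmat XL(1)])
  have B: "idm m - mm n Y L \<in> fmat m m" by (rule fmat_closed(3)[OF idm_fmat XL(2)])
  note q = quasi_inverse(1,2)[OF X Y L E]
  have eq: "1\<^sub>m m + mf m n (mun L) * mf n m (mun X) = mf m m (mun (idm m + mm n X L))"
    unfolding mf_mult[OF mun_fmat[OF L] mun_fmat[OF X]] mm_mun mun_simps(2) mun_idm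
    by (intro eq_matI) (auto simp: mf_def idm_def)
  show GL: "1\<^sub>m m + mf m n (mun L) * mf n m (mun X) \<in> GL m"
    unfolding eq by (rule mf_GL[OF mun_fmat[OF A] mun_fmat[OF B]]) (simp_all only: mm_mun q mun_idm)
  note inv = mat_inv_GL[OF GL] and c = conjunct1[OF GL[unfolded GL_iff]]
  have "mf n m (mun Y) * (1\<^sub>m m + mf m n (mun L) * mf n m (mun X)) = mf n m (mun X)"
    unfolding eq mf_mult[OF mun_fmat[OF Y] mun_fmat[OF A]] mm_mun mm_add_left mm_id_left[OF Y order_refl] E ..
  then have "mf n m (mun X) * mat_inv m (1\<^sub>m m + mf m n (mun L) * mf n m (mun X))
      = mf n m (mun Y) * ((1\<^sub>m m + mf m n (mun L) * mf n m (mun X)) * mat_inv m (1\<^sub>m m + mf m n (mun L) * mf n m (mun X)))"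
    using assoc_mult_mat[OF mf_carrier[of n m "mun Y"] c inv(1)] by simp
  also have "\<dots> = mf n m (mun Y)" unfolding inv(3) by (rule right_mult_one_mat[OF mf_carrier])
  finally show "mf n m (mun X) * mat_inv m (1\<^sub>m m + mf m n (mun L) * mf n m (mun X)) = mf n m (mun Y)" .
qed

lemma hom_form_if_straight:
  fixes \<phi> :: "'a::division_ring mat \<Rightarrow> 'b::division_ring mat"
  assumes car: "\<And>X. X \<in> carrier_mat m n \<Longrightarrow> \<phi> X \<in> carrier_mat m' n'"
    and S: "straight_hom m n (\<lambda>X. ff (\<phi> (mf m n X)))"
    and adj: "\<forall>A\<in>fmat m n. \<forall>x\<in>fvec m. \<forall>y\<in>fvec n.
      \<exists>u v. ff (\<phi> (mf m n (A + outer x y))) - ff (\<phi> (mf m n A)) = outer u v"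
  shows "\<exists>P Q \<tau> L. hom_form m n m' n' \<phi> P Q \<tau> L"
proof -
  from straight_hom_form[OF S ff_fmat[OF car[OF mf_carrier]] adj] obtain \<tau> L K Ki H Hi where
    le: "m \<le> m'" "n \<le> n'" and \<tau>: "rhom \<tau>" and L: "L \<in> fmat n m"
    and K: "K \<in> fmat m' m'" "Ki \<in> fmat m' m'" "mm m' K Ki = idm m'" "mm m' Ki K = idm m'"
    and H: "H \<in> fmat n' n'" "Hi \<in> fmat n' n'" "mm n' H Hi = idm n'" "mm n' Hi H = idm n'"
    and form: "\<forall>X\<in>fmat m n. \<exists>Y\<in>fmat m n. ff (\<phi> (mf m n X)) = mm m' K (mm n' Y H) \<and>
      Y + mm m (mm n (\<lambda>i j. \<tau> (X i j)) L) Y = (\<lambda>i j. \<tau> (X i j)) \<and>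
      Y + mm m (mm n Y L) (\<lambda>i j. \<tau> (X i j)) = (\<lambda>i j. \<tau> (X i j))"
    by (elim conjE exE) blast
  have "hom_form m n m' n' \<phi> (mf m' m' K) (mf n' n' H) \<tau> (mf n m L)"
    unfolding hom_form_def
  proof (intro conjI ballI)
    show "m \<le> m'" "n \<le> n'" by fact+
    show "mf m' m' K \<in> GL m'" by (rule mf_GL[OF K])
    show "mf n' n' H \<in> GL n'" by (rule mf_GL[OF H])
    show "nonzero_ring_hom \<tau>" by (rule rhom_nonzero_ring_hom[OF \<tau>])
    show "mf n m L \<in> carrier_mat n m" by simp
  next
    fix X :: "'a mat" assume X: "X \<in> carrier_mat m n"
    define xt where "xt = (\<lambda>i j. \<tau> (ff X i j))"
    have XT: "map_mat \<tau> X = mf m n xt"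
      unfolding xt_def ff_map_mat[OF \<tau>, symmetric] by (rule mf_ff[symmetric]) (use X in simp)
    have xt: "xt \<in> fmat m n" unfolding xt_def ff_map_mat[OF \<tau>, symmetric] by (rule ff_fmat) (use X in simp)
    from form[rule_format, OF ff_fmat[OF X]] obtain Y where Y: "Y \<in> fmat m n"
      "ff (\<phi> X) = mm m' K (mm n' Y H)" "Y + mm m (mm n xt L) Y = xt"
      unfolding mf_ff[OF X] xt_def by blast
    note q = quasi_inverse_GL[OF xt Y(1) L Y(3)]
    show "1\<^sub>m m + map_mat \<tau> X * mf n m L \<in> GL m" unfolding XT by (rule q(1))
    have c: "corner m n m' n' (mf m n Y) \<in> carrier_mat m' n'" by (rule corner_carrier[OF mf_carrier le])
    have Pc: "mf m' m' K * corner m n m' n' (mf m n Y) \<in> carrier_mat m' n'"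
      by (rule mult_carrier_mat[OF mf_carrier c])
    have "ff (mf m' m' K * corner m n m' n' (mf m n Y) * mf n' n' H) = ff (\<phi> X)"
      unfolding ff_mult[OF Pc mf_carrier] ff_mult[OF mf_carrier c] ff_corner[OF mf_carrier le]
        ff_mf[OF K(1)] ff_mf[OF H(1)] ff_mf[OF Y(1)] Y(2) mm_assoc ..
    then have "\<phi> X = mf m' m' K * corner m n m' n' (mf m n Y) * mf n' n' H"
      using ff_inject[OF mult_carrier_mat[OF Pc mf_carrier] car[OF X]] by simp
    then show "\<phi> X = mf m' m' K * corner m n m' n' (mat_inv m (1\<^sub>m m + map_mat \<tau> X * mf n m L) * map_mat \<tau> X) * mf n' n' H"
      unfolding XT q(2) .
  qed
  then show ?thesis by blast
qed

text \<open>After transposition the target consists of matrices with \<open>n'\<close> rows and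
  \<open>m'\<close> columns over the opposite ring, and the map is straight. Returning by
  \<open>mun\<close> exchanges the roles of \<open>K\<close> and \<open>H\<close>, and
  \<open>\<tau>\<close> followed by \<open>unop\<close> is an anti-homomorphism.\<close>

lemma antihom_form_if_twisted:
  fixes \<phi> :: "'a::division_ring mat \<Rightarrow> 'b::division_ring mat"
  assumes car: "\<And>X. X \<in> carrier_mat m n \<Longrightarrow> \<phi> X \<in> carrier_mat m' n'"
    and S: "straight_hom m n (\<lambda>X. mop (ff (\<phi> (mf m n X))))"
    and adj: "\<forall>A\<in>fmat m n. \<forall>x\<in>fvec m. \<forall>y\<in>fvec n.
      \<exists>u v. ff (\<phi> (mf m n (A + outer x y))) - ff (\<phi> (mf m n A)) = outer u v"
  shows "\<exists>P Q \<sigma> L. antihom_form m n m' n' \<phi> P Q \<sigma> L"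
proof -
  have bd: "mop (ff (\<phi> (mf m n X))) \<in> fmat n' m'" for X
    using ff_fmat[OF car[OF mf_carrier], of X] by (auto simp: fmat_def mop_def)
  have adj': "\<forall>A\<in>fmat m n. \<forall>x\<in>fvec m. \<forall>y\<in>fvec n.
      \<exists>u v. mop (ff (\<phi> (mf m n (A + outer x y)))) - mop (ff (\<phi> (mf m n A))) = outer u v"
  proof (intro ballI)
    fix A :: "nat \<Rightarrow> nat \<Rightarrow> 'a" and x y :: "nat \<Rightarrow> 'a" assume "A \<in> fmat m n" "x \<in> fvec m" "y \<in> fvec n"
    with adj obtain u v where "ff (\<phi> (mf m n (A + outer x y))) - ff (\<phi> (mf m n A)) = outer u v"
      by blast
    then have "mop (ff (\<phi> (mf m n (A + outer x y)))) - mop (ff (\<phi> (mf m n A))) = outer (vop v) (vop u)"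
      unfolding mop_simps(3)[symmetric] mop_simps(4)[symmetric] by (rule arg_cong)
    then show "\<exists>u v. mop (ff (\<phi> (mf m n (A + outer x y)))) - mop (ff (\<phi> (mf m n A))) = outer u v" by blast
  qed
  from straight_hom_form[OF S bd adj'] obtain \<tau> L K Ki H Hi where
    le: "m \<le> n'" "n \<le> m'" and \<tau>: "rhom \<tau>" and L: "L \<in> fmat n m"
    and K: "K \<in> fmat n' n'" "Ki \<in> fmat n' n'" "mm n' K Ki = idm n'" "mm n' Ki K = idm n'"
    and H: "H \<in> fmat m' m'" "Hi \<in> fmat m' m'" "mm m' H Hi = idm m'" "mm m' Hi H = idm m'"
    and form: "\<forall>X\<in>fmat m n. \<exists>Y\<in>fmat m n. mop (ff (\<phi> (mf m n X))) = mm n' K (mm m' Y H) \<and>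
      Y + mm m (mm n (\<lambda>i j. \<tau> (X i j)) L) Y = (\<lambda>i j. \<tau> (X i j)) \<and>
      Y + mm m (mm n Y L) (\<lambda>i j. \<tau> (X i j)) = (\<lambda>i j. \<tau> (X i j))"
    by (elim conjE exE) blast
  define \<sigma> where "\<sigma> a = unop (\<tau> a)" for a
  have "antihom_form m n m' n' \<phi> (mf m' m' (mun H)) (mf n' n' (mun K)) \<sigma> (mf m n (mun L))"
    unfolding antihom_form_def
  proof (intro conjI ballI)
    show "n \<le> m'" "m \<le> n'" by fact+
    show "mf m' m' (mun H) \<in> GL m'"
      by (rule mf_GL[OF mun_fmat[OF H(1)] mun_fmat[OF H(2)]]) (simp_all only: mm_mun H mun_idm)
    show "mf n' n' (mun K) \<in> GL n'"
      by (rule mf_GL[OF mun_fmat[OF K(1)] mun_fmat[OF K(2)]]) (simp_all only: mm_mun K mun_idm)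
    have "\<sigma> 1 \<noteq> 0" "\<sigma> (x + y) = \<sigma> x + \<sigma> y" "\<sigma> (x * y) = \<sigma> y * \<sigma> x" for x y
      by (simp_all add: \<sigma>_def rhom_simps[OF \<tau>])
    then show "nonzero_ring_antihom \<sigma>" unfolding nonzero_ring_antihom_def by blast
    show "mf m n (mun L) \<in> carrier_mat m n" by simp
  next
    fix X :: "'a mat" assume X: "X \<in> carrier_mat m n"
    define xt where "xt = (\<lambda>i j. \<tau> (ff X i j))"
    have XT: "transpose_mat (map_mat \<sigma> X) = mf n m (mun xt)"
      using X by (intro eq_matI) (auto simp: mf_def mun_def xt_def \<sigma>_def ff_def)
    have xt: "xt \<in> fmat m n" using ff_fmat[OF X] by (auto simp: xt_def fmat_def rhom_simps[OF \<tau>])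
    from form[rule_format, OF ff_fmat[OF X]] obtain Y where Y: "Y \<in> fmat m n"
      "mop (ff (\<phi> X)) = mm n' K (mm m' Y H)" "Y + mm m (mm n xt L) Y = xt"
      unfolding mf_ff[OF X] xt_def by blast
    have Y2: "ff (\<phi> X) = mm n' (mm m' (mun H) (mun Y)) (mun K)"
      unfolding mm_mun Y(2)[symmetric] mop_mun ..
    note q = quasi_inverse_GL'[OF xt Y(1) L Y(3)]
    show "1\<^sub>m m + mf m n (mun L) * transpose_mat (map_mat \<sigma> X) \<in> GL m" unfolding XT by (rule q(1))
    have c: "corner n m m' n' (mf n m (mun Y)) \<in> carrier_mat m' n'" by (rule corner_carrier[OF mf_carrier le(2,1)])
    have Pc: "mf m' m' (mun H) * corner n m m' n' (mf n m (mun Y)) \<in> carrier_mat m' n'"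
      by (rule mult_carrier_mat[OF mf_carrier c])
    have "ff (mf m' m' (mun H) * corner n m m' n' (mf n m (mun Y)) * mf n' n' (mun K)) = ff (\<phi> X)"
      unfolding ff_mult[OF Pc mf_carrier] ff_mult[OF mf_carrier c] ff_corner[OF mf_carrier le(2,1)]
        ff_mf[OF mun_fmat[OF K(1)]] ff_mf[OF mun_fmat[OF H(1)]] ff_mf[OF mun_fmat[OF Y(1)]] Y2 ..
    then have "\<phi> X = mf m' m' (mun H) * corner n m m' n' (mf n m (mun Y)) * mf n' n' (mun K)"
      using ff_inject[OF mult_carrier_mat[OF Pc mf_carrier] car[OF X]] by simp
    then show "\<phi> X = mf m' m' (mun H) * corner n m m' n'
        (transpose_mat (map_mat \<sigma> X) * mat_inv m (1\<^sub>m m + mf m n (mun L) * transpose_mat (map_mat \<sigma> X))) * mf n' n' (mun K)"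
      unfolding XT q(2) .
  qed
  then show ?thesis by blast
qed

lemma GL_kernel:
  fixes A :: "'a::division_ring mat"
  assumes "A \<in> GL m" "b < m"
  shows "mv m (ff A) (ev b) \<noteq> 0" "vm m (ev b) (ff A) \<noteq> 0"
proof -
  note inv = mat_inv_GL[OF assms(1)]
  have A: "A \<in> carrier_mat m m" using assms(1) by (simp add: GL_iff)
  have "mv m (ff (mat_inv m A)) (mv m (ff A) (ev b)) = ev b"
    unfolding mv_mm[symmetric] ff_mult[OF inv(1) A, symmetric] inv(2) ff_one by (rule mv_id[OF ev_fvec[OF assms(2)]])
  then show "mv m (ff A) (ev b) \<noteq> 0" by auto
  have "vm m (vm m (ev b) (ff A)) (ff (mat_inv m A)) = ev b"
    unfolding vm_mm[symmetric] ff_mult[OF A inv(1), symmetric] inv(3) ff_one by (rule vm_id[OF ev_fvec[OF assms(2)]])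
  then show "vm m (ev b) (ff A) \<noteq> 0" by auto
qed

text \<open>A nonzero entry of \<open>L\<close> can be compensated by surjectivity: the matrix
  \<open>X\<close> with a single nonzero entry, at position \<open>(b, a)\<close> and with
  \<open>\<tau>\<close>-image \<open>- inverse (L $$ (a, b))\<close>, makes \<open>1 + X L\<close>
  annihilate \<open>ev b\<close>, against invertibility. Injectivity is automatic over division
  rings.\<close>

lemma hom_form_surj:
  fixes \<phi> :: "'a::division_ring mat \<Rightarrow> 'b::division_ring mat"
  assumes form: "hom_form m n m' n' \<phi> P Q \<tau> L" and surj: "surj \<tau>"
  shows "L = 0\<^sub>m n m \<and> bij \<tau>"
proof
  have \<tau>: "rhom \<tau>" and L: "L \<in> carrier_mat n m"
    and GL: "\<And>X. X \<in> carrier_mat m n \<Longrightarrow> 1\<^sub>m m + map_mat \<tau> X * L \<in> GL m"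
    using form nonzero_ring_hom_rhom by (auto simp: hom_form_def)
  have "inj \<tau>" by (rule injI) (simp add: rhom_inj[OF \<tau>])
  with surj show "bij \<tau>" by (simp add: bij_def)
  show "L = 0\<^sub>m n m"
  proof (rule ccontr)
    assume "L \<noteq> 0\<^sub>m n m"
    then obtain a b where ab: "a < n" "b < m" "L $$ (a, b) \<noteq> 0"
      using L by (metis (no_types, lifting) carrier_matD eq_matI index_zero_mat)
    obtain t where t: "\<tau> t = - inverse (L $$ (a, b))" using surj by (metis surjD)
    define X where "X = mf m n (outer (ev b) (t *\<^sub>l ev a))"
    have X: "X \<in> carrier_mat m n" by (simp add: X_def)
    have o: "outer (ev b) (t *\<^sub>l ev a) \<in> fmat m n" by (rule outer_fmat[OF ev_fvec[OF ab(2)] fvec_closed(5)[OF ev_fvec[OF ab(1)]]])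
    have "ff (map_mat \<tau> X) = outer (ev b) (\<tau> t *\<^sub>l ev a)"
      unfolding ff_map_mat[OF \<tau>] X_def ff_mf[OF o]
      by (intro ext) (simp add: ev_def rhom_simps[OF \<tau>])
    moreover have XT: "map_mat \<tau> X \<in> carrier_mat m n" using X by simp
    ultimately have "ff (1\<^sub>m m + map_mat \<tau> X * L) = idm m + outer (ev b) (vm n (\<tau> t *\<^sub>l ev a) (ff L))"
      using ff_add[OF one_carrier_mat mult_carrier_mat[OF XT L]] ff_mult[OF XT L]
      by (simp only: ff_one mm_outer)
    also have "vm n (\<tau> t *\<^sub>l ev a) (ff L) = \<tau> t *\<^sub>l ff L a" unfolding vm_lsc vm_ev[OF ab(1)] ..
    finally have "mv m (ff (1\<^sub>m m + map_mat \<tau> X * L)) (ev b) = ev b + mv m (outer (ev b) (\<tau> t *\<^sub>l ff L a)) (ev b)"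
      by (simp only: mv_add mv_id[OF ev_fvec[OF ab(2)]])
    also have "mv m (outer (ev b) (\<tau> t *\<^sub>l ff L a)) (ev b) = - ev b"
    proof
      fix i
      show "mv m (outer (ev b) (\<tau> t *\<^sub>l ff L a)) (ev b) i = (- ev b) i"
        unfolding mv_ev[OF ab(2)] using ab L t by (simp add: ff_def ev_def)
    qed
    finally show False unfolding right_minus using GL_kernel(1)[OF GL[OF X] ab(2)] by contradiction
  qed
qed

text \<open>As in the homomorphism case, but \<open>L\<close> stands on the left of the transposed
  matrix, so the vector annihilated by \<open>1 + L X\<close> is the row vector
  \<open>ev b\<close>.\<close>

lemma antihom_form_surj:
  fixes \<phi> :: "'a::division_ring mat \<Rightarrow> 'b::division_ring mat"
  assumes form: "antihom_form m n m' n' \<phi> P Q \<sigma> L" and surj: "surj \<sigma>"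
  shows "L = 0\<^sub>m m n \<and> bij \<sigma>"
proof
  have anti: "nonzero_ring_antihom \<sigma>" and L: "L \<in> carrier_mat m n"
    and GL: "\<And>X. X \<in> carrier_mat m n \<Longrightarrow> 1\<^sub>m m + L * transpose_mat (map_mat \<sigma> X) \<in> GL m"
    using form by (auto simp: antihom_form_def)
  define \<tau> where "\<tau> a = op (\<sigma> a)" for a
  have "nonzero_ring_hom \<tau>"
    using anti unfolding nonzero_ring_antihom_def nonzero_ring_hom_def \<tau>_def by simp
  then have \<tau>: "rhom \<tau>" by (rule nonzero_ring_hom_rhom)
  have \<sigma>0: "\<sigma> 0 = 0" using rhom_simps(4)[OF \<tau>] by (simp add: \<tau>_def)
  have "inj \<sigma>" by (rule injI) (metis \<tau>_def rhom_inj[OF \<tau>])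
  with surj show "bij \<sigma>" by (simp add: bij_def)
  show "L = 0\<^sub>m m n"
  proof (rule ccontr)
    assume "L \<noteq> 0\<^sub>m m n"
    then obtain b a where ab: "b < m" "a < n" "L $$ (b, a) \<noteq> 0"
      using L by (metis (no_types, lifting) carrier_matD eq_matI index_zero_mat)
    obtain t where t: "\<sigma> t = - inverse (L $$ (b, a))" using surj by (metis surjD)
    define X where "X = mat m n (\<lambda>(i, j). if i = b \<and> j = a then t else 0)"
    have X: "X \<in> carrier_mat m n" by (simp add: X_def)
    have XT: "transpose_mat (map_mat \<sigma> X) \<in> carrier_mat n m" using X by simp
    have "ff (transpose_mat (map_mat \<sigma> X)) = outer (ev a) (\<sigma> t *\<^sub>l ev b)"
      using ab by (intro ext) (auto simp: X_def ff_def ev_def \<sigma>0)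
    then have "ff (1\<^sub>m m + L * transpose_mat (map_mat \<sigma> X)) = idm m + outer (mv n (ff L) (ev a)) (\<sigma> t *\<^sub>l ev b)"
      using ff_add[OF one_carrier_mat mult_carrier_mat[OF L XT]] ff_mult[OF L XT]
      by (simp only: ff_one mm_outer)
    then have "vm m (ev b) (ff (1\<^sub>m m + L * transpose_mat (map_mat \<sigma> X)))
        = ev b + vm m (ev b) (outer (\<lambda>i. ff L i a) (\<sigma> t *\<^sub>l ev b))"
      by (simp only: vm_add vm_id[OF ev_fvec[OF ab(1)]] mv_ev[OF ab(2)])
    also have "vm m (ev b) (outer (\<lambda>i. ff L i a) (\<sigma> t *\<^sub>l ev b)) = - ev b"
    proof
      fix i
      show "vm m (ev b) (outer (\<lambda>i. ff L i a) (\<sigma> t *\<^sub>l ev b)) i = (- ev b) i"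
        unfolding vm_ev[OF ab(1)] using ab L t by (simp add: ff_def ev_def)
    qed
    finally show False unfolding right_minus using GL_kernel(2)[OF GL[OF X] ab(1)] by contradiction
  qed
qed

theorem theorem2p1:
  fixes \<phi> :: "'a::division_ring mat \<Rightarrow> 'b::division_ring mat"
    and m n m' n' :: nat
  assumes "infinite (UNIV :: 'a set) \<or> card (UNIV :: 'a set) \<ge> 4"
    and "m \<ge> 2" and "n \<ge> 2" and "m' \<ge> 2" and "n' \<ge> 2"
    and "graph_hom m n m' n' \<phi>"
    and "\<not> degenerate m n m' n' \<phi>"
    and "\<phi> (0\<^sub>m m n) = 0\<^sub>m m' n'"
    and "has_adj_dim m' n' (\<phi> ` first_row_mats m n) n"
    and "has_adj_dim m' n' (\<phi> ` first_col_mats m n) m"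
  shows "((\<exists>P Q \<tau> L. hom_form m n m' n' \<phi> P Q \<tau> L) \<or>
          (\<exists>P Q \<sigma> L. antihom_form m n m' n' \<phi> P Q \<sigma> L)) \<and>
         (\<forall>P Q \<tau> L. hom_form m n m' n' \<phi> P Q \<tau> L \<and> surj \<tau> \<longrightarrow> L = 0\<^sub>m n m \<and> bij \<tau>) \<and>
         (\<forall>P Q \<sigma> L. antihom_form m n m' n' \<phi> P Q \<sigma> L \<and> surj \<sigma> \<longrightarrow> L = 0\<^sub>m m n \<and> bij \<sigma>)"
proof (intro conjI allI impI)
  define \<Phi> where "\<Phi> = (\<lambda>X. ff (\<phi> (mf m n X)))"
  interpret N: nondegenerate_hom m n \<Phi>
    unfolding \<Phi>_def by (rule nondegenerate_hom_ff[OF assms(2-8)])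
  have pos: "0 < m" "0 < n" "0 < m'" "0 < n'" using assms(2-5) by simp_all
  have car: "\<phi> X \<in> carrier_mat m' n'" if "X \<in> carrier_mat m n" for X
    using assms(6) that by (auto simp: graph_hom_def)
  have rowel: "\<exists>y\<in>fvec n. ff X = \<Phi> (outer (ev 0) y)" if X: "X \<in> \<phi> ` first_row_mats m n" for X
  proof -
    obtain F where "X = \<phi> F" "F \<in> first_row_mats m n" using X by blast
    then obtain y where F: "X = \<phi> F" "F \<in> carrier_mat m n" "y \<in> fvec n" "ff F = outer (ev 0) y"
      unfolding first_row_mats_iff[OF pos(1)] by blast
    then show ?thesis using mf_ff[OF F(2)] unfolding \<Phi>_def by metis
  qed
  have colel: "\<exists>x\<in>fvec m. ff X = \<Phi> (outer x (ev 0))" if X: "X \<in> \<phi> ` first_col_mats m n" for X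
  proof -
    obtain F where "X = \<phi> F" "F \<in> first_col_mats m n" using X by blast
    then obtain y where F: "X = \<phi> F" "F \<in> carrier_mat m n" "y \<in> fvec m" "ff F = outer y (ev 0)"
      unfolding first_col_mats_iff[OF pos(2)] by blast
    then show ?thesis using mf_ff[OF F(2)] unfolding \<Phi>_def by metis
  qed
  have e0: "ev 0 \<in> fvec m - {0 :: nat \<Rightarrow> 'a}" "ev 0 \<in> fvec n - {0 :: nat \<Rightarrow> 'a}" using pos by auto
  have neq: "\<Phi> (A + outer x y) \<noteq> \<Phi> A" if "A \<in> Rk1 m n" "x \<in> fvec m" "y \<in> fvec n" "x \<noteq> 0" "y \<noteq> 0" for A x y
    using N.phi_adj[OF Rk1_fmat[OF that(1)] that(2-5)] by fastforce
  have adj: "\<forall>A\<in>fmat m n. \<forall>x\<in>fvec m. \<forall>y\<in>fvec n.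
      \<exists>u v. ff (\<phi> (mf m n (A + outer x y))) - ff (\<phi> (mf m n A)) = outer u v"
    using N.phi_rank_one unfolding \<Phi>_def by blast
  have cpar: "\<exists>s. vop w = s *\<^sub>l vop p" if w: "outer w q \<in> Rset p" "q \<noteq> 0" for w q p :: "nat \<Rightarrow> 'b"
  proof -
    obtain v where "outer w q = outer p v" using w(1) by (rule RsetE)
    from outer_eq_colD[OF this w(2)] obtain s where "w = p *\<^sub>r s" by blast
    then have "vop w = op s *\<^sub>l vop p" by simp
    then show ?thesis by blast
  qed
  have rpar: "\<exists>s. w = s *\<^sub>l q" if "outer p w \<in> Cset q" "p \<noteq> 0" for w q p :: "nat \<Rightarrow> 'b"
    using that outer_eq_rowD by (elim CsetE) blast
  show "(\<exists>P Q \<tau> L. hom_form m n m' n' \<phi> P Q \<tau> L) \<or> (\<exists>P Q \<sigma> L. antihom_form m n m' n' \<phi> P Q \<sigma> L)"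
    using N.straight_or_twisted
  proof
    assume str: "\<forall>A\<in>Rk1 m n. N.straight A"
    then have s0: "N.straight 0" by simp
    have "N.rowR 0 (ev 0)" using s0 e0(1) unfolding N.straight_def by blast
    then obtain p0 where p0: "\<forall>y\<in>fvec n. \<Phi> (outer (ev 0) y) \<in> Rset p0"
      unfolding N.rowR_def by (auto simp: N.phi_zero)
    have "N.colC 0 (ev 0)" using s0 e0(2) unfolding N.straight_def by blast
    then obtain q0 where q0: "\<forall>x\<in>fvec m. \<Phi> (outer x (ev 0)) \<in> Cset q0"
      unfolding N.colC_def by (auto simp: N.phi_zero)
    have "straight_hom m n \<Phi>"
    proof (unfold_locales, fact assms(1), fact assms(2), fact assms(3), fact N.phi_zero, fact neq)
      fix A :: "nat \<Rightarrow> nat \<Rightarrow> 'a" and x :: "nat \<Rightarrow> 'a" assume "A \<in> Rk1 m n" "x \<in> fvec m" "x \<noteq> 0"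
      then show "\<exists>p. \<forall>y\<in>fvec n. \<Phi> (A + outer x y) - \<Phi> A \<in> Rset p"
        using str unfolding N.straight_def N.rowR_def by blast
    next
      fix A :: "nat \<Rightarrow> nat \<Rightarrow> 'a" and y :: "nat \<Rightarrow> 'a" assume "A \<in> Rk1 m n" "y \<in> fvec n" "y \<noteq> 0"
      then show "\<exists>q. \<forall>x\<in>fvec m. \<Phi> (A + outer x y) - \<Phi> A \<in> Cset q"
        using str unfolding N.straight_def N.colC_def by blast
    next
      show "\<exists>p ys w. p \<noteq> 0 \<and> (\<forall>i<n. ys i \<in> fvec n \<and> \<Phi> (outer (ev 0) (ys i)) = outer p (w i)) \<and> lind {..<n} w"
      proof (cases rule: has_adj_dim_cases[OF assms(9) pos(3,4)])
        case (1 p b w)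
        then have "\<forall>i\<in>{..<n}. \<exists>y. y \<in> fvec n \<and> \<Phi> (outer (ev 0) y) = outer p (w i)" using rowel by fastforce
        then obtain ys where "\<forall>i<n. ys i \<in> fvec n \<and> \<Phi> (outer (ev 0) (ys i)) = outer p (w i)" by (metis lessThan_iff)
        with 1(1,3) show ?thesis by blast
      next
        case (2 q b w)
        have "\<exists>s. vop (w i) = s *\<^sub>l vop p0" if "i < n" for i
          using 2(2)[OF that] rowel[of "b i"] p0 by (intro cpar[OF _ 2(1)]) auto
        with not_lind_parallel[OF 2(3) assms(3)] show ?thesis by blast
      qed
      show "\<exists>q xs w. q \<noteq> 0 \<and> (\<forall>i<m. xs i \<in> fvec m \<and> \<Phi> (outer (xs i) (ev 0)) = outer (w i) q) \<and>
          lind {..<m} (\<lambda>i. vop (w i))"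
      proof (cases rule: has_adj_dim_cases[OF assms(10) pos(3,4)])
        case (1 p b w)
        have "\<exists>s. w i = s *\<^sub>l q0" if "i < m" for i
          using 1(2)[OF that] colel[of "b i"] q0 by (intro rpar[OF _ 1(1)]) auto
        with not_lind_parallel[OF 1(3) assms(2)] show ?thesis by blast
      next
        case (2 q b w)
        then have "\<forall>i\<in>{..<m}. \<exists>x. x \<in> fvec m \<and> \<Phi> (outer x (ev 0)) = outer (w i) q" using colel by fastforce
        then obtain xs where "\<forall>i<m. xs i \<in> fvec m \<and> \<Phi> (outer (xs i) (ev 0)) = outer (w i) q" by (metis lessThan_iff)
        with 2(1,3) show ?thesis by blast
      qed
    qed
    then show ?thesis using hom_form_if_straight[OF car _ adj] unfolding \<Phi>_def by blast
  next
    assume twi: "\<forall>A\<in>Rk1 m n. N.twisted A"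
    then have t0: "N.twisted 0" by simp
    have "N.rowC 0 (ev 0)" using t0 e0(1) unfolding N.twisted_def by blast
    then obtain q0 where q0: "\<forall>y\<in>fvec n. \<Phi> (outer (ev 0) y) \<in> Cset q0"
      unfolding N.rowC_def by (auto simp: N.phi_zero)
    have "N.colR 0 (ev 0)" using t0 e0(2) unfolding N.twisted_def by blast
    then obtain p0 where p0: "\<forall>x\<in>fvec m. \<Phi> (outer x (ev 0)) \<in> Rset p0"
      unfolding N.colR_def by (auto simp: N.phi_zero)
    define \<Psi> where "\<Psi> X = mop (\<Phi> X)" for X
    have "straight_hom m n \<Psi>"
    proof (unfold_locales, fact assms(1), fact assms(2), fact assms(3))
      show "\<Psi> 0 = 0" by (simp add: \<Psi>_def N.phi_zero)
    next
      fix A :: "nat \<Rightarrow> nat \<Rightarrow> 'a" and x y :: "nat \<Rightarrow> 'a"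
      assume "A \<in> Rk1 m n" "x \<in> fvec m" "y \<in> fvec n" "x \<noteq> 0" "y \<noteq> 0"
      from neq[OF this] show "\<Psi> (A + outer x y) \<noteq> \<Psi> A" by (simp add: \<Psi>_def)
    next
      fix A :: "nat \<Rightarrow> nat \<Rightarrow> 'a" and x :: "nat \<Rightarrow> 'a" assume "A \<in> Rk1 m n" "x \<in> fvec m" "x \<noteq> 0"
      then obtain q where "\<forall>y\<in>fvec n. \<Phi> (A + outer x y) - \<Phi> A \<in> Cset q"
        using twi unfolding N.twisted_def N.rowC_def by blast
      then have "\<forall>y\<in>fvec n. \<Psi> (A + outer x y) - \<Psi> A \<in> Rset (vop q)"
        unfolding \<Psi>_def mop_simps(3)[symmetric] using mop_Cset by blast
      then show "\<exists>p. \<forall>y\<in>fvec n. \<Psi> (A + outer x y) - \<Psi> A \<in> Rset p" by blast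
    next
      fix A :: "nat \<Rightarrow> nat \<Rightarrow> 'a" and y :: "nat \<Rightarrow> 'a" assume "A \<in> Rk1 m n" "y \<in> fvec n" "y \<noteq> 0"
      then obtain p where "\<forall>x\<in>fvec m. \<Phi> (A + outer x y) - \<Phi> A \<in> Rset p"
        using twi unfolding N.twisted_def N.colR_def by blast
      then have "\<forall>x\<in>fvec m. \<Psi> (A + outer x y) - \<Psi> A \<in> Cset (vop p)"
        unfolding \<Psi>_def mop_simps(3)[symmetric] using mop_Rset by blast
      then show "\<exists>q. \<forall>x\<in>fvec m. \<Psi> (A + outer x y) - \<Psi> A \<in> Cset q" by blast
    next
      \<comment> \<open>Rows now have images in a set of type two, so the alternative with a common
        row survives and the one with a common column contradicts \<open>n \<ge> 2\<close>.\<close>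
      show "\<exists>p ys w. p \<noteq> 0 \<and> (\<forall>i<n. ys i \<in> fvec n \<and> \<Psi> (outer (ev 0) (ys i)) = outer p (w i)) \<and> lind {..<n} w"
      proof (cases rule: has_adj_dim_cases[OF assms(9) pos(3,4)])
        case (1 p b w)
        have "\<exists>s. w i = s *\<^sub>l q0" if "i < n" for i
          using 1(2)[OF that] rowel[of "b i"] q0 by (intro rpar[OF _ 1(1)]) auto
        with not_lind_parallel[OF 1(3) assms(3)] show ?thesis by blast
      next
        case (2 q b w)
        then have "\<forall>i\<in>{..<n}. \<exists>y. y \<in> fvec n \<and> \<Phi> (outer (ev 0) y) = outer (w i) q" using rowel by fastforce
        then obtain ys where "\<forall>i<n. ys i \<in> fvec n \<and> \<Phi> (outer (ev 0) (ys i)) = outer (w i) q" by (metis lessThan_iff)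
        then have "\<forall>i<n. ys i \<in> fvec n \<and> \<Psi> (outer (ev 0) (ys i)) = outer (vop q) (vop (w i))"
          unfolding \<Psi>_def by simp
        moreover have "vop q \<noteq> 0" using 2(1) by simp
        ultimately show ?thesis using 2(3) by (intro exI[of _ "vop q"] exI[of _ ys] exI[of _ "\<lambda>i. vop (w i)"]) blast
      qed
      show "\<exists>q xs w. q \<noteq> 0 \<and> (\<forall>i<m. xs i \<in> fvec m \<and> \<Psi> (outer (xs i) (ev 0)) = outer (w i) q) \<and>
          lind {..<m} (\<lambda>i. vop (w i))"
      proof (cases rule: has_adj_dim_cases[OF assms(10) pos(3,4)])
        case (1 p b w)
        then have "\<forall>i\<in>{..<m}. \<exists>x. x \<in> fvec m \<and> \<Phi> (outer x (ev 0)) = outer p (w i)" using colel by fastforce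
        then obtain xs where "\<forall>i<m. xs i \<in> fvec m \<and> \<Phi> (outer (xs i) (ev 0)) = outer p (w i)" by (metis lessThan_iff)
        then have "\<forall>i<m. xs i \<in> fvec m \<and> \<Psi> (outer (xs i) (ev 0)) = outer (vop (w i)) (vop p)"
          unfolding \<Psi>_def by simp
        moreover have "vop p \<noteq> 0" using 1(1) by simp
        ultimately show ?thesis using lind_vop_vop[OF 1(3)]
          by (intro exI[of _ "vop p"] exI[of _ xs] exI[of _ "\<lambda>i. vop (w i)"]) blast
      next
        case (2 q b w)
        have "\<exists>s. vop (w i) = s *\<^sub>l vop p0" if "i < m" for i
          using 2(2)[OF that] colel[of "b i"] p0 by (intro cpar[OF _ 2(1)]) auto
        with not_lind_parallel[OF 2(3) assms(2)] show ?thesis by blast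
      qed
    qed
    then show ?thesis using antihom_form_if_twisted[OF car _ adj] unfolding \<Psi>_def[abs_def] \<Phi>_def by blast
  qed
qed (use hom_form_surj antihom_form_surj in blast)+

end
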